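(* Let $\pi$ be a limit ordinal of uncountable cofinality and let $\mathbb{P}=\langle\mathbb{P}_\alpha,\dot{\mathbb{Q}}_\alpha:\alpha<\pi\rangle$ be a finite support iteration of non-trivial $\mathrm{cf}(\pi)$-cc posets. Then $\mathbb{P}$ forces that there is an ideal $J$ on $\omega$ (which can moreover be taken maximal) such that $\mathfrak{b}_J(\overline{\Omega})=\mathrm{add}(\mathcal{N}_J)=\mathrm{add}(\mathcal{N}^*_J)=\mathrm{cof}(\mathcal{N}^*_J)=\mathrm{cof}(\mathcal{N}_J)=\mathfrak{d}_J(\overline{\Omega})=\mathrm{cf}(\pi)$.
   Context: An ideal on $\omega$ is a family $J\subseteq\mathcal{P}(\omega)$ closed under subsets and finite unions, containing all finite sets, with $\omega\notin J$; $J^+=\mathcal{P}(\omega)\setminus J$, $J^d=\{\omega\setminus a:a\in J\}$. ${}^\omega2$ has Lebesgue measure $\mu$; $\Omega$ is the set of clopen subsets. For $\bar c\in{}^\omega\Omega$: $N(\bar c)=\{x:x\in c_n\text{ for infinitely many }n\}$, $\overline{\Omega}=\{\bar c:\mu(N(\bar c))=0\}$, $N_J(\bar c)=\{x:\{n:x\in c_n\}\in J^+\}$, $N^*_J(\bar c)=\{x:\{n:x\in c_n\}\in J^d\}$, $\mathcal{N}_J=\{X\subseteq{}^\omega2:\exists\bar c\in\overline{\Omega}\ X\subseteq N_J(\bar c)\}$, $\mathcal{N}^*_J=\{X:\exists\bar c\in\overline{\Omega}\ X\subseteq N^*_J(\bar c)\}$. For $\bar c,\bar d\in\overline{\Omega}$,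 $\bar c\subseteq^J\bar d$ iff $\{n:c_n\not\subseteq d_n\}\in J$; $\mathfrak{b}_J(\overline{\Omega})$ is the least size of a subset of $\overline{\Omega}$ without a $\subseteq^J$-upper bound in $\overline{\Omega}$, and $\mathfrak{d}_J(\overline{\Omega})$ the least size of a $\subseteq^J$-cofinal subset of $\overline{\Omega}$. $\mathrm{add}$ and $\mathrm{cof}$ denote additivity and cofinality of an ideal. *)

theory Defs
  imports "HOL-Analysis.Analysis"
begin

unbundle cardinal_syntax

text \<open>
  The ground model \<open>V\<close> is the HOL universe. A forcing notion on a type \<open>'p\<close> is given by its order
  \<open>le\<close> alone (\<open>le q p\<close>: \<open>q\<close> is stronger than \<open>p\<close>); its set of conditions is \<open>{p. le p p}\<close>.

  Names are the usual sets of pairs (name of an element, condition), arranged by type: if \<open>'a\<close> is a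
  ground type (whose elements \<open>a\<close> stand for their check names) or itself a type of names, then
  \<open>('a, 'p) name\<close> consists of the names for sets of objects named by \<open>'a\<close>. So
  \<open>(nat, 'p) name\<close> names the subsets of \<open>\<omega>\<close>, equivalently (by characteristic functions) the points
  of the Cantor space, \<open>((nat, 'p) name, 'p) name\<close> names the sets of those, and so on; every object
  of these kinds in the extension has a name in the corresponding type. Pairs whose second
  component is not a condition have no effect.

  A sentence of the forcing language is identified with the set of conditions forcing it: \<open>\<phi> p\<close>
  reads \<open>p \<tturnstile> \<phi>\<close>. The clauses for the connectives and for \<open>\<in>\<close> and \<open>=\<close> between names are the
  standard recursive ones, and quantifiers range over all names of the type in question (over a
  ground type such as \<open>nat\<close>: over all check names).
\<close>

type_synonym ('a, 'p) name = "('a \<times> 'p) set"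
type_synonym 'p sentence = "'p \<Rightarrow> bool"
type_synonym 'p real_name = "(nat, 'p) name"
type_synonym 'p set_name = "('p real_name, 'p) name"
type_synonym 'p clopen_seq_name = "(nat \<times> (nat \<Rightarrow> bool) set, 'p) name"

definition cone :: "bool list \<Rightarrow> (nat \<Rightarrow> bool) set" where
  "cone s = {x. \<forall>i < length s. x i = s ! i}"

definition f_ground :: "bool \<Rightarrow> 'p sentence" where
  "f_ground b = (\<lambda>p. b)"

definition f_and :: "'p sentence \<Rightarrow> 'p sentence \<Rightarrow> 'p sentence" (infixr "\<^bold>\<and>" 35) where
  "(\<phi> \<^bold>\<and> \<psi>) = (\<lambda>p. \<phi> p \<and> \<psi> p)"

definition f_all :: "('a \<Rightarrow> 'p sentence) \<Rightarrow> 'p sentence" (binder "\<^bold>\<forall>" 10) where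
  "f_all \<phi> = (\<lambda>p. \<forall>x. \<phi> x p)"

definition f_geq :: "'a \<Rightarrow> 'a \<Rightarrow> 'p sentence" where
  "f_geq x y = f_ground (x = y)"

definition f_pair_eq ::
    "('a \<Rightarrow> 'a \<Rightarrow> 'p sentence) \<Rightarrow> ('b \<Rightarrow> 'b \<Rightarrow> 'p sentence) \<Rightarrow> 'a \<times> 'b \<Rightarrow> 'a \<times> 'b \<Rightarrow> 'p sentence" where
  "f_pair_eq eqa eqb u v = (eqa (fst u) (fst v) \<^bold>\<and> eqb (snd u) (snd v))"

context
  fixes le :: "'p \<Rightarrow> 'p \<Rightarrow> bool"
begin

definition forced :: "'p sentence \<Rightarrow> bool" where
  "forced \<phi> \<longleftrightarrow> (\<forall>p. le p p \<longrightarrow> \<phi> p)"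

definition f_not :: "'p sentence \<Rightarrow> 'p sentence" ("\<^bold>\<not> _" [40] 40) where
  "(\<^bold>\<not> \<phi>) = (\<lambda>p. \<forall>q. le q p \<longrightarrow> \<not> \<phi> q)"

definition f_or :: "'p sentence \<Rightarrow> 'p sentence \<Rightarrow> 'p sentence" (infixr "\<^bold>\<or>" 30) where
  "(\<phi> \<^bold>\<or> \<psi>) = (\<^bold>\<not> (\<^bold>\<not> \<phi> \<^bold>\<and> \<^bold>\<not> \<psi>))"

definition f_imp :: "'p sentence \<Rightarrow> 'p sentence \<Rightarrow> 'p sentence" (infixr "\<^bold>\<longrightarrow>" 25) where
  "(\<phi> \<^bold>\<longrightarrow> \<psi>) = (\<^bold>\<not> (\<phi> \<^bold>\<and> \<^bold>\<not> \<psi>))"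

definition f_iff :: "'p sentence \<Rightarrow> 'p sentence \<Rightarrow> 'p sentence" (infixr "\<^bold>\<longleftrightarrow>" 25) where
  "(\<phi> \<^bold>\<longleftrightarrow> \<psi>) = ((\<phi> \<^bold>\<longrightarrow> \<psi>) \<^bold>\<and> (\<psi> \<^bold>\<longrightarrow> \<phi>))"

definition f_ex :: "('a \<Rightarrow> 'p sentence) \<Rightarrow> 'p sentence" (binder "\<^bold>\<exists>" 10) where
  "f_ex \<phi> = (\<^bold>\<not> (\<^bold>\<forall>x. \<^bold>\<not> \<phi> x))"

text \<open>
  Membership and equality for sets of objects whose own equality is interpreted by \<open>eq\<close>: the set of
  conditions \<open>r\<close> that are below some \<open>s\<close> with \<open>(y, s) \<in> \<tau>\<close> and force \<open>x = y\<close> is dense below \<open>p\<close>;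
  and every element of either name is forced into the other.
\<close>

definition f_mem :: "('a \<Rightarrow> 'a \<Rightarrow> 'p sentence) \<Rightarrow> 'a \<Rightarrow> ('a, 'p) name \<Rightarrow> 'p sentence" where
  "f_mem eq x \<tau> = (\<lambda>p. \<forall>q. le q p \<longrightarrow> (\<exists>r. le r q \<and> (\<exists>(y, s) \<in> \<tau>. le r s \<and> eq x y r)))"

definition f_set_eq ::
    "('a \<Rightarrow> 'a \<Rightarrow> 'p sentence) \<Rightarrow> ('a, 'p) name \<Rightarrow> ('a, 'p) name \<Rightarrow> 'p sentence" where
  "f_set_eq eq \<sigma> \<tau> = (\<lambda>p.
     (\<forall>(x, s) \<in> \<sigma>. \<forall>q. le q p \<and> le q s \<longrightarrow> f_mem eq x \<tau> q) \<and>
     (\<forall>(x, s) \<in> \<tau>. \<forall>q. le q p \<and> le q s \<longrightarrow> f_mem eq x \<sigma> q))"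

text \<open>The name for the set of all objects satisfying \<open>\<phi>\<close> in the extension.\<close>

definition f_compr :: "('a \<Rightarrow> 'p sentence) \<Rightarrow> ('a, 'p) name" where
  "f_compr \<phi> = {(x, p). le p p \<and> \<phi> x p}"

definition f_subset :: "('a \<Rightarrow> 'a \<Rightarrow> 'p sentence) \<Rightarrow> ('a, 'p) name \<Rightarrow> ('a, 'p) name \<Rightarrow> 'p sentence" where
  "f_subset eq \<sigma> \<tau> = (\<^bold>\<forall>x. f_mem eq x \<sigma> \<^bold>\<longrightarrow> f_mem eq x \<tau>)"

abbreviation f_gmem :: "'a \<Rightarrow> ('a, 'p) name \<Rightarrow> 'p sentence" (infix "\<in>\<^sub>g" 50) where
  "x \<in>\<^sub>g \<tau> \<equiv> f_mem f_geq x \<tau>"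

abbreviation f_real_eq :: "'p real_name \<Rightarrow> 'p real_name \<Rightarrow> 'p sentence" where
  "f_real_eq \<equiv> f_set_eq f_geq"

abbreviation f_real_mem :: "'p real_name \<Rightarrow> 'p set_name \<Rightarrow> 'p sentence" (infix "\<in>\<^sub>r" 50) where
  "x \<in>\<^sub>r X \<equiv> f_mem f_real_eq x X"

abbreviation f_set_mem :: "'p set_name \<Rightarrow> ('p set_name, 'p) name \<Rightarrow> 'p sentence" (infix "\<in>\<^sub>s" 50) where
  "X \<in>\<^sub>s F \<equiv> f_mem (f_set_eq f_real_eq) X F"

abbreviation f_seq_eq :: "'p clopen_seq_name \<Rightarrow> 'p clopen_seq_name \<Rightarrow> 'p sentence" where
  "f_seq_eq \<equiv> f_set_eq f_geq"

abbreviation f_seq_mem ::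
    "'p clopen_seq_name \<Rightarrow> ('p clopen_seq_name, 'p) name \<Rightarrow> 'p sentence" (infix "\<in>\<^sub>c" 50) where
  "c \<in>\<^sub>c F \<equiv> f_mem f_seq_eq c F"

text \<open>There is an injection from \<open>F\<close> into the (check name of the) ground model set \<open>A\<close>.\<close>

definition f_embeds :: "('a \<Rightarrow> 'a \<Rightarrow> 'p sentence) \<Rightarrow> ('a, 'p) name \<Rightarrow> 'k set \<Rightarrow> 'p sentence" where
  "f_embeds eq F A = (\<^bold>\<exists>f :: ('a \<times> 'k, 'p) name.
     (\<^bold>\<forall>x. f_mem eq x F \<^bold>\<longrightarrow> (\<^bold>\<exists>\<eta>. f_ground (\<eta> \<in> A) \<^bold>\<and> f_mem (f_pair_eq eq f_geq) (x, \<eta>) f)) \<^bold>\<and>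
     (\<^bold>\<forall>x \<eta> \<zeta>. f_mem (f_pair_eq eq f_geq) (x, \<eta>) f \<^bold>\<and> f_mem (f_pair_eq eq f_geq) (x, \<zeta>) f
        \<^bold>\<longrightarrow> f_geq \<eta> \<zeta>) \<^bold>\<and>
     (\<^bold>\<forall>x y \<eta>. f_mem (f_pair_eq eq f_geq) (x, \<eta>) f \<^bold>\<and> f_mem (f_pair_eq eq f_geq) (y, \<eta>) f
        \<^bold>\<longrightarrow> eq x y))"

text \<open>
  Here \<open>\<kappa>\<close> is a ground model ordinal, given as a well-order; its elements \<open>\<xi>\<close> are the ordinals below
  it, as initial segments. The cardinality of \<open>F\<close> is an ordinal less than \<open>\<kappa>\<close> iff \<open>F\<close> embeds into
  some \<open>\<xi> < \<kappa>\<close>.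
\<close>

definition f_size_less :: "('a \<Rightarrow> 'a \<Rightarrow> 'p sentence) \<Rightarrow> ('a, 'p) name \<Rightarrow> 'k rel \<Rightarrow> 'p sentence" where
  "f_size_less eq F \<kappa> = (\<^bold>\<exists>\<xi>. f_ground (\<xi> \<in> Field \<kappa>) \<^bold>\<and> f_embeds eq F (underS \<kappa> \<xi>))"

text \<open>
  The least cardinality of a set \<open>F\<close> with \<open>\<Phi> F\<close> is the ordinal \<open>\<kappa>\<close>. In particular
  this implies that \<open>\<kappa>\<close> is still a cardinal in the extension.
\<close>

definition f_least_size ::
    "('a \<Rightarrow> 'a \<Rightarrow> 'p sentence) \<Rightarrow> (('a, 'p) name \<Rightarrow> 'p sentence) \<Rightarrow> 'k rel \<Rightarrow> 'p sentence" where
  "f_least_size eq \<Phi> \<kappa> =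
     ((\<^bold>\<exists>F. \<Phi> F \<^bold>\<and> f_embeds eq F (Field \<kappa>)) \<^bold>\<and>
      (\<^bold>\<forall>F. \<Phi> F \<^bold>\<longrightarrow> (\<^bold>\<not> f_size_less eq F \<kappa>)))"

text \<open>\<open>(Q, L)\<close> names a set with an order, the underlying set consisting of ground model objects.\<close>

definition f_preorder :: "('q, 'p) name \<Rightarrow> ('q \<times> 'q, 'p) name \<Rightarrow> 'p sentence" where
  "f_preorder Q L =
     ((\<^bold>\<forall>x. x \<in>\<^sub>g Q \<^bold>\<longrightarrow> (x, x) \<in>\<^sub>g L) \<^bold>\<and>
      (\<^bold>\<forall>x y z. x \<in>\<^sub>g Q \<^bold>\<and> y \<in>\<^sub>g Q \<^bold>\<and> z \<in>\<^sub>g Q \<^bold>\<and> (x, y) \<in>\<^sub>g L \<^bold>\<and> (y, z) \<in>\<^sub>g L \<^bold>\<longrightarrow> (x, z) \<in>\<^sub>g L))"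

definition f_incompatible :: "('q, 'p) name \<Rightarrow> ('q \<times> 'q, 'p) name \<Rightarrow> 'q \<Rightarrow> 'q \<Rightarrow> 'p sentence" where
  "f_incompatible Q L x y = (\<^bold>\<not> (\<^bold>\<exists>z. z \<in>\<^sub>g Q \<^bold>\<and> (z, x) \<in>\<^sub>g L \<^bold>\<and> (z, y) \<in>\<^sub>g L))"

definition f_nontrivial :: "('q, 'p) name \<Rightarrow> ('q \<times> 'q, 'p) name \<Rightarrow> 'p sentence" where
  "f_nontrivial Q L = (\<^bold>\<exists>x y. x \<in>\<^sub>g Q \<^bold>\<and> y \<in>\<^sub>g Q \<^bold>\<and> f_incompatible Q L x y)"

definition f_antichain :: "('q, 'p) name \<Rightarrow> ('q \<times> 'q, 'p) name \<Rightarrow> ('q, 'p) name \<Rightarrow> 'p sentence" where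
  "f_antichain Q L A =
     (f_subset f_geq A Q \<^bold>\<and>
      (\<^bold>\<forall>x y. x \<in>\<^sub>g A \<^bold>\<and> y \<in>\<^sub>g A \<^bold>\<and> (\<^bold>\<not> f_geq x y) \<^bold>\<longrightarrow> f_incompatible Q L x y))"

definition f_cc :: "'k rel \<Rightarrow> ('q, 'p) name \<Rightarrow> ('q \<times> 'q, 'p) name \<Rightarrow> 'p sentence" where
  "f_cc \<kappa> Q L = (\<^bold>\<forall>A. f_antichain Q L A \<^bold>\<longrightarrow> f_size_less f_geq A \<kappa>)"

text \<open>A subset of \<open>\<omega>\<close> is finite iff it is bounded.\<close>

definition f_ideal :: "'p set_name \<Rightarrow> 'p sentence" where
  "f_ideal J =
     ((\<^bold>\<forall>a b. b \<in>\<^sub>r J \<^bold>\<and> f_subset f_geq a b \<^bold>\<longrightarrow> a \<in>\<^sub>r J) \<^bold>\<and>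
      (\<^bold>\<forall>a b. a \<in>\<^sub>r J \<^bold>\<and> b \<in>\<^sub>r J \<^bold>\<longrightarrow> f_compr (\<lambda>n. n \<in>\<^sub>g a \<^bold>\<or> n \<in>\<^sub>g b) \<in>\<^sub>r J) \<^bold>\<and>
      (\<^bold>\<forall>a. (\<^bold>\<exists>m. \<^bold>\<forall>n. n \<in>\<^sub>g a \<^bold>\<longrightarrow> f_ground (n < m)) \<^bold>\<longrightarrow> a \<in>\<^sub>r J) \<^bold>\<and>
      (\<^bold>\<not> f_compr (\<lambda>n. f_ground True) \<in>\<^sub>r J))"

definition f_maximal_ideal :: "'p set_name \<Rightarrow> 'p sentence" where
  "f_maximal_ideal J =
     (f_ideal J \<^bold>\<and>
      (\<^bold>\<forall>K. f_ideal K \<^bold>\<and> f_subset f_real_eq J K \<^bold>\<longrightarrow> f_subset f_real_eq K J))"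

definition f_positive :: "'p set_name \<Rightarrow> 'p real_name \<Rightarrow> 'p sentence" where
  "f_positive J a = (\<^bold>\<not> a \<in>\<^sub>r J)"

definition f_dual :: "'p set_name \<Rightarrow> 'p real_name \<Rightarrow> 'p sentence" where
  "f_dual J a = (f_compr (\<lambda>n. \<^bold>\<not> n \<in>\<^sub>g a) \<in>\<^sub>r J)"

definition f_prefix :: "bool list \<Rightarrow> 'p real_name \<Rightarrow> 'p sentence" where
  "f_prefix s x = (\<^bold>\<forall>i. f_ground (i < length s) \<^bold>\<longrightarrow> (i \<in>\<^sub>g x \<^bold>\<longleftrightarrow> f_ground (s ! i)))"

text \<open>
  By compactness, the clopen sets of the extension are exactly the reinterpretations of the clopen
  sets \<open>C\<close> of the ground model, and \<open>C\<close> is uniquely determined. The reinterpretation of an open set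
  is the union, in the extension, of the basic open sets that it contains. Thus a sequence of clopen
  sets is (a name for) a function from \<open>\<omega>\<close> into the clopen sets of the ground model.
\<close>

definition f_in_clopen :: "'p real_name \<Rightarrow> (nat \<Rightarrow> bool) set \<Rightarrow> 'p sentence" where
  "f_in_clopen x C = (\<^bold>\<exists>s. f_ground (cone s \<subseteq> C) \<^bold>\<and> f_prefix s x)"

definition f_function :: "(nat \<times> 'b, 'p) name \<Rightarrow> 'b set \<Rightarrow> 'p sentence" where
  "f_function f B =
     ((\<^bold>\<forall>n. \<^bold>\<exists>b. (n, b) \<in>\<^sub>g f) \<^bold>\<and>
      (\<^bold>\<forall>n b. (n, b) \<in>\<^sub>g f \<^bold>\<longrightarrow> f_ground (b \<in> B)) \<^bold>\<and>
      (\<^bold>\<forall>n b b'. (n, b) \<in>\<^sub>g f \<^bold>\<and> (n, b') \<in>\<^sub>g f \<^bold>\<longrightarrow> f_geq b b'))"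

definition f_clopen_seq :: "'p clopen_seq_name \<Rightarrow> 'p sentence" where
  "f_clopen_seq c = f_function c {C. open C \<and> closed C}"

definition f_in_nth :: "'p real_name \<Rightarrow> 'p clopen_seq_name \<Rightarrow> nat \<Rightarrow> 'p sentence" where
  "f_in_nth x c n = (\<^bold>\<exists>C. (n, C) \<in>\<^sub>g c \<^bold>\<and> f_in_clopen x C)"

text \<open>
  Measure zero, i.e. outer measure zero, for the product measure on the Cantor space: for every \<open>k\<close>
  there is a sequence \<open>u\<close> of basic open sets covering \<open>X\<close> whose measures sum up to at most \<open>2\<^sup>-\<^sup>k\<close>.
  The list \<open>ss\<close> is an initial segment of \<open>u\<close>, so that all partial sums are bounded.
\<close>

definition f_null :: "'p set_name \<Rightarrow> 'p sentence" where
  "f_null X = (\<^bold>\<forall>k. \<^bold>\<exists>u :: (nat \<times> bool list, 'p) name.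
     f_function u UNIV \<^bold>\<and>
     (\<^bold>\<forall>x. x \<in>\<^sub>r X \<^bold>\<longrightarrow> (\<^bold>\<exists>n s. (n, s) \<in>\<^sub>g u \<^bold>\<and> f_prefix s x)) \<^bold>\<and>
     (\<^bold>\<forall>ss. (\<^bold>\<forall>i. f_ground (i < length ss) \<^bold>\<longrightarrow> (i, ss ! i) \<in>\<^sub>g u) \<^bold>\<longrightarrow>
        f_ground ((\<Sum>s\<leftarrow>ss. (1/2) ^ length s) \<le> ((1/2) ^ k :: real))))"

definition f_N :: "'p clopen_seq_name \<Rightarrow> 'p set_name" where
  "f_N c = f_compr (\<lambda>x. \<^bold>\<forall>m. \<^bold>\<exists>n. f_ground (m \<le> n) \<^bold>\<and> f_in_nth x c n)"

definition f_Omega_bar :: "'p clopen_seq_name \<Rightarrow> 'p sentence" where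
  "f_Omega_bar c = (f_clopen_seq c \<^bold>\<and> f_null (f_N c))"

definition f_hits :: "'p real_name \<Rightarrow> 'p clopen_seq_name \<Rightarrow> 'p real_name" where
  "f_hits x c = f_compr (\<lambda>n. f_in_nth x c n)"

definition f_N_J :: "'p set_name \<Rightarrow> 'p clopen_seq_name \<Rightarrow> 'p set_name" where
  "f_N_J J c = f_compr (\<lambda>x. f_positive J (f_hits x c))"

definition f_N_star_J :: "'p set_name \<Rightarrow> 'p clopen_seq_name \<Rightarrow> 'p set_name" where
  "f_N_star_J J c = f_compr (\<lambda>x. f_dual J (f_hits x c))"

definition f_null_ideal :: "'p set_name \<Rightarrow> ('p set_name, 'p) name" where
  "f_null_ideal J = f_compr (\<lambda>X. \<^bold>\<exists>c. f_Omega_bar c \<^bold>\<and> f_subset f_real_eq X (f_N_J J c))"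

definition f_null_star_ideal :: "'p set_name \<Rightarrow> ('p set_name, 'p) name" where
  "f_null_star_ideal J = f_compr (\<lambda>X. \<^bold>\<exists>c. f_Omega_bar c \<^bold>\<and> f_subset f_real_eq X (f_N_star_J J c))"

definition f_add_eq :: "('p set_name, 'p) name \<Rightarrow> 'k rel \<Rightarrow> 'p sentence" where
  "f_add_eq I \<kappa> = f_least_size (f_set_eq f_real_eq)
     (\<lambda>F. f_subset (f_set_eq f_real_eq) F I \<^bold>\<and>
          (\<^bold>\<not> f_compr (\<lambda>x. \<^bold>\<exists>X. X \<in>\<^sub>s F \<^bold>\<and> x \<in>\<^sub>r X) \<in>\<^sub>s I)) \<kappa>"

definition f_cof_eq :: "('p set_name, 'p) name \<Rightarrow> 'k rel \<Rightarrow> 'p sentence" where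
  "f_cof_eq I \<kappa> = f_least_size (f_set_eq f_real_eq)
     (\<lambda>F. f_subset (f_set_eq f_real_eq) F I \<^bold>\<and>
          (\<^bold>\<forall>X. X \<in>\<^sub>s I \<^bold>\<longrightarrow> (\<^bold>\<exists>Y. Y \<in>\<^sub>s F \<^bold>\<and> f_subset f_real_eq X Y))) \<kappa>"

definition f_le_J :: "'p set_name \<Rightarrow> 'p clopen_seq_name \<Rightarrow> 'p clopen_seq_name \<Rightarrow> 'p sentence" where
  "f_le_J J c d = (f_compr (\<lambda>n. \<^bold>\<not> (\<^bold>\<forall>x. f_in_nth x c n \<^bold>\<longrightarrow> f_in_nth x d n)) \<in>\<^sub>r J)"

definition f_b_eq :: "'p set_name \<Rightarrow> 'k rel \<Rightarrow> 'p sentence" where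
  "f_b_eq J \<kappa> = f_least_size f_seq_eq
     (\<lambda>F. (\<^bold>\<forall>c. c \<in>\<^sub>c F \<^bold>\<longrightarrow> f_Omega_bar c) \<^bold>\<and>
          (\<^bold>\<not> (\<^bold>\<exists>d. f_Omega_bar d \<^bold>\<and> (\<^bold>\<forall>c. c \<in>\<^sub>c F \<^bold>\<longrightarrow> f_le_J J c d)))) \<kappa>"

definition f_d_eq :: "'p set_name \<Rightarrow> 'k rel \<Rightarrow> 'p sentence" where
  "f_d_eq J \<kappa> = f_least_size f_seq_eq
     (\<lambda>F. (\<^bold>\<forall>c. c \<in>\<^sub>c F \<^bold>\<longrightarrow> f_Omega_bar c) \<^bold>\<and>
          (\<^bold>\<forall>c. f_Omega_bar c \<^bold>\<longrightarrow> (\<^bold>\<exists>d. d \<in>\<^sub>c F \<^bold>\<and> f_le_J J c d))) \<kappa>"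

definition f_all_values_eq :: "'p set_name \<Rightarrow> 'k rel \<Rightarrow> 'p sentence" where
  "f_all_values_eq J \<kappa> =
     (f_b_eq J \<kappa> \<^bold>\<and> f_add_eq (f_null_ideal J) \<kappa> \<^bold>\<and> f_add_eq (f_null_star_ideal J) \<kappa> \<^bold>\<and>
      f_cof_eq (f_null_star_ideal J) \<kappa> \<^bold>\<and> f_cof_eq (f_null_ideal J) \<kappa> \<^bold>\<and> f_d_eq J \<kappa>)"

end

text \<open>The ordinal \<open>\<pi>\<close> is the order type of \<open>'o\<close>.\<close>

definition cofinal_in :: "'o::wellorder set \<Rightarrow> bool" where
  "cofinal_in C \<longleftrightarrow> (\<forall>\<alpha>. \<exists>\<beta>\<in>C. \<alpha> \<le> \<beta>)"

definition cofinality :: "'o::wellorder rel" where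
  "cofinality = |SOME K :: 'o set. cofinal_in K \<and> (\<forall>C :: 'o set. cofinal_in C \<longrightarrow> |K| \<le>o |C| )|"

text \<open>
  For each \<open>\<alpha> < \<pi>\<close>, the pair \<open>(Q \<alpha>, L \<alpha>)\<close> of names for the stage \<open>\<alpha>\<close> is a name for a preorder, where
  \<open>'q\<close> is an arbitrary ground model type providing the domains of the names \<open>Q \<alpha>\<close>. Up to isomorphism
  in the extension this covers every name for a preorder. A condition is a finite partial function
  \<open>p\<close> such that for every \<open>\<xi>\<close> in its domain, \<open>p \<xi>\<close> is in the domain of the name \<open>Q \<xi>\<close> and
  \<open>p \<restriction> \<xi>\<close> forces \<open>p \<xi> \<in> Q \<xi>\<close>; coordinates outside the domain are trivial.

  \<open>fs_order R Q L I\<close> is the order on the conditions with domain contained in the initial segment \<open>I\<close>,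
  given the orders \<open>R \<xi>\<close> of the stages \<open>\<xi> \<in> I\<close>.
\<close>

definition fs_conditions ::
    "('o::wellorder \<Rightarrow> ('o \<rightharpoonup> 'q) \<Rightarrow> ('o \<rightharpoonup> 'q) \<Rightarrow> bool) \<Rightarrow>
     ('o \<Rightarrow> ('q, 'o \<rightharpoonup> 'q) name) \<Rightarrow> 'o set \<Rightarrow> ('o \<rightharpoonup> 'q) set" where
  "fs_conditions R Q I = {p. finite (dom p) \<and> dom p \<subseteq> I \<and>
     (\<forall>\<xi>\<in>dom p. f_mem (R \<xi>) f_geq (the (p \<xi>)) (Q \<xi>) (p |` {..<\<xi>}))}"

definition fs_order ::
    "('o::wellorder \<Rightarrow> ('o \<rightharpoonup> 'q) \<Rightarrow> ('o \<rightharpoonup> 'q) \<Rightarrow> bool) \<Rightarrow>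
     ('o \<Rightarrow> ('q, 'o \<rightharpoonup> 'q) name) \<Rightarrow> ('o \<Rightarrow> ('q \<times> 'q, 'o \<rightharpoonup> 'q) name) \<Rightarrow> 'o set \<Rightarrow>
     ('o \<rightharpoonup> 'q) \<Rightarrow> ('o \<rightharpoonup> 'q) \<Rightarrow> bool" where
  "fs_order R Q L I p q \<longleftrightarrow>
     p \<in> fs_conditions R Q I \<and> q \<in> fs_conditions R Q I \<and> dom q \<subseteq> dom p \<and>
     (\<forall>\<xi>\<in>dom q. f_mem (R \<xi>) f_geq (the (p \<xi>), the (q \<xi>)) (L \<xi>) (p |` {..<\<xi>}))"

text \<open>The stage \<open>\<alpha> < \<pi>\<close>, by recursion on \<open>\<alpha>\<close>; only the orders of stages \<open>\<xi> < \<alpha>\<close> are relevant to it.\<close>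

function fs_stage ::
    "('o::wellorder \<Rightarrow> ('q, 'o \<rightharpoonup> 'q) name) \<Rightarrow> ('o \<Rightarrow> ('q \<times> 'q, 'o \<rightharpoonup> 'q) name) \<Rightarrow> 'o \<Rightarrow>
     ('o \<rightharpoonup> 'q) \<Rightarrow> ('o \<rightharpoonup> 'q) \<Rightarrow> bool" where
  "fs_stage Q L \<alpha> =
     fs_order (\<lambda>\<xi>. if \<xi> < \<alpha> then fs_stage Q L \<xi> else (\<lambda>_ _. False)) Q L {..<\<alpha>}"
  by pat_completeness auto
termination
  by (relation "inv_image {(\<xi>, \<alpha>). \<xi> < \<alpha>} (\<lambda>(Q, L, \<alpha>). \<alpha>)") (auto simp: wf wf_inv_image)

definition fs_limit ::
    "('o::wellorder \<Rightarrow> ('q, 'o \<rightharpoonup> 'q) name) \<Rightarrow> ('o \<Rightarrow> ('q \<times> 'q, 'o \<rightharpoonup> 'q) name) \<Rightarrow>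
     ('o \<rightharpoonup> 'q) \<Rightarrow> ('o \<rightharpoonup> 'q) \<Rightarrow> bool" where
  "fs_limit Q L = fs_order (fs_stage Q L) Q L UNIV"

end

theory Submission
  imports Defs "HOL-Probability.Probability"
begin

text \<open>
  Let \<open>\<kappa>\<close> be the cofinality of \<open>\<pi>\<close>. The iteration is \<open>\<kappa>\<close>-cc, so every sequence of clopen sets in the
  extension is determined by a stage before \<open>\<pi>\<close>. Since the iterands are nontrivial, the \<open>\<omega>\<close> steps
  from a limit stage \<open>\<delta>\<close> on add a Cohen real, which codes a sequence \<open>c\<^sup>\<delta>\<close> of clopen sets with summable
  measures. If \<open>d\<close> is in \<open>\<Omega>\<close>-bar, then \<open>\<mu>(d\<^sub>n)\<close> converges to 0 (otherwise the limit superior would not be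
  null); so if \<open>d\<close> and an infinite set \<open>A\<close> belong to the stage \<open>\<delta>\<close>, then by genericity \<open>d\<^sub>n \<subseteq> c\<^sup>\<delta>\<^sub>n\<close> for
  infinitely many \<open>n \<in> A\<close>. Hence the sets \<open>{n. d\<^sub>n \<subseteq> c\<^sup>\<delta>\<^sub>n}\<close>, with \<open>d\<close> in the stage \<open>\<delta>\<close>, generate a proper
  filter. For every maximal ideal \<open>J\<close> disjoint from it, the \<open>c\<^sup>\<delta>\<close> are increasing and cofinal with respect
  to \<open>\<subseteq>\<^sup>J\<close>, and so are the sets \<open>N\<^sub>J(c\<^sup>\<delta>)\<close> and \<open>N\<^sup>*\<^sub>J(c\<^sup>\<delta>)\<close> in their ideals. No member is a largest
  one, because singletons are in the ideals but the whole space is not null, so all six cardinals equal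
  \<open>\<kappa>\<close>, which is still regular in the extension.
\<close>

subsection \<open>Forcing with a preorder\<close>

text \<open>No generic extension is available: HOL itself is the ground model, and a sentence is the
  set of conditions forcing it. Intermediate models are replaced by supports: a sentence belongs to
  the stage \<delta> if a condition forces it exactly when its restriction to \<delta> does. Such
  sentences survive cutting a condition at \<delta> and attaching another tail, so quotient forcings
  never appear. Absoluteness of measure theory is replaced by transfer from all assignments of truth
  values to names; hence points and covers have to be explicit Borel functions of codes. The main
  tension lies in the coding of the Cohen sequences: the total weight must stay bounded for every
  bit sequence, while finitely many bits must leave room for a prescribed clopen set at a prescribed
  later place. The allowance 2^-w, halved at each nonempty entry, serves both, and it is why
  \<mu>(d_n) has to tend to 0: only small d_n fit. Properness of the filter for several limits
  \<delta> at once is an induction in increasing order, because domination at the smaller limits is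
  a sentence of the largest stage.\<close>

locale forcing_order =
  fixes le :: "'p \<Rightarrow> 'p \<Rightarrow> bool"
  assumes le_trans: "le r q \<Longrightarrow> le q p \<Longrightarrow> le r p"
    and le_left: "le q p \<Longrightarrow> le q q"
    and le_right: "le q p \<Longrightarrow> le p p"
begin

text \<open>The regular open sets of conditions, i.e. the truth values of the Boolean completion.
  The guard \<open>le p p\<close> matters: nothing lies below a non-condition, so the density
  premise would hold there vacuously.\<close>

definition regular :: "'p sentence \<Rightarrow> bool" where
  "regular \<phi> \<longleftrightarrow> (\<forall>p q. \<phi> p \<longrightarrow> le q p \<longrightarrow> \<phi> q) \<and>
     (\<forall>p. le p p \<longrightarrow> (\<forall>q. le q p \<longrightarrow> (\<exists>r. le r q \<and> \<phi> r)) \<longrightarrow> \<phi> p)"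

lemma regular_mono: "regular \<phi> \<Longrightarrow> \<phi> p \<Longrightarrow> le q p \<Longrightarrow> \<phi> q"
  unfolding regular_def by blast

lemma regular_dense: "regular \<phi> \<Longrightarrow> le p p \<Longrightarrow> (\<And>q. le q p \<Longrightarrow> \<exists>r. le r q \<and> \<phi> r) \<Longrightarrow> \<phi> p"
  unfolding regular_def by blast

lemma regularI:
  assumes "\<And>p q. \<phi> p \<Longrightarrow> le q p \<Longrightarrow> \<phi> q"
    and "\<And>p. le p p \<Longrightarrow> (\<And>q. le q p \<Longrightarrow> \<exists>r. le r q \<and> \<phi> r) \<Longrightarrow> \<phi> p"
  shows "regular \<phi>"
  unfolding regular_def using assms by blast

lemma regular_ground [simp, intro]: "regular (f_ground b)"
  by (rule regularI) (auto simp: f_ground_def)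

lemma regular_geq [simp, intro]: "regular (f_geq x y)"
  unfolding f_geq_def by simp

lemma regular_all [intro]: "(\<And>x. regular (\<phi> x)) \<Longrightarrow> regular (f_all \<phi>)"
  unfolding f_all_def by (rule regularI) (blast intro: regular_mono, blast intro: regular_dense)

lemma regular_ball: "(\<And>x. x \<in> A \<Longrightarrow> regular (\<phi> x)) \<Longrightarrow> regular (\<lambda>p. \<forall>x\<in>A. \<phi> x p)"
  by (rule regularI) (blast intro: regular_mono, blast intro: regular_dense)

lemma regular_and [intro]: "regular \<phi> \<Longrightarrow> regular \<psi> \<Longrightarrow> regular (\<phi> \<^bold>\<and> \<psi>)"
  unfolding f_and_def by (rule regularI) (blast intro: regular_mono, blast intro: regular_dense)

lemma regular_not [intro]: "regular \<phi> \<Longrightarrow> regular (f_not le \<phi>)"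
  unfolding f_not_def
  by (rule regularI) (blast intro: le_trans, meson regular_mono le_trans le_left)

lemma regular_or [intro]: "regular \<phi> \<Longrightarrow> regular \<psi> \<Longrightarrow> regular (f_or le \<phi> \<psi>)"
  unfolding f_or_def by blast

lemma regular_imp [intro]: "regular \<phi> \<Longrightarrow> regular \<psi> \<Longrightarrow> regular (f_imp le \<phi> \<psi>)"
  unfolding f_imp_def by blast

lemma regular_iff [intro]: "regular \<phi> \<Longrightarrow> regular \<psi> \<Longrightarrow> regular (f_iff le \<phi> \<psi>)"
  unfolding f_iff_def by blast

lemma regular_ex [intro]: "(\<And>x. regular (\<phi> x)) \<Longrightarrow> regular (f_ex le \<phi>)"
  unfolding f_ex_def by blast

text \<open>The density built into the clause for membership makes it regular for every
  \<open>eq\<close>, even if \<open>eq\<close> itself is not.\<close>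

lemma regular_mem [simp, intro]: "regular (f_mem le eq x \<tau>)"
  unfolding f_mem_def by (rule regularI) (meson le_trans, meson le_trans le_left)

lemma mem_mono: "f_mem le eq x \<tau> p \<Longrightarrow> le q p \<Longrightarrow> f_mem le eq x \<tau> q"
  by (rule regular_mono[OF regular_mem])

lemma regular_set_eq [simp, intro]: "regular (f_set_eq le eq \<sigma> \<tau>)"
proof -
  have half: "regular (\<lambda>p. \<forall>(x, s)\<in>\<sigma>. \<forall>q. le q p \<and> le q s \<longrightarrow> f_mem le eq x \<tau> q)" for \<sigma> \<tau> :: "('a, 'p) name"
  proof (rule regularI, goal_cases)
    case (1 p q)
    then show ?case using le_trans by blast
  next
    case (2 p)
    have "f_mem le eq x \<tau> q" if xs: "(x, s) \<in> \<sigma>" and q: "le q p" "le q s" for x s q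
    proof (rule regular_dense[OF regular_mem])
      show "le q q" using q le_left by blast
      fix q' assume q': "le q' q"
      then have "le q' p" using q le_trans by blast
      then obtain r where r: "le r q'" "\<forall>(x, s)\<in>\<sigma>. \<forall>q. le q r \<and> le q s \<longrightarrow> f_mem le eq x \<tau> q"
        using 2(2) by blast
      moreover have "le r s" "le r r" using r(1) q' q le_trans le_left by blast+
      ultimately show "\<exists>r. le r q' \<and> f_mem le eq x \<tau> r"
        using xs by blast
    qed
    then show ?case by blast
  qed
  show ?thesis
    using regular_and[OF half[of \<sigma> \<tau>] half[of \<tau> \<sigma>]] unfolding f_and_def f_set_eq_def .
qed

section \<open>Forcing clauses in readable form\<close>

lemma not_iff: "f_not le \<phi> p \<longleftrightarrow> (\<forall>q. le q p \<longrightarrow> \<not> \<phi> q)"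
  by (simp add: f_not_def)

lemma and_iff: "(\<phi> \<^bold>\<and> \<psi>) p \<longleftrightarrow> \<phi> p \<and> \<psi> p"
  by (simp add: f_and_def)

lemma all_iff: "f_all \<phi> p \<longleftrightarrow> (\<forall>x. \<phi> x p)"
  by (simp add: f_all_def)

lemma ground_iff: "f_ground b p \<longleftrightarrow> b"
  by (simp add: f_ground_def)

lemma geq_iff: "f_geq x y p \<longleftrightarrow> x = y"
  by (simp add: f_geq_def f_ground_def)

text \<open>By definition the implication only excludes a stronger condition that forces \<phi> and
  the negation of \<psi>. Regularity of \<psi> turns this double negation into \<psi>
  itself.\<close>

lemma imp_iff:
  assumes "regular \<phi>" "regular \<psi>"
  shows "f_imp le \<phi> \<psi> p \<longleftrightarrow> (\<forall>q. le q p \<longrightarrow> \<phi> q \<longrightarrow> \<psi> q)"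
proof
  assume *: "f_imp le \<phi> \<psi> p"
  show "\<forall>q. le q p \<longrightarrow> \<phi> q \<longrightarrow> \<psi> q"
  proof (intro allI impI)
    fix q assume q: "le q p" "\<phi> q"
    show "\<psi> q"
    proof (rule regular_dense[OF assms(2)])
      show "le q q" using q le_left by blast
      fix q' assume q': "le q' q"
      then have "\<phi> q'" "le q' p" using q assms(1) le_trans regular_mono by blast+
      then show "\<exists>r. le r q' \<and> \<psi> r"
        using * unfolding f_imp_def f_not_def f_and_def by blast
    qed
  qed
next
  assume *: "\<forall>q. le q p \<longrightarrow> \<phi> q \<longrightarrow> \<psi> q"
  then show "f_imp le \<phi> \<psi> p"
    unfolding f_imp_def f_not_def f_and_def using le_left by blast
qed

lemma iff_iff:
  assumes "regular \<phi>" "regular \<psi>"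
  shows "f_iff le \<phi> \<psi> p \<longleftrightarrow> (\<forall>q. le q p \<longrightarrow> (\<phi> q \<longleftrightarrow> \<psi> q))"
  unfolding f_iff_def and_iff imp_iff[OF assms] imp_iff[OF assms(2,1)] by blast

lemma ex_iff: "f_ex le \<phi> p \<longleftrightarrow> (\<forall>q. le q p \<longrightarrow> (\<exists>r. le r q \<and> (\<exists>x. \<phi> x r)))"
  unfolding f_ex_def f_not_def f_all_def by blast

lemma or_iff: "f_or le \<phi> \<psi> p \<longleftrightarrow> (\<forall>q. le q p \<longrightarrow> (\<exists>r. le r q \<and> (\<phi> r \<or> \<psi> r)))"
  unfolding f_or_def f_not_def f_and_def by auto

lemma exI_forced: "regular (\<phi> x) \<Longrightarrow> \<phi> x p \<Longrightarrow> f_ex le \<phi> p"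
  unfolding ex_iff using regular_mono[of "\<phi> x"] le_left by meson

lemma decide:
  assumes "le p p"
  obtains q where "le q p" "\<phi> q \<or> f_not le \<phi> q"
  using assms unfolding f_not_def by blast

lemma not_forced:
  assumes "regular \<phi>" "le p p" "\<not> \<phi> p"
  obtains q where "le q p" "f_not le \<phi> q"
  using assms regular_dense[OF assms(1,2)] unfolding f_not_def by blast

text \<open>An equality of names forced by p makes sentences equivalent only below p, so all
  congruence rules are relative to a condition.\<close>

definition agree :: "'p \<Rightarrow> 'p sentence \<Rightarrow> 'p sentence \<Rightarrow> bool" where
  "agree p \<phi> \<psi> \<longleftrightarrow> (\<forall>q. le q p \<longrightarrow> \<phi> q = \<psi> q)"

lemma agree_refl [simp]: "agree p \<phi> \<phi>"
  by (simp add: agree_def)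

lemma agreeD: "agree p \<phi> \<psi> \<Longrightarrow> le q p \<Longrightarrow> \<phi> q = \<psi> q"
  by (simp add: agree_def)

lemma agree_mono: "agree p \<phi> \<psi> \<Longrightarrow> le q p \<Longrightarrow> agree q \<phi> \<psi>"
  unfolding agree_def using le_trans by blast

lemma agree_and: "agree p \<phi> \<phi>' \<Longrightarrow> agree p \<psi> \<psi>' \<Longrightarrow> agree p (\<phi> \<^bold>\<and> \<psi>) (\<phi>' \<^bold>\<and> \<psi>')"
  by (simp add: agree_def f_and_def)

lemma agree_not: "agree p \<phi> \<phi>' \<Longrightarrow> agree p (f_not le \<phi>) (f_not le \<phi>')"
  unfolding agree_def f_not_def using le_trans by blast

lemma agree_all: "(\<And>x. agree p (\<phi> x) (\<phi>' x)) \<Longrightarrow> agree p (f_all \<phi>) (f_all \<phi>')"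
  by (simp add: agree_def f_all_def)

lemma agree_imp: "agree p \<phi> \<phi>' \<Longrightarrow> agree p \<psi> \<psi>' \<Longrightarrow> agree p (f_imp le \<phi> \<psi>) (f_imp le \<phi>' \<psi>')"
  unfolding f_imp_def by (intro agree_not agree_and)

lemma agree_iff: "agree p \<phi> \<phi>' \<Longrightarrow> agree p \<psi> \<psi>' \<Longrightarrow> agree p (f_iff le \<phi> \<psi>) (f_iff le \<phi>' \<psi>')"
  unfolding f_iff_def by (intro agree_imp agree_and)

lemma agree_ex: "(\<And>x. agree p (\<phi> x) (\<phi>' x)) \<Longrightarrow> agree p (f_ex le \<phi>) (f_ex le \<phi>')"
  unfolding f_ex_def by (intro agree_not agree_all)

lemma agree_compr:
  assumes "\<And>x. agree p (\<phi> x) (\<phi>' x)" "\<And>x. regular (\<phi> x)" "\<And>x. regular (\<phi>' x)"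
  shows "agree p (f_mem le eq x (f_compr le \<phi>)) (f_mem le eq x (f_compr le \<phi>'))"
proof -
  have *: "f_mem le eq x (f_compr le \<psi>') q"
    if ag: "\<And>x. agree p (\<psi> x) (\<psi>' x)" and reg: "\<And>x. regular (\<psi> x)"
      and mem: "f_mem le eq x (f_compr le \<psi>) q" and "le q p" for \<psi> \<psi>' q
    unfolding f_mem_def
  proof (intro allI impI)
    fix q' assume q': "le q' q"
    then obtain r y s where r: "le r q'" "\<psi> y s" "le r s" "eq x y r"
      using mem unfolding f_mem_def f_compr_def by blast
    \<comment> \<open>The element enters the name with a condition s that need not be below p;
      agreement can be applied only at r.\<close>
    have "le r p" using r(1) q' \<open>le q p\<close> le_trans by blast
    then have "\<psi>' y r" using ag[of y] regular_mono[OF reg r(2,3)] agreeD by blast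
    then show "\<exists>r. le r q' \<and> (\<exists>(y, s)\<in>f_compr le \<psi>'. le r s \<and> eq x y r)"
      using r le_left[OF r(1)] unfolding f_compr_def by blast
  qed
  have sym: "agree p (\<phi>' x) (\<phi> x)" for x using assms(1) by (simp add: agree_def)
  show ?thesis
    unfolding agree_def[of p "f_mem le eq x (f_compr le \<phi>)"]
    using *[of \<phi> \<phi>', OF assms(1,2)] *[of \<phi>' \<phi>, OF sym assms(3)] by blast
qed

section \<open>Boolean-valued equality and comprehension\<close>

definition equality :: "('a \<Rightarrow> 'a \<Rightarrow> 'p sentence) \<Rightarrow> bool" where
  "equality eq \<longleftrightarrow> (\<forall>x p. le p p \<longrightarrow> eq x x p) \<and> (\<forall>x y p. eq x y p \<longrightarrow> eq y x p) \<and>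
     (\<forall>x y z p. eq x y p \<longrightarrow> eq y z p \<longrightarrow> eq x z p) \<and> (\<forall>x y. regular (eq x y))"

lemma equalityD:
  assumes "equality eq"
  shows equality_refl: "le p p \<Longrightarrow> eq x x p"
    and equality_sym: "eq x y p \<Longrightarrow> eq y x p"
    and equality_trans: "eq x y p \<Longrightarrow> eq y z p \<Longrightarrow> eq x z p"
    and equality_regular: "regular (eq x y)"
    and equality_mono: "eq x y p \<Longrightarrow> le q p \<Longrightarrow> eq x y q"
  using assms unfolding equality_def regular_def by blast+

lemma equality_geq [simp]: "equality f_geq"
  unfolding equality_def by (simp add: geq_iff)

lemma equality_pair:
  assumes "equality eqa" "equality eqb"
  shows "equality (f_pair_eq eqa eqb)"
proof -
  note a = equalityD[OF assms(1)] and b = equalityD[OF assms(2)]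
  show ?thesis
    unfolding equality_def
  proof (intro conjI allI impI)
    show "regular (f_pair_eq eqa eqb x y)" for x y
      unfolding f_pair_eq_def by (intro regular_and a b)
    show "f_pair_eq eqa eqb x z p"
      if "f_pair_eq eqa eqb x y p" "f_pair_eq eqa eqb y z p" for x y z p
      using that a(3) b(3) unfolding f_pair_eq_def and_iff by blast
  qed (auto simp: f_pair_eq_def and_iff intro: a b)
qed

lemma mem_cong:
  assumes "equality eq" "eq x y p" "f_mem le eq y \<tau> p"
  shows "f_mem le eq x \<tau> p"
  unfolding f_mem_def
proof (intro allI impI)
  fix q assume q: "le q p"
  then obtain r z s where r: "le r q" "(z, s) \<in> \<tau>" "le r s" "eq y z r"
    using assms(3) unfolding f_mem_def by blast
  have "eq x y r" using equality_mono[OF assms(1,2)] le_trans[OF r(1) q] by blast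
  then have "eq x z r" using r(4) equality_trans[OF assms(1)] by blast
  then show "\<exists>r. le r q \<and> (\<exists>(y, s)\<in>\<tau>. le r s \<and> eq x y r)" using r by blast
qed

lemma set_eq_mem:
  assumes "equality eq" "f_set_eq le eq \<sigma> \<tau> p" "f_mem le eq x \<sigma> p"
  shows "f_mem le eq x \<tau> p"
  unfolding f_mem_def
proof (intro allI impI)
  fix q assume q: "le q p"
  then obtain r y s where r: "le r q" "(y, s) \<in> \<sigma>" "le r s" "eq x y r"
    using assms(3) unfolding f_mem_def by blast
  have "le r p" using r q le_trans by blast
  then have "f_mem le eq y \<tau> r" using assms(2) r unfolding f_set_eq_def by blast
  then have "f_mem le eq x \<tau> r" using mem_cong[OF assms(1) r(4)] by blast
  then obtain r' where "le r' r" "\<exists>(y, s)\<in>\<tau>. le r' s \<and> eq x y r'"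
    unfolding f_mem_def using le_left[OF r(1)] by blast
  then show "\<exists>r. le r q \<and> (\<exists>(y, s)\<in>\<tau>. le r s \<and> eq x y r)" using r le_trans by blast
qed

lemma memI:
  assumes "equality eq" "(x, s) \<in> \<tau>" "le p s"
  shows "f_mem le eq x \<tau> p"
  unfolding f_mem_def using assms by (blast intro: equality_refl le_trans le_left)

lemma mem_geqI: "(x, s) \<in> \<tau> \<Longrightarrow> le p s \<Longrightarrow> f_mem le f_geq x \<tau> p"
  by (rule memI[OF equality_geq])

lemma set_eq_iff:
  assumes "equality eq"
  shows "f_set_eq le eq \<sigma> \<tau> p \<longleftrightarrow>
    (\<forall>x q. le q p \<longrightarrow> f_mem le eq x \<sigma> q \<longleftrightarrow> f_mem le eq x \<tau> q)" (is "?l \<longleftrightarrow> ?r")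
proof
  have sym: "f_set_eq le eq \<tau> \<sigma> q" if "f_set_eq le eq \<sigma> \<tau> q" for q
    using that unfolding f_set_eq_def by blast
  assume ?l
  then show ?r
    using set_eq_mem[OF assms] sym regular_mono[OF regular_set_eq] by blast
next
  assume r: ?r
  show ?l unfolding f_set_eq_def
    using r memI[OF assms] by fast
qed

lemma equality_set_eq:
  assumes "equality eq"
  shows "equality (f_set_eq le eq)"
  unfolding equality_def by (auto simp: set_eq_iff[OF assms] intro: regular_set_eq)

lemma equality_real: "equality (f_set_eq le f_geq)"
  by (simp add: equality_set_eq)

lemma equality_set_real: "equality (f_set_eq le (f_set_eq le f_geq))"
  by (simp add: equality_set_eq)

text \<open>The element found in the name is merely forced equal to x, so comprehension needs that
  \<phi> respects \<open>eq\<close>; density then carries \<phi> from below p up to p.\<close>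

lemma mem_compr:
  assumes "equality eq" "\<And>x. regular (\<phi> x)"
    and "\<And>x y q. le q q \<Longrightarrow> eq x y q \<Longrightarrow> \<phi> y q \<Longrightarrow> \<phi> x q" and "le p p"
  shows "f_mem le eq x (f_compr le \<phi>) p \<longleftrightarrow> \<phi> x p"
proof
  assume *: "f_mem le eq x (f_compr le \<phi>) p"
  show "\<phi> x p"
  proof (rule regular_dense[OF assms(2,4)])
    fix q assume "le q p"
    then obtain r y s where r: "le r q" "\<phi> y s" "le r s" "eq x y r"
      using * unfolding f_mem_def f_compr_def by blast
    then have "\<phi> x r" using assms(3)[of r x y] regular_mono[OF assms(2)] le_left by blast
    then show "\<exists>r. le r q \<and> \<phi> x r" using r by blast
  qed
next
  assume "\<phi> x p"
  then show "f_mem le eq x (f_compr le \<phi>) p"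
    using assms(4) by (intro memI[OF assms(1), where s = p]) (auto simp: f_compr_def)
qed

lemma mem_compr_geq:
  assumes "\<And>x. regular (\<phi> x)" "le p p"
  shows "f_mem le f_geq x (f_compr le \<phi>) p \<longleftrightarrow> \<phi> x p"
  by (rule mem_compr) (use assms in \<open>auto simp: geq_iff\<close>)

lemma subset_iff:
  "f_subset le eq \<sigma> \<tau> p \<longleftrightarrow> (\<forall>x q. le q p \<longrightarrow> f_mem le eq x \<sigma> q \<longrightarrow> f_mem le eq x \<tau> q)"
  unfolding f_subset_def all_iff imp_iff[OF regular_mem regular_mem] by blast

lemma regular_subset [simp, intro]: "regular (f_subset le eq \<sigma> \<tau>)"
  unfolding f_subset_def by blast

end

subsection \<open>Uncountable regular cardinals\<close>

locale uncountable_regular =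
  fixes \<kappa> :: "'k rel"
  assumes card_order: "Card_order \<kappa>"
    and regular_card: "regularCard \<kappa>"
    and uncountable: "|UNIV :: nat set| <o \<kappa>"
begin

definition small :: "'a set \<Rightarrow> bool" where
  "small A \<longleftrightarrow> |A| <o \<kappa>"

lemma small_mono: "small B \<Longrightarrow> A \<subseteq> B \<Longrightarrow> small A"
  unfolding small_def using card_of_mono1 ordLeq_ordLess_trans by blast

lemma small_image: "small A \<Longrightarrow> small (f ` A)"
  unfolding small_def using card_of_image ordLeq_ordLess_trans by blast

lemma small_inj: "small B \<Longrightarrow> inj_on f A \<Longrightarrow> f ` A \<subseteq> B \<Longrightarrow> small A"
  unfolding small_def by (metis card_of_ordLeq ordLeq_ordLess_trans)

lemma small_countable: "countable A \<Longrightarrow> small A"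
  by (rule small_inj[of "UNIV :: nat set" "to_nat_on A"])
    (auto simp: small_def uncountable)

lemma small_finite: "finite A \<Longrightarrow> small A"
  by (simp add: small_countable uncountable_infinite countable_finite)

lemma small_UN:
  assumes "small I" "\<And>i. i \<in> I \<Longrightarrow> small (A i)"
  shows "small (\<Union>i\<in>I. A i)"
proof -
  have "infinite (Field \<kappa>)"
    using uncountable card_order
    by (metis card_of_Field_ordIso infinite_UNIV_nat infinite_iff_card_of_nat ordLeq_ordIso_trans
        ordIso_symmetric ordLess_imp_ordLeq)
  then have "Cinfinite \<kappa>" using card_order by (simp add: cinfinite_def)
  then show ?thesis
    using card_of_UNION_ordLess_infinite_Field_regularCard[OF regular_card, of I A] assms
    unfolding small_def by blast
qed

lemma small_Sigma:
  assumes "small I" "\<And>i. i \<in> I \<Longrightarrow> small (A i)"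
  shows "small (Sigma I A)"
proof -
  have "Sigma I A = (\<Union>i\<in>I. Pair i ` A i)" by auto
  then show ?thesis by (simp only:) (intro small_UN assms(1) small_image assms(2))
qed

lemma small_underS: "\<xi> \<in> Field \<kappa> \<Longrightarrow> small (underS \<kappa> \<xi>)"
  unfolding small_def by (rule card_of_underS[OF card_order])

lemma large_fibre:
  assumes "\<not> small A" "small I" "f ` A \<subseteq> I"
  obtains i where "i \<in> I" "\<not> small {x \<in> A. f x = i}"
proof -
  have "A = (\<Union>i\<in>I. {x \<in> A. f x = i})" using assms(3) by auto
  then show ?thesis using assms(1) small_UN[OF assms(2), of "\<lambda>i. {x \<in> A. f x = i}"] that by metis
qed

text \<open>The \<Delta>-system lemma for an indexed family of n-element sets. A point lying in
  \<kappa> many sets is put into the root and removed. If there is none, a maximal pairwise disjoint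
  subfamily is large: otherwise its union has fewer than \<kappa> points, each in fewer than
  \<kappa> sets, and by maximality every set meets this union.\<close>

lemma delta_system_card:
  assumes "\<not> small A" "\<And>p. p \<in> A \<Longrightarrow> finite (f p) \<and> card (f p) = n"
  shows "\<exists>B\<subseteq>A. \<not> small B \<and> (\<exists>R. \<forall>p\<in>B. \<forall>q\<in>B. p \<noteq> q \<longrightarrow> f p \<inter> f q = R)"
  using assms
proof (induction n arbitrary: A f)
  case 0
  then have "f p = {}" if "p \<in> A" for p using that by (metis card_0_eq)
  then have "\<forall>p\<in>A. \<forall>q\<in>A. p \<noteq> q \<longrightarrow> f p \<inter> f q = {}" by simp
  then show ?case using 0(1) by blast
next
  case (Suc n)
  show ?case
  proof (cases "\<exists>x. \<not> small {p \<in> A. x \<in> f p}")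
    case True
    then obtain x where x: "\<not> small {p \<in> A. x \<in> f p}" by blast
    have "finite (f p - {x}) \<and> card (f p - {x}) = n" if "p \<in> {p \<in> A. x \<in> f p}" for p
      using Suc.prems(2)[of p] that by auto
    with x have "\<exists>B\<subseteq>{p \<in> A. x \<in> f p}. \<not> small B \<and>
        (\<exists>R. \<forall>p\<in>B. \<forall>q\<in>B. p \<noteq> q \<longrightarrow> (f p - {x}) \<inter> (f q - {x}) = R)"
      by (rule Suc.IH)
    then obtain B R where B: "B \<subseteq> {p \<in> A. x \<in> f p}" "\<not> small B"
      "\<forall>p\<in>B. \<forall>q\<in>B. p \<noteq> q \<longrightarrow> (f p - {x}) \<inter> (f q - {x}) = R" by (elim exE conjE)
    have "f p \<inter> f q = insert x R" if "p \<in> B" "q \<in> B" "p \<noteq> q" for p q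
    proof -
      have "(f p - {x}) \<inter> (f q - {x}) = R" using B(3) that by blast
      moreover have "x \<in> f p" "x \<in> f q" using B(1) that by blast+
      ultimately show ?thesis by blast
    qed
    then have "\<forall>p\<in>B. \<forall>q\<in>B. p \<noteq> q \<longrightarrow> f p \<inter> f q = insert x R" by blast
    moreover have "B \<subseteq> A" using B(1) by blast
    ultimately show ?thesis using B(2) by meson
  next
    case False
    let ?Z = "{M. M \<subseteq> A \<and> (\<forall>p\<in>M. \<forall>q\<in>M. p \<noteq> q \<longrightarrow> f p \<inter> f q = {})}"
    have "\<exists>M\<in>?Z. \<forall>X\<in>?Z. M \<subseteq> X \<longrightarrow> X = M"
    proof (rule subset_Zorn')
      fix C assume C: "subset.chain ?Z C"
      have "p = q \<or> f p \<inter> f q = {}" if pq: "p \<in> \<Union>C" "q \<in> \<Union>C" for p q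
      proof -
        obtain X Y where XY: "X \<in> C" "Y \<in> C" "p \<in> X" "q \<in> Y" using pq by blast
        then have "X \<subseteq> Y \<or> Y \<subseteq> X" using C by (meson subset_chain_def)
        then obtain Z where Z: "Z \<in> C" "p \<in> Z" "q \<in> Z" using XY by blast
        moreover have "C \<subseteq> ?Z" using C by (meson subset_chain_def)
        ultimately have "Z \<in> ?Z" by (rule_tac subsetD)
        then show ?thesis using Z by blast
      qed
      moreover have "C \<subseteq> ?Z" using C by (meson subset_chain_def)
      then have "\<Union>C \<subseteq> A" by blast
      ultimately show "\<Union>C \<in> ?Z" by blast
    qed
    then obtain M where M: "M \<subseteq> A" "\<forall>p\<in>M. \<forall>q\<in>M. p \<noteq> q \<longrightarrow> f p \<inter> f q = {}"
      and max: "\<And>X. X \<in> ?Z \<Longrightarrow> M \<subseteq> X \<Longrightarrow> X = M" by force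
    have "\<not> small M"
    proof
      assume "small M"
      then have "small (\<Union>p\<in>M. f p)"
        by (rule small_UN) (use M(1) Suc.prems(2) small_finite in blast)
      then have "small (\<Union>x\<in>(\<Union>p\<in>M. f p). {p \<in> A. x \<in> f p})"
        by (rule small_UN) (use False in blast)
      moreover have "A \<subseteq> (\<Union>x\<in>(\<Union>p\<in>M. f p). {p \<in> A. x \<in> f p})"
      proof
        fix p assume p: "p \<in> A"
        then have ne: "f p \<noteq> {}" using Suc.prems(2)[of p] by auto
        have "\<exists>q\<in>M. f p \<inter> f q \<noteq> {}"
        proof (rule ccontr)
          assume no: "\<not> ?thesis"
          then have "insert p M \<in> ?Z" using M p by blast
          then have "p \<in> M" using max[of "insert p M"] by blast
          then show False using no ne by blast
        qed
        then show "p \<in> (\<Union>x\<in>(\<Union>p\<in>M. f p). {p \<in> A. x \<in> f p})" using p by blast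
      qed
      ultimately show False using Suc.prems(1) small_mono by blast
    qed
    then show ?thesis using M by blast
  qed
qed

lemma delta_system:
  assumes "\<not> small A" "\<And>p. p \<in> A \<Longrightarrow> finite (f p)"
  obtains B R where "B \<subseteq> A" "\<not> small B" "\<And>p q. p \<in> B \<Longrightarrow> q \<in> B \<Longrightarrow> p \<noteq> q \<Longrightarrow> f p \<inter> f q = R"
proof -
  obtain n where n: "\<not> small {p \<in> A. card (f p) = n}"
    using large_fibre[OF assms(1) small_countable, of "UNIV :: nat set" "\<lambda>p. card (f p)"] by blast
  have "finite (f p) \<and> card (f p) = n" if "p \<in> {p \<in> A. card (f p) = n}" for p
    using that assms(2) by blast
  with n have "\<exists>B\<subseteq>{p \<in> A. card (f p) = n}. \<not> small B \<and>
      (\<exists>R. \<forall>p\<in>B. \<forall>q\<in>B. p \<noteq> q \<longrightarrow> f p \<inter> f q = R)"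
    by (rule delta_system_card)
  then obtain B R where "B \<subseteq> {p \<in> A. card (f p) = n}" "\<not> small B"
    "\<forall>p\<in>B. \<forall>q\<in>B. p \<noteq> q \<longrightarrow> f p \<inter> f q = R" by (elim exE conjE)
  then show ?thesis using that[of B R] by blast
qed

end

section \<open>The cofinality of a well-order\<close>

lemma cofinality_eq:
  obtains K where "(cofinality :: 'o::wellorder rel) = |K|" "cofinal_in K"
    "\<And>C :: 'o set. cofinal_in C \<Longrightarrow> |K| \<le>o |C|"
proof -
  let ?R = "card_of ` {C :: 'o set. cofinal_in C}"
  have "|UNIV| \<in> ?R" by (auto simp: cofinal_in_def)
  then have "\<exists>r\<in>?R. \<forall>r'\<in>?R. r \<le>o r'" by (intro exists_minim_Card_order) (auto simp: card_of_Card_order)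
  then have "\<exists>K :: 'o set. cofinal_in K \<and> (\<forall>C :: 'o set. cofinal_in C \<longrightarrow> |K| \<le>o |C| )" by blast
  from someI_ex[OF this] show ?thesis using that unfolding cofinality_def by blast
qed

lemma bounded_of_less_cofinality:
  fixes C :: "'o::wellorder set"
  assumes "|C| <o (cofinality :: 'o rel)"
  obtains \<beta> where "\<And>\<gamma>. \<gamma> \<in> C \<Longrightarrow> \<gamma> < \<beta>"
proof -
  obtain K where K: "(cofinality :: 'o rel) = |K|" "\<And>C :: 'o set. cofinal_in C \<Longrightarrow> |K| \<le>o |C|"
    using cofinality_eq[where ?'o = 'o] by metis
  have "\<not> cofinal_in C"
    using assms K(2)[of C] not_ordLess_ordLeq[of "|C|" "|K|"] unfolding K(1) by blast
  then show ?thesis using that unfolding cofinal_in_def by (metis not_le)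
qed

lemma uncountable_regular_cofinality:
  assumes "|UNIV :: nat set| <o (cofinality :: 'o::wellorder rel)"
  shows "uncountable_regular (cofinality :: 'o rel)"
proof -
  obtain K where K: "(cofinality :: 'o rel) = |K|" "cofinal_in K"
    using cofinality_eq[where ?'o = 'o] by metis
  have "regularCard (cofinality :: 'o rel)"
    unfolding regularCard_def
  proof (intro allI impI)
    fix X assume X: "X \<subseteq> Field (cofinality :: 'o rel) \<and> cofinal X (cofinality :: 'o rel)"
    show "|X| =o (cofinality :: 'o rel)"
    proof (rule ccontr)
      assume "\<not> ?thesis"
      moreover have "|X| \<le>o |K|" using X unfolding K(1) by (simp add: Field_card_of card_of_mono1)
      ultimately have X_less: "|X| <o (cofinality :: 'o rel)"
        unfolding K(1) using ordLeq_iff_ordLess_or_ordIso by blast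
      \<comment> \<open>A short cofinal X would split K into fewer than \<kappa> initial segments,
        each too short to be cofinal in the well-order. Their bounds b x are again fewer than
        \<kappa>, so K itself would be bounded.\<close>
      have "\<exists>b. \<forall>\<gamma>\<in>underS (cofinality :: 'o rel) x. \<gamma> < b" if "x \<in> X" for x
      proof -
        have "|underS (cofinality :: 'o rel) x| <o (cofinality :: 'o rel)"
          using \<open>x \<in> X\<close> X by (intro card_of_underS) (auto simp: K(1) card_of_Card_order)
        then show ?thesis using bounded_of_less_cofinality by metis
      qed
      then obtain b where b: "\<And>x \<gamma>. x \<in> X \<Longrightarrow> \<gamma> \<in> underS (cofinality :: 'o rel) x \<Longrightarrow> \<gamma> < b x"
        by metis
      have "|b ` X| <o (cofinality :: 'o rel)"
        using X_less by (rule ordLeq_ordLess_trans[OF card_of_image])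
      then obtain \<beta> where \<beta>: "\<And>x. x \<in> X \<Longrightarrow> b x < \<beta>"
        using bounded_of_less_cofinality[of "b ` X"] by (metis imageI)
      obtain \<gamma> where \<gamma>: "\<gamma> \<in> K" "\<beta> \<le> \<gamma>" using K(2) unfolding cofinal_in_def by blast
      then obtain x where "x \<in> X" "\<gamma> \<in> underS (cofinality :: 'o rel) x"
        using X unfolding cofinal_def underS_def K(1) by (auto simp: Field_card_of)
      then have "\<gamma> < \<beta>" using b \<beta> by fastforce
      then show False using \<gamma> by simp
    qed
  qed
  then show ?thesis
    using assms by unfold_locales (auto simp: K(1) card_of_Card_order)
qed

subsection \<open>Finite support iterations\<close>

declare fs_stage.simps [simp del]

lemma Int_lessThan_absorb [simp]:
  fixes \<eta> \<xi> :: "'o::linorder"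
  shows "\<eta> \<le> \<xi> \<Longrightarrow> {..<\<xi>} \<inter> {..<\<eta>} = {..<\<eta>}"
  by auto

locale fs_iteration =
  fixes Q :: "'o::wellorder \<Rightarrow> ('q, 'o \<rightharpoonup> 'q) name"
    and L :: "'o \<Rightarrow> ('q \<times> 'q, 'o \<rightharpoonup> 'q) name"
  assumes poset: "\<And>\<alpha>. forced (fs_stage Q L \<alpha>) (f_preorder (fs_stage Q L \<alpha>) (Q \<alpha>) (L \<alpha>))"
begin

abbreviation stage :: "'o \<Rightarrow> ('o \<rightharpoonup> 'q) \<Rightarrow> ('o \<rightharpoonup> 'q) \<Rightarrow> bool" where
  "stage \<equiv> fs_stage Q L"

abbreviation leq :: "('o \<rightharpoonup> 'q) \<Rightarrow> ('o \<rightharpoonup> 'q) \<Rightarrow> bool" where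
  "leq \<equiv> fs_limit Q L"

definition conds :: "('o \<rightharpoonup> 'q) set" where
  "conds = fs_conditions stage Q UNIV"

definition in_Q :: "'o \<Rightarrow> 'q \<Rightarrow> ('o \<rightharpoonup> 'q) sentence" where
  "in_Q \<xi> x = f_mem (stage \<xi>) f_geq x (Q \<xi>)"

definition in_L :: "'o \<Rightarrow> 'q \<Rightarrow> 'q \<Rightarrow> ('o \<rightharpoonup> 'q) sentence" where
  "in_L \<xi> x y = f_mem (stage \<xi>) f_geq (x, y) (L \<xi>)"

lemma conds_iff:
  "p \<in> conds \<longleftrightarrow> finite (dom p) \<and> (\<forall>\<xi>\<in>dom p. in_Q \<xi> (the (p \<xi>)) (p |` {..<\<xi>}))"
  by (simp add: conds_def fs_conditions_def in_Q_def)

lemma leq_iff: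
  "leq p q \<longleftrightarrow> p \<in> conds \<and> q \<in> conds \<and> dom q \<subseteq> dom p \<and>
     (\<forall>\<xi>\<in>dom q. in_L \<xi> (the (p \<xi>)) (the (q \<xi>)) (p |` {..<\<xi>}))"
  by (simp add: fs_limit_def fs_order_def conds_def in_L_def)

lemma fs_conditions_stage:
  "p \<in> fs_conditions (\<lambda>\<xi>. if \<xi> < \<alpha> then stage \<xi> else (\<lambda>_ _. False)) Q {..<\<alpha>} \<longleftrightarrow>
     p \<in> conds \<and> dom p \<subseteq> {..<\<alpha>}"
  unfolding conds_def fs_conditions_def
  by (auto simp: subset_iff)

text \<open>The stages are literally suborders of the limit: the recursion consults only coordinates
  below \<xi>, where its dummy order for later stages is never reached. So everything can be done
  with \<open>leq\<close> and restrictions of domains.\<close>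

lemma stage_iff: "stage \<xi> p q \<longleftrightarrow> leq p q \<and> dom p \<subseteq> {..<\<xi>}"
proof -
  have "stage \<xi> p q \<longleftrightarrow> p \<in> conds \<and> dom p \<subseteq> {..<\<xi>} \<and> q \<in> conds \<and> dom q \<subseteq> {..<\<xi>} \<and> dom q \<subseteq> dom p \<and>
     (\<forall>\<eta>\<in>dom q. f_mem (if \<eta> < \<xi> then stage \<eta> else (\<lambda>_ _. False)) f_geq (the (p \<eta>), the (q \<eta>)) (L \<eta>)
        (p |` {..<\<eta>}))"
    by (subst fs_stage.simps) (simp add: fs_order_def fs_conditions_stage)
  also have "\<dots> \<longleftrightarrow> leq p q \<and> dom p \<subseteq> {..<\<xi>}"
  proof -
    have "(if \<eta> < \<xi> then stage \<eta> else (\<lambda>_ _. False)) = stage \<eta>" if "dom q \<subseteq> {..<\<xi>}" "\<eta> \<in> dom q" for \<eta>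
      using that by (simp add: subset_iff)
    then have "(\<forall>\<eta>\<in>dom q. f_mem (if \<eta> < \<xi> then stage \<eta> else (\<lambda>_ _. False)) f_geq
          (the (p \<eta>), the (q \<eta>)) (L \<eta>) (p |` {..<\<eta>})) \<longleftrightarrow>
        (\<forall>\<eta>\<in>dom q. in_L \<eta> (the (p \<eta>)) (the (q \<eta>)) (p |` {..<\<eta>}))" if "dom q \<subseteq> {..<\<xi>}"
      using that unfolding in_L_def by (intro ball_cong) auto
    then show ?thesis unfolding leq_iff using order_trans[of "dom q" "dom p" "{..<\<xi>}"] by argo
  qed
  finally show ?thesis .
qed

lemma leq_conds: "leq p q \<Longrightarrow> p \<in> conds" "leq p q \<Longrightarrow> q \<in> conds"
  by (simp_all add: leq_iff)

lemma leq_dom: "leq p q \<Longrightarrow> dom q \<subseteq> dom p"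
  by (simp add: leq_iff)

lemma restrict_conds: "p \<in> conds \<Longrightarrow> p |` {..<\<xi>} \<in> conds"
  by (auto simp: conds_iff less_imp_le)

lemma restrict_leq: "leq p q \<Longrightarrow> leq (p |` {..<\<xi>}) (q |` {..<\<xi>})"
  unfolding leq_iff by (auto simp: restrict_conds less_imp_le)

lemma dom_restrict_lessThan [simp]: "dom (p |` {..<\<xi>}) \<subseteq> {..<\<xi>}"
  by auto

text \<open>The axioms for the iterand at \<eta> are forced by conditions of the stage \<eta> only,
  and using them requires that this stage is already known to be a preorder; hence the induction.
  The set I lets one argument serve both the induction step and the limit.\<close>

lemma preorder_below:
  assumes "\<And>\<eta>. \<eta> \<in> I \<Longrightarrow> forcing_order (stage \<eta>) \<and> (\<forall>p\<in>conds. dom p \<subseteq> {..<\<eta>} \<longrightarrow> leq p p)"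
  shows "\<And>p. p \<in> conds \<Longrightarrow> dom p \<subseteq> I \<Longrightarrow> leq p p"
    and "\<And>p q r. leq p q \<Longrightarrow> leq q r \<Longrightarrow> dom p \<subseteq> I \<Longrightarrow> leq p r"
proof -
  have pre: "in_Q \<eta> x s \<longrightarrow> in_L \<eta> x x s"
    "in_Q \<eta> x s \<and> in_Q \<eta> y s \<and> in_Q \<eta> z s \<and> in_L \<eta> x y s \<and> in_L \<eta> y z s \<longrightarrow> in_L \<eta> x z s"
    if "\<eta> \<in> I" "s \<in> conds" "dom s \<subseteq> {..<\<eta>}" for \<eta> x y z s
  proof -
    interpret forcing_order "stage \<eta>" using assms that by blast
    have s: "stage \<eta> s s" using assms that by (auto simp: stage_iff)
    then have "f_preorder (stage \<eta>) (Q \<eta>) (L \<eta>) s" using poset unfolding forced_def by blast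
    note pre = this[unfolded f_preorder_def and_iff all_iff imp_iff[OF regular_mem regular_mem]
        imp_iff[OF regular_and[OF regular_mem regular_and[OF regular_mem regular_and[OF regular_mem
          regular_and[OF regular_mem regular_mem]]]] regular_mem]]
    show "in_Q \<eta> x s \<longrightarrow> in_L \<eta> x x s"
      using pre[THEN conjunct1] s unfolding in_Q_def in_L_def by blast
    show "in_Q \<eta> x s \<and> in_Q \<eta> y s \<and> in_Q \<eta> z s \<and> in_L \<eta> x y s \<and> in_L \<eta> y z s \<longrightarrow> in_L \<eta> x z s"
      using pre[THEN conjunct2, rule_format, of s x y z] s unfolding in_Q_def in_L_def by blast
  qed
  show "leq p p" if p: "p \<in> conds" "dom p \<subseteq> I" for p
  proof -
    have "in_L \<xi> (the (p \<xi>)) (the (p \<xi>)) (p |` {..<\<xi>})" if "\<xi> \<in> dom p" for \<xi>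
      using pre(1)[of \<xi> "p |` {..<\<xi>}" "the (p \<xi>)"] that p restrict_conds[OF p(1), of \<xi>]
        dom_restrict_lessThan[of p \<xi>] conds_iff[of p] by blast
    then show ?thesis using p unfolding leq_iff by blast
  qed
  show "leq p r" if pq: "leq p q" "leq q r" "dom p \<subseteq> I" for p q r
  proof -
    have "in_L \<eta> (the (p \<eta>)) (the (r \<eta>)) (p |` {..<\<eta>})" if \<eta>: "\<eta> \<in> dom r" for \<eta>
    proof -
      have dom: "\<eta> \<in> dom q" "\<eta> \<in> dom p" using \<eta> pq leq_dom by blast+
      then have "\<eta> \<in> I" using pq(3) by blast
      then interpret forcing_order "stage \<eta>" using assms by blast
      have st: "stage \<eta> (p |` {..<\<eta>}) (q |` {..<\<eta>})"
        by (simp add: stage_iff restrict_leq[OF pq(1)])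
      have st': "stage \<eta> (q |` {..<\<eta>}) (r |` {..<\<eta>})"
        by (simp add: stage_iff restrict_leq[OF pq(2)])
      have "in_Q \<eta> (the (p \<eta>)) (p |` {..<\<eta>})" "in_Q \<eta> (the (q \<eta>)) (q |` {..<\<eta>})"
        "in_Q \<eta> (the (r \<eta>)) (r |` {..<\<eta>})"
        using leq_conds[OF pq(1)] leq_conds[OF pq(2)] dom \<eta> by (simp_all add: conds_iff)
      then have "in_Q \<eta> (the (p \<eta>)) (p |` {..<\<eta>})" "in_Q \<eta> (the (q \<eta>)) (p |` {..<\<eta>})"
        "in_Q \<eta> (the (r \<eta>)) (p |` {..<\<eta>})"
        using mem_mono[OF _ st] mem_mono[OF _ le_trans[OF st st']] by (simp_all add: in_Q_def)
      moreover have "in_L \<eta> (the (p \<eta>)) (the (q \<eta>)) (p |` {..<\<eta>})"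
        using pq(1) dom by (simp add: leq_iff)
      moreover have "in_L \<eta> (the (q \<eta>)) (the (r \<eta>)) (q |` {..<\<eta>})"
        using pq(2) \<eta> by (simp add: leq_iff)
      then have "in_L \<eta> (the (q \<eta>)) (the (r \<eta>)) (p |` {..<\<eta>})"
        using mem_mono[OF _ st] by (simp add: in_L_def)
      moreover have "p |` {..<\<eta>} \<in> conds" using leq_conds[OF pq(1)] restrict_conds by blast
      ultimately show ?thesis
        using pre(2)[OF \<open>\<eta> \<in> I\<close>, of "p |` {..<\<eta>}" "the (p \<eta>)" "the (q \<eta>)" "the (r \<eta>)"] by auto
    qed
    then show ?thesis
      using leq_conds[OF pq(1)] leq_conds[OF pq(2)] leq_dom[OF pq(1)] leq_dom[OF pq(2)]
      by (simp add: leq_iff)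
  qed
qed

lemma stage_preorder:
  "forcing_order (stage \<xi>) \<and> (\<forall>p\<in>conds. dom p \<subseteq> {..<\<xi>} \<longrightarrow> leq p p)"
proof (induction \<xi> rule: less_induct)
  case (less \<xi>)
  then have IH: "\<And>\<eta>. \<eta> \<in> {..<\<xi>} \<Longrightarrow> forcing_order (stage \<eta>) \<and> (\<forall>p\<in>conds. dom p \<subseteq> {..<\<eta>} \<longrightarrow> leq p p)"
    by blast
  note refl = preorder_below(1)[of "{..<\<xi>}", OF IH] and trans = preorder_below(2)[of "{..<\<xi>}", OF IH]
  have "forcing_order (stage \<xi>)"
  proof
    show "stage \<xi> r p" if "stage \<xi> r q" "stage \<xi> q p" for r q p
      using that trans unfolding stage_iff by blast
    show "stage \<xi> q q" if "stage \<xi> q p" for q p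
      using that refl leq_conds unfolding stage_iff by blast
    show "stage \<xi> p p" if "stage \<xi> q p" for q p
      using that refl leq_conds leq_dom unfolding stage_iff by blast
  qed
  then show ?case using refl by blast
qed

lemma leq_refl: "p \<in> conds \<Longrightarrow> leq p p"
  using preorder_below(1)[of UNIV, OF stage_preorder] by blast

lemma forcing_order_limit: "forcing_order leq"
proof
  show "leq r p" if "leq r q" "leq q p" for r q p
    using that preorder_below(2)[of UNIV, OF stage_preorder] by blast
qed (use leq_refl leq_conds in blast)+

sublocale forcing_order "fs_limit Q L"
  by (rule forcing_order_limit)

sublocale stage: forcing_order "fs_stage Q L \<xi>" for \<xi>
  using stage_preorder by blast

lemma in_L_refl:
  assumes "in_Q \<xi> x s" "stage \<xi> s s"
  shows "in_L \<xi> x x s"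
proof -
  have "f_preorder (stage \<xi>) (Q \<xi>) (L \<xi>) s" using assms(2) poset unfolding forced_def by blast
  then show ?thesis
    using assms by (simp add: f_preorder_def and_iff all_iff in_Q_def in_L_def
        stage.imp_iff[OF stage.regular_mem stage.regular_mem])
qed

lemma stage_restrict: "leq p q \<Longrightarrow> stage \<xi> (p |` {..<\<xi>}) (q |` {..<\<xi>})"
  by (simp add: stage_iff restrict_leq)

lemma stage_refl: "s \<in> conds \<Longrightarrow> dom s \<subseteq> {..<\<xi>} \<Longrightarrow> stage \<xi> s s"
  by (simp add: stage_iff leq_refl)

lemma in_Q_mono: "in_Q \<xi> x s \<Longrightarrow> stage \<xi> t s \<Longrightarrow> in_Q \<xi> x t"
  unfolding in_Q_def by (rule stage.mem_mono)

lemma in_L_mono: "in_L \<xi> x y s \<Longrightarrow> stage \<xi> t s \<Longrightarrow> in_L \<xi> x y t"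
  unfolding in_L_def by (rule stage.mem_mono)

text \<open>A common lower bound assembled coordinate by coordinate. What is assumed about a
  coordinate \<eta> is forced by the restriction of the member a that supplies it; inductively the
  restriction of r to \<eta> is stronger than that of a, so it forces the same.\<close>

lemma glue:
  assumes S: "S \<subseteq> conds" "\<And>p. p \<in> S \<Longrightarrow> dom p \<subseteq> dom r" and fin: "finite (dom r)"
    and coord: "\<And>\<eta>. \<eta> \<in> dom r \<Longrightarrow> \<exists>a\<in>S. \<eta> \<in> dom a \<and> r \<eta> = a \<eta> \<and>
      (\<forall>p\<in>S. \<eta> \<in> dom p \<longrightarrow> p \<eta> = a \<eta> \<or> in_L \<eta> (the (a \<eta>)) (the (p \<eta>)) (a |` {..<\<eta>}))"
  shows "r \<in> conds" "\<And>p. p \<in> S \<Longrightarrow> leq r p"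
proof -
  define good where "good \<xi> \<longleftrightarrow> r |` {..<\<xi>} \<in> conds \<and> (\<forall>p\<in>S. leq (r |` {..<\<xi>}) (p |` {..<\<xi>}))" for \<xi>
  have step: "in_Q \<eta> (the (r \<eta>)) (r |` {..<\<eta>}) \<and>
      (\<forall>p\<in>S. \<eta> \<in> dom p \<longrightarrow> in_L \<eta> (the (r \<eta>)) (the (p \<eta>)) (r |` {..<\<eta>}))"
    if "good \<eta>" and \<eta>: "\<eta> \<in> dom r" for \<eta>
  proof -
    obtain a where a: "a \<in> S" "\<eta> \<in> dom a" "r \<eta> = a \<eta>"
      "\<And>p. p \<in> S \<Longrightarrow> \<eta> \<in> dom p \<Longrightarrow> p \<eta> = a \<eta> \<or> in_L \<eta> (the (a \<eta>)) (the (p \<eta>)) (a |` {..<\<eta>})"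
      using coord[OF \<eta>] by blast
    have le: "stage \<eta> (r |` {..<\<eta>}) (a |` {..<\<eta>})"
      using \<open>good \<eta>\<close> a(1) unfolding good_def by (simp add: stage_iff)
    have Qa: "in_Q \<eta> (the (a \<eta>)) (a |` {..<\<eta>})" using a(1,2) S(1) conds_iff by blast
    have "in_L \<eta> (the (r \<eta>)) (the (p \<eta>)) (r |` {..<\<eta>})" if "p \<in> S" "\<eta> \<in> dom p" for p
    proof -
      have "in_L \<eta> (the (a \<eta>)) (the (p \<eta>)) (a |` {..<\<eta>})"
        using a(4)[OF that] in_L_refl[OF Qa] stage.le_right[OF le] by auto
      then show ?thesis using in_L_mono le a(3) by simp
    qed
    then show ?thesis using in_Q_mono[OF Qa le] a(3) by simp
  qed
  have all_good: "good \<xi>" for \<xi>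
  proof (induction \<xi> rule: less_induct)
    case (less \<xi>)
    have c: "r |` {..<\<xi>} \<in> conds"
      using step[OF less] fin by (fastforce simp: conds_iff)
    moreover have "leq (r |` {..<\<xi>}) (p |` {..<\<xi>})" if "p \<in> S" for p
    proof -
      have "in_L \<eta> (the (r \<eta>)) (the (p \<eta>)) (r |` {..<\<eta>})" if "\<eta> < \<xi>" "\<eta> \<in> dom p" for \<eta>
        using step[OF less, OF that(1)] that(2) \<open>p \<in> S\<close> S(2) by blast
      moreover have "dom (p |` {..<\<xi>}) \<subseteq> dom (r |` {..<\<xi>})" using S(2)[OF that] by auto
      moreover have "p |` {..<\<xi>} \<in> conds" using S(1) that restrict_conds by blast
      moreover from calculation(1) have "\<forall>\<eta>\<in>dom (p |` {..<\<xi>}).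
          in_L \<eta> (the ((r |` {..<\<xi>}) \<eta>)) (the ((p |` {..<\<xi>}) \<eta>)) (r |` {..<\<xi>} |` {..<\<eta>})"
        by (simp add: less_imp_le)
      ultimately show ?thesis using c unfolding leq_iff by blast
    qed
    ultimately show ?case unfolding good_def by blast
  qed
  show c: "r \<in> conds" using step[OF all_good] fin by (simp add: conds_iff)
  show "leq r p" if "p \<in> S" for p
  proof -
    have "\<forall>\<eta>\<in>dom p. in_L \<eta> (the (r \<eta>)) (the (p \<eta>)) (r |` {..<\<eta>})"
    proof
      fix \<eta> assume \<eta>: "\<eta> \<in> dom p"
      then have "\<eta> \<in> dom r" using S(2)[OF that] by (rule_tac subsetD)
      from step[OF all_good this] that \<eta> show "in_L \<eta> (the (r \<eta>)) (the (p \<eta>)) (r |` {..<\<eta>})" by simp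
    qed
    then show ?thesis using that S(1) S(2)[OF that] c by (auto simp: leq_iff)
  qed
qed

definition splice :: "'o \<Rightarrow> ('o \<rightharpoonup> 'q) \<Rightarrow> ('o \<rightharpoonup> 'q) \<Rightarrow> ('o \<rightharpoonup> 'q)" where
  "splice \<xi> s q = (\<lambda>\<eta>. if \<eta> < \<xi> then s \<eta> else q \<eta>)"

lemma dom_splice: "dom (splice \<xi> s q) = (dom s \<inter> {..<\<xi>}) \<union> (dom q \<inter> {\<xi>..})"
  by (auto simp: splice_def dom_def not_less split: if_splits)

text \<open>Restriction to \<xi> is a projection: an extension s of the restricted condition is
  compatible with the whole condition, and the old tail can be kept. This is the complete embedding
  of the stage \<xi> into the iteration.\<close>

lemma splice_leq:
  assumes "q \<in> conds" "leq s (q |` {..<\<xi>})" "dom s \<subseteq> {..<\<xi>}"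
  shows "leq (splice \<xi> s q) q" "leq (splice \<xi> s q) s"
proof -
  have s: "s \<in> conds" using assms(2) leq_conds by blast
  let ?r = "splice \<xi> s q"
  have sub: "dom q \<inter> {..<\<xi>} \<subseteq> dom s" using leq_dom[OF assms(2)] by auto
  have dom: "dom p \<subseteq> dom ?r" if "p \<in> {s, q}" for p
    using that sub assms(3) unfolding dom_splice by force
  have fin: "finite (dom ?r)"
    using s assms(1) unfolding dom_splice conds_iff by blast
  have coord: "\<exists>a\<in>{s, q}. \<eta> \<in> dom a \<and> ?r \<eta> = a \<eta> \<and>
      (\<forall>p\<in>{s, q}. \<eta> \<in> dom p \<longrightarrow> p \<eta> = a \<eta> \<or> in_L \<eta> (the (a \<eta>)) (the (p \<eta>)) (a |` {..<\<eta>}))"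
    if "\<eta> \<in> dom ?r" for \<eta>
  proof (cases "\<eta> < \<xi>")
    case True
    then have "in_L \<eta> (the (s \<eta>)) (the (q \<eta>)) (s |` {..<\<eta>})" if "\<eta> \<in> dom q"
      using assms(2) that unfolding leq_iff by auto
    then show ?thesis using True \<open>\<eta> \<in> dom ?r\<close> by (auto simp: splice_def)
  next
    case False
    then have "\<eta> \<notin> dom s" using assms(3) by auto
    then show ?thesis using False \<open>\<eta> \<in> dom ?r\<close> by (auto simp: splice_def)
  qed
  have "{s, q} \<subseteq> conds" using s assms(1) by blast
  from glue(2)[OF this dom fin coord] show "leq ?r q" "leq ?r s" by blast+
qed

lemma leq_restrict: "p \<in> conds \<Longrightarrow> leq p (p |` {..<\<xi>})"
proof -
  assume p: "p \<in> conds"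
  have "splice \<xi> (p |` {..<\<xi>}) p = p" by (auto simp: splice_def)
  then show ?thesis
    using splice_leq(2)[OF p leq_refl[OF restrict_conds[OF p, of \<xi>]] dom_restrict_lessThan] by simp
qed

text \<open>Besides two conditions to be made compatible in the chain condition argument, it also
  covers \<open>p = p'\<close>, where it adds a value at a new coordinate \<xi>.\<close>

lemma amalgamate:
  assumes p: "p \<in> conds" "p' \<in> conds"
    and s: "leq s (p |` {..<\<xi>})" "leq s (p' |` {..<\<xi>})" "dom s \<subseteq> {..<\<xi>}"
    and x: "in_Q \<xi> x s" "\<xi> \<in> dom p \<Longrightarrow> in_L \<xi> x (the (p \<xi>)) s" "\<xi> \<in> dom p' \<Longrightarrow> in_L \<xi> x (the (p' \<xi>)) s"
    and tails: "\<And>\<eta>. \<xi> < \<eta> \<Longrightarrow> \<eta> \<in> dom p \<Longrightarrow> \<eta> \<in> dom p' \<Longrightarrow> p \<eta> = p' \<eta>"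
  obtains r where "leq r p" "leq r p'" "r |` {..<\<xi>} = s" "r \<xi> = Some x"
    "dom r \<subseteq> dom s \<union> {\<xi>} \<union> dom p \<union> dom p'"
proof -
  have sc: "s \<in> conds" using s(1) leq_conds by blast
  have st: "stage \<xi> s s" using sc s(3) stage_refl by blast
  define t where "t = s(\<xi> \<mapsto> x)"
  have t_restr: "t |` {..<\<eta>} = s |` {..<\<eta>}" if "\<eta> \<le> \<xi>" for \<eta>
    using that by (auto simp: t_def restrict_map_def fun_eq_iff)
  have s_restr: "s |` {..<\<xi>} = s" using s(3)
    by (auto simp: restrict_map_def fun_eq_iff) (metis domIff lessThan_iff subsetD)
  have t: "t \<in> conds"
    unfolding conds_iff
  proof
    show "finite (dom t)" using sc by (simp add: t_def conds_iff)
    show "\<forall>\<eta>\<in>dom t. in_Q \<eta> (the (t \<eta>)) (t |` {..<\<eta>})"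
    proof
      fix \<eta> assume "\<eta> \<in> dom t"
      then consider "\<eta> = \<xi>" | "\<eta> < \<xi>" "\<eta> \<in> dom s" using s(3) by (auto simp: t_def split: if_splits)
      then show "in_Q \<eta> (the (t \<eta>)) (t |` {..<\<eta>})"
      proof cases
        case 1
        then show ?thesis using x(1) t_restr[of \<xi>] s_restr by (simp add: t_def)
      next
        case 2
        then have "t \<eta> = s \<eta>" by (auto simp: t_def)
        then show ?thesis using 2 sc t_restr[of \<eta>] by (simp add: conds_iff)
      qed
    qed
  qed
  define r where "r = (\<lambda>\<eta>. if \<eta> \<le> \<xi> then t \<eta> else if \<eta> \<in> dom p then p \<eta> else p' \<eta>)"
  have domr: "dom r \<subseteq> dom s \<union> {\<xi>} \<union> dom p \<union> dom p'"
    by (auto simp: r_def t_def split: if_splits)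
  have below: "\<eta> \<in> dom t" if "\<eta> \<in> dom p \<union> dom p'" "\<eta> \<le> \<xi>" for \<eta>
    using that leq_dom[OF s(1)] leq_dom[OF s(2)] by (cases "\<eta> = \<xi>") (auto simp: t_def)
  have S: "{t, p, p'} \<subseteq> conds" using t p by blast
  have dom: "dom a \<subseteq> dom r" if "a \<in> {t, p, p'}" for a
  proof
    fix \<eta> assume \<eta>: "\<eta> \<in> dom a"
    show "\<eta> \<in> dom r"
    proof (cases "\<eta> \<le> \<xi>")
      case True
      then have "\<eta> \<in> dom t" using \<eta> that below by blast
      then show ?thesis using True by (simp add: r_def domIff)
    next
      case False
      then have "\<eta> \<notin> dom t" using s(3) by (auto simp: t_def)
      then have "\<eta> \<in> dom p \<union> dom p'" using \<eta> that by blast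
      then show ?thesis using False by (auto simp: r_def domIff)
    qed
  qed
  have fin: "finite (dom r)"
    using domr sc p by (meson conds_iff finite.emptyI finite_UnI finite_insert finite_subset)
  have coord: "\<exists>a\<in>{t, p, p'}. \<eta> \<in> dom a \<and> r \<eta> = a \<eta> \<and>
      (\<forall>q\<in>{t, p, p'}. \<eta> \<in> dom q \<longrightarrow> q \<eta> = a \<eta> \<or> in_L \<eta> (the (a \<eta>)) (the (q \<eta>)) (a |` {..<\<eta>}))"
    if \<eta>: "\<eta> \<in> dom r" for \<eta>
  proof (cases "\<eta> \<le> \<xi>")
    case True
    have "in_L \<eta> (the (t \<eta>)) (the (q \<eta>)) (t |` {..<\<eta>})" if q: "q \<in> {p, p'}" "\<eta> \<in> dom q" for q
    proof (cases "\<eta> = \<xi>")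
      case True
      then show ?thesis using q x t_restr[of \<xi>] s_restr by (auto simp: t_def)
    next
      case False
      then have "\<eta> < \<xi>" using \<open>\<eta> \<le> \<xi>\<close> by simp
      moreover have "leq s (q |` {..<\<xi>})" using q s by blast
      ultimately have "in_L \<eta> (the (s \<eta>)) (the (q \<eta>)) (s |` {..<\<eta>})"
        using q unfolding leq_iff by auto
      moreover have "t \<eta> = s \<eta>" using \<open>\<eta> < \<xi>\<close> by (auto simp: t_def)
      ultimately show ?thesis using \<open>\<eta> < \<xi>\<close> t_restr[of \<eta>] by simp
    qed
    moreover have "r \<eta> = t \<eta>" using True by (simp add: r_def)
    moreover from this have "\<eta> \<in> dom t" using \<eta> by (simp add: domIff)
    ultimately show ?thesis by blast
  next
    case False
    then have t_none: "\<eta> \<notin> dom t" using s(3) by (auto simp: t_def)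
    show ?thesis
    proof (cases "\<eta> \<in> dom p")
      case True
      then have "r \<eta> = p \<eta>" using False by (simp add: r_def)
      moreover have "p' \<eta> = p \<eta>" if "\<eta> \<in> dom p'" using tails[of \<eta>] True that False by simp
      ultimately show ?thesis using True t_none by blast
    next
      case np: False
      then have "r \<eta> = p' \<eta>" using False by (simp add: r_def)
      moreover from this have "\<eta> \<in> dom p'" using \<eta> by (simp add: domIff)
      ultimately show ?thesis using np t_none by blast
    qed
  qed
  have "leq r p" "leq r p'" using glue(2)[OF S dom fin coord] by blast+
  moreover have "r |` {..<\<xi>} = s"
  proof -
    have "r |` {..<\<xi>} = t |` {..<\<xi>}" by (auto simp: r_def restrict_map_def fun_eq_iff)
    then show ?thesis using s_restr t_restr[of \<xi>] by simp
  qed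
  moreover have "r \<xi> = Some x" by (simp add: r_def t_def)
  ultimately show ?thesis using that domr by blast
qed

lemma disjoint_compatible:
  assumes "p \<in> conds" "q \<in> conds" "dom p \<inter> dom q = {}"
  shows "\<exists>r. leq r p \<and> leq r q"
proof -
  have S: "{p, q} \<subseteq> conds" using assms by blast
  have dom: "dom a \<subseteq> dom (p ++ q)" if "a \<in> {p, q}" for a using that by auto
  have fin: "finite (dom (p ++ q))" using assms by (simp add: conds_iff)
  have coord: "\<exists>a\<in>{p, q}. \<eta> \<in> dom a \<and> (p ++ q) \<eta> = a \<eta> \<and>
      (\<forall>q\<in>{p, q}. \<eta> \<in> dom q \<longrightarrow> q \<eta> = a \<eta> \<or> in_L \<eta> (the (a \<eta>)) (the (q \<eta>)) (a |` {..<\<eta>}))"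
    if \<eta>: "\<eta> \<in> dom (p ++ q)" for \<eta>
  proof (cases "\<eta> \<in> dom p")
    case True
    then have "\<eta> \<notin> dom q" using assms(3) by blast
    then show ?thesis using True by (auto simp: map_add_dom_app_simps)
  next
    case False
    then have "\<eta> \<in> dom q" using \<eta> by auto
    then show ?thesis using False by (auto simp: map_add_dom_app_simps)
  qed
  show ?thesis using glue(2)[OF S dom fin coord] by blast
qed

end

subsection \<open>The chain condition and supports\<close>

context forcing_order
begin

definition antichain :: "'p set \<Rightarrow> bool" where
  "antichain A \<longleftrightarrow> (\<forall>p\<in>A. le p p) \<and> (\<forall>p\<in>A. \<forall>q\<in>A. p \<noteq> q \<longrightarrow> (\<forall>r. \<not> (le r p \<and> le r q)))"

lemma antichain_subset: "antichain A \<Longrightarrow> B \<subseteq> A \<Longrightarrow> antichain B"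
  unfolding antichain_def by (meson subsetD)

lemma maximal_antichain:
  assumes "\<And>p. E p \<Longrightarrow> le p p"
  obtains M where "antichain M" "\<And>p. p \<in> M \<Longrightarrow> E p" "\<And>p. E p \<Longrightarrow> \<exists>m\<in>M. \<exists>r. le r p \<and> le r m"
proof -
  let ?Z = "{M. antichain M \<and> M \<subseteq> Collect E}"
  have "\<exists>M\<in>?Z. \<forall>X\<in>?Z. M \<subseteq> X \<longrightarrow> X = M"
  proof (rule subset_Zorn')
    fix C assume C: "subset.chain ?Z C"
    then have sub: "C \<subseteq> ?Z" by (meson subset_chain_def)
    have "p = q \<or> (\<forall>r. \<not> (le r p \<and> le r q))" if pq: "p \<in> \<Union>C" "q \<in> \<Union>C" for p q
    proof -
      obtain X Y where XY: "X \<in> C" "Y \<in> C" "p \<in> X" "q \<in> Y" using pq by blast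
      then have "X \<subseteq> Y \<or> Y \<subseteq> X" using C by (meson subset_chain_def)
      then obtain Z where Z: "Z \<in> C" "p \<in> Z" "q \<in> Z" using XY by blast
      then have "antichain Z" using sub by blast
      then show ?thesis using Z unfolding antichain_def by blast
    qed
    moreover have "\<Union>C \<subseteq> Collect E" using sub by blast
    ultimately show "\<Union>C \<in> ?Z" using assms unfolding antichain_def by blast
  qed
  then obtain M where M: "antichain M" "M \<subseteq> Collect E"
    and max: "\<And>X. X \<in> ?Z \<Longrightarrow> M \<subseteq> X \<Longrightarrow> X = M" by auto
  have "\<exists>m\<in>M. \<exists>r. le r p \<and> le r m" if p: "E p" for p
  proof (rule ccontr)
    assume no: "\<not> ?thesis"
    have "le q q" if "q \<in> insert p M" for q using that M p assms by blast
    moreover have "\<not> (le r q \<and> le r q')" if "q \<in> insert p M" "q' \<in> insert p M" "q \<noteq> q'" for q q' r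
      using that no M(1) unfolding antichain_def by blast
    ultimately have "insert p M \<in> ?Z" using M(2) p unfolding antichain_def by blast
    then have "p \<in> M" using max[of "insert p M"] by blast
    then show False using no p assms by blast
  qed
  then show ?thesis using that[of M] M by blast
qed

end

section \<open>Injections into ground model sets\<close>

context forcing_order
begin

lemmas regular_intros = regular_and regular_not regular_or regular_imp regular_iff regular_all
  regular_ex regular_ground regular_geq regular_mem regular_set_eq regular_subset

definition inj_name ::
    "('a \<Rightarrow> 'a \<Rightarrow> 'p sentence) \<Rightarrow> ('a, 'p) name \<Rightarrow> 'k set \<Rightarrow> ('a \<times> 'k, 'p) name \<Rightarrow> 'p sentence" where
  "inj_name eq F A f q \<longleftrightarrow>
     (\<forall>x t. le t q \<longrightarrow> f_mem le eq x F t \<longrightarrow>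
        (\<forall>u. le u t \<longrightarrow> (\<exists>t' \<zeta>. le t' u \<and> \<zeta> \<in> A \<and> f_mem le (f_pair_eq eq f_geq) (x, \<zeta>) f t'))) \<and>
     (\<forall>x \<eta> \<zeta> t. le t q \<longrightarrow> f_mem le (f_pair_eq eq f_geq) (x, \<eta>) f t \<longrightarrow>
        f_mem le (f_pair_eq eq f_geq) (x, \<zeta>) f t \<longrightarrow> \<eta> = \<zeta>) \<and>
     (\<forall>x y \<eta> t. le t q \<longrightarrow> f_mem le (f_pair_eq eq f_geq) (x, \<eta>) f t \<longrightarrow>
        f_mem le (f_pair_eq eq f_geq) (y, \<eta>) f t \<longrightarrow> eq x y t)"

lemma embeds_iff:
  assumes "equality eq"
  shows "f_embeds le eq F A p \<longleftrightarrow> (\<forall>q. le q p \<longrightarrow> (\<exists>r. le r q \<and> (\<exists>f. inj_name eq F A f r)))"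
proof -
  have 1: "f_imp le (f_mem le eq x F) (f_ex le (\<lambda>\<eta>. f_ground (\<eta> \<in> A) \<^bold>\<and> f_mem le (f_pair_eq eq f_geq) (x, \<eta>) f)) r
      \<longleftrightarrow> (\<forall>t. le t r \<longrightarrow> f_mem le eq x F t \<longrightarrow>
        (\<forall>u. le u t \<longrightarrow> (\<exists>t' \<zeta>. le t' u \<and> \<zeta> \<in> A \<and> f_mem le (f_pair_eq eq f_geq) (x, \<zeta>) f t')))" for x f r
    by (subst imp_iff, (intro regular_intros)+) (auto simp: ex_iff and_iff ground_iff)
  have 2: "f_imp le (f_mem le (f_pair_eq eq f_geq) (x, \<eta>) f \<^bold>\<and> f_mem le (f_pair_eq eq f_geq) (x, \<zeta>) f) (f_geq \<eta> \<zeta>) r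
      \<longleftrightarrow> (\<forall>t. le t r \<longrightarrow> f_mem le (f_pair_eq eq f_geq) (x, \<eta>) f t \<longrightarrow>
        f_mem le (f_pair_eq eq f_geq) (x, \<zeta>) f t \<longrightarrow> \<eta> = \<zeta>)" for x \<eta> \<zeta> f r
    by (subst imp_iff, (intro regular_intros)+) (auto simp: and_iff geq_iff)
  have 3: "f_imp le (f_mem le (f_pair_eq eq f_geq) (x, \<eta>) f \<^bold>\<and> f_mem le (f_pair_eq eq f_geq) (y, \<eta>) f) (eq x y) r
      \<longleftrightarrow> (\<forall>t. le t r \<longrightarrow> f_mem le (f_pair_eq eq f_geq) (x, \<eta>) f t \<longrightarrow>
        f_mem le (f_pair_eq eq f_geq) (y, \<eta>) f t \<longrightarrow> eq x y t)" for x y \<eta> f r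
    by (subst imp_iff, (intro regular_intros equality_regular[OF assms])+) (auto simp: and_iff)
  show ?thesis
    unfolding f_embeds_def inj_name_def by (subst ex_iff) (simp add: and_iff all_iff 1 2 3 cong: conj_cong)
qed

text \<open>The dense choices of the bound \<xi> and of the injection can be merged into one, since
  \<open>inj_name\<close> is inherited by stronger conditions.\<close>

lemma size_less_iff:
  assumes "equality eq"
  shows "f_size_less le eq F \<kappa> p \<longleftrightarrow>
    (\<forall>q. le q p \<longrightarrow> (\<exists>r \<xi> f. le r q \<and> \<xi> \<in> Field \<kappa> \<and> inj_name eq F (underS \<kappa> \<xi>) f r))"
proof -
  have "f_size_less le eq F \<kappa> p \<longleftrightarrow> (\<forall>q. le q p \<longrightarrow> (\<exists>r. le r q \<and> (\<exists>\<xi>. \<xi> \<in> Field \<kappa> \<and>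
      (\<forall>q. le q r \<longrightarrow> (\<exists>r. le r q \<and> (\<exists>f. inj_name eq F (underS \<kappa> \<xi>) f r))))))"
    unfolding f_size_less_def ex_iff and_iff ground_iff embeds_iff[OF assms] ..
  moreover have "inj_name eq F A f r'" if "inj_name eq F A f r" "le r' r" for A :: "'b set" and f r r'
    using that le_trans unfolding inj_name_def by meson
  ultimately show ?thesis using le_left le_trans by meson
qed

lemma regular_embeds:
  assumes "equality eq"
  shows "regular (f_embeds le eq F A)"
  unfolding f_embeds_def by (intro regular_intros equality_regular[OF assms])

lemma regular_size_less:
  assumes "equality eq"
  shows "regular (f_size_less le eq F \<kappa>)"
  unfolding f_size_less_def by (intro regular_intros regular_embeds assms)

end

section \<open>Iterations with the chain condition\<close>

locale fs_iteration_cc = fs_iteration Q L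
  for Q :: "'o::wellorder \<Rightarrow> ('q, 'o \<rightharpoonup> 'q) name" and L :: "'o \<Rightarrow> ('q \<times> 'q, 'o \<rightharpoonup> 'q) name" +
  assumes uncountable_cof: "|UNIV :: nat set| <o (cofinality :: 'o rel)"
    and nontrivial: "\<And>\<alpha>. forced (fs_stage Q L \<alpha>) (f_nontrivial (fs_stage Q L \<alpha>) (Q \<alpha>) (L \<alpha>))"
    and cc: "\<And>\<alpha>. forced (fs_stage Q L \<alpha>)
                 (f_cc (fs_stage Q L \<alpha>) (cofinality :: 'o rel) (Q \<alpha>) (L \<alpha>))"
begin

sublocale uncountable_regular "cofinality :: 'o rel"
  by (rule uncountable_regular_cofinality[OF uncountable_cof])

lemma small_bounded:
  fixes C :: "'o set"
  assumes "small C"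
  obtains \<beta> where "\<And>\<gamma>. \<gamma> \<in> C \<Longrightarrow> \<gamma> < \<beta>"
  using bounded_of_less_cofinality[of C] assms unfolding small_def by metis

lemma incompatible_iff:
  "f_incompatible (stage \<xi>) (Q \<xi>) (L \<xi>) x y s \<longleftrightarrow>
     (\<forall>t z. stage \<xi> t s \<longrightarrow> \<not> (in_Q \<xi> z t \<and> in_L \<xi> z x t \<and> in_L \<xi> z y t))"
  unfolding f_incompatible_def stage.not_iff stage.ex_iff and_iff in_Q_def[symmetric] in_L_def[symmetric]
  using stage.le_left stage.le_trans in_Q_mono in_L_mono by meson

lemma regular_incompatible: "stage.regular \<xi> (f_incompatible (stage \<xi>) (Q \<xi>) (L \<xi>) x y)"
  unfolding f_incompatible_def by (intro stage.regular_not stage.regular_ex stage.regular_and stage.regular_mem)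

text \<open>
  A large antichain is thinned out to a \<open>\<Delta>\<close>-system of domains. At the maximum \<open>\<xi>\<close> of the root, the
  values \<open>p \<xi>\<close> with \<open>p \<restriction> \<xi>\<close> in the generic filter form an antichain of \<open>Q \<xi>\<close>, because the tails have
  pairwise disjoint domains; an injection of it into an ordinal below \<open>\<kappa>\<close> yields a large antichain of
  the stage \<open>\<xi>\<close>.
\<close>

lemma cc_step:
  assumes IH: "\<And>A. A \<subseteq> {p. dom p \<subseteq> {..<\<xi>}} \<Longrightarrow> antichain A \<Longrightarrow> small A"
    and B: "antichain B" "\<not> small B"
    and root: "\<And>p q. p \<in> B \<Longrightarrow> q \<in> B \<Longrightarrow> p \<noteq> q \<Longrightarrow> dom p \<inter> dom q = R"
    and \<xi>: "\<xi> \<in> R" "\<And>\<eta>. \<eta> \<in> R \<Longrightarrow> \<eta> \<le> \<xi>"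
  shows False
proof -
  have Bc: "p \<in> conds" if "p \<in> B" for p using B(1) that leq_conds unfolding antichain_def by blast
  have \<xi>dom: "\<xi> \<in> dom p" if p: "p \<in> B" for p
  proof -
    \<comment> \<open>The root is only described through pairs of different members, so a second
      member is needed to place it inside the domain of p.\<close>
    have "\<not> B \<subseteq> {p}" using B(2) small_finite finite_subset by blast
    then obtain q where "q \<in> B" "p \<noteq> q" by blast
    then show ?thesis using root[OF p] \<xi>(1) by blast
  qed
  have restr: "stage \<xi> (p |` {..<\<xi>}) (p |` {..<\<xi>})" if "p \<in> B" for p
    using stage_restrict[OF leq_refl[OF Bc[OF that]]] .
  have Qp: "in_Q \<xi> (the (p \<xi>)) (p |` {..<\<xi>})" if "p \<in> B" for p
    using Bc[OF that] \<xi>dom[OF that] by (simp add: conds_iff)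
  have clash: False
    if pq: "p \<in> B" "q \<in> B" "p \<noteq> q" and t: "stage \<xi> t (p |` {..<\<xi>})" "stage \<xi> t (q |` {..<\<xi>})"
      and z: "in_Q \<xi> z t" "in_L \<xi> z (the (p \<xi>)) t" "in_L \<xi> z (the (q \<xi>)) t" for p q t z
  proof -
    have "leq t (p |` {..<\<xi>})" "leq t (q |` {..<\<xi>})" "dom t \<subseteq> {..<\<xi>}" using t by (auto simp: stage_iff)
    moreover have "p \<eta> = q \<eta>" if "\<xi> < \<eta>" "\<eta> \<in> dom p" "\<eta> \<in> dom q" for \<eta>
    proof -
      have "\<eta> \<in> R" using root[OF pq] that by blast
      then show ?thesis using \<xi>(2) that(1) by force
    qed
    ultimately obtain r where "leq r p" "leq r q"
      using amalgamate[OF Bc[OF pq(1)] Bc[OF pq(2)], of t \<xi> z] z by metis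
    then show False using B(1) pq unfolding antichain_def by blast
  qed
  define A where "A = {(the (p \<xi>), p |` {..<\<xi>}) | p. p \<in> B}"
  have memA: "\<exists>t p. stage \<xi> t s \<and> p \<in> B \<and> stage \<xi> t (p |` {..<\<xi>}) \<and> x = the (p \<xi>)"
    if "f_mem (stage \<xi>) f_geq x A s" "stage \<xi> s s" for x s
    using that unfolding f_mem_def A_def geq_iff by blast
  have anti: "f_antichain (stage \<xi>) (Q \<xi>) (L \<xi>) A s" if s: "stage \<xi> s s" for s
  proof -
    have sub: "f_subset (stage \<xi>) f_geq A (Q \<xi>) s"
      unfolding stage.subset_iff
    proof (intro allI impI)
      fix x q assume q: "stage \<xi> q s" "f_mem (stage \<xi>) f_geq x A q"
      show "f_mem (stage \<xi>) f_geq x (Q \<xi>) q"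
      proof (rule stage.regular_dense[OF stage.regular_mem])
        show "stage \<xi> q q" using q stage.le_left by blast
        fix q' assume q': "stage \<xi> q' q"
        then obtain t p where t: "stage \<xi> t q'" "p \<in> B" "stage \<xi> t (p |` {..<\<xi>})" "x = the (p \<xi>)"
          using memA[of x q'] stage.mem_mono[OF q(2)] stage.le_left by blast
        then have "in_Q \<xi> x t" using Qp in_Q_mono by blast
        then show "\<exists>r. stage \<xi> r q' \<and> f_mem (stage \<xi>) f_geq x (Q \<xi>) r"
          using t unfolding in_Q_def by blast
      qed
    qed
    have inc: "f_imp (stage \<xi>) (f_mem (stage \<xi>) f_geq x A \<^bold>\<and> f_mem (stage \<xi>) f_geq y A \<^bold>\<and>
        f_not (stage \<xi>) (f_geq x y)) (f_incompatible (stage \<xi>) (Q \<xi>) (L \<xi>) x y) s" for x y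
      unfolding stage.imp_iff[OF stage.regular_and[OF stage.regular_mem stage.regular_and[OF stage.regular_mem
          stage.regular_not[OF stage.regular_geq]]] regular_incompatible]
    proof (intro allI impI)
      fix q assume q: "stage \<xi> q s" and
        conj: "(f_mem (stage \<xi>) f_geq x A \<^bold>\<and> f_mem (stage \<xi>) f_geq y A \<^bold>\<and> f_not (stage \<xi>) (f_geq x y)) q"
      have xy: "f_mem (stage \<xi>) f_geq x A q" "f_mem (stage \<xi>) f_geq y A q" "x \<noteq> y"
        using conj stage.le_left[OF q] by (auto simp: and_iff stage.not_iff geq_iff)
      show "f_incompatible (stage \<xi>) (Q \<xi>) (L \<xi>) x y q"
        unfolding incompatible_iff
      proof (intro allI impI notI)
        fix t z assume t: "stage \<xi> t q" and z: "in_Q \<xi> z t \<and> in_L \<xi> z x t \<and> in_L \<xi> z y t"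
        obtain t1 p1 where 1: "stage \<xi> t1 t" "p1 \<in> B" "stage \<xi> t1 (p1 |` {..<\<xi>})" "x = the (p1 \<xi>)"
          using memA[of x t] stage.mem_mono[OF xy(1) t] stage.le_left[OF t] by blast
        obtain t2 p2 where 2: "stage \<xi> t2 t1" "p2 \<in> B" "stage \<xi> t2 (p2 |` {..<\<xi>})" "y = the (p2 \<xi>)"
          using memA[of y t1] stage.mem_mono[OF xy(2) stage.le_trans[OF 1(1) t]] stage.le_left[OF 1(1)]
          by blast
        have "stage \<xi> t2 t" using 1 2 stage.le_trans by blast
        then have "in_Q \<xi> z t2" "in_L \<xi> z x t2" "in_L \<xi> z y t2" using z in_Q_mono in_L_mono by blast+
        moreover have "p1 \<noteq> p2" using 1(4) 2(4) xy(3) by blast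
        moreover have "stage \<xi> t2 (p1 |` {..<\<xi>})" using 1(3) 2(1) stage.le_trans by blast
        ultimately show False using clash[of p1 p2 t2 z] 1 2 by blast
      qed
    qed
    show ?thesis using sub inc unfolding f_antichain_def f_and_def f_all_def by blast
  qed
  define emb where "emb s \<beta> f \<longleftrightarrow> stage \<xi> s s \<and> \<beta> \<in> Field (cofinality :: 'o rel) \<and>
     stage.inj_name \<xi> f_geq A (underS cofinality \<beta>) f s" for s and \<beta> :: 'o and f
  have dense_emb: "\<exists>t \<beta> f. stage \<xi> t s \<and> emb t \<beta> f" if s: "stage \<xi> s s" for s
  proof -
    have "f_cc (stage \<xi>) (cofinality :: 'o rel) (Q \<xi>) (L \<xi>) s" using cc s unfolding forced_def by blast
    then have imp: "f_imp (stage \<xi>) (f_antichain (stage \<xi>) (Q \<xi>) (L \<xi>) A)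
        (f_size_less (stage \<xi>) f_geq A (cofinality :: 'o rel)) s"
      unfolding f_cc_def all_iff by blast
    have r: "stage.regular \<xi> (f_antichain (stage \<xi>) (Q \<xi>) (L \<xi>) A)"
      unfolding f_antichain_def
      by (intro stage.regular_intros regular_incompatible)
    have "f_size_less (stage \<xi>) f_geq A (cofinality :: 'o rel) s"
      using anti[OF s] s imp unfolding stage.imp_iff[OF r stage.regular_size_less[OF stage.equality_geq]] by blast
    then show ?thesis
      using s stage.le_left unfolding stage.size_less_iff[OF stage.equality_geq] emb_def by meson
  qed
  \<comment> \<open>Conditions of the stage \<xi> that decide both the ordinal bound and a name of
    the injection. A maximal antichain of them is small by the induction hypothesis.\<close>
  define E where "E s \<longleftrightarrow> (\<exists>\<beta> f. emb s \<beta> f)" for s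
  have "stage \<xi> s s" if "E s" for s using that unfolding E_def emb_def by blast
  then obtain M where M: "stage.antichain \<xi> M" "\<And>s. s \<in> M \<Longrightarrow> E s"
      "\<And>s. E s \<Longrightarrow> \<exists>m\<in>M. \<exists>r. stage \<xi> r s \<and> stage \<xi> r m"
    using stage.maximal_antichain[of E \<xi>] by metis
  have stage_antichain: "small X" if "stage.antichain \<xi> X" for X
  proof (rule IH)
    show "X \<subseteq> {p. dom p \<subseteq> {..<\<xi>}}" using that unfolding stage.antichain_def stage_iff by blast
    have "\<not> (leq r p \<and> leq r q)" if pq: "p \<in> X" "q \<in> X" "p \<noteq> q" for p q r
    proof
      assume r: "leq r p \<and> leq r q"
      have dom: "p |` {..<\<xi>} = p" "q |` {..<\<xi>} = q"
        using pq \<open>X \<subseteq> {p. dom p \<subseteq> {..<\<xi>}}\<close>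
        by (auto simp: restrict_map_def fun_eq_iff) (metis domIff lessThan_iff mem_Collect_eq subsetD)+
      have "stage \<xi> (r |` {..<\<xi>}) p" "stage \<xi> (r |` {..<\<xi>}) q"
        using stage_restrict[of r p \<xi>] stage_restrict[of r q \<xi>] r dom by simp_all
      then show False using pq \<open>stage.antichain \<xi> X\<close> unfolding stage.antichain_def by blast
    qed
    then show "antichain X" using that unfolding antichain_def stage.antichain_def stage_iff by blast
  qed
  then have "small M" using M(1) by blast
  obtain \<beta> f where \<beta>f: "\<And>m. m \<in> M \<Longrightarrow> emb m (\<beta> m) (f m)"
    using M(2) unfolding E_def by metis
  have ex: "\<exists>m \<zeta> t. m \<in> M \<and> \<zeta> \<in> underS cofinality (\<beta> m) \<and> stage \<xi> t m \<and> stage \<xi> t (p |` {..<\<xi>}) \<and>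
      f_mem (stage \<xi>) (f_pair_eq f_geq f_geq) (the (p \<xi>), \<zeta>) (f m) t" if p: "p \<in> B" for p
  proof -
    obtain t where t: "stage \<xi> t (p |` {..<\<xi>})" "E t"
      using dense_emb[OF restr[OF p]] unfolding E_def by blast
    obtain m r where m: "m \<in> M" "stage \<xi> r t" "stage \<xi> r m" using M(3)[OF t(2)] by blast
    have rp: "stage \<xi> r (p |` {..<\<xi>})" using m(2) t(1) stage.le_trans by blast
    have "(the (p \<xi>), p |` {..<\<xi>}) \<in> A" using p unfolding A_def by blast
    then have "f_mem (stage \<xi>) f_geq (the (p \<xi>)) A r" using rp by (rule stage.mem_geqI)
    then obtain t' \<zeta> where "stage \<xi> t' r" "\<zeta> \<in> underS cofinality (\<beta> m)"
        "f_mem (stage \<xi>) (f_pair_eq f_geq f_geq) (the (p \<xi>), \<zeta>) (f m) t'"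
      using \<beta>f[OF m(1)] m(3) stage.le_left[OF m(3)] unfolding emb_def stage.inj_name_def by meson
    then show ?thesis using m rp stage.le_trans by blast
  qed
  then obtain m \<zeta> t where mt: "\<And>p. p \<in> B \<Longrightarrow> m p \<in> M \<and> \<zeta> p \<in> underS cofinality (\<beta> (m p)) \<and>
      stage \<xi> (t p) (m p) \<and> stage \<xi> (t p) (p |` {..<\<xi>}) \<and>
      f_mem (stage \<xi>) (f_pair_eq f_geq f_geq) (the (p \<xi>), \<zeta> p) (f (m p)) (t p)"
    by metis
  \<comment> \<open>Each p in B determines a decision m and the value \<zeta> that the injection of
    m assigns to its \<xi>-th coordinate. There are fewer than \<kappa> such pairs, so a large part
    of B shares one.\<close>
  have "small (SIGMA m:M. underS (cofinality :: 'o rel) (\<beta> m))"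
    using \<open>small M\<close> by (rule small_Sigma) (use \<beta>f small_underS in \<open>auto simp: emb_def\<close>)
  moreover have "(\<lambda>p. (m p, \<zeta> p)) ` B \<subseteq> (SIGMA m:M. underS (cofinality :: 'o rel) (\<beta> m))"
    using mt by auto
  ultimately obtain i where i: "\<not> small {p \<in> B. (m p, \<zeta> p) = i}"
    using large_fibre[OF B(2), of "SIGMA m:M. underS (cofinality :: 'o rel) (\<beta> m)" "\<lambda>p. (m p, \<zeta> p)"]
    by blast
  let ?B = "{p \<in> B. (m p, \<zeta> p) = i}"
  \<comment> \<open>A common extension of t p and t q would force, by injectivity of the shared map,
    that p and q have the same value at \<xi>. This value is then a lower bound of both, and
    \<open>clash\<close> applies.\<close>
  have incomp: "\<not> (stage \<xi> r (t p) \<and> stage \<xi> r (t q))" if pq: "p \<in> ?B" "q \<in> ?B" "p \<noteq> q" for p q r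
  proof
    assume r: "stage \<xi> r (t p) \<and> stage \<xi> r (t q)"
    have same: "m q = m p" "\<zeta> q = \<zeta> p" using pq by auto
    have le: "stage \<xi> r (m p)" "stage \<xi> r (p |` {..<\<xi>})" "stage \<xi> r (q |` {..<\<xi>})"
      using mt pq r stage.le_trans by blast+
    have "f_mem (stage \<xi>) (f_pair_eq f_geq f_geq) (the (p \<xi>), \<zeta> p) (f (m p)) r"
      "f_mem (stage \<xi>) (f_pair_eq f_geq f_geq) (the (q \<xi>), \<zeta> p) (f (m p)) r"
      using mt[of p] mt[of q] pq r same stage.mem_mono[of \<xi> _ _ _ "t p" r] stage.mem_mono[of \<xi> _ _ _ "t q" r]
      by auto
    then have eq: "the (p \<xi>) = the (q \<xi>)"
      using \<beta>f[of "m p"] mt[of p] pq le(1) unfolding emb_def stage.inj_name_def geq_iff by blast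
    have Q: "in_Q \<xi> (the (p \<xi>)) r" using Qp pq le(2) in_Q_mono by blast
    have "in_L \<xi> (the (p \<xi>)) (the (p \<xi>)) r" using in_L_refl[OF Q] stage.le_left le(1) by blast
    then show False using clash[of p q r "the (p \<xi>)"] pq le Q eq by auto
  qed
  have tt: "stage \<xi> (t p) (t p)" if "p \<in> ?B" for p using mt that stage.le_left by blast
  have "inj_on t ?B"
  proof (rule inj_onI, rule ccontr)
    fix p q assume pq: "p \<in> ?B" "q \<in> ?B" "t p = t q" "p \<noteq> q"
    then show False using incomp[OF pq(1,2,4), of "t p"] tt[OF pq(1)] by simp
  qed
  moreover have "stage.antichain \<xi> (t ` ?B)"
    unfolding stage.antichain_def
  proof (intro conjI ballI impI allI)
    fix a b r assume "a \<in> t ` ?B" "b \<in> t ` ?B" "a \<noteq> b"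
    then obtain p q where "p \<in> ?B" "q \<in> ?B" "a = t p" "b = t q" by (elim imageE)
    then show "\<not> (stage \<xi> r a \<and> stage \<xi> r b)" using incomp[of p q r] \<open>a \<noteq> b\<close> by auto
  next
    fix a assume "a \<in> t ` ?B"
    then show "stage \<xi> a a" using tt by (elim imageE) simp
  qed
  then have "small (t ` ?B)" by (rule stage_antichain)
  ultimately show False using i small_inj[of "t ` ?B" t ?B] by simp
qed

text \<open>With an empty root two members of the \<Delta>-system have disjoint domains, hence are
  compatible. Otherwise the maximum of the root is a coordinate in I, at which
  \<open>cc_step\<close> applies. As before, I covers both a stage and the limit.\<close>

lemma cc_below:
  assumes IH: "\<And>\<xi> A. \<xi> \<in> I \<Longrightarrow> A \<subseteq> {p. dom p \<subseteq> {..<\<xi>}} \<Longrightarrow> antichain A \<Longrightarrow> small A"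
    and A: "antichain A" "A \<subseteq> {p. dom p \<subseteq> I}"
  shows "small A"
proof (rule ccontr)
  assume ns: "\<not> small A"
  have Ac: "p \<in> conds" if "p \<in> A" for p using A(1) that leq_conds unfolding antichain_def by blast
  then have "finite (dom p)" if "p \<in> A" for p using that by (simp add: conds_iff)
  then obtain B R where B: "B \<subseteq> A" "\<not> small B"
      "\<And>p q. p \<in> B \<Longrightarrow> q \<in> B \<Longrightarrow> p \<noteq> q \<Longrightarrow> dom p \<inter> dom q = R"
    using delta_system[OF ns, of dom] by blast
  have "antichain B" using antichain_subset[OF A(1) B(1)] .
  have "B \<noteq> {}" using B(2) small_finite[of B] by auto
  then obtain p where p: "p \<in> B" by auto
  have "\<not> B \<subseteq> {p}" using B(2) small_finite finite_subset by blast
  then obtain q where q: "q \<in> B" "p \<noteq> q" by blast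
  show False
  proof (cases "R = {}")
    case True
    then obtain r where "leq r p" "leq r q"
      using disjoint_compatible[of p q] B(3)[OF p q] Ac B(1) p q(1) by blast
    then show False using \<open>antichain B\<close> p q unfolding antichain_def by blast
  next
    case False
    have R: "R \<subseteq> dom p" using B(3)[OF p q] by blast
    then have fin: "finite R" using p B(1) Ac conds_iff finite_subset by blast
    have "Max R \<in> I" using Max_in[OF fin False] R p B(1) A(2) by blast
    show False
      using cc_step[of "Max R" B R, OF IH[OF \<open>Max R \<in> I\<close>] \<open>antichain B\<close> B(2,3)]
        Max_in[OF fin False] Max_ge[OF fin] by blast
  qed
qed

lemma antichain_small_stage: "A \<subseteq> {p. dom p \<subseteq> {..<\<xi>}} \<Longrightarrow> antichain A \<Longrightarrow> small A"
proof (induction \<xi> arbitrary: A rule: less_induct)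
  case (less \<xi>)
  show ?case
    by (rule cc_below[of "{..<\<xi>}"]) (use less in auto)
qed

lemma antichain_small: "antichain A \<Longrightarrow> small A"
  by (rule cc_below[of UNIV]) (use antichain_small_stage in auto)

text \<open>The truth value of the sentence lies in the Boolean completion of the stage \<alpha>.
  This plays the role of evaluating the sentence in the intermediate extension.\<close>

definition supported :: "'o \<Rightarrow> ('o \<rightharpoonup> 'q) sentence \<Rightarrow> bool" where
  "supported \<alpha> \<phi> \<longleftrightarrow> (\<forall>q\<in>conds. \<phi> q \<longleftrightarrow> \<phi> (q |` {..<\<alpha>}))"

lemma restrict_id: "dom p \<subseteq> {..<\<alpha>} \<Longrightarrow> p |` {..<\<alpha>} = p"
  by (auto simp: restrict_map_def fun_eq_iff) (metis domIff lessThan_iff subsetD)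

lemma splice_stronger:
  assumes "q \<in> conds" "leq r (q |` {..<\<alpha>})"
  shows "leq (splice \<alpha> (r |` {..<\<alpha>}) q) q" "leq (splice \<alpha> (r |` {..<\<alpha>}) q) (r |` {..<\<alpha>})"
proof -
  have "leq (r |` {..<\<alpha>}) (q |` {..<\<alpha>})"
    using restrict_leq[OF assms(2), of \<alpha>] by simp
  then show "leq (splice \<alpha> (r |` {..<\<alpha>}) q) q" "leq (splice \<alpha> (r |` {..<\<alpha>}) q) (r |` {..<\<alpha>})"
    using splice_leq[OF assms(1)] by simp_all
qed

lemma supportedI:
  assumes "regular \<phi>" "\<And>q. q \<in> conds \<Longrightarrow> \<phi> q \<Longrightarrow> \<phi> (q |` {..<\<alpha>})"
  shows "supported \<alpha> \<phi>"
  unfolding supported_def using assms leq_restrict regular_mono by blast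

lemma supported_mono:
  assumes "supported \<alpha> \<phi>" "\<alpha> \<le> \<beta>" "regular \<phi>"
  shows "supported \<beta> \<phi>"
proof (rule supportedI[OF assms(3)])
  fix q assume q: "q \<in> conds" "\<phi> q"
  then have "\<phi> (q |` {..<\<alpha>})" using assms(1) unfolding supported_def by blast
  moreover have "leq (q |` {..<\<beta>}) (q |` {..<\<alpha>})"
    using leq_restrict[OF restrict_conds[OF q(1)], of \<beta> \<alpha>] assms(2) by simp
  ultimately show "\<phi> (q |` {..<\<beta>})" using assms(3) regular_mono by blast
qed

text \<open>A maximal antichain M of conditions forcing \<phi> is small, so its domains are bounded
  by some \<alpha>. If q forces \<phi>, then any r below the restriction of q to \<alpha> can be
  spliced with q and thereby meets some m in M; since m lives below \<alpha>, r itself has an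
  extension below m.\<close>

lemma ex_supported:
  assumes "regular \<phi>"
  obtains \<alpha> where "supported \<alpha> \<phi>"
proof -
  obtain M where M: "antichain M" "\<And>p. p \<in> M \<Longrightarrow> leq p p \<and> \<phi> p"
      "\<And>p. leq p p \<and> \<phi> p \<Longrightarrow> \<exists>m\<in>M. \<exists>r. leq r p \<and> leq r m"
    using maximal_antichain[of "\<lambda>p. leq p p \<and> \<phi> p"] by metis
  have "small (\<Union>m\<in>M. dom m)"
    using antichain_small[OF M(1)] by (rule small_UN) (use M(2) leq_conds conds_iff small_finite in blast)
  then obtain \<alpha> where \<alpha>: "\<And>m. m \<in> M \<Longrightarrow> dom m \<subseteq> {..<\<alpha>}" using small_bounded by (metis UN_I lessThan_iff subsetI)
  have "\<phi> (q |` {..<\<alpha>})" if q: "q \<in> conds" "\<phi> q" for q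
  proof (rule regular_dense[OF assms leq_refl[OF restrict_conds[OF q(1)]]])
    fix r assume r: "leq r (q |` {..<\<alpha>})"
    define t where "t = splice \<alpha> (r |` {..<\<alpha>}) q"
    have t: "leq t q" "leq t (r |` {..<\<alpha>})" unfolding t_def using splice_stronger[OF q(1) r] by auto
    then have "leq t t \<and> \<phi> t" using q(2) assms regular_mono le_left by blast
    then obtain m t' where m: "m \<in> M" "leq t' t" "leq t' m" using M(3) by blast
    have "leq (t' |` {..<\<alpha>}) (r |` {..<\<alpha>})"
      using restrict_leq[OF le_trans[OF m(2) t(2)], of \<alpha>] by simp
    moreover have "leq (t' |` {..<\<alpha>}) m"
      using restrict_leq[OF m(3), of \<alpha>] restrict_id[OF \<alpha>[OF m(1)]] by simp
    moreover have "leq (splice \<alpha> (t' |` {..<\<alpha>}) r) r" "leq (splice \<alpha> (t' |` {..<\<alpha>}) r) (t' |` {..<\<alpha>})"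
      using splice_leq[OF leq_conds(1)[OF r] calculation(1)] by simp_all
    ultimately show "\<exists>u. leq u r \<and> \<phi> u" using M(2)[OF m(1)] assms regular_mono le_trans by meson
  qed
  then show ?thesis using that supportedI[OF assms] by blast
qed

lemma ex_supported_countable:
  fixes \<phi> :: "'c::countable \<Rightarrow> ('o \<rightharpoonup> 'q) sentence"
  assumes "\<And>i. regular (\<phi> i)"
  obtains \<alpha> where "\<And>i. supported \<alpha> (\<phi> i)"
proof -
  have "\<exists>\<alpha>. supported \<alpha> (\<phi> i)" for i using ex_supported[OF assms] by blast
  then obtain a where a: "\<And>i. supported (a i) (\<phi> i)" by metis
  have "small (range a)" by (rule small_countable) simp
  then obtain \<alpha> where "\<And>i. a i < \<alpha>" using small_bounded by (metis rangeI)
  then show ?thesis using that supported_mono[OF a _ assms] less_imp_le by blast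
qed

text \<open>If an extension of the restricted condition forced \<phi>, its part below \<alpha> would
  already do so and could be spliced with q.\<close>

lemma supported_not:
  assumes "supported \<alpha> \<phi>" "regular \<phi>"
  shows "supported \<alpha> (f_not leq \<phi>)"
proof (rule supportedI)
  show "regular (f_not leq \<phi>)" using assms by blast
  fix q assume q: "q \<in> conds" "f_not leq \<phi> q"
  show "f_not leq \<phi> (q |` {..<\<alpha>})"
    unfolding not_iff
  proof (intro allI impI notI)
    fix r assume r: "leq r (q |` {..<\<alpha>})" "\<phi> r"
    then have "\<phi> (r |` {..<\<alpha>})" using assms(1) leq_conds unfolding supported_def by blast
    then have "\<phi> (splice \<alpha> (r |` {..<\<alpha>}) q)"
      using splice_stronger[OF q(1) r(1)] assms(2) regular_mono by blast
    then show False using q(2) splice_stronger[OF q(1) r(1)] unfolding not_iff by blast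
  qed
qed

lemma supported_and: "supported \<alpha> \<phi> \<Longrightarrow> supported \<alpha> \<psi> \<Longrightarrow> supported \<alpha> (\<phi> \<^bold>\<and> \<psi>)"
  unfolding supported_def f_and_def by blast

lemma supported_all: "(\<And>x. supported \<alpha> (\<phi> x)) \<Longrightarrow> supported \<alpha> (f_all \<phi>)"
  unfolding supported_def f_all_def by blast

lemma supported_ground: "supported \<alpha> (f_ground b)"
  unfolding supported_def f_ground_def by blast

lemma supported_ex:
  "(\<And>x. supported \<alpha> (\<phi> x)) \<Longrightarrow> (\<And>x. regular (\<phi> x)) \<Longrightarrow> supported \<alpha> (f_ex leq \<phi>)"
  unfolding f_ex_def by (intro supported_not supported_all regular_all regular_not)

end

subsection \<open>Transfer of Borel predicates\<close>

abbreviation bits :: "('i \<Rightarrow> bool) measure" where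
  "bits \<equiv> Pi\<^sub>M UNIV (\<lambda>_. count_space UNIV)"

context forcing_order
begin

definition dense_set :: "('p \<Rightarrow> bool) \<Rightarrow> bool" where
  "dense_set D \<longleftrightarrow> (\<forall>p. le p p \<longrightarrow> (\<exists>q. le q p \<and> D q))"

text \<open>A descending sequence stands for the filter it generates; as only countably many dense
  sets are to be met, such sequences exist in the ground model.\<close>

definition generic :: "(nat \<Rightarrow> 'p \<Rightarrow> bool) \<Rightarrow> (nat \<Rightarrow> 'p) \<Rightarrow> bool" where
  "generic D G \<longleftrightarrow> (\<forall>i. le (G (Suc i)) (G i)) \<and> (\<forall>n. \<exists>i. D n (G i))"

definition holds :: "(nat \<Rightarrow> 'p) \<Rightarrow> 'p sentence \<Rightarrow> bool" where
  "holds G \<phi> \<longleftrightarrow> (\<exists>i. \<phi> (G i))"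

lemma generic_exists:
  assumes "\<And>n. dense_set (D n)" "le p p"
  obtains G where "generic D G" "G 0 = p"
proof -
  have "\<exists>G. G 0 = p \<and> (\<forall>n. le (G (Suc n)) (G n) \<and> D n (G (Suc n)))"
  proof -
    have "\<exists>G. \<forall>n. (le (G n) (G n) \<and> (n = 0 \<longrightarrow> G n = p)) \<and> le (G (Suc n)) (G n) \<and> D n (G (Suc n))"
    proof (rule dependent_nat_choice)
      show "\<exists>q. le q q \<and> (0 = (0::nat) \<longrightarrow> q = p)" using assms(2) by blast
      fix q and n :: nat assume "le q q \<and> (n = 0 \<longrightarrow> q = p)"
      then show "\<exists>r. (le r r \<and> (Suc n = 0 \<longrightarrow> r = p)) \<and> le r q \<and> D n r"
        using assms(1)[of n] le_left unfolding dense_set_def by blast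
    qed
    then show ?thesis by blast
  qed
  then show ?thesis using that unfolding generic_def by blast
qed

lemma generic_mono:
  assumes "generic D G" "i \<le> j"
  shows "le (G j) (G i)"
  using assms(2)
proof (induction j rule: dec_induct)
  case base
  then show ?case using assms(1) le_right unfolding generic_def by blast
next
  case (step j)
  then show ?case using assms(1) le_trans unfolding generic_def by blast
qed

lemma generic_common: "generic D G \<Longrightarrow> \<exists>k. le (G k) (G i) \<and> le (G k) (G j)"
  using generic_mono[of D G i "max i j"] generic_mono[of D G j "max i j"] by auto

lemma generic_subfamily:
  assumes "generic (\<lambda>n. case prod_decode n of (k, m) \<Rightarrow> D k m) G"
  shows "generic (D k) G"
  unfolding generic_def
proof (intro conjI allI)
  show "le (G (Suc i)) (G i)" for i using assms unfolding generic_def by blast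
  show "\<exists>i. D k n (G i)" for n
    using assms[unfolded generic_def, THEN conjunct2, rule_format, of "prod_encode (k, n)"] by simp
qed

text \<open>
  \<open>represents \<theta> \<Psi> B\<close>: the truth value of \<open>\<Psi>\<close> is obtained from those of the sentences \<open>\<theta> i\<close> by
  applying \<open>B\<close>, for every filter that meets suitable countably many dense sets. By the lemma of Rasiowa
  and Sikorski, implications between Borel predicates \<open>B\<close> then transfer to the forcing relation.
\<close>

definition represents :: "('i \<Rightarrow> 'p sentence) \<Rightarrow> 'p sentence \<Rightarrow> (('i \<Rightarrow> bool) \<Rightarrow> bool) \<Rightarrow> bool" where
  "represents \<theta> \<Psi> B \<longleftrightarrow> regular \<Psi> \<and> (\<exists>D. (\<forall>n. dense_set (D n)) \<and>
     (\<forall>G. generic D G \<longrightarrow> (holds G \<Psi> \<longleftrightarrow> B (\<lambda>i. holds G (\<theta> i)))))"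

lemma represents_regular: "represents \<theta> \<Psi> B \<Longrightarrow> regular \<Psi>"
  unfolding represents_def by blast

lemma represents_atom: "regular (\<theta> i) \<Longrightarrow> represents \<theta> (\<theta> i) (\<lambda>y. y i)"
  unfolding represents_def dense_set_def by blast

lemma represents_ground: "represents \<theta> (f_ground b) (\<lambda>_. b)"
proof -
  have "holds G (f_ground b) \<longleftrightarrow> b" for G by (simp add: holds_def f_ground_def)
  then show ?thesis unfolding represents_def dense_set_def by blast
qed

lemma represents_reindex:
  "represents (\<lambda>i. \<theta> (f i)) \<Psi> B \<Longrightarrow> represents \<theta> \<Psi> (\<lambda>y. B (\<lambda>i. y (f i)))"
  unfolding represents_def by blast

lemma represents_cong:
  assumes "represents \<theta> \<Psi> B" "regular \<Psi>'" "\<And>p. le p p \<Longrightarrow> \<Psi> p \<longleftrightarrow> \<Psi>' p"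
  shows "represents \<theta> \<Psi>' B"
proof -
  have "holds G \<Psi> \<longleftrightarrow> holds G \<Psi>'" if "generic D G" for D G
    using assms(3) that le_left le_right unfolding holds_def generic_def by blast
  then show ?thesis using assms(1,2) unfolding represents_def by metis
qed

lemma represents_not:
  assumes "represents \<theta> \<Psi> B"
  shows "represents \<theta> (f_not le \<Psi>) (\<lambda>y. \<not> B y)"
proof -
  obtain D where D: "\<And>n. dense_set (D n)" "\<And>G. generic D G \<Longrightarrow> holds G \<Psi> \<longleftrightarrow> B (\<lambda>i. holds G (\<theta> i))"
    and reg: "regular \<Psi>" using assms unfolding represents_def by blast
  \<comment> \<open>The additional dense set at index 0 makes the sequence decide \<Psi>;
    consistency along the sequence then gives the equivalence with the negation.\<close>
  define D' where "D' n = (case n of 0 \<Rightarrow> (\<lambda>r. \<Psi> r \<or> f_not le \<Psi> r) | Suc m \<Rightarrow> D m)" for n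
  have "dense_set (D' n)" for n
    using D(1) by (auto simp: D'_def dense_set_def split: nat.splits) (meson decide)
  moreover have "holds G (f_not le \<Psi>) \<longleftrightarrow> \<not> B (\<lambda>i. holds G (\<theta> i))" if G: "generic D' G" for G
  proof -
    have "generic D G" using G unfolding generic_def D'_def
      by (metis old.nat.simps(5))
    then have B: "holds G \<Psi> \<longleftrightarrow> B (\<lambda>i. holds G (\<theta> i))" using D(2) by blast
    have "holds G \<Psi> \<or> holds G (f_not le \<Psi>)"
      using G[unfolded generic_def, THEN conjunct2, rule_format, of 0]
      unfolding D'_def holds_def by auto
    moreover have "\<not> (holds G \<Psi> \<and> holds G (f_not le \<Psi>))"
    proof
      assume "holds G \<Psi> \<and> holds G (f_not le \<Psi>)"
      then obtain i j where "\<Psi> (G i)" "f_not le \<Psi> (G j)" unfolding holds_def by blast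
      moreover obtain k where "le (G k) (G i)" "le (G k) (G j)" using generic_common[OF G] by blast
      ultimately show False using regular_mono[OF reg] unfolding not_iff by blast
    qed
    ultimately show ?thesis using B by blast
  qed
  ultimately show ?thesis using regular_not[OF reg] unfolding represents_def by blast
qed

lemma represents_all_nat:
  fixes \<Psi> :: "nat \<Rightarrow> 'p sentence"
  assumes "\<And>n. represents \<theta> (\<Psi> n) (B n)"
  shows "represents \<theta> (f_all \<Psi>) (\<lambda>y. \<forall>n. B n y)"
proof -
  have "\<exists>D. (\<forall>m. dense_set (D m)) \<and> (\<forall>G. generic D G \<longrightarrow> (holds G (\<Psi> n) \<longleftrightarrow> B n (\<lambda>i. holds G (\<theta> i))))" for n
    using assms unfolding represents_def by blast
  then obtain D where D: "\<And>n m. dense_set (D n m)"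
      "\<And>n G. generic (D n) G \<Longrightarrow> holds G (\<Psi> n) \<longleftrightarrow> B n (\<lambda>i. holds G (\<theta> i))" by metis
  have reg: "regular (\<Psi> n)" for n using assms represents_regular by blast
  \<comment> \<open>If all instances hold along the sequence, it must still be excluded that no
    single condition forces all of them. The extra dense set consists of the conditions that force
    the universal sentence or refute some instance.\<close>
  define D' where "D' n = (case n of 0 \<Rightarrow> (\<lambda>_ r. f_all \<Psi> r \<or> (\<exists>x. f_not le (\<Psi> x) r)) | Suc m \<Rightarrow> D m)" for n
  define D'' where "D'' n = (case prod_decode n of (k, m) \<Rightarrow> D' k m)" for n
  have d0: "dense_set (\<lambda>r. f_all \<Psi> r \<or> (\<exists>x. f_not le (\<Psi> x) r))"
    unfolding dense_set_def
  proof (intro allI impI)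
    fix p assume p: "le p p"
    show "\<exists>q. le q p \<and> (f_all \<Psi> q \<or> (\<exists>x. f_not le (\<Psi> x) q))"
    proof (cases "f_all \<Psi> p")
      case True
      then show ?thesis using p by blast
    next
      case False
      then obtain x where "\<not> \<Psi> x p" unfolding all_iff by blast
      then show ?thesis using not_forced[OF reg p] by metis
    qed
  qed
  have "dense_set (D'' n)" for n
    using D(1) d0 by (auto simp: D''_def D'_def split: prod.splits nat.splits)
  moreover have "holds G (f_all \<Psi>) \<longleftrightarrow> (\<forall>n. B n (\<lambda>i. holds G (\<theta> i)))" if G: "generic D'' G" for G
  proof -
    have sub: "generic (D' k) G" for k
      using generic_subfamily[of D' G k] G unfolding D''_def by blast
    have "generic (D k) G" for k using sub[of "Suc k"] by (simp add: D'_def)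
    then have B: "holds G (\<Psi> n) \<longleftrightarrow> B n (\<lambda>i. holds G (\<theta> i))" for n using D(2) by blast
    have "holds G (f_all \<Psi>) \<or> (\<exists>x. holds G (f_not le (\<Psi> x)))"
      using sub[of 0] unfolding generic_def D'_def holds_def by auto
    moreover have "\<not> (holds G (\<Psi> x) \<and> holds G (f_not le (\<Psi> x)))" for x
    proof
      assume "holds G (\<Psi> x) \<and> holds G (f_not le (\<Psi> x))"
      then obtain i j where "\<Psi> x (G i)" "f_not le (\<Psi> x) (G j)" unfolding holds_def by blast
      moreover obtain k where "le (G k) (G i)" "le (G k) (G j)" using generic_common[OF G] by blast
      ultimately show False using regular_mono[OF reg] unfolding not_iff by blast
    qed
    moreover have "holds G (\<Psi> x)" if "holds G (f_all \<Psi>)" for x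
      using that unfolding holds_def all_iff by blast
    ultimately show ?thesis using B by blast
  qed
  ultimately show ?thesis using regular_all[of \<Psi>] reg unfolding represents_def by blast
qed

lemma represents_all:
  fixes \<Psi> :: "'c::countable \<Rightarrow> 'p sentence"
  assumes "\<And>x. represents \<theta> (\<Psi> x) (B x)"
  shows "represents \<theta> (f_all \<Psi>) (\<lambda>y. \<forall>x. B x y)"
proof -
  have "represents \<theta> (f_all (\<lambda>n. \<Psi> (from_nat n))) (\<lambda>y. \<forall>n. B (from_nat n) y)"
    by (rule represents_all_nat) (rule assms)
  moreover have "f_all (\<lambda>n. \<Psi> (from_nat n)) = f_all \<Psi>"
    unfolding f_all_def by (metis from_nat_to_nat)
  moreover have "(\<lambda>y. \<forall>n. B (from_nat n) y) = (\<lambda>y. \<forall>x. B x y)"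
    by (metis from_nat_to_nat)
  ultimately show ?thesis by simp
qed

lemma represents_and:
  assumes "represents \<theta> \<Phi> A" "represents \<theta> \<Psi> B"
  shows "represents \<theta> (\<Phi> \<^bold>\<and> \<Psi>) (\<lambda>y. A y \<and> B y)"
proof -
  have "represents \<theta> (f_all (\<lambda>b. if b then \<Phi> else \<Psi>)) (\<lambda>y. \<forall>b. (if b then A else B) y)"
    by (rule represents_all) (use assms in auto)
  moreover have "f_all (\<lambda>b. if b then \<Phi> else \<Psi>) = (\<Phi> \<^bold>\<and> \<Psi>)"
    unfolding f_all_def f_and_def by (auto simp: fun_eq_iff all_bool_eq)
  moreover have "(\<lambda>y. \<forall>b. (if b then A else B) y) = (\<lambda>y. A y \<and> B y)"
    by (auto simp: fun_eq_iff all_bool_eq)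
  ultimately show ?thesis by simp
qed

lemma represents_or:
  "represents \<theta> \<Phi> A \<Longrightarrow> represents \<theta> \<Psi> B \<Longrightarrow> represents \<theta> (f_or le \<Phi> \<Psi>) (\<lambda>y. A y \<or> B y)"
  using represents_not[OF represents_and[OF represents_not represents_not], of \<theta> \<Phi> A \<Psi> B]
  unfolding f_or_def by simp

lemma represents_imp:
  "represents \<theta> \<Phi> A \<Longrightarrow> represents \<theta> \<Psi> B \<Longrightarrow> represents \<theta> (f_imp le \<Phi> \<Psi>) (\<lambda>y. A y \<longrightarrow> B y)"
  using represents_not[OF represents_and[OF _ represents_not], of \<theta> \<Phi> A \<Psi> B]
  unfolding f_imp_def by simp

lemma represents_iff:
  assumes "represents \<theta> \<Phi> A" "represents \<theta> \<Psi> B"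
  shows "represents \<theta> (f_iff le \<Phi> \<Psi>) (\<lambda>y. A y \<longleftrightarrow> B y)"
  using represents_and[OF represents_imp[OF assms] represents_imp[OF assms(2,1)]]
  unfolding f_iff_def iff_conv_conj_imp .

lemma represents_ex:
  fixes \<Psi> :: "'c::countable \<Rightarrow> 'p sentence"
  assumes "\<And>x. represents \<theta> (\<Psi> x) (B x)"
  shows "represents \<theta> (f_ex le \<Psi>) (\<lambda>y. \<exists>x. B x y)"
  using represents_not[OF represents_all[of \<theta> "\<lambda>x. f_not le (\<Psi> x)" "\<lambda>x y. \<not> B x y"]] represents_not[OF assms]
  unfolding f_ex_def by simp

lemmas represents_intros = represents_ground represents_not represents_and represents_or
  represents_imp represents_iff represents_all represents_ex

text \<open>Otherwise some q below p forces the negation of \<Psi>. A sequence through q that is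
  generic for both families of dense sets yields one assignment y satisfying A but not B.\<close>

lemma transfer:
  assumes "represents \<theta> \<Phi> A" "represents \<theta> \<Psi> B" "\<And>y. A y \<Longrightarrow> B y" "\<Phi> p" "le p p"
  shows "\<Psi> p"
proof (rule ccontr)
  assume "\<not> \<Psi> p"
  then obtain q where q: "le q p" "f_not le \<Psi> q"
    using not_forced[OF represents_regular[OF assms(2)] assms(5)] by blast
  obtain D where D: "\<And>n. dense_set (D n)" "\<And>G. generic D G \<Longrightarrow> holds G \<Phi> \<longleftrightarrow> A (\<lambda>i. holds G (\<theta> i))"
    using assms(1) unfolding represents_def by blast
  obtain D' where D': "\<And>n. dense_set (D' n)"
      "\<And>G. generic D' G \<Longrightarrow> holds G (f_not le \<Psi>) \<longleftrightarrow> \<not> B (\<lambda>i. holds G (\<theta> i))"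
    using represents_not[OF assms(2)] unfolding represents_def by blast
  define E where "E k = (if k = (0::nat) then D else D')" for k
  define F where "F n = (case prod_decode n of (k, m) \<Rightarrow> E k m)" for n
  have "dense_set (F n)" for n using D(1) D'(1) by (auto simp: F_def E_def split: prod.splits)
  then obtain G where G: "generic F G" "G 0 = q" using generic_exists le_left[OF q(1)] by metis
  have "generic (E k) G" for k using generic_subfamily[of E G k] G(1) unfolding F_def by blast
  from this[of 0] this[of 1] have g: "generic D G" "generic D' G" by (simp_all add: E_def)
  have "\<Phi> q" using assms(4) q(1) represents_regular[OF assms(1)] regular_mono by blast
  then have "holds G \<Phi>" "holds G (f_not le \<Psi>)" using q(2) G(2) unfolding holds_def by metis+
  then show False using D(2)[OF g(1)] D'(2)[OF g(2)] assms(3) by blast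
qed

lemma transfer_valid:
  assumes "represents \<theta> \<Psi> B" "\<And>y. B y" "le p p"
  shows "\<Psi> p"
  by (rule transfer[OF represents_ground[of \<theta> True] assms(1)]) (auto simp: ground_iff assms)

text \<open>
  The predicate \<open>Pr\<close> allows to keep track of further properties of the representing sentences that are
  inherited from the atoms \<open>\<theta> i\<close>.
\<close>

definition closed_property :: "('p sentence \<Rightarrow> bool) \<Rightarrow> bool" where
  "closed_property Pr \<longleftrightarrow> (\<forall>b. Pr (f_ground b)) \<and> (\<forall>\<phi>. regular \<phi> \<longrightarrow> Pr \<phi> \<longrightarrow> Pr (f_not le \<phi>)) \<and>
     (\<forall>\<phi> \<psi>. Pr \<phi> \<longrightarrow> Pr \<psi> \<longrightarrow> Pr (\<phi> \<^bold>\<and> \<psi>)) \<and> (\<forall>\<phi> :: nat \<Rightarrow> 'p sentence. (\<forall>n. Pr (\<phi> n)) \<longrightarrow> Pr (f_all \<phi>)) \<and>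
     (\<forall>\<phi> \<psi>. Pr \<phi> \<longrightarrow> regular \<psi> \<longrightarrow> (\<forall>p. le p p \<longrightarrow> \<phi> p = \<psi> p) \<longrightarrow> Pr \<psi>)"

lemma closed_property_cong:
  assumes "closed_property Pr" "Pr \<phi>" "regular \<psi>" "\<And>p. le p p \<Longrightarrow> \<phi> p = \<psi> p"
  shows "Pr \<psi>"
  using assms(1)[unfolded closed_property_def, THEN conjunct2, THEN conjunct2, THEN conjunct2, THEN conjunct2]
    assms(2-4) by blast

text \<open>Induction over the sigma-algebra generated by the coordinates: complements become
  negations and countable unions become existential quantifiers over the natural numbers. The index
  type may be uncountable.\<close>

lemma ex_represents:
  fixes \<theta> :: "'i \<Rightarrow> 'p sentence"
  assumes reg: "\<And>i. regular (\<theta> i)" and B: "Measurable.pred bits B"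
    and Pr: "closed_property Pr" "\<And>i. Pr (\<theta> i)"
  shows "\<exists>\<Psi>. represents \<theta> \<Psi> B \<and> Pr \<Psi>"
proof -
  have Pr_ground: "Pr (f_ground b)" and Pr_not: "regular \<phi> \<Longrightarrow> Pr \<phi> \<Longrightarrow> Pr (f_not le \<phi>)"
    and Pr_and: "Pr \<phi> \<Longrightarrow> Pr \<psi> \<Longrightarrow> Pr (\<phi> \<^bold>\<and> \<psi>)" and Pr_all: "(\<And>n. Pr (\<Phi> n)) \<Longrightarrow> Pr (f_all \<Phi>)"
    for b \<phi> \<psi> and \<Phi> :: "nat \<Rightarrow> 'p sentence"
    using Pr(1) unfolding closed_property_def by blast+
  have sets_bits: "sets (bits :: ('i \<Rightarrow> bool) measure) = sigma_sets UNIV {{f. f i \<in> A} | i A. True}"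
    using sets_PiM_single[of "UNIV :: 'i set" "\<lambda>_. count_space (UNIV :: bool set)"] by simp
  have "\<exists>\<Psi>. represents \<theta> \<Psi> (\<lambda>y. y \<in> S) \<and> Pr \<Psi>" if "S \<in> sets (bits :: ('i \<Rightarrow> bool) measure)" for S
    using that unfolding sets_bits
  proof (induction S rule: sigma_sets.induct)
    case (Basic S)
    then obtain i A where S: "S = {f. f i \<in> A}" by blast
    have "represents \<theta> (f_or le (\<theta> i \<^bold>\<and> f_ground (True \<in> A)) (f_not le (\<theta> i) \<^bold>\<and> f_ground (False \<in> A)))
        (\<lambda>y. y i \<and> True \<in> A \<or> \<not> y i \<and> False \<in> A)"
      by (intro represents_intros represents_atom reg)
    moreover have "(\<lambda>y. y i \<and> True \<in> A \<or> \<not> y i \<and> False \<in> A) = (\<lambda>y. y \<in> S)"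
    proof
      show "(y i \<and> True \<in> A \<or> \<not> y i \<and> False \<in> A) = (y \<in> S)" for y by (cases "y i") (auto simp: S)
    qed
    moreover have "Pr (f_or le (\<theta> i \<^bold>\<and> f_ground (True \<in> A)) (f_not le (\<theta> i) \<^bold>\<and> f_ground (False \<in> A)))"
      unfolding f_or_def by (intro Pr_not Pr_and Pr_ground Pr(2) regular_intros reg)
    ultimately show ?case by auto
  next
    case Empty
    then show ?case using represents_ground[of \<theta> False] Pr_ground by auto
  next
    case (Compl a)
    then obtain \<Psi> where \<Psi>: "represents \<theta> \<Psi> (\<lambda>y. y \<in> a)" "Pr \<Psi>" by blast
    have "represents \<theta> (f_not le \<Psi>) (\<lambda>y. y \<in> UNIV - a)" using represents_not[OF \<Psi>(1)] by simp
    then show ?case using Pr_not[OF represents_regular[OF \<Psi>(1)] \<Psi>(2)] by blast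
  next
    case (Union a)
    then obtain \<Psi> where \<Psi>: "\<And>n. represents \<theta> (\<Psi> n) (\<lambda>y. y \<in> a n)" "\<And>n. Pr (\<Psi> n)" by metis
    have "Pr (f_ex le \<Psi>)"
      unfolding f_ex_def
      by (intro Pr_not Pr_all \<Psi>(2) regular_intros represents_regular[OF \<Psi>(1)])
    then show ?case using represents_ex[of \<theta> \<Psi>, OF \<Psi>(1)] by auto
  qed
  moreover have "{y. B y} \<in> sets bits" using B by (simp add: pred_def space_PiM)
  ultimately show ?thesis by fastforce
qed

text \<open>Evaluates a Borel function at names: the family B describes, element by element, a
  subset of a ground set computed from the truth values of the atoms. No coherence between different
  b is required, since coherent behaviour is recovered by transfer.\<close>

lemma ex_name_closed:
  fixes \<theta> :: "'i \<Rightarrow> 'p sentence" and B :: "'b \<Rightarrow> ('i \<Rightarrow> bool) \<Rightarrow> bool"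
  assumes "\<And>i. regular (\<theta> i)" "\<And>b. Measurable.pred bits (B b)" "closed_property Pr" "\<And>i. Pr (\<theta> i)"
  obtains w :: "('b, 'p) name" where "\<And>b. represents \<theta> (f_mem le f_geq b w) (B b)"
    "\<And>b. Pr (f_mem le f_geq b w)"
proof -
  have "\<exists>\<Psi>. represents \<theta> \<Psi> (B b) \<and> Pr \<Psi>" for b using ex_represents[of \<theta> "B b" Pr, OF assms] .
  then obtain \<Psi> where \<Psi>: "\<And>b. represents \<theta> (\<Psi> b) (B b)" "\<And>b. Pr (\<Psi> b)" by metis
  have reg: "regular (\<Psi> b)" for b using \<Psi> represents_regular by blast
  have eq: "f_mem le f_geq b (f_compr le \<Psi>) p = \<Psi> b p" if "le p p" for b p
    using mem_compr_geq[of \<Psi>, OF reg that] .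
  have "represents \<theta> (f_mem le f_geq b (f_compr le \<Psi>)) (B b)" for b
    using \<Psi>(1)[of b] by (rule represents_cong) (auto simp: eq)
  moreover have "Pr (f_mem le f_geq b (f_compr le \<Psi>))" for b
    by (rule closed_property_cong[OF assms(3) \<Psi>(2)[of b] regular_mem]) (simp add: eq)
  ultimately show ?thesis using that by blast
qed

lemma ex_name:
  fixes \<theta> :: "'i \<Rightarrow> 'p sentence" and B :: "'b \<Rightarrow> ('i \<Rightarrow> bool) \<Rightarrow> bool"
  assumes "\<And>i. regular (\<theta> i)" "\<And>b. Measurable.pred bits (B b)"
  obtains w :: "('b, 'p) name" where "\<And>b. represents \<theta> (f_mem le f_geq b w) (B b)"
proof -
  have closed: "closed_property (\<lambda>_. True)" by (simp add: closed_property_def)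
  show ?thesis
  proof (rule ex_name_closed[of \<theta> B "\<lambda>_. True", OF assms closed TrueI])
    fix w :: "('b, 'p) name"
    assume "\<And>b. represents \<theta> (f_mem le f_geq b w) (B b)"
    then show thesis by (rule that)
  qed
qed

lemma represents_prefix:
  assumes "\<And>i. represents \<theta> (f_mem le f_geq i x) (X i)"
  shows "represents \<theta> (f_prefix le s x) (\<lambda>y. \<forall>i<length s. X i y \<longleftrightarrow> s ! i)"
proof -
  have "represents \<theta> (f_prefix le s x) (\<lambda>y. \<forall>i. i < length s \<longrightarrow> (X i y \<longleftrightarrow> s ! i))"
    unfolding f_prefix_def by (intro represents_intros assms)
  then show ?thesis by simp
qed

lemma represents_in_clopen:
  assumes "\<And>i. represents \<theta> (f_mem le f_geq i x) (X i)"
  shows "represents \<theta> (f_in_clopen le x C) (\<lambda>y. \<exists>s. cone s \<subseteq> C \<and> (\<lambda>i. X i y) \<in> cone s)"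
proof -
  have "represents \<theta> (f_in_clopen le x C) (\<lambda>y. \<exists>s. cone s \<subseteq> C \<and> (\<forall>i<length s. X i y \<longleftrightarrow> s ! i))"
    unfolding f_in_clopen_def by (intro represents_intros represents_prefix assms)
  then show ?thesis by (simp add: cone_def)
qed

end

subsection \<open>Measure on the Cantor space\<close>

definition coin :: "(nat \<Rightarrow> bool) measure" where
  "coin = Pi\<^sub>M UNIV (\<lambda>_. measure_pmf (bernoulli_pmf (1/2)))"

interpretation coin: prob_space coin
  unfolding coin_def by (intro prob_space_PiM measure_pmf.prob_space_axioms)

lemma sets_coin [simp, measurable_cong]: "sets coin = sets bits"
  unfolding coin_def by (intro sets_PiM_cong) auto

lemma space_coin [simp]: "space coin = UNIV"
  by (simp add: coin_def space_PiM)

lemma cone_sets [measurable]: "cone s \<in> sets bits"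
proof -
  have "Measurable.pred bits (\<lambda>x. \<forall>i<length s. x i = s ! i)" by measurable
  then show ?thesis by (simp add: cone_def pred_def space_PiM)
qed

lemma emeasure_cone: "emeasure coin (cone s) = ennreal ((1/2) ^ length s)"
proof -
  interpret product_prob_space "\<lambda>_ :: nat. measure_pmf (bernoulli_pmf (1/2))" UNIV
    by unfold_locales
  have "cone s = prod_emb UNIV (\<lambda>_. measure_pmf (bernoulli_pmf (1/2))) {..<length s}
      (\<Pi>\<^sub>E i\<in>{..<length s}. {s ! i})"
    by (intro set_eqI) (auto simp: cone_def prod_emb_iff Pi_iff)
  then have "emeasure coin (cone s) = (\<Prod>i<length s. emeasure (measure_pmf (bernoulli_pmf (1/2))) {s ! i})"
    unfolding coin_def by (simp only:) (rule emeasure_PiM_emb, auto)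
  also have "\<dots> = (\<Prod>i<length s. ennreal (1/2))"
  proof (rule prod.cong[OF refl])
    show "emeasure (measure_pmf (bernoulli_pmf (1/2))) {s ! i} = ennreal (1/2)" for i
      by (cases "s ! i") (simp_all add: emeasure_pmf_single)
  qed
  also have "\<dots> = ennreal ((1/2) ^ length s)"
    by (simp only: prod_constant card_lessThan) (rule ennreal_power, simp)
  finally show ?thesis .
qed

lemma measure_cone: "measure coin (cone s) = (1/2) ^ length s"
  by (simp add: measure_def emeasure_cone)

lemma cone_Nil [simp]: "cone [] = UNIV"
  by (simp add: cone_def)

lemma mem_cone_iff: "x \<in> cone s \<longleftrightarrow> map x [0..<length s] = s"
proof
  assume "x \<in> cone s"
  then show "map x [0..<length s] = s" by (intro nth_equalityI) (auto simp: cone_def)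
next
  assume *: "map x [0..<length s] = s"
  have "x i = s ! i" if "i < length s" for i using arg_cong[OF *, of "\<lambda>l. l ! i"] that by simp
  then show "x \<in> cone s" by (simp add: cone_def)
qed

lemma mem_cone_map [simp]: "x \<in> cone (map x [0..<n])"
  by (simp add: cone_def)

lemma cone_mono: "x \<in> cone s \<Longrightarrow> x \<in> cone t \<Longrightarrow> length s \<le> length t \<Longrightarrow> cone t \<subseteq> cone s"
  unfolding cone_def by fastforce

lemma cone_disjoint: "length s = length t \<Longrightarrow> s \<noteq> t \<Longrightarrow> cone s \<inter> cone t = {}"
  by (auto simp: cone_def list_eq_iff_nth_eq)

lemma open_cone: "open (cone s)"
proof -
  have "cone s = Pi\<^sub>E UNIV (\<lambda>i. if i < length s then {s ! i} else UNIV)"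
    by (auto simp: cone_def PiE_iff split: if_splits)
  moreover have "open (Pi\<^sub>E UNIV (\<lambda>i. if i < length s then {s ! i} else UNIV))"
    by (rule open_PiE) (auto intro: discrete_topology_class.open_discrete finite_subset[of _ "{..<length s}"])
  ultimately show ?thesis by simp
qed

lemma open_contains_cone:
  assumes "open C" "x \<in> C"
  obtains s where "x \<in> cone s" "cone s \<subseteq> C"
proof -
  have "openin (product_topology (\<lambda>i. euclidean) UNIV) C"
    using assms(1) by (simp add: open_fun_def)
  then obtain X where X: "x \<in> Pi\<^sub>E UNIV X" "finite {i. X i \<noteq> UNIV}" "Pi\<^sub>E UNIV X \<subseteq> C"
    using product_topology_open_contains_basis[OF _ assms(2), of "\<lambda>_. euclidean" UNIV] by auto
  obtain n where n: "\<And>i. X i \<noteq> UNIV \<Longrightarrow> i < n"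
    using X(2) finite_nat_set_iff_bounded[of "{i. X i \<noteq> UNIV}"] by auto
  have "cone (map x [0..<n]) \<subseteq> C"
  proof
    fix z assume "z \<in> cone (map x [0..<n])"
    then have z: "\<And>i. i < n \<Longrightarrow> z i = x i" by (simp add: cone_def)
    have "z i \<in> X i" for i
      using n[of i] z[of i] X(1) by (cases "X i = UNIV") (auto simp: PiE_iff)
    then show "z \<in> C" using X(3) by (auto simp: PiE_iff)
  qed
  then show ?thesis using that[of "map x [0..<n]"] by simp
qed

text \<open>Codes of clopen sets form a countable type, so that quantifiers over them are
  representable and functions into them can be treated with the discrete sigma-algebra.\<close>

definition clop :: "bool list list \<Rightarrow> (nat \<Rightarrow> bool) set" where
  "clop l = (\<Union>s\<in>set l. cone s)"

text \<open>An upper bound for the measure of \<open>clop l\<close>; it can be larger because the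
  cones in the list may overlap.\<close>

definition weight :: "bool list list \<Rightarrow> real" where
  "weight l = (\<Sum>s\<leftarrow>l. (1/2) ^ length s)"

lemma clop_sets [measurable]: "clop l \<in> sets bits"
  unfolding clop_def by (intro sets.finite_UN) auto

lemma open_clop: "open (clop l)"
  unfolding clop_def using open_cone by blast

lemma weight_nonneg: "0 \<le> weight l"
  unfolding weight_def by (intro sum_list_nonneg) auto

lemma compact_UNIV_cantor: "compact (UNIV :: (nat \<Rightarrow> bool) set)"
proof -
  have "compact_space (euclidean :: bool topology)"
    by (simp add: compact_space_def compactin_euclidean_iff finite_imp_compact)
  then have "compact_space (product_topology (\<lambda>_. euclidean :: bool topology) (UNIV :: nat set))"
    by (simp add: compact_space_product_topology)
  then show ?thesis
    by (simp add: compact_space_def euclidean_product_topology compactin_euclidean_iff)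
qed

text \<open>Compactness gives a finite cover by cones. Cutting all of them at one common length
  makes the cones disjoint, which gives a code whose weight is the exact measure.\<close>

lemma clopen_eq_clop:
  assumes "open C" "closed C"
  obtains l where "clop l = C" "weight l = measure coin C"
proof -
  have "compact C" using assms(2) compact_UNIV_cantor closed_Int_compact[of C UNIV] by simp
  moreover have "C \<subseteq> (\<Union>s\<in>{s. cone s \<subseteq> C}. cone s)" using open_contains_cone[OF assms(1)] by blast
  ultimately obtain S where S: "S \<subseteq> {s. cone s \<subseteq> C}" "finite S" "C \<subseteq> (\<Union>s\<in>S. cone s)"
    using compactE_image[of C "{s. cone s \<subseteq> C}" cone] open_cone by metis
  \<comment> \<open>The additional 0 keeps the maximum meaningful when C is empty.\<close>
  define n where "n = Max (insert 0 (length ` S))"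
  have n: "length s \<le> n" if "s \<in> S" for s using that S(2) by (simp add: n_def)
  define T where "T = {s :: bool list. length s = n \<and> cone s \<subseteq> C}"
  have "finite {s :: bool list. set s \<subseteq> UNIV \<and> length s = n}" by (rule finite_lists_length_eq) simp
  then have "finite T" by (rule finite_subset[rotated]) (auto simp: T_def)
  then obtain l where l: "set l = T" "distinct l" using finite_distinct_list by blast
  have C: "clop l = C"
  proof
    show "clop l \<subseteq> C" using l by (auto simp: clop_def T_def)
    show "C \<subseteq> clop l"
    proof
      fix x assume "x \<in> C"
      then obtain s where s: "s \<in> S" "x \<in> cone s" using S(3) by blast
      have "cone (map x [0..<n]) \<subseteq> cone s" using cone_mono[OF s(2), of "map x [0..<n]"] n[OF s(1)] by simp
      then have "map x [0..<n] \<in> T" using s(1) S(1) by (auto simp: T_def)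
      then show "x \<in> clop l" unfolding clop_def l(1) by (rule UN_I) simp
    qed
  qed
  have "measure coin C = (\<Sum>s\<in>T. measure coin (cone s))"
    unfolding C[symmetric] clop_def l(1)
    by (rule coin.finite_measure_finite_Union)
      (use \<open>finite T\<close> cone_disjoint in \<open>auto simp: disjoint_family_on_def T_def\<close>)
  then have "weight l = measure coin C"
    unfolding weight_def by (simp add: measure_cone sum_list_distinct_conv_sum_set[OF l(2)] l(1))
  then show ?thesis using that C by blast
qed

lemma closed_clop: "closed (clop l)"
proof -
  have "- cone s = (\<Union>t\<in>{t. length t = length s \<and> t \<noteq> s}. cone t)" for s
  proof
    show "- cone s \<subseteq> (\<Union>t\<in>{t. length t = length s \<and> t \<noteq> s}. cone t)"
    proof
      fix x assume "x \<in> - cone s"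
      then have "map x [0..<length s] \<noteq> s" using mem_cone_iff by blast
      then show "x \<in> (\<Union>t\<in>{t. length t = length s \<and> t \<noteq> s}. cone t)"
        by (intro UN_I[of "map x [0..<length s]"]) auto
    qed
  qed (use cone_disjoint in blast)
  then have "closed (cone s)" for s using open_cone by (metis (no_types, lifting) open_UN closed_def)
  then show ?thesis unfolding clop_def by (intro closed_UN) auto
qed

lemma ex_cone_iff: "(\<exists>s. cone s \<subseteq> clop l \<and> x \<in> cone s) \<longleftrightarrow> x \<in> clop l"
  using open_contains_cone[OF open_clop] by blast

text \<open>E is a relation and not a sequence, because it is going to be read off an arbitrary
  assignment of truth values, which need not describe a function. The same holds for
  \<open>covered\<close>.\<close>

definition limsup_clop :: "(nat \<Rightarrow> bool list list \<Rightarrow> bool) \<Rightarrow> (nat \<Rightarrow> bool) set" where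
  "limsup_clop E = {x. \<forall>m. \<exists>n\<ge>m. \<exists>l. E n l \<and> x \<in> clop l}"

definition covered :: "(nat \<Rightarrow> bool list \<Rightarrow> bool) \<Rightarrow> (nat \<Rightarrow> bool) set" where
  "covered U = {x. \<exists>n s. U n s \<and> x \<in> cone s}"

lemma limsup_clop_sets [measurable]: "limsup_clop E \<in> sets bits"
proof -
  have "Measurable.pred bits (\<lambda>x. \<forall>m. \<exists>n\<ge>m. \<exists>l. E n l \<and> x \<in> clop l)" by measurable
  then show ?thesis by (simp add: limsup_clop_def pred_def space_PiM)
qed

lemma covered_sets [measurable]: "covered U \<in> sets bits"
proof -
  have "Measurable.pred bits (\<lambda>x. \<exists>n s. U n s \<and> x \<in> cone s)" by measurable
  then show ?thesis by (simp add: covered_def pred_def space_PiM)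
qed

text \<open>
  If the part of the limit superior outside the cover has positive measure, then a point of it is
  found by a Borel procedure: \<open>branch\<close> chooses longer and longer cones that are contained in one more
  of the clopen sets and that still meet this part in a set of positive measure.
\<close>

definition pos :: "(nat \<Rightarrow> bool list list \<Rightarrow> bool) \<Rightarrow> (nat \<Rightarrow> bool list \<Rightarrow> bool) \<Rightarrow> bool list \<Rightarrow> bool" where
  "pos E U s \<longleftrightarrow> emeasure coin ((limsup_clop E - covered U) \<inter> cone s) \<noteq> 0"

definition good_ext where
  "good_ext E U k s t \<longleftrightarrow> length s < length t \<and> take (length s) t = s \<and>
     (\<exists>n\<ge>k. \<exists>l. E n l \<and> cone t \<subseteq> clop l) \<and> pos E U t"

text \<open>Every point of the limit superior in the cone of s lies in some longer cone contained in
  one of the sets with index at least k. There are countably many such cones, so if all of them met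
  the difference in a null set, s would not be positive.\<close>

lemma ex_good_ext:
  assumes "pos E U s"
  shows "\<exists>t. good_ext E U k s t"
proof (rule ccontr)
  assume no: "\<not> ?thesis"
  let ?R = "limsup_clop E - covered U"
  define T where "T = {t. length s < length t \<and> take (length s) t = s \<and> (\<exists>n\<ge>k. \<exists>l. E n l \<and> cone t \<subseteq> clop l)}"
  have null: "?R \<inter> cone t \<in> null_sets coin" if "t \<in> T" for t
    using no that unfolding good_ext_def pos_def T_def by (auto intro!: null_setsI)
  have "(\<Union>t\<in>T. ?R \<inter> cone t) \<in> null_sets coin"
    by (rule null_sets_UN') (use null in auto)
  moreover have "?R \<inter> cone s \<subseteq> (\<Union>t\<in>T. ?R \<inter> cone t)"
  proof
    fix x assume x: "x \<in> ?R \<inter> cone s"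
    then obtain n l r where r: "k \<le> n" "E n l" "r \<in> set l" "x \<in> cone r"
      unfolding limsup_clop_def clop_def by blast
    \<comment> \<open>At least as long as r, so that the cone of t is inside the cone of r, and
      strictly longer than s.\<close>
    define t where "t = map x [0..<max (length r) (Suc (length s))]"
    have "cone t \<subseteq> cone r" by (rule cone_mono[OF r(4)]) (simp_all add: t_def)
    then have "cone t \<subseteq> clop l" using r(3) by (auto simp: clop_def)
    moreover have "take (length s) t = s"
      using x mem_cone_iff[of x s] by (simp add: t_def take_map)
    ultimately have "t \<in> T" using r(1,2) by (auto simp: T_def t_def)
    then show "x \<in> (\<Union>t\<in>T. ?R \<inter> cone t)" using x by (intro UN_I[of t]) (auto simp: t_def)
  qed
  ultimately have "emeasure coin (?R \<inter> cone s) \<le> 0"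
    using emeasure_mono[of "?R \<inter> cone s" "\<Union>t\<in>T. ?R \<inter> cone t" coin] by (simp only: null_setsD1 null_setsD2)
  then show False using assms unfolding pos_def by simp
qed

primrec branch where
  "branch E U 0 = []"
| "branch E U (Suc k) = from_nat (LEAST j. good_ext E U k (branch E U k) (from_nat j))"

text \<open>The i-th coordinate is read at step i+1, by which time a positive branch has length
  greater than i.\<close>

definition point where
  "point E U i = branch E U (Suc i) ! i"

text \<open>Step k puts the point into some set with index at least k, hence into the limit
  superior. A cone of the cover through the point would contain the cone of a sufficiently long
  branch, and that branch could not be positive.\<close>

lemma point_limsup_not_covered:
  assumes "pos E U []"
  shows point_limsup: "point E U \<in> limsup_clop E" and point_not_covered: "point E U \<notin> covered U"
proof -
  have good: "good_ext E U k (branch E U k) (branch E U (Suc k))" if pos: "pos E U (branch E U k)" for k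
  proof -
    obtain t where "good_ext E U k (branch E U k) t"
      using ex_good_ext[OF pos, of k] by blast
    then have "good_ext E U k (branch E U k) (from_nat (to_nat t))" by simp
    from LeastI[of "\<lambda>j. good_ext E U k (branch E U k) (from_nat j)", OF this] show ?thesis by simp
  qed
  have p: "pos E U (branch E U k)" for k
  proof (induction k)
    case (Suc k)
    then show ?case using good[OF Suc] unfolding good_ext_def by blast
  qed (use assms in simp)
  note good = good[OF p]
  have len: "k \<le> length (branch E U k)" for k
  proof (induction k)
    case (Suc k)
    then show ?case using good[of k] unfolding good_ext_def by linarith
  qed simp
  have pre: "take (length (branch E U k)) (branch E U j) = branch E U k \<and> length (branch E U k) \<le> length (branch E U j)"
    if "k \<le> j" for k j
    using that
  proof (induction j rule: dec_induct)
    case (step j)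
    have "length (branch E U j) < length (branch E U (Suc j))"
      "take (length (branch E U j)) (branch E U (Suc j)) = branch E U j"
      using good[of j] unfolding good_ext_def by blast+
    then show ?case using step.IH
      by (metis less_imp_le min.absorb1 order_trans take_take)
  qed simp
  have nth: "branch E U j ! i = branch E U k ! i" if "i < length (branch E U k)" "i < length (branch E U j)" for i j k
    using pre[of k j] pre[of j k] that by (metis nat_le_linear nth_take)
  have mem: "point E U \<in> cone (branch E U k)" for k
    unfolding cone_def point_def mem_Collect_eq
  proof (intro allI impI)
    fix i assume i: "i < length (branch E U k)"
    have "i < length (branch E U (Suc i))" using len[of "Suc i"] by linarith
    then show "branch E U (Suc i) ! i = branch E U k ! i" using nth i by blast
  qed
  show "point E U \<in> limsup_clop E"
    unfolding limsup_clop_def mem_Collect_eq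
  proof
    fix m
    show "\<exists>n\<ge>m. \<exists>l. E n l \<and> point E U \<in> clop l"
      using good[of m] mem[of "Suc m"] unfolding good_ext_def by blast
  qed
  show "point E U \<notin> covered U"
  proof
    assume "point E U \<in> covered U"
    then obtain n s where s: "U n s" "point E U \<in> cone s" unfolding covered_def by blast
    have "cone (branch E U (length s)) \<subseteq> cone s" by (rule cone_mono[OF s(2) mem len])
    then have "cone (branch E U (length s)) \<subseteq> covered U" using s(1) by (auto simp: covered_def)
    then have "(limsup_clop E - covered U) \<inter> cone (branch E U (length s)) = {}" by blast
    then show False using p[of "length s"] by (simp add: pos_def)
  qed
qed

text \<open>By continuity from above the limit superior has measure at least \<epsilon>, and by
  continuity from below the cover has measure at most \<delta>; so the difference is not
  null.\<close>

lemma pos_Nil: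
  assumes E: "\<And>m. \<exists>n\<ge>m. \<exists>l. E n l \<and> \<epsilon> < measure coin (clop l)"
    and U: "\<And>n. \<exists>s. U n s" "\<And>n s s'. U n s \<Longrightarrow> U n s' \<Longrightarrow> s = s'"
    and sum: "\<And>ss. (\<forall>i<length ss. U i (ss ! i)) \<Longrightarrow> (\<Sum>s\<leftarrow>ss. (1/2) ^ length s) \<le> \<delta>"
    and "\<delta> < \<epsilon>"
  shows "pos E U []"
proof -
  define A where "A m = (\<Union>n\<in>{m..}. \<Union>l\<in>{l. E n l}. clop l)" for m
  have A_sets: "A m \<in> sets coin" for m unfolding A_def by measurable
  have lim: "limsup_clop E = (\<Inter>m. A m)"
    unfolding limsup_clop_def A_def by blast
  have "decseq A" unfolding A_def decseq_def by force
  then have "(\<lambda>m. measure coin (A m)) \<longlonglongrightarrow> measure coin (\<Inter>m. A m)"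
    using A_sets by (intro coin.finite_Lim_measure_decseq) auto
  moreover have "\<epsilon> \<le> measure coin (A m)" for m
  proof -
    obtain n l where "n \<ge> m" "E n l" "\<epsilon> < measure coin (clop l)" using E by blast
    moreover have "measure coin (clop l) \<le> measure coin (A m)" if "n \<ge> m" "E n l" for n
      using that by (intro coin.finite_measure_mono A_sets) (auto simp: A_def)
    ultimately show ?thesis by force
  qed
  ultimately have L: "\<epsilon> \<le> measure coin (limsup_clop E)"
    unfolding lim by (meson LIMSEQ_le_const)
  obtain u where u: "\<And>n. U n (u n)" using U(1) by metis
  define W where "W N = (\<Union>n<N. cone (u n))" for N
  have W: "covered U = (\<Union>N. W N)"
  proof
    show "covered U \<subseteq> (\<Union>N. W N)"
    proof
      fix x assume "x \<in> covered U"
      then obtain n s where s: "U n s" "x \<in> cone s" unfolding covered_def by blast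
      then have "x \<in> cone (u n)" using U(2) u by blast
      then have "x \<in> W (Suc n)" unfolding W_def by blast
      then show "x \<in> (\<Union>N. W N)" by blast
    qed
  qed (use u in \<open>auto simp: W_def covered_def\<close>)
  have W_sets: "W N \<in> sets coin" for N unfolding W_def by measurable
  have "incseq W" unfolding W_def incseq_def by force
  then have "(\<lambda>N. measure coin (W N)) \<longlonglongrightarrow> measure coin (\<Union>N. W N)"
    using W_sets by (intro coin.finite_Lim_measure_incseq) auto
  moreover have "measure coin (W N) \<le> \<delta>" for N
  proof -
    have "measure coin (W N) \<le> (\<Sum>n<N. measure coin (cone (u n)))"
      unfolding W_def by (rule coin.finite_measure_subadditive_finite) auto
    also have "\<dots> = (\<Sum>s\<leftarrow>map u [0..<N]. (1/2) ^ length s)"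
      by (simp add: measure_cone interv_sum_list_conv_sum_set_nat atLeast0LessThan comp_def)
    also have "\<dots> \<le> \<delta>" by (rule sum) (simp add: u)
    finally show ?thesis .
  qed
  ultimately have "measure coin (covered U) \<le> \<delta>"
    unfolding W by (meson LIMSEQ_le_const2)
  moreover have "measure coin (limsup_clop E) \<le>
      measure coin (limsup_clop E - covered U) + measure coin (covered U)"
    by (rule order_trans[OF coin.finite_measure_mono[of _ "(limsup_clop E - covered U) \<union> covered U"]
          measure_Un_le]) auto
  ultimately have "0 < measure coin (limsup_clop E - covered U)" using L \<open>\<delta> < \<epsilon>\<close> by linarith
  then show ?thesis unfolding pos_def by (simp add: coin.emeasure_eq_measure)
qed

section \<open>Measurability of the point in the truth values\<close>

abbreviation seq_atom :: "(nat \<times> bool list list + nat \<times> bool list \<Rightarrow> bool) \<Rightarrow> nat \<Rightarrow> bool list list \<Rightarrow> bool" where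
  "seq_atom y n l \<equiv> y (Inl (n, l))"

abbreviation cover_atom :: "(nat \<times> bool list list + nat \<times> bool list \<Rightarrow> bool) \<Rightarrow> nat \<Rightarrow> bool list \<Rightarrow> bool" where
  "cover_atom y n s \<equiv> y (Inr (n, s))"

text \<open>As part of Fubini's theorem, the measure of a section of a measurable set is a
  measurable function of the parameter.\<close>

lemma pred_pos [measurable]: "Measurable.pred bits (\<lambda>y. pos (seq_atom y) (cover_atom y) s)"
proof -
  define A where "A = {(y, x). x \<in> (limsup_clop (seq_atom y) - covered (cover_atom y)) \<inter> cone s}"
  have "Measurable.pred (bits \<Otimes>\<^sub>M coin) (\<lambda>(y, x). (\<forall>m. \<exists>n\<ge>m. \<exists>l. seq_atom y n l \<and> x \<in> clop l) \<and>
      \<not> (\<exists>n t. cover_atom y n t \<and> x \<in> cone t) \<and> x \<in> cone s)"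
    by measurable
  then have "A \<in> sets (bits \<Otimes>\<^sub>M coin)"
    unfolding A_def limsup_clop_def covered_def
    by (simp add: pred_def space_pair_measure space_PiM case_prod_beta' Collect_conj_eq)
  then have "(\<lambda>y. emeasure coin (Pair y -` A)) \<in> borel_measurable bits"
    by (rule coin.measurable_emeasure_Pair)
  moreover have "Pair y -` A = (limsup_clop (seq_atom y) - covered (cover_atom y)) \<inter> cone s" for y
    by (auto simp: A_def)
  ultimately show ?thesis unfolding pos_def by simp
qed

lemma measurable_branch [measurable]:
  "(\<lambda>y. branch (seq_atom y) (cover_atom y) k) \<in> measurable bits (count_space UNIV)"
proof (induction k)
  case (Suc k)
  have "(\<lambda>y. from_nat (LEAST j. good_ext (seq_atom y) (cover_atom y) k s (from_nat j)) :: bool list)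
      \<in> measurable bits (count_space UNIV)" for s
    unfolding good_ext_def by measurable
  from measurable_compose_countable[OF this Suc] show ?case by simp
qed simp

lemma pred_point [measurable]: "Measurable.pred bits (\<lambda>y. point (seq_atom y) (cover_atom y) i)"
proof -
  have "Measurable.pred bits (\<lambda>y. (\<lambda>s. s ! i) (branch (seq_atom y) (cover_atom y) (Suc i)))"
    by (rule measurable_compose[OF measurable_branch]) simp
  then show ?thesis unfolding point_def by simp
qed

definition tail_index :: "(nat \<Rightarrow> bool list list) \<Rightarrow> nat \<Rightarrow> nat" where
  "tail_index cs k = (LEAST m. \<forall>N. (\<Sum>n=m..<N. weight (cs n)) \<le> (1/2) ^ Suc k)"

definition tail_cover :: "(nat \<Rightarrow> bool list list) \<Rightarrow> nat \<Rightarrow> nat \<Rightarrow> bool list" where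
  "tail_cover cs k i = (if tail_index cs k \<le> fst (prod_decode i) \<and>
     snd (prod_decode i) < length (cs (fst (prod_decode i)))
     then cs (fst (prod_decode i)) ! snd (prod_decode i) else replicate (i + k + 2) False)"

lemma tail_index:
  assumes "\<And>N. (\<Sum>n<N. weight (cs n)) \<le> c"
  shows "(\<Sum>n=tail_index cs k..<N. weight (cs n)) \<le> (1/2) ^ Suc k"
proof -
  have "summable (\<lambda>n. weight (cs n))"
    by (rule summableI_nonneg_bounded[OF weight_nonneg assms])
  then obtain M where M: "\<And>m N. m \<ge> M \<Longrightarrow> norm (\<Sum>n=m..<N. weight (cs n)) < (1/2) ^ Suc k"
    unfolding summable_Cauchy by (metis half_gt_zero_iff zero_less_one zero_less_power)
  then have "\<forall>N. (\<Sum>n=M..<N. weight (cs n)) \<le> (1/2) ^ Suc k"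
    by (metis abs_le_D1 less_imp_le order_refl real_norm_def)
  then show ?thesis unfolding tail_index_def by (rule LeastI2) blast
qed

lemma tail_cover_covers:
  assumes "tail_index cs k \<le> n" "x \<in> clop (cs n)"
  shows "\<exists>i. x \<in> cone (tail_cover cs k i)"
proof -
  obtain j where "j < length (cs n)" "x \<in> cone (cs n ! j)"
    using assms(2) unfolding clop_def by (auto simp: in_set_conv_nth)
  then have "x \<in> cone (tail_cover cs k (prod_encode (n, j)))" using assms(1) by (simp add: tail_cover_def)
  then show ?thesis by blast
qed

lemma tail_cover_sum:
  assumes "\<And>N. (\<Sum>n<N. weight (cs n)) \<le> c"
  shows "(\<Sum>i<N. (1/2) ^ length (tail_cover cs k i)) \<le> ((1/2) ^ k :: real)"
proof -
  let ?P = "\<lambda>i. tail_index cs k \<le> fst (prod_decode i) \<and>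
     snd (prod_decode i) < length (cs (fst (prod_decode i)))"
  let ?f = "\<lambda>(n, j). (1/2) ^ length (cs n ! j) :: real"
  let ?S = "SIGMA n:{tail_index cs k..<N}. {..<length (cs n)}"
  have "(\<Sum>i<N. (1/2) ^ length (tail_cover cs k i)) \<le>
      (\<Sum>i<N. (if ?P i then ?f (prod_decode i) else 0) + (1/2) ^ (i + k + 2) :: real)"
    by (rule sum_mono) (auto simp: tail_cover_def case_prod_beta)
  also have "\<dots> = (\<Sum>i\<in>{i\<in>{..<N}. ?P i}. ?f (prod_decode i)) + (\<Sum>i<N. (1/2) ^ (i + k + 2))"
    by (simp only: sum.distrib sum.inter_filter[OF finite_lessThan])
  also have "(\<Sum>i\<in>{i\<in>{..<N}. ?P i}. ?f (prod_decode i)) = sum ?f (prod_decode ` {i\<in>{..<N}. ?P i})"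
    by (subst sum.reindex) (auto intro: inj_on_subset[OF inj_prod_decode])
  also have "\<dots> \<le> sum ?f ?S"
  proof (rule sum_mono2)
    \<comment> \<open>Since the first component of a pair is at most its code, the first N places
      only involve lists with index below N.\<close>
    have le: "fst (prod_decode i) \<le> i" for i by (metis le_prod_encode_1 prod.collapse prod_decode_inverse)
    show "prod_decode ` {i\<in>{..<N}. ?P i} \<subseteq> ?S"
    proof (intro image_subsetI)
      fix i assume "i \<in> {i\<in>{..<N}. ?P i}"
      then show "prod_decode i \<in> ?S" using le_less_trans[OF le[of i], of N] by (cases "prod_decode i") auto
    qed
  qed auto
  also have "sum ?f ?S = (\<Sum>n=tail_index cs k..<N. \<Sum>j<length (cs n). (1/2) ^ length (cs n ! j))"
    by (subst sum.Sigma) auto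
  also have "\<dots> = (\<Sum>n=tail_index cs k..<N. weight (cs n))"
    by (simp add: weight_def sum_list_sum_nth atLeast0LessThan)
  also have "\<dots> \<le> (1/2) ^ Suc k" by (rule tail_index[OF assms])
  also have "(\<Sum>i<N. (1/2) ^ (i + k + 2) :: real) = (1/2) ^ (k + 2) * (\<Sum>i<N. (1/2) ^ i)"
    by (simp add: power_add sum_distrib_left mult_ac)
  also have "(\<Sum>i<N. (1/2) ^ i :: real) \<le> 2"
  proof -
    have "(\<Sum>i<N. (1/2) ^ i :: real) = 2 - 2 * (1/2) ^ N" by (induction N) auto
    then show ?thesis by simp
  qed
  finally show ?thesis by simp
qed

lemma measurable_tail_cover:
  assumes [measurable]: "\<And>n. (\<lambda>y. cs y n) \<in> measurable M (count_space UNIV)"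
  shows "(\<lambda>y. tail_cover (cs y) k i) \<in> measurable M (count_space UNIV)"
proof -
  have [measurable]: "(\<lambda>y. weight (cs y n)) \<in> borel_measurable M" for n
    by (rule measurable_compose[OF assms]) simp
  have [measurable]: "(\<lambda>y. tail_index (cs y) k) \<in> measurable M (count_space UNIV)"
    unfolding tail_index_def by measurable
  let ?g = "\<lambda>m l. if m \<le> fst (prod_decode i) \<and> snd (prod_decode i) < length l
     then l ! snd (prod_decode i) else replicate (i + k + 2) False"
  have "(\<lambda>y. ?g m (cs y (fst (prod_decode i)))) \<in> measurable M (count_space UNIV)" for m
    by (rule measurable_compose[OF assms]) simp
  from measurable_compose_countable[OF this, of "\<lambda>y. tail_index (cs y) k"] show ?thesis
    unfolding tail_cover_def by simp
qed

lemma measurable_map_upt: "(\<lambda>y. map y [0..<n]) \<in> measurable bits (count_space UNIV)" for n :: nat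
proof (induction n)
  case (Suc n)
  have "(\<lambda>y. xs @ [y n]) \<in> measurable bits (count_space UNIV)" for xs :: "bool list"
    by (rule measurable_compose[of "\<lambda>y. y n" bits "count_space UNIV"]) simp_all
  from measurable_compose_countable[OF this Suc] show ?case by simp
qed simp

subsection \<open>Sequences of clopen sets\<close>

context forcing_order
begin

abbreviation gmem :: "'a \<Rightarrow> ('a, 'p) name \<Rightarrow> 'p sentence" where
  "gmem \<equiv> f_mem le f_geq"

abbreviation real_eq :: "'p real_name \<Rightarrow> 'p real_name \<Rightarrow> 'p sentence" where
  "real_eq \<equiv> f_set_eq le f_geq"

abbreviation rmem :: "'p real_name \<Rightarrow> 'p set_name \<Rightarrow> 'p sentence" where
  "rmem \<equiv> f_mem le (f_set_eq le f_geq)"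

lemma agree_gmem: "f_set_eq le f_geq a b p \<Longrightarrow> agree p (gmem i a) (gmem i b)"
  unfolding agree_def set_eq_iff[OF equality_geq] by blast

lemma agree_prefix: "real_eq x y p \<Longrightarrow> agree p (f_prefix le s x) (f_prefix le s y)"
  unfolding f_prefix_def by (intro agree_all agree_imp agree_iff agree_refl agree_gmem)

lemma agree_in_clopen: "real_eq x y p \<Longrightarrow> agree p (f_in_clopen le x C) (f_in_clopen le y C)"
  unfolding f_in_clopen_def by (intro agree_ex agree_and agree_refl agree_prefix)

lemma agree_in_nth_real: "real_eq x y p \<Longrightarrow> agree p (f_in_nth le x c n) (f_in_nth le y c n)"
  unfolding f_in_nth_def by (intro agree_ex agree_and agree_refl agree_in_clopen)

lemma agree_in_nth_seq: "f_set_eq le f_geq c d p \<Longrightarrow> agree p (f_in_nth le x c n) (f_in_nth le x d n)"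
  unfolding f_in_nth_def by (intro agree_ex agree_and agree_refl agree_gmem)

lemma regular_prefix: "regular (f_prefix le s x)"
  unfolding f_prefix_def by (intro regular_intros)

lemma regular_in_clopen: "regular (f_in_clopen le x C)"
  unfolding f_in_clopen_def by (intro regular_intros regular_prefix)

lemma regular_in_nth: "regular (f_in_nth le x c n)"
  unfolding f_in_nth_def by (intro regular_intros regular_in_clopen)

lemma regular_function: "regular (f_function le f B)"
  unfolding f_function_def by (intro regular_intros)

lemma regular_null: "regular (f_null le X)"
  unfolding f_null_def by (intro regular_intros regular_function regular_prefix)

lemma regular_Omega_bar: "regular (f_Omega_bar le c)"
  unfolding f_Omega_bar_def f_clopen_seq_def by (intro regular_intros regular_function regular_null)

lemma function_iff:
  "f_function le f B p \<longleftrightarrow>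
     (\<forall>n q. le q p \<longrightarrow> (\<exists>r. le r q \<and> (\<exists>b. gmem (n, b) f r))) \<and>
     (\<forall>n b q. le q p \<longrightarrow> gmem (n, b) f q \<longrightarrow> b \<in> B) \<and>
     (\<forall>n b b' q. le q p \<longrightarrow> gmem (n, b) f q \<longrightarrow> gmem (n, b') f q \<longrightarrow> b = b')"
  unfolding f_function_def imp_iff[OF regular_mem regular_ground]
    imp_iff[OF regular_and[OF regular_mem regular_mem] regular_geq]
  unfolding and_iff all_iff ex_iff ground_iff geq_iff
  by (simp only: imp_conjL)

lemma clopen_seq_range:
  assumes "f_clopen_seq le d p" "le q p" "gmem (n, C) d q"
  shows "open C" "closed C"
proof -
  have "C \<in> {C. open C \<and> closed C}"
    using assms(1)[unfolded f_clopen_seq_def function_iff, THEN conjunct2, THEN conjunct1] assms(2,3) by blast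
  then show "open C" "closed C" by auto
qed

lemma clopen_seq_total:
  assumes "f_clopen_seq le d p" "le q p"
  obtains r l where "le r q" "gmem (n, clop l) d r"
proof -
  obtain r C where r: "le r q" "gmem (n, C) d r"
    using assms(1)[unfolded f_clopen_seq_def function_iff, THEN conjunct1] assms(2) by blast
  have "le r p" using r(1) assms(2) le_trans by blast
  then have "open C" "closed C" using clopen_seq_range[OF assms(1) _ r(2)] by blast+
  then show ?thesis using clopen_eq_clop[of C] r that by metis
qed

text \<open>\<open>f_in_nth\<close> quantifies over all sets C, an uncountable type, for which the
  existential quantifier has no representation lemma. Quantifying over codes is equivalent for
  sequences of clopen sets.\<close>

definition in_nth_list :: "'p real_name \<Rightarrow> 'p clopen_seq_name \<Rightarrow> nat \<Rightarrow> 'p sentence" where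
  "in_nth_list x d n = f_ex le (\<lambda>l. gmem (n, clop l) d \<^bold>\<and> f_in_clopen le x (clop l))"

lemma in_nth_of_list: "in_nth_list x d n p \<Longrightarrow> f_in_nth le x d n p"
  unfolding in_nth_list_def f_in_nth_def ex_iff by blast

lemma in_nth_list_iff:
  assumes "f_clopen_seq le d p"
  shows "in_nth_list x d n p \<longleftrightarrow> f_in_nth le x d n p"
proof
  assume "f_in_nth le x d n p"
  then show "in_nth_list x d n p"
    unfolding in_nth_list_def f_in_nth_def ex_iff and_iff
  proof (intro allI impI)
    fix q assume *: "\<forall>q. le q p \<longrightarrow> (\<exists>r. le r q \<and> (\<exists>C. gmem (n, C) d r \<and> f_in_clopen le x C r))" "le q p"
    then obtain r C where r: "le r q" "gmem (n, C) d r" "f_in_clopen le x C r" by blast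
    have "le r p" using r(1) *(2) le_trans by blast
    then have "open C" "closed C" using clopen_seq_range[OF assms _ r(2)] by blast+
    then obtain l where "clop l = C" using clopen_eq_clop by metis
    then show "\<exists>r. le r q \<and> (\<exists>l. gmem (n, clop l) d r \<and> f_in_clopen le x (clop l) r)" using r by blast
  qed
qed (rule in_nth_of_list)

definition inf_often :: "'p real_name \<Rightarrow> 'p clopen_seq_name \<Rightarrow> 'p sentence" where
  "inf_often x c = f_all (\<lambda>m. f_ex le (\<lambda>n. f_ground (m \<le> n) \<^bold>\<and> f_in_nth le x c n))"

lemma regular_inf_often: "regular (inf_often x c)"
  unfolding inf_often_def by (intro regular_intros regular_in_nth)

lemma agree_inf_often_real: "real_eq x y p \<Longrightarrow> agree p (inf_often x c) (inf_often y c)"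
  unfolding inf_often_def by (intro agree_all agree_ex agree_and agree_refl agree_in_nth_real)

lemma agree_inf_often_seq: "f_set_eq le f_geq c d p \<Longrightarrow> agree p (inf_often x c) (inf_often x d)"
  unfolding inf_often_def by (intro agree_all agree_ex agree_and agree_refl agree_in_nth_seq)

lemma mem_N: "le p p \<Longrightarrow> rmem x (f_N le c) p \<longleftrightarrow> inf_often x c p"
  unfolding f_N_def inf_often_def[symmetric]
  by (rule mem_compr[OF equality_real regular_inf_often]) (auto dest!: agree_inf_often_real agreeD)

lemma agree_N:
  assumes "f_set_eq le f_geq c d p"
  shows "agree p (rmem x (f_N le c)) (rmem x (f_N le d))"
  unfolding f_N_def inf_often_def[symmetric]
  by (intro agree_compr agree_inf_often_seq assms regular_inf_often)

lemma agree_function: "f_set_eq le f_geq f g p \<Longrightarrow> agree p (f_function le f B) (f_function le g B)"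
  unfolding f_function_def by (intro agree_and agree_all agree_ex agree_imp agree_refl agree_gmem)

lemma agree_Omega_bar:
  "f_set_eq le f_geq c d p \<Longrightarrow> agree p (f_Omega_bar le c) (f_Omega_bar le d)"
  unfolding f_Omega_bar_def f_clopen_seq_def f_null_def
  by (intro agree_and agree_function agree_all agree_ex agree_imp agree_refl agree_N)

section \<open>Null sets in the extension\<close>

definition f_covers :: "(nat \<times> bool list, 'p) name \<Rightarrow> 'p real_name \<Rightarrow> 'p sentence" where
  "f_covers u x = f_ex le (\<lambda>n. f_ex le (\<lambda>s. gmem (n, s) u \<^bold>\<and> f_prefix le s x))"

definition f_sum_le :: "(nat \<times> bool list, 'p) name \<Rightarrow> nat \<Rightarrow> 'p sentence" where
  "f_sum_le u k = f_all (\<lambda>ss. f_imp le (f_all (\<lambda>i. f_imp le (f_ground (i < length ss)) (gmem (i, ss ! i) u)))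
     (f_ground ((\<Sum>s\<leftarrow>ss. (1/2) ^ length s) \<le> ((1/2) ^ k :: real))))"

lemma regular_covers: "regular (f_covers u x)"
  unfolding f_covers_def by (intro regular_intros regular_prefix)

lemma null_iff:
  "f_null le X p \<longleftrightarrow> (\<forall>k q. le q p \<longrightarrow> (\<exists>r u. le r q \<and> f_function le u UNIV r \<and>
     (\<forall>x t. le t r \<longrightarrow> rmem x X t \<longrightarrow> f_covers u x t) \<and> f_sum_le u k r))"
proof -
  have "f_null le X p \<longleftrightarrow> (\<forall>k. f_ex le (\<lambda>u. f_function le u UNIV \<^bold>\<and>
      f_all (\<lambda>x. f_imp le (rmem x X) (f_covers u x)) \<^bold>\<and> f_sum_le u k) p)"
    unfolding f_null_def f_covers_def f_sum_le_def all_iff ..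
  then show ?thesis
    unfolding imp_iff[OF regular_mem regular_covers] ex_iff and_iff all_iff by blast
qed

lemma represents_covers:
  assumes "\<And>i. represents \<theta> (gmem i x) (X i)" "\<And>n s. represents \<theta> (gmem (n, s) u) (U n s)"
  shows "represents \<theta> (f_covers u x) (\<lambda>y. (\<lambda>i. X i y) \<in> covered (\<lambda>n s. U n s y))"
proof -
  have "represents \<theta> (f_covers u x) (\<lambda>y. \<exists>n s. U n s y \<and> (\<forall>i<length s. X i y \<longleftrightarrow> s ! i))"
    unfolding f_covers_def by (intro represents_intros represents_prefix assms)
  then show ?thesis by (simp add: covered_def cone_def)
qed

lemma represents_geq: "represents \<theta> (f_geq a b) (\<lambda>_. a = b)"
  unfolding f_geq_def by (rule represents_ground)

lemma represents_function:
  fixes f :: "(nat \<times> 'b::countable, 'p) name"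
  assumes "\<And>n b. represents \<theta> (gmem (n, b) f) (F n b)"
  shows "represents \<theta> (f_function le f UNIV)
    (\<lambda>y. (\<forall>n. \<exists>b. F n b y) \<and> (\<forall>n b b'. F n b y \<and> F n b' y \<longrightarrow> b = b'))"
proof -
  have "represents \<theta> (f_function le f UNIV)
    (\<lambda>y. (\<forall>n. \<exists>b. F n b y) \<and> (\<forall>n b. F n b y \<longrightarrow> b \<in> UNIV) \<and> (\<forall>n b b'. F n b y \<and> F n b' y \<longrightarrow> b = b'))"
    unfolding f_function_def by (intro represents_intros represents_geq assms)
  then show ?thesis by simp
qed

lemma represents_sum_le:
  assumes "\<And>n s. represents \<theta> (gmem (n, s) u) (U n s)"
  shows "represents \<theta> (f_sum_le u k) (\<lambda>y. \<forall>ss. (\<forall>i. i < length ss \<longrightarrow> U i (ss ! i) y) \<longrightarrow>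
    (\<Sum>s\<leftarrow>ss. (1/2) ^ length s) \<le> ((1/2) ^ k :: real))"
  unfolding f_sum_le_def by (intro represents_intros assms)

text \<open>The point constructed from a sequence and a cover is itself a name, and the ground model
  facts about it transfer. The atoms e are arbitrary sentences so that both a given sequence and the
  constant sequence of the whole space can be inserted.\<close>

lemma avoid_cover:
  fixes e :: "nat \<Rightarrow> bool list list \<Rightarrow> 'p sentence"
  assumes p: "le p p" and reg: "\<And>n l. regular (e n l)"
    and u: "f_function le u UNIV p" "f_sum_le u (Suc k) p"
    and e: "f_all (\<lambda>m. f_ex le (\<lambda>n. f_ex le (\<lambda>l.
      f_ground (m \<le> n \<and> (1/2) ^ k < measure coin (clop l)) \<^bold>\<and> e n l))) p"
  obtains x where "f_all (\<lambda>m. f_ex le (\<lambda>n. f_ex le (\<lambda>l.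
      f_ground (m \<le> n) \<^bold>\<and> e n l \<^bold>\<and> f_in_clopen le x (clop l)))) p" "f_not le (f_covers u x) p"
proof -
  define \<theta> where "\<theta> i = (case i of Inl (n, l) \<Rightarrow> e n l | Inr (n, s) \<Rightarrow> gmem (n, s) u)" for i
  have "regular (\<theta> i)" for i using reg by (auto simp: \<theta>_def split: sum.splits)
  from ex_name[of \<theta> "\<lambda>i y. point (seq_atom y) (cover_atom y) i", OF this pred_point]
  obtain x where x: "\<And>i. represents \<theta> (gmem i x) (\<lambda>y. point (seq_atom y) (cover_atom y) i)" by blast
  have re: "represents \<theta> (e n l) (\<lambda>y. seq_atom y n l)" for n l
    using represents_atom[of \<theta> "Inl (n, l)"] reg by (simp add: \<theta>_def)
  have ru: "represents \<theta> (gmem (n, s) u) (\<lambda>y. cover_atom y n s)" for n s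
    using represents_atom[of \<theta> "Inr (n, s)"] by (simp add: \<theta>_def)
  have hyp: "represents \<theta> ((f_all (\<lambda>m. f_ex le (\<lambda>n. f_ex le (\<lambda>l.
      f_ground (m \<le> n \<and> (1/2) ^ k < measure coin (clop l)) \<^bold>\<and> e n l)))) \<^bold>\<and>
      f_function le u UNIV \<^bold>\<and> f_sum_le u (Suc k))
    (\<lambda>y. (\<forall>m. \<exists>n l. (m \<le> n \<and> (1/2) ^ k < measure coin (clop l)) \<and> seq_atom y n l) \<and>
      ((\<forall>n. \<exists>b. cover_atom y n b) \<and> (\<forall>n b b'. cover_atom y n b \<and> cover_atom y n b' \<longrightarrow> b = b')) \<and>
      (\<forall>ss. (\<forall>i. i < length ss \<longrightarrow> cover_atom y i (ss ! i)) \<longrightarrow>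
        (\<Sum>s\<leftarrow>ss. (1/2) ^ length s) \<le> ((1/2) ^ Suc k :: real)))"
    by (intro represents_intros represents_function represents_sum_le re ru)
  have conc: "represents \<theta> (f_all (\<lambda>m. f_ex le (\<lambda>n. f_ex le (\<lambda>l.
      f_ground (m \<le> n) \<^bold>\<and> e n l \<^bold>\<and> f_in_clopen le x (clop l)))) \<^bold>\<and> f_not le (f_covers u x))
    (\<lambda>y. (\<forall>m. \<exists>n l. m \<le> n \<and> seq_atom y n l \<and> (\<exists>s. cone s \<subseteq> clop l \<and> (\<lambda>i. point (seq_atom y) (cover_atom y) i) \<in> cone s)) \<and>
      \<not> (\<lambda>i. point (seq_atom y) (cover_atom y) i) \<in> covered (\<lambda>n s. cover_atom y n s))"
    by (intro represents_intros represents_in_clopen represents_covers x re ru)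
  have "(f_all (\<lambda>m. f_ex le (\<lambda>n. f_ex le (\<lambda>l.
      f_ground (m \<le> n) \<^bold>\<and> e n l \<^bold>\<and> f_in_clopen le x (clop l)))) \<^bold>\<and> f_not le (f_covers u x)) p"
  proof (rule transfer[OF hyp conc _ _ p], goal_cases)
    case (1 y)
    have "pos (seq_atom y) (cover_atom y) []"
    proof (rule pos_Nil[where \<epsilon> = "(1/2) ^ k" and \<delta> = "(1/2) ^ Suc k"])
      show "\<exists>n\<ge>m. \<exists>l. seq_atom y n l \<and> (1/2) ^ k < measure coin (clop l)" for m
        using 1[THEN conjunct1, rule_format, of m] by blast
      show "\<exists>s. cover_atom y n s" for n
        using 1[THEN conjunct2, THEN conjunct1, THEN conjunct1] by blast
      show "s = s'" if "cover_atom y n s" "cover_atom y n s'" for n s s'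
        using 1[THEN conjunct2, THEN conjunct1, THEN conjunct2] that by blast
      show "(\<Sum>s\<leftarrow>ss. (1/2) ^ length s) \<le> ((1/2) ^ Suc k :: real)" if "\<forall>i<length ss. cover_atom y i (ss ! i)" for ss
        using 1[THEN conjunct2, THEN conjunct2] that by blast
    qed simp
    from point_limsup[OF this] point_not_covered[OF this] show ?case
      unfolding ex_cone_iff limsup_clop_def by blast
  next
    case 2
    then show ?case using e u by (simp add: and_iff)
  qed
  then show ?thesis using that unfolding and_iff by blast
qed

text \<open>The measures converge to 0: if sets of measure greater than 2^-k occurred infinitely
  often, the limit superior could not be covered by cones of total measure 2^-(k+1).\<close>

lemma Omega_bar_small:
  assumes d: "f_Omega_bar le d p" and q: "le q p"
  obtains r m where "le r q"
    "\<And>n l t. m \<le> n \<Longrightarrow> le t r \<Longrightarrow> gmem (n, clop l) d t \<Longrightarrow> measure coin (clop l) \<le> (1/2) ^ k"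
proof -
  define E where "E m = f_ex le (\<lambda>n. f_ex le (\<lambda>l.
      f_ground (m \<le> n \<and> (1/2) ^ k < measure coin (clop l)) \<^bold>\<and> gmem (n, clop l) d))" for m
  have regE: "regular (E m)" for m unfolding E_def by (intro regular_intros)
  obtain r where r: "le r q" "f_all E r \<or> f_not le (f_all E) r" using decide le_left[OF q] by metis
  have "\<not> f_all E r"
  proof
    assume all: "f_all E r"
    have "le r p" using r(1) q le_trans by blast
    then obtain t u where t: "le t r" "f_function le u UNIV t" "f_sum_le u (Suc k) t"
        and cov: "\<And>x t'. le t' t \<Longrightarrow> rmem x (f_N le d) t' \<Longrightarrow> f_covers u x t'"
      using d unfolding f_Omega_bar_def and_iff null_iff by metis
    have tt: "le t t" using t(1) le_left by blast
    have "f_all E t" using all t(1) regE regular_all regular_mono by blast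
    then obtain x where x: "f_all (\<lambda>m. f_ex le (\<lambda>n. f_ex le (\<lambda>l.
        f_ground (m \<le> n) \<^bold>\<and> gmem (n, clop l) d \<^bold>\<and> f_in_clopen le x (clop l)))) t" "f_not le (f_covers u x) t"
      using avoid_cover[of t "\<lambda>n l. gmem (n, clop l) d" u k, OF tt regular_mem t(2,3)] unfolding E_def by blast
    have "inf_often x d t"
      unfolding inf_often_def all_iff ex_iff and_iff ground_iff
    proof (intro allI impI)
      fix m q assume q: "le q t"
      obtain r n where r: "le r q" "f_ex le (\<lambda>l. f_ground (m \<le> n) \<^bold>\<and> gmem (n, clop l) d \<^bold>\<and> f_in_clopen le x (clop l)) r"
        using x(1)[unfolded all_iff, rule_format, of m] q unfolding ex_iff[of "\<lambda>n. f_ex le (F n)" for F] by blast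
      then obtain r' l where r': "le r' r" "m \<le> n" "gmem (n, clop l) d r'" "f_in_clopen le x (clop l) r'"
        using le_left[OF r(1)] unfolding ex_iff and_iff ground_iff by blast
      have "f_in_nth le x d n r'"
        unfolding f_in_nth_def
        by (rule exI_forced[of _ "clop l"]) (use r' in \<open>auto simp: and_iff intro!: regular_and regular_in_clopen\<close>)
      then show "\<exists>r. le r q \<and> (\<exists>n. m \<le> n \<and> f_in_nth le x d n r)" using r' r(1) le_trans by blast
    qed
    then have "f_covers u x t" using cov[OF tt] mem_N[OF tt] by blast
    then show False using x(2) tt unfolding not_iff by blast
  qed
  then have "f_not le (f_all E) r" using r by blast
  then obtain m where "\<not> E m r" using le_left[OF r(1)] unfolding not_iff all_iff by blast
  then obtain t where t: "le t r" "f_not le (E m) t"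
    using not_forced[OF regE] le_left[OF r(1)] by metis
  have "measure coin (clop l) \<le> (1/2) ^ k" if n: "m \<le> n" and t': "le t' t" "gmem (n, clop l) d t'" for n l t'
  proof (rule ccontr)
    assume "\<not> ?thesis"
    then have "E m t'"
      unfolding E_def
      by (intro exI_forced[of _ n] exI_forced[of _ l] regular_intros) (use n t' in \<open>auto simp: and_iff ground_iff\<close>)
    then show False using t(2) t'(1) unfolding not_iff by blast
  qed
  then show ?thesis using that[of t m] t(1) r(1) le_trans by blast
qed

text \<open>The whole space is not null in the extension. Applied to the constant sequence of the
  whole space, coded by \<open>[[]]\<close>, \<open>avoid_cover\<close> gives a point outside a
  cover of total measure at most 1/4.\<close>

lemma ex_not_in_N:
  assumes d: "f_Omega_bar le d p" and p: "le p p"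
  obtains r x where "le r p" "\<And>t. le t r \<Longrightarrow> \<not> rmem x (f_N le d) t"
proof -
  obtain t u where t: "le t p" "f_function le u UNIV t" "f_sum_le u (Suc 1) t"
      and cov: "\<And>x t'. le t' t \<Longrightarrow> rmem x (f_N le d) t' \<Longrightarrow> f_covers u x t'"
    using d p unfolding f_Omega_bar_def and_iff null_iff by metis
  have tt: "le t t" using t(1) le_left by blast
  have one: "measure coin (clop [[]]) = 1" by (simp add: clop_def measure_cone flip: cone_Nil)
  have "f_all (\<lambda>m :: nat. f_ex le (\<lambda>n. f_ex le (\<lambda>l.
      f_ground (m \<le> n \<and> (1/2) ^ 1 < measure coin (clop l)) \<^bold>\<and> f_ground (l = [[]])))) t"
    unfolding all_iff
  proof (intro allI)
    fix m :: nat
    show "f_ex le (\<lambda>n. f_ex le (\<lambda>l.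
        f_ground (m \<le> n \<and> (1/2) ^ 1 < measure coin (clop l)) \<^bold>\<and> f_ground (l = [[]]))) t"
      by (rule exI_forced[of _ m], intro regular_intros, rule exI_forced[of _ "[[]]"], intro regular_intros)
        (simp add: and_iff ground_iff one)
  qed
  then obtain x where "f_not le (f_covers u x) t"
    using avoid_cover[of t "\<lambda>n l. f_ground (l = [[]])" u 1, OF tt regular_ground t(2,3)] by blast
  then show ?thesis using that[of t x] t(1) cov unfolding not_iff by blast
qed

lemma summable_Omega_bar:
  fixes \<theta> :: "'i \<Rightarrow> 'p sentence" and cs :: "('i \<Rightarrow> bool) \<Rightarrow> nat \<Rightarrow> bool list list"
  assumes reg: "\<And>i. regular (\<theta> i)"
    and cs [measurable]: "\<And>n. (\<lambda>y. cs y n) \<in> measurable bits (count_space UNIV)"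
    and sum: "\<And>y N. (\<Sum>n<N. weight (cs y n)) \<le> 2"
    and c: "\<And>n C. represents \<theta> (gmem (n, C) c) (\<lambda>y. clop (cs y n) = C)"
    and p: "le p p"
  shows "f_Omega_bar le c p"
proof -
  have seq: "f_clopen_seq le c q" if "le q q" for q
    unfolding f_clopen_seq_def function_iff
  proof (intro conjI allI impI)
    fix n q' assume q': "le q' q"
    have "represents \<theta> (f_ex le (\<lambda>l. gmem (n, clop l) c)) (\<lambda>y. \<exists>l. clop (cs y n) = clop l)"
      by (intro represents_intros c)
    from transfer_valid[OF this _ le_left[OF q']] have "f_ex le (\<lambda>l. gmem (n, clop l) c) q'" by blast
    then show "\<exists>r. le r q' \<and> (\<exists>b. gmem (n, b) c r)" using le_left[OF q'] unfolding ex_iff by blast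
  next
    fix n C q' assume q': "le q' q" "gmem (n, C) c q'"
    have "f_ground (C \<in> {C. open C \<and> closed C}) q'"
      by (rule transfer[OF c represents_ground _ q'(2) le_left[OF q'(1)]]) (auto simp: open_clop closed_clop)
    then show "C \<in> {C. open C \<and> closed C}" by (simp add: ground_iff)
  next
    fix n C C' q' assume q': "le q' q" "gmem (n, C) c q'" "gmem (n, C') c q'"
    have "f_ground (C = C') q'"
      by (rule transfer[OF represents_and[OF c[of n C] c[of n C']] represents_ground _ _ le_left[OF q'(1)]])
        (use q' in \<open>auto simp: and_iff\<close>)
    then show "C = C'" by (simp add: ground_iff)
  qed
  have "f_null le (f_N le c) p"
    unfolding null_iff
  proof (intro allI impI)
    fix k q assume q: "le q p"
    have qq: "le q q" using q le_left by blast
    have "Measurable.pred bits (\<lambda>y. tail_cover (cs y) k n = s)" for n s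
      using measurable_tail_cover[OF cs, where k = k and i = n] by measurable
    then obtain u :: "(nat \<times> bool list, 'p) name"
      where u: "\<And>b. represents \<theta> (gmem b u) (\<lambda>y. tail_cover (cs y) k (fst b) = snd b)"
      using ex_name[of \<theta> "\<lambda>b y. tail_cover (cs y) k (fst b) = snd b", OF reg] by blast
    have u': "represents \<theta> (gmem (n, s) u) (\<lambda>y. tail_cover (cs y) k n = s)" for n s
      using u[of "(n, s)"] by simp
    have "f_function le u UNIV q"
      by (rule transfer_valid[OF represents_function[OF u'] _ qq]) auto
    moreover have "f_sum_le u k q"
    proof (rule transfer_valid[OF represents_sum_le[OF u'] _ qq], intro allI impI)
      fix y ss assume ss: "\<forall>i<length ss. tail_cover (cs y) k i = ss ! i"
      have "(\<Sum>s\<leftarrow>ss. (1/2) ^ length s) = (\<Sum>i<length ss. (1/2) ^ length (tail_cover (cs y) k i) :: real)"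
        using ss by (simp add: sum_list_sum_nth atLeast0LessThan)
      also have "\<dots> \<le> (1/2) ^ k" by (rule tail_cover_sum[OF sum])
      finally show "(\<Sum>s\<leftarrow>ss. (1/2) ^ length s) \<le> ((1/2) ^ k :: real)" .
    qed
    moreover have "f_covers u x t" if t: "le t q" "rmem x (f_N le c) t" for x t
    proof -
      have tt: "le t t" using t(1) le_left by blast
      \<comment> \<open>The point x is an arbitrary name, unrelated to the given atoms; its bits are
        adjoined as further atoms, and the previous representations are reindexed.\<close>
      define \<theta>' where "\<theta>' i = (case i of Inl j \<Rightarrow> \<theta> j | Inr n \<Rightarrow> gmem n x)" for i
      have x': "represents \<theta>' (gmem n x) (\<lambda>y. y (Inr n))" for n
        using represents_atom[of \<theta>' "Inr n"] by (simp add: \<theta>'_def)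
      have c': "represents \<theta>' (gmem (n, C) c) (\<lambda>y. clop (cs (\<lambda>i. y (Inl i)) n) = C)" for n C
        using represents_reindex[of \<theta>' Inl "gmem (n, C) c"] c[of n C] by (simp add: \<theta>'_def)
      have u'': "represents \<theta>' (gmem (n, s) u) (\<lambda>y. tail_cover (cs (\<lambda>i. y (Inl i))) k n = s)" for n s
        using represents_reindex[of \<theta>' Inl "gmem (n, s) u"] u'[of n s] by (simp add: \<theta>'_def)
      have hyp: "represents \<theta>' (f_all (\<lambda>m. f_ex le (\<lambda>n. f_ground (m \<le> n) \<^bold>\<and> in_nth_list x c n)))
          (\<lambda>y. \<forall>m. \<exists>n. m \<le> n \<and> (\<exists>l. clop (cs (\<lambda>i. y (Inl i)) n) = clop l \<and>
            (\<exists>s. cone s \<subseteq> clop l \<and> (\<lambda>i. y (Inr i)) \<in> cone s)))"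
        unfolding in_nth_list_def by (intro represents_intros represents_in_clopen x' c')
      show ?thesis
      proof (rule transfer[OF hyp represents_covers[OF x' u''] _ _ tt], goal_cases)
        case (1 y)
        then obtain n where n: "tail_index (cs (\<lambda>i. y (Inl i))) k \<le> n"
          "(\<lambda>i. y (Inr i)) \<in> clop (cs (\<lambda>i. y (Inl i)) n)"
          unfolding ex_cone_iff by metis
        from tail_cover_covers[OF this] show ?case unfolding covered_def by blast
      next
        case 2
        have "inf_often x c t" using t(2) mem_N[OF tt] by blast
        then show ?case
          unfolding inf_often_def all_iff ex_iff and_iff
          using in_nth_list_iff[OF seq[OF le_left]] le_trans by meson
      qed
    qed
    ultimately show "\<exists>r u. le r q \<and> f_function le u UNIV r \<and>
        (\<forall>x t. le t r \<longrightarrow> rmem x (f_N le c) t \<longrightarrow> f_covers u x t) \<and> f_sum_le u k r"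
      using qq by blast
  qed
  then show ?thesis using seq[OF p] unfolding f_Omega_bar_def and_iff by blast
qed

text \<open>The entries are the cones of the initial segments of x, with total weight at most 2.
  This sequence witnesses that no member of a scale is largest: its limit superior is a
  singleton.\<close>

lemma ex_point_seq:
  obtains c where "\<And>p. le p p \<Longrightarrow> f_Omega_bar le c p" "\<And>p n. le p p \<Longrightarrow> f_in_nth le x c n p"
proof -
  let ?cs = "\<lambda>(y :: nat \<Rightarrow> bool) n. [map y [0..<n]]"
  have cs: "(\<lambda>y. ?cs y n) \<in> measurable bits (count_space UNIV)" for n
    by (rule measurable_compose[OF measurable_map_upt]) simp
  have reg: "regular (gmem i x)" for i by simp
  have "Measurable.pred bits (\<lambda>y. clop (?cs y n) = C)" for n C
    by (rule measurable_compose[OF cs]) simp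
  then obtain c :: "'p clopen_seq_name"
    where "\<And>b. represents (\<lambda>i. gmem i x) (gmem b c) (\<lambda>y. clop (?cs y (fst b)) = snd b)"
    using ex_name[of "\<lambda>i. gmem i x" "\<lambda>b y. clop (?cs y (fst b)) = snd b", OF reg] by blast
  from this[of "(n, C)" for n C]
  have c: "represents (\<lambda>i. gmem i x) (gmem (n, C) c) (\<lambda>y. clop (?cs y n) = C)" for n C by simp
  have "(\<Sum>n<N. weight (?cs y n)) \<le> 2" for y N
  proof -
    have "(\<Sum>n<N. weight (?cs y n)) = (\<Sum>n<N. (1/2) ^ n)" by (simp add: weight_def)
    also have "\<dots> = 2 - 2 * (1/2) ^ N" by (induction N) auto
    finally show ?thesis by simp
  qed
  from summable_Omega_bar[OF reg cs this c] have 1: "f_Omega_bar le c p" if "le p p" for p using that .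
  have x: "represents (\<lambda>i. gmem i x) (gmem i x) (\<lambda>y. y i)" for i
    using represents_atom[of "\<lambda>i. gmem i x" i] by simp
  have "in_nth_list x c n p" if p: "le p p" for p n
  proof -
    have "represents (\<lambda>i. gmem i x) (in_nth_list x c n) (\<lambda>y. \<exists>l. clop (?cs y n) = clop l \<and>
        (\<exists>s. cone s \<subseteq> clop l \<and> (\<lambda>i. y i) \<in> cone s))"
      unfolding in_nth_list_def by (intro represents_intros represents_in_clopen x c)
    then show ?thesis
    proof (rule transfer_valid[OF _ _ p])
      show "\<exists>l. clop (?cs y n) = clop l \<and> (\<exists>s. cone s \<subseteq> clop l \<and> (\<lambda>i. y i) \<in> cone s)" for y
        unfolding ex_cone_iff by (rule exI[of _ "?cs y n"]) (simp add: clop_def)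
    qed
  qed
  then show ?thesis using that 1 in_nth_of_list by blast
qed

end

subsection \<open>Cohen sequences\<close>

text \<open>
  A binary sequence is read as a sequence of natural numbers in unary, separated by zeros, and these
  as codes of lists of cones. An entry is discarded unless its weight is at most \<open>2\<^sup>-\<^sup>w\<close>, where \<open>w\<close> is
  the number of nonempty entries before it; so all sequences of entries have total weight at most 2.
\<close>

definition nonempty_count :: "bool list list list \<Rightarrow> nat" where
  "nonempty_count cs = length (filter (\<lambda>l. l \<noteq> []) cs)"

definition item :: "bool list list list \<Rightarrow> nat \<Rightarrow> bool list list" where
  "item cs k = (case k of 0 \<Rightarrow> [] | Suc j \<Rightarrow>
     if weight (from_nat j) \<le> (1/2) ^ nonempty_count cs then from_nat j else [])"

definition decode_step :: "bool list list list \<times> nat \<Rightarrow> bool \<Rightarrow> bool list list list \<times> nat" where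
  "decode_step st b = (if b then (fst st, Suc (snd st)) else (fst st @ [item (fst st) (snd st)], 0))"

definition decode :: "bool list \<Rightarrow> bool list list list \<times> nat" where
  "decode t = foldl decode_step ([], 0) t"

lemma decode_snoc: "decode (t @ [b]) = decode_step (decode t) b"
  by (simp add: decode_def)

lemma decode_extend: "\<exists>zs. fst (decode (t @ t')) = fst (decode t) @ zs"
proof (induction t' rule: rev_induct)
  case (snoc b t')
  then show ?case
    unfolding append_assoc[symmetric] decode_snoc by (auto simp: decode_step_def)
qed simp

lemma weight_Nil [simp]: "weight [] = 0"
  by (simp add: weight_def)

text \<open>The bound is exactly what the allowance sustains: a nonempty entry weighs at most 2^-w,
  and 2 - 2 * 2^-w grows by 2^-w when w is increased by one.\<close>

lemma decode_weight:
  "(\<Sum>l\<leftarrow>fst (decode t). weight l) \<le> 2 - 2 * (1/2) ^ nonempty_count (fst (decode t))"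
proof (induction t rule: rev_induct)
  case Nil
  then show ?case by (simp add: decode_def nonempty_count_def)
next
  case (snoc b t)
  define cs where "cs = fst (decode t)"
  define l where "l = item cs (snd (decode t))"
  have l: "l = [] \<or> weight l \<le> (1/2) ^ nonempty_count cs"
    by (auto simp: l_def item_def split: nat.splits)
  show ?case
  proof (cases b)
    case True
    then show ?thesis using snoc by (simp add: decode_snoc decode_step_def)
  next
    case False
    then have fst: "fst (decode (t @ [b])) = cs @ [l]" by (simp add: decode_snoc decode_step_def cs_def l_def)
    show ?thesis
    proof (cases "l = []")
      case True
      then show ?thesis using snoc unfolding fst cs_def[symmetric] by (simp add: nonempty_count_def)
    next
      case False
      then show ?thesis using snoc l unfolding fst cs_def[symmetric] by (simp add: nonempty_count_def)
    qed
  qed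
qed

text \<open>Places that are never reached, as happens when y has finitely many zeros, count as
  empty, so that the weight bound holds for every y.\<close>

definition entry :: "(nat \<Rightarrow> bool) \<Rightarrow> nat \<Rightarrow> bool list list" where
  "entry y n = (if \<exists>m. n < length (fst (decode (map y [0..<m])))
     then fst (decode (map y [0..<(LEAST m. n < length (fst (decode (map y [0..<m]))))])) ! n else [])"

lemma entry_eq:
  assumes "n < length (fst (decode (map y [0..<m])))"
  shows "entry y n = fst (decode (map y [0..<m])) ! n"
proof -
  let ?k = "LEAST m. n < length (fst (decode (map y [0..<m])))"
  have k: "n < length (fst (decode (map y [0..<?k])))" by (rule LeastI[of _ m]) (rule assms)
  have "?k \<le> m" by (rule Least_le) (rule assms)
  then have "map y [0..<m] = map y [0..<?k] @ map y [?k..<m]"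
    by (metis le_add_diff_inverse map_append upt_add_eq_append zero_le)
  then obtain zs where "fst (decode (map y [0..<m])) = fst (decode (map y [0..<?k])) @ zs"
    using decode_extend by metis
  then show ?thesis using k assms unfolding entry_def by (auto simp: nth_append)
qed

lemma entry_weight: "(\<Sum>n<N. weight (entry y n)) \<le> 2"
proof -
  let ?c = "\<lambda>m. fst (decode (map y [0..<m]))"
  have mono: "length (?c m) \<le> length (?c m')" if "m \<le> m'" for m m'
  proof -
    have "map y [0..<m'] = map y [0..<m] @ map y [m..<m']"
      using that by (metis le_add_diff_inverse map_append upt_add_eq_append zero_le)
    then obtain zs where "?c m' = ?c m @ zs" using decode_extend by metis
    then show ?thesis by simp
  qed
  \<comment> \<open>One initial segment of y already produces all those of the first N entries that
    are ever produced, so the bound for finite codes applies.\<close>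
  have "\<exists>m. \<forall>n<N. (\<exists>m'. n < length (?c m')) \<longrightarrow> n < length (?c m)"
  proof (induction N)
    case (Suc N)
    then obtain m where m: "\<forall>n<N. (\<exists>m'. n < length (?c m')) \<longrightarrow> n < length (?c m)" by blast
    show ?case
    proof (cases "\<exists>m'. N < length (?c m')")
      case True
      then obtain m' where m': "N < length (?c m')" by blast
      have "N < length (?c (max m m'))" using m' mono[of m' "max m m'"] by simp
      moreover have "n < length (?c (max m m'))" if "n < length (?c m)" for n
        using that mono[of m "max m m'"] by simp
      ultimately show ?thesis using m by (metis less_Suc_eq)
    next
      case False
      then show ?thesis using m less_Suc_eq by metis
    qed
  qed simp
  then obtain m where m: "\<And>n. n < N \<Longrightarrow> (\<exists>m'. n < length (?c m')) \<Longrightarrow> n < length (?c m)" by blast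
  have "weight (entry y n) = (if n < length (?c m) then weight (?c m ! n) else 0)" if "n < N" for n
    using m[OF that] entry_eq[of n y m] by (auto simp: entry_def)
  then have "(\<Sum>n<N. weight (entry y n)) = (\<Sum>n<N. if n < length (?c m) then weight (?c m ! n) else 0)"
    by (intro sum.cong) auto
  also have "\<dots> = (\<Sum>n\<in>{n\<in>{..<N}. n < length (?c m)}. weight (?c m ! n))"
    by (simp only: sum.inter_filter[OF finite_lessThan])
  also have "\<dots> \<le> (\<Sum>n<length (?c m). weight (?c m ! n))"
    by (rule sum_mono2) (auto simp: weight_nonneg)
  also have "\<dots> = (\<Sum>l\<leftarrow>?c m. weight l)" by (simp add: sum_list_sum_nth atLeast0LessThan)
  also have "\<dots> \<le> 2 - 2 * (1/2) ^ nonempty_count (?c m)" by (rule decode_weight)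
  also have "\<dots> \<le> 2" by simp
  finally show ?thesis .
qed

lemma measurable_entry: "(\<lambda>y. entry y n) \<in> measurable bits (count_space UNIV)"
proof -
  have d [measurable]: "(\<lambda>y. fst (decode (map y [0..<m]))) \<in> measurable bits (count_space UNIV)" for m
    by (rule measurable_compose[OF measurable_map_upt]) simp
  have [measurable]: "Measurable.pred bits (\<lambda>y. n < length (fst (decode (map y [0..<m]))))" for m
    by (rule measurable_compose[OF d]) simp
  have [measurable]: "(\<lambda>y. fst (decode (map y [0..<m])) ! n) \<in> measurable bits (count_space UNIV)" for m
    by (rule measurable_compose[OF d]) simp
  have [measurable]: "(\<lambda>y. LEAST m. n < length (fst (decode (map y [0..<m])))) \<in> measurable bits (count_space UNIV)"
    by measurable
  have [measurable]: "(\<lambda>y. fst (decode (map y [0..<(LEAST m. n < length (fst (decode (map y [0..<m]))))])) ! n)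
      \<in> measurable bits (count_space UNIV)"
    by (rule measurable_compose_countable[where f = "\<lambda>m y. fst (decode (map y [0..<m])) ! n"]) measurable
  show ?thesis unfolding entry_def by measurable
qed

text \<open>The code t may end within a run of ones. A first zero closes that run and may thereby
  create one more, possibly nonempty, entry; this accounts for both occurrences of
  \<open>Suc\<close>. Further zeros append empty entries, which cost no allowance, up to place n,
  where the code of l is written.\<close>

lemma decode_reach:
  assumes n: "Suc (length (fst (decode t))) \<le> n"
    and l: "weight l \<le> (1/2) ^ Suc (nonempty_count (fst (decode t)))"
  obtains t' where "n < length (fst (decode (t @ t')))" "fst (decode (t @ t')) ! n = l"
proof -
  define cs where "cs = fst (decode (t @ [False]))"
  have d1: "decode (t @ [False]) = (cs, 0)" by (simp add: cs_def decode_snoc decode_step_def)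
  have len: "length cs = Suc (length (fst (decode t)))"
    and cnt: "nonempty_count cs \<le> Suc (nonempty_count (fst (decode t)))"
    by (simp_all add: cs_def decode_snoc decode_step_def nonempty_count_def)
  have d2: "decode (t @ [False] @ replicate j False) = (cs @ replicate j [], 0)" for j
  proof (induction j)
    case (Suc j)
    have "t @ [False] @ replicate (Suc j) False = (t @ [False] @ replicate j False) @ [False]"
      by (simp add: replicate_append_same)
    then show ?case
      using Suc by (simp only: decode_snoc) (simp add: decode_step_def item_def replicate_append_same)
  qed (use d1 in simp)
  define j where "j = n - length cs"
  define cs' where "cs' = cs @ replicate j []"
  have len': "length cs' = n" using n len by (simp add: cs'_def j_def)
  have d3: "decode (t @ [False] @ replicate j False @ replicate k True) = (cs', k)" for k
  proof (induction k)
    case (Suc k)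
    have "t @ [False] @ replicate j False @ replicate (Suc k) True =
        (t @ [False] @ replicate j False @ replicate k True) @ [True]"
      by (simp add: replicate_append_same)
    then show ?case using Suc by (simp only: decode_snoc) (simp add: decode_step_def)
  qed (use d2 in \<open>simp add: cs'_def\<close>)
  define t' where "t' = [False] @ replicate j False @ replicate (Suc (to_nat l)) True @ [False]"
  have "nonempty_count cs' = nonempty_count cs" by (simp add: cs'_def nonempty_count_def)
  then have "(1/2 :: real) ^ Suc (nonempty_count (fst (decode t))) \<le> (1/2) ^ nonempty_count cs'"
    using cnt by (intro power_decreasing) auto
  then have it: "item cs' (Suc (to_nat l)) = l" using l by (simp add: item_def)
  have eq: "t @ t' = (t @ [False] @ replicate j False @ replicate (Suc (to_nat l)) True) @ [False]"
    by (simp add: t'_def)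
  have "decode (t @ t') = (cs' @ [l], 0)"
    unfolding eq decode_snoc d3 decode_step_def by (simp add: it)
  moreover have "(cs' @ [l]) ! n = l" using len' by (simp add: nth_append)
  ultimately show ?thesis using that[of t'] len' by simp
qed

section \<open>Cohen bits added by the iterands\<close>

context fs_iteration_cc
begin

definition nx :: "'o \<Rightarrow> 'o" where
  "nx \<xi> = (LEAST \<beta>. \<xi> < \<beta>)"

lemma nx_greater: "\<xi> < nx \<xi>"
proof -
  obtain \<beta> where "\<xi> < \<beta>" using small_bounded[OF small_finite, of "{\<xi>}"] by blast
  then show ?thesis unfolding nx_def by (rule LeastI)
qed

lemma nx_le: "\<xi> < \<beta> \<Longrightarrow> nx \<xi> \<le> \<beta>"
  unfolding nx_def by (rule Least_le)

lemma lessThan_nx: "{..<nx \<xi>} = {..\<xi>}"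
proof (intro set_eqI)
  fix x
  have "x < nx \<xi> \<longleftrightarrow> x \<le> \<xi>"
    using nx_le[of \<xi> x] le_less_trans[OF _ nx_greater[of \<xi>], of x] by (meson not_le)
  then show "x \<in> {..<nx \<xi>} \<longleftrightarrow> x \<in> {..\<xi>}" by simp
qed

text \<open>The ordinal \<delta> + j.\<close>

definition blk :: "'o \<Rightarrow> nat \<Rightarrow> 'o" where
  "blk \<delta> j = (nx ^^ j) \<delta>"

lemma blk_0 [simp]: "blk \<delta> 0 = \<delta>" and blk_Suc: "blk \<delta> (Suc j) = nx (blk \<delta> j)"
  by (simp_all add: blk_def)

lemma blk_strict_mono: "strict_mono (blk \<delta>)"
  by (rule strict_mono_Suc_iff[THEN iffD2]) (simp add: blk_Suc nx_greater)

text \<open>The least element counts as a limit as well.\<close>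

definition is_lim :: "'o \<Rightarrow> bool" where
  "is_lim \<delta> \<longleftrightarrow> (\<forall>\<xi><\<delta>. nx \<xi> < \<delta>)"

lemma blk_less_lim: "is_lim \<delta>' \<Longrightarrow> \<delta> < \<delta>' \<Longrightarrow> blk \<delta> j < \<delta>'"
  by (induction j) (auto simp: blk_Suc is_lim_def)

text \<open>The supremum of the \<alpha> + j exists because the cofinality is uncountable, and it is
  a limit.\<close>

lemma ex_lim: obtains \<delta> where "is_lim \<delta>" "\<alpha> \<le> \<delta>"
proof -
  have "small (range (blk \<alpha>))" by (rule small_countable) simp
  then obtain \<beta> where \<beta>: "\<forall>j. blk \<alpha> j < \<beta>" using small_bounded by (metis rangeI)
  define \<delta> where "\<delta> = (LEAST \<beta>. \<forall>j. blk \<alpha> j < \<beta>)"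
  have \<delta>: "\<forall>j. blk \<alpha> j < \<delta>" unfolding \<delta>_def by (rule LeastI) (rule \<beta>)
  have "nx \<xi> < \<delta>" if "\<xi> < \<delta>" for \<xi>
  proof -
    have "\<not> (\<forall>j. blk \<alpha> j < \<xi>)" using that not_less_Least unfolding \<delta>_def by blast
    then obtain j where "\<xi> \<le> blk \<alpha> j" by (auto simp: not_less)
    then have "\<xi> < blk \<alpha> (Suc j)" using strict_monoD[OF blk_strict_mono[of \<alpha>], of j "Suc j"] by simp
    then have "nx \<xi> \<le> blk \<alpha> (Suc j)" by (rule nx_le)
    then show ?thesis using \<delta> le_less_trans by blast
  qed
  then have "is_lim \<delta>" unfolding is_lim_def by blast
  moreover have "\<alpha> \<le> \<delta>" using \<delta>[rule_format, of 0] by simp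
  ultimately show ?thesis using that by blast
qed

definition splits :: "'o \<Rightarrow> ('o \<rightharpoonup> 'q) \<Rightarrow> 'q \<Rightarrow> 'q \<Rightarrow> bool" where
  "splits \<xi> s x y \<longleftrightarrow> stage \<xi> s s \<and> in_Q \<xi> x s \<and> in_Q \<xi> y s \<and> f_incompatible (stage \<xi>) (Q \<xi>) (L \<xi>) x y s"

lemma splits_dense:
  assumes "stage \<xi> s s"
  shows "\<exists>t x y. stage \<xi> t s \<and> splits \<xi> t x y"
proof -
  have nt: "f_nontrivial (stage \<xi>) (Q \<xi>) (L \<xi>) s" using nontrivial assms unfolding forced_def by blast
  obtain t x where t: "stage \<xi> t s" "f_ex (stage \<xi>) (\<lambda>y. f_mem (stage \<xi>) f_geq x (Q \<xi>) \<^bold>\<and>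
      f_mem (stage \<xi>) f_geq y (Q \<xi>) \<^bold>\<and> f_incompatible (stage \<xi>) (Q \<xi>) (L \<xi>) x y) t"
    using nt assms unfolding f_nontrivial_def stage.ex_iff[of \<xi> "\<lambda>x. f_ex (stage \<xi>) (F x)" for F] by blast
  then obtain t' y where "stage \<xi> t' t" "in_Q \<xi> x t'" "in_Q \<xi> y t'"
      "f_incompatible (stage \<xi>) (Q \<xi>) (L \<xi>) x y t'"
    using stage.le_left[OF t(1)] unfolding stage.ex_iff and_iff in_Q_def by blast
  then show ?thesis using t(1) stage.le_trans stage.le_left unfolding splits_def by blast
qed

definition splitting :: "'o \<Rightarrow> ('o \<rightharpoonup> 'q) set \<Rightarrow> (('o \<rightharpoonup> 'q) \<Rightarrow> 'q) \<Rightarrow> (('o \<rightharpoonup> 'q) \<Rightarrow> 'q) \<Rightarrow> bool" where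
  "splitting \<xi> M X Y \<longleftrightarrow> stage.antichain \<xi> M \<and> (\<forall>m\<in>M. splits \<xi> m (X m) (Y m)) \<and>
     (\<forall>s. stage \<xi> s s \<longrightarrow> (\<exists>m\<in>M. \<exists>r. stage \<xi> r s \<and> stage \<xi> r m))"

lemma ex_splitting: "\<exists>M X Y. splitting \<xi> M X Y"
proof -
  obtain M where M: "stage.antichain \<xi> M" "\<And>p. p \<in> M \<Longrightarrow> \<exists>x y. splits \<xi> p x y"
      "\<And>p. \<exists>x y. splits \<xi> p x y \<Longrightarrow> \<exists>m\<in>M. \<exists>r. stage \<xi> r p \<and> stage \<xi> r m"
    using stage.maximal_antichain[of "\<lambda>p. \<exists>x y. splits \<xi> p x y" \<xi>] unfolding splits_def by blast
  obtain X Y where XY: "\<And>m. m \<in> M \<Longrightarrow> splits \<xi> m (X m) (Y m)" using M(2) by metis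
  have "\<exists>m\<in>M. \<exists>r. stage \<xi> r s \<and> stage \<xi> r m" if s: "stage \<xi> s s" for s
  proof -
    obtain t where "stage \<xi> t s" "\<exists>x y. splits \<xi> t x y" using splits_dense[OF s] by blast
    then show ?thesis using M(3) stage.le_trans by meson
  qed
  then show ?thesis using M(1) XY unfolding splitting_def by blast
qed

text \<open>
  \<open>gbit \<xi>\<close> says that the generic filter of \<open>Q \<xi>\<close> contains the first one of two incompatible
  conditions, which are chosen along a maximal antichain of the stage \<open>\<xi>\<close>.
\<close>

definition bit_conds :: "'o \<Rightarrow> ('o \<rightharpoonup> 'q) set" where
  "bit_conds \<xi> = (SOME S. \<exists>M X Y. splitting \<xi> M X Y \<and>
     S = {r \<in> conds. dom r \<subseteq> {..\<xi>} \<and> \<xi> \<in> dom r \<and>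
       (\<exists>m\<in>M. stage \<xi> (r |` {..<\<xi>}) m \<and> in_L \<xi> (the (r \<xi>)) (X m) (r |` {..<\<xi>}))})"

definition gbit :: "'o \<Rightarrow> ('o \<rightharpoonup> 'q) sentence" where
  "gbit \<xi> = f_mem leq f_geq () {((), r) | r. r \<in> bit_conds \<xi>}"

lemma regular_gbit [simp]: "regular (gbit \<xi>)"
  unfolding gbit_def by simp

lemma bit_conds_eq:
  obtains M X Y where "splitting \<xi> M X Y"
    "bit_conds \<xi> = {r \<in> conds. dom r \<subseteq> {..\<xi>} \<and> \<xi> \<in> dom r \<and>
       (\<exists>m\<in>M. stage \<xi> (r |` {..<\<xi>}) m \<and> in_L \<xi> (the (r \<xi>)) (X m) (r |` {..<\<xi>}))}"
proof -
  have "\<exists>S M X Y. splitting \<xi> M X Y \<and>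
     S = {r \<in> conds. dom r \<subseteq> {..\<xi>} \<and> \<xi> \<in> dom r \<and>
       (\<exists>m\<in>M. stage \<xi> (r |` {..<\<xi>}) m \<and> in_L \<xi> (the (r \<xi>)) (X m) (r |` {..<\<xi>}))}"
    using ex_splitting by blast
  from someI_ex[OF this] show ?thesis using that unfolding bit_conds_def[symmetric] by blast
qed

lemma supported_mem:
  assumes "\<And>y s. (y, s) \<in> \<tau> \<Longrightarrow> dom s \<subseteq> {..<\<alpha>}"
  shows "supported \<alpha> (f_mem leq f_geq x \<tau>)"
proof (rule supportedI[OF regular_mem])
  fix q assume q: "q \<in> conds" "f_mem leq f_geq x \<tau> q"
  show "f_mem leq f_geq x \<tau> (q |` {..<\<alpha>})"
  proof (rule regular_dense[OF regular_mem leq_refl[OF restrict_conds[OF q(1)]]])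
    fix r assume r: "leq r (q |` {..<\<alpha>})"
    define t where "t = splice \<alpha> (r |` {..<\<alpha>}) q"
    have t: "leq t q" "leq t (r |` {..<\<alpha>})" unfolding t_def using splice_stronger[OF q(1) r] by auto
    obtain t' s where t': "leq t' t" "(x, s) \<in> \<tau>" "leq t' s"
      using q(2) t(1) unfolding f_mem_def geq_iff by blast
    have 1: "leq (t' |` {..<\<alpha>}) (r |` {..<\<alpha>})"
      using restrict_leq[OF le_trans[OF t'(1) t(2)], of \<alpha>] by simp
    have 2: "leq (t' |` {..<\<alpha>}) s"
      using restrict_leq[OF t'(3), of \<alpha>] restrict_id[OF assms[OF t'(2)]] by simp
    have 3: "leq (splice \<alpha> (t' |` {..<\<alpha>}) r) r" "leq (splice \<alpha> (t' |` {..<\<alpha>}) r) (t' |` {..<\<alpha>})"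
      using splice_leq[OF leq_conds(1)[OF r] 1] by simp_all
    have "f_mem leq f_geq x \<tau> (splice \<alpha> (t' |` {..<\<alpha>}) r)"
      using mem_geqI[OF t'(2)] le_trans[OF 3(2) 2] .
    then show "\<exists>u. leq u r \<and> f_mem leq f_geq x \<tau> u" using 3(1) by blast
  qed
qed

lemma supported_bit: "supported (nx \<xi>) (gbit \<xi>)"
  unfolding gbit_def
proof (rule supported_mem)
  fix y s assume "(y, s) \<in> {((), r) | r. r \<in> bit_conds \<xi>}"
  then have s: "s \<in> bit_conds \<xi>" by blast
  show "dom s \<subseteq> {..<nx \<xi>}"
  proof (rule bit_conds_eq[of \<xi>])
    fix M X Y
    assume "bit_conds \<xi> = {r \<in> conds. dom r \<subseteq> {..\<xi>} \<and> \<xi> \<in> dom r \<and>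
       (\<exists>m\<in>M. stage \<xi> (r |` {..<\<xi>}) m \<and> in_L \<xi> (the (r \<xi>)) (X m) (r |` {..<\<xi>}))}"
    with s show ?thesis unfolding lessThan_nx by simp
  qed
qed

lemma in_L_trans:
  assumes "stage \<xi> s s" "in_Q \<xi> x s" "in_Q \<xi> y s" "in_Q \<xi> z s" "in_L \<xi> x y s" "in_L \<xi> y z s"
  shows "in_L \<xi> x z s"
proof -
  have "f_preorder (stage \<xi>) (Q \<xi>) (L \<xi>) s" using assms(1) poset unfolding forced_def by blast
  note pre = this[unfolded f_preorder_def and_iff all_iff
      stage.imp_iff[OF stage.regular_mem stage.regular_mem]
      stage.imp_iff[OF stage.regular_and[OF stage.regular_mem stage.regular_and[OF stage.regular_mem
        stage.regular_and[OF stage.regular_mem stage.regular_and[OF stage.regular_mem stage.regular_mem]]]]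
        stage.regular_mem]]
  show ?thesis
    using pre[THEN conjunct2, rule_format, of s x y z] assms unfolding in_Q_def in_L_def by blast
qed

text \<open>A bit whose coordinate is still free can be given either value by choosing the first or
  the second of the two incompatible conditions. In the second case, a stronger condition forcing
  the bit would lie below some m' of the antichain and below m; so m' = m, and its value at \<xi>
  would be below both. Only coordinates up to \<xi> are added, so later bits stay free.\<close>

lemma bit_extend:
  assumes q: "q \<in> conds" "\<xi> \<notin> dom q"
  obtains r where "leq r q" "dom r \<subseteq> {..\<xi>} \<union> dom q" "if b then gbit \<xi> r else f_not leq (gbit \<xi>) r"
proof -
  obtain M X Y where M: "splitting \<xi> M X Y"
    and bc: "bit_conds \<xi> = {r \<in> conds. dom r \<subseteq> {..\<xi>} \<and> \<xi> \<in> dom r \<and>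
       (\<exists>m\<in>M. stage \<xi> (r |` {..<\<xi>}) m \<and> in_L \<xi> (the (r \<xi>)) (X m) (r |` {..<\<xi>}))}"
    using bit_conds_eq by blast
  have "stage \<xi> (q |` {..<\<xi>}) (q |` {..<\<xi>})" using stage_restrict[OF leq_refl[OF q(1)]] .
  then obtain m s where m: "m \<in> M" "stage \<xi> s (q |` {..<\<xi>})" "stage \<xi> s m"
    using M unfolding splitting_def by blast
  have sp: "splits \<xi> m (X m) (Y m)" using M m(1) unfolding splitting_def by blast
  define x where "x = (if b then X m else Y m)"
  have x: "in_Q \<xi> x s" using sp in_Q_mono[OF _ m(3)] unfolding splits_def x_def by auto
  have s: "leq s (q |` {..<\<xi>})" "dom s \<subseteq> {..<\<xi>}" using m(2) by (auto simp: stage_iff)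
  have ss: "stage \<xi> s s" using stage.le_left[OF m(2)] .
  obtain r where r: "leq r q" "r |` {..<\<xi>} = s" "r \<xi> = Some x" "dom r \<subseteq> dom s \<union> {\<xi>} \<union> dom q \<union> dom q"
    using amalgamate[OF q(1) q(1) s(1) s(1) s(2) x] q(2) by blast
  have dom: "dom r \<subseteq> {..\<xi>} \<union> dom q" using r(4) s(2) by force
  have "if b then gbit \<xi> r else f_not leq (gbit \<xi>) r"
  proof (cases b)
    case True
    let ?r = "r |` {..<nx \<xi>}"
    have rc: "r \<in> conds" using r(1) leq_conds by blast
    have 1: "?r |` {..<\<xi>} = s" using r(2) nx_greater[of \<xi>] by simp
    have 2: "?r \<xi> = Some x" using r(3) nx_greater[of \<xi>] by simp
    have 3: "in_L \<xi> x (X m) s" using in_L_refl[OF x ss] True by (simp add: x_def)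
    have "stage \<xi> (?r |` {..<\<xi>}) m \<and> in_L \<xi> (the (?r \<xi>)) (X m) (?r |` {..<\<xi>})"
      unfolding 1 2 using 3 m(3) by simp
    moreover have "dom ?r \<subseteq> {..\<xi>}" using dom_restrict_lessThan[of r "nx \<xi>"] unfolding lessThan_nx .
    moreover have "\<xi> \<in> dom ?r" using 2 by (rule domI)
    ultimately have "?r \<in> bit_conds \<xi>"
      unfolding bc using m(1) restrict_conds[OF rc] by blast
    then have "gbit \<xi> r" unfolding gbit_def by (intro mem_geqI[of _ ?r]) (auto intro: leq_restrict rc)
    then show ?thesis using True by simp
  next
    case False
    have "\<not> gbit \<xi> r'" if r': "leq r' r" for r'
    proof
      assume "gbit \<xi> r'"
      then obtain t u where t: "leq t r'" "u \<in> bit_conds \<xi>" "leq t u"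
        using le_left[OF r'] unfolding gbit_def f_mem_def by blast
      obtain m' where m': "m' \<in> M" "stage \<xi> (u |` {..<\<xi>}) m'" "in_L \<xi> (the (u \<xi>)) (X m') (u |` {..<\<xi>})"
        "\<xi> \<in> dom u" "u \<in> conds" using t(2) unfolding bc by blast
      let ?t = "t |` {..<\<xi>}"
      have tu: "stage \<xi> ?t (u |` {..<\<xi>})" using stage_restrict[OF t(3)] .
      have tr: "leq t r" using t(1) r' le_trans by blast
      have ts: "stage \<xi> ?t s" using stage_restrict[OF tr, of \<xi>] r(2) by simp
      have tm: "stage \<xi> ?t m" "stage \<xi> ?t m'"
        using stage.le_trans[OF ts m(3)] stage.le_trans[OF tu m'(2)] .
      then have "m' = m" using M m(1) m'(1) unfolding splitting_def stage.antichain_def by blast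
      have tt: "stage \<xi> ?t ?t" using stage.le_left[OF ts] .
      have dt: "\<xi> \<in> dom t" using leq_dom[OF t(3)] m'(4) by blast
      have tc: "t \<in> conds" using t(1) leq_conds by blast
      have Qt: "in_Q \<xi> (the (t \<xi>)) ?t" using tc dt by (simp add: conds_iff)
      have Qu: "in_Q \<xi> (the (u \<xi>)) ?t" using in_Q_mono[OF _ tu] m'(4,5) by (simp add: conds_iff)
      have QX: "in_Q \<xi> (X m) ?t" using sp in_Q_mono[OF _ tm(1)] unfolding splits_def by blast
      have "in_L \<xi> (the (t \<xi>)) (the (u \<xi>)) ?t" using t(3) m'(4) by (simp add: leq_iff)
      moreover have "in_L \<xi> (the (u \<xi>)) (X m) ?t" using in_L_mono[OF m'(3) tu] \<open>m' = m\<close> by simp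
      ultimately have "in_L \<xi> (the (t \<xi>)) (X m) ?t" using in_L_trans[OF tt Qt Qu QX] by blast
      moreover have "in_L \<xi> (the (t \<xi>)) (Y m) ?t"
        using tr r(3) False unfolding leq_iff x_def by (metis domI option.sel)
      moreover have "f_incompatible (stage \<xi>) (Q \<xi>) (L \<xi>) (X m) (Y m) m" using sp unfolding splits_def by blast
      ultimately show False using Qt tm(1) unfolding incompatible_iff by blast
    qed
    then show ?thesis using False unfolding not_iff by simp
  qed
  then show ?thesis using that r(1) dom by blast
qed

text \<open>The second clause records that the name is built from the bits alone and therefore
  inherits any support they have in common.\<close>

definition is_cohen :: "'o \<Rightarrow> ('o \<rightharpoonup> 'q) clopen_seq_name \<Rightarrow> bool" where
  "is_cohen \<delta> c \<longleftrightarrow> (\<forall>n C. represents (\<lambda>j. gbit (blk \<delta> j)) (gmem (n, C) c) (\<lambda>y. clop (entry y n) = C)) \<and>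
     (\<forall>n C \<alpha>. (\<forall>j. supported \<alpha> (gbit (blk \<delta> j))) \<longrightarrow> supported \<alpha> (gmem (n, C) c))"

definition cohen :: "'o \<Rightarrow> ('o \<rightharpoonup> 'q) clopen_seq_name" where
  "cohen \<delta> = (SOME c. is_cohen \<delta> c)"

lemma is_cohen: "is_cohen \<delta> (cohen \<delta>)"
proof -
  define Pr where "Pr \<phi> \<longleftrightarrow> (\<forall>\<alpha>. (\<forall>j. supported \<alpha> (gbit (blk \<delta> j))) \<longrightarrow> supported \<alpha> \<phi>)" for \<phi>
  have cong: "supported \<alpha> \<psi>" if "supported \<alpha> \<phi>" "\<forall>p. leq p p \<longrightarrow> \<phi> p = \<psi> p" for \<alpha> \<phi> \<psi>
    using that leq_refl restrict_conds unfolding supported_def by metis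
  have "closed_property Pr"
    unfolding closed_property_def Pr_def
  proof (intro conjI allI impI)
    show "supported \<alpha> (f_ground b)" for b \<alpha> by (rule supported_ground)
    show "supported \<alpha> (f_not leq \<phi>)"
      if "regular \<phi>" "\<forall>\<alpha>. (\<forall>j. supported \<alpha> (gbit (blk \<delta> j))) \<longrightarrow> supported \<alpha> \<phi>"
        "\<forall>j. supported \<alpha> (gbit (blk \<delta> j))" for \<alpha> \<phi>
      using that supported_not by blast
    show "supported \<alpha> (\<phi> \<^bold>\<and> \<psi>)"
      if "\<forall>\<alpha>. (\<forall>j. supported \<alpha> (gbit (blk \<delta> j))) \<longrightarrow> supported \<alpha> \<phi>"
        "\<forall>\<alpha>. (\<forall>j. supported \<alpha> (gbit (blk \<delta> j))) \<longrightarrow> supported \<alpha> \<psi>"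
        "\<forall>j. supported \<alpha> (gbit (blk \<delta> j))" for \<alpha> \<phi> \<psi>
      using that supported_and by blast
    show "supported \<alpha> (f_all \<Phi>)"
      if "\<forall>n. \<forall>\<alpha>. (\<forall>j. supported \<alpha> (gbit (blk \<delta> j))) \<longrightarrow> supported \<alpha> (\<Phi> n)"
        "\<forall>j. supported \<alpha> (gbit (blk \<delta> j))" for \<alpha> and \<Phi> :: "nat \<Rightarrow> ('o \<rightharpoonup> 'q) sentence"
      by (rule supported_all) (use that in blast)
    show "supported \<alpha> \<psi>"
      if "\<forall>\<alpha>. (\<forall>j. supported \<alpha> (gbit (blk \<delta> j))) \<longrightarrow> supported \<alpha> \<phi>" "\<forall>p. leq p p \<longrightarrow> \<phi> p = \<psi> p"
        "\<forall>j. supported \<alpha> (gbit (blk \<delta> j))" for \<alpha> \<phi> \<psi>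
      by (rule cong[of \<alpha> \<phi>]) (use that in blast)+
  qed
  moreover have "Pr (gbit (blk \<delta> j))" for j unfolding Pr_def by blast
  moreover have "Measurable.pred bits (\<lambda>y. clop (entry y (fst b)) = snd b)" for b
    by (rule measurable_compose[OF measurable_entry]) simp
  moreover have "regular (gbit (blk \<delta> j))" for j by simp
  ultimately obtain c :: "('o \<rightharpoonup> 'q) clopen_seq_name" where
    c: "\<And>b. represents (\<lambda>j. gbit (blk \<delta> j)) (gmem b c) (\<lambda>y. clop (entry y (fst b)) = snd b)"
      "\<And>b. Pr (gmem b c)"
    using ex_name_closed[of "\<lambda>j. gbit (blk \<delta> j)" "\<lambda>b y. clop (entry y (fst b)) = snd b" Pr] by blast
  then have "is_cohen \<delta> c" unfolding is_cohen_def Pr_def by (metis fst_conv snd_conv)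
  then show ?thesis unfolding cohen_def by (rule someI)
qed

lemma cohen_Omega_bar: "p \<in> conds \<Longrightarrow> f_Omega_bar leq (cohen \<delta>) p"
  by (rule summable_Omega_bar[of "\<lambda>j. gbit (blk \<delta> j)" entry])
    (use is_cohen[of \<delta>] in \<open>auto simp: is_cohen_def measurable_entry entry_weight leq_refl\<close>)

lemma supported_cohen:
  assumes "is_lim \<delta>'" "\<delta> < \<delta>'"
  shows "supported \<delta>' (gmem (n, C) (cohen \<delta>))"
proof -
  have "supported \<delta>' (gbit (blk \<delta> j))" for j
    using supported_mono[OF supported_bit, of "blk \<delta> j" \<delta>'] blk_less_lim[OF assms, of "Suc j"]
    by (simp add: blk_Suc)
  then show ?thesis using is_cohen[of \<delta>] unfolding is_cohen_def by blast
qed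

section \<open>Deciding finitely many bits\<close>

definition bit_eq :: "'o \<Rightarrow> nat \<Rightarrow> bool \<Rightarrow> ('o \<rightharpoonup> 'q) sentence" where
  "bit_eq \<delta> j b = (if b then gbit (blk \<delta> j) else f_not leq (gbit (blk \<delta> j)))"

lemma regular_bit_eq: "regular (bit_eq \<delta> j b)"
  unfolding bit_eq_def by (auto intro: regular_not)

lemma supported_bit_eq:
  assumes "j < M"
  shows "supported (blk \<delta> M) (bit_eq \<delta> j b)"
proof -
  have "supported (blk \<delta> (Suc j)) (bit_eq \<delta> j b)"
    unfolding bit_eq_def blk_Suc using supported_bit supported_not by auto
  moreover have "blk \<delta> (Suc j) \<le> blk \<delta> M"
    using assms strict_mono_less_eq[OF blk_strict_mono] by (simp add: Suc_le_eq)
  ultimately show ?thesis using supported_mono regular_bit_eq by blast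
qed

lemma cohen_of_bits:
  assumes r: "r \<in> conds" and b: "\<And>j. j < length t \<Longrightarrow> bit_eq \<delta> j (t ! j) r"
    and n: "n < length (fst (decode t))"
  shows "gmem (n, clop (fst (decode t) ! n)) (cohen \<delta>) r"
proof -
  let ?\<theta> = "\<lambda>j. gbit (blk \<delta> j)"
  have "represents ?\<theta> (f_all (\<lambda>j. f_imp leq (f_ground (j < length t)) (f_iff leq (gbit (blk \<delta> j)) (f_ground (t ! j)))))
      (\<lambda>y. \<forall>j. j < length t \<longrightarrow> (y j \<longleftrightarrow> t ! j))"
    by (intro represents_intros represents_atom[of ?\<theta>]) simp
  moreover have "represents ?\<theta> (gmem (n, clop (fst (decode t) ! n)) (cohen \<delta>))
      (\<lambda>y. clop (entry y n) = clop (fst (decode t) ! n))"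
    using is_cohen[of \<delta>] unfolding is_cohen_def by blast
  ultimately show ?thesis
  proof (rule transfer[OF _ _ _ _ leq_refl[OF r]], goal_cases)
    case (1 y)
    then have "map y [0..<length t] = t" by (intro nth_equalityI) auto
    then have "entry y n = fst (decode t) ! n" using entry_eq[of n y "length t"] n by simp
    then show ?case by simp
  next
    case 2
    have "f_iff leq (gbit (blk \<delta> j)) (f_ground (t ! j)) q" if "leq q r" "j < length t" for q j
      unfolding iff_iff[OF regular_gbit regular_ground] ground_iff
    proof (intro allI impI)
      fix q' assume "leq q' q"
      then have "leq q' r" using that(1) le_trans by blast
      then show "gbit (blk \<delta> j) q' \<longleftrightarrow> t ! j"
        using b[OF that(2)] regular_mono[OF regular_gbit] unfolding bit_eq_def not_iff by (auto split: if_splits)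
    qed
    then show ?case
      unfolding all_iff imp_iff[OF regular_ground regular_iff[OF regular_gbit regular_ground]] ground_iff by blast
  qed
qed

definition free :: "'o \<Rightarrow> nat \<Rightarrow> ('o \<rightharpoonup> 'q) \<Rightarrow> bool" where
  "free \<delta> M q \<longleftrightarrow> (\<forall>j\<ge>M. blk \<delta> j \<notin> dom q)"

lemma ex_free:
  assumes "q \<in> conds"
  obtains M where "free \<delta> M q"
proof -
  have "inj (blk \<delta>)" using blk_strict_mono strict_mono_imp_inj_on by blast
  then have "finite (blk \<delta> -` dom q)" using assms finite_vimageI unfolding conds_iff by blast
  then obtain M where "\<forall>j\<in>blk \<delta> -` dom q. j < M" using finite_nat_set_iff_bounded by blast
  then show ?thesis using that[of M] unfolding free_def by (auto simp: not_less[symmetric])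
qed

text \<open>Deciding the first M bits may occupy arbitrary later coordinates. As these bits are
  supported below \<delta> + M, the part of the deciding condition below \<delta> + M suffices;
  spliced with the original tail it leaves the coordinates \<delta> + j with j \<ge> M free.\<close>

lemma decide_bits:
  assumes q: "q \<in> conds" "free \<delta> M q"
  obtains r t where "leq r q" "free \<delta> M r" "length t = M" "\<And>j. j < M \<Longrightarrow> bit_eq \<delta> j (t ! j) r"
proof -
  have "\<exists>r t. leq r q \<and> length t = m \<and> (\<forall>j<m. bit_eq \<delta> j (t ! j) r)" for m
  proof (induction m)
    case 0
    then show ?case using leq_refl[OF q(1)] by auto
  next
    case (Suc m)
    then obtain r t where r: "leq r q" "length t = m" "\<forall>j<m. bit_eq \<delta> j (t ! j) r" by blast
    obtain r' where r': "leq r' r" "gbit (blk \<delta> m) r' \<or> f_not leq (gbit (blk \<delta> m)) r'"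
      using decide le_left[OF r(1)] by metis
    then obtain b where b: "bit_eq \<delta> m b r'" unfolding bit_eq_def by metis
    have "bit_eq \<delta> j ((t @ [b]) ! j) r'" if "j < Suc m" for j
    proof (cases "j = m")
      case True
      then show ?thesis using b r(2) by (simp add: nth_append)
    next
      case False
      then have "j < m" using that by simp
      then show ?thesis using r(2,3) r'(1) regular_mono[OF regular_bit_eq] by (auto simp: nth_append)
    qed
    moreover have "leq r' q" using le_trans[OF r'(1) r(1)] .
    ultimately show ?case using r(2) by (intro exI[of _ r'] exI[of _ "t @ [b]"]) simp
  qed
  then obtain r t where r: "leq r q" "length t = M" "\<forall>j<M. bit_eq \<delta> j (t ! j) r" by blast
  let ?\<beta> = "blk \<delta> M"
  define r1 where "r1 = splice ?\<beta> (r |` {..<?\<beta>}) q"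
  have rc: "r \<in> conds" using r(1) leq_conds by blast
  have le: "leq r (q |` {..<?\<beta>})" using le_trans[OF r(1) leq_restrict[OF q(1)]] .
  have r1: "leq r1 q" "leq r1 (r |` {..<?\<beta>})" unfolding r1_def using splice_stronger[OF q(1) le] .
  have "bit_eq \<delta> j (t ! j) r1" if "j < M" for j
  proof -
    have "bit_eq \<delta> j (t ! j) (r |` {..<?\<beta>})"
      using supported_bit_eq[OF that, of \<delta> "t ! j"] r(3) that rc unfolding supported_def by blast
    then show ?thesis using r1(2) regular_mono[OF regular_bit_eq] by blast
  qed
  moreover have "free \<delta> M r1"
    unfolding free_def r1_def dom_splice
  proof (intro allI impI)
    fix j assume "M \<le> j"
    then have "?\<beta> \<le> blk \<delta> j" using strict_mono_less_eq[OF blk_strict_mono] by blast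
    then show "blk \<delta> j \<notin> dom (r |` {..<?\<beta>}) \<inter> {..<?\<beta>} \<union> dom q \<inter> {?\<beta>..}"
      using q(2) \<open>M \<le> j\<close> unfolding free_def by (auto simp: not_less[symmetric])
  qed
  ultimately show ?thesis using that r1(1) r(2) by blast
qed

lemma extend_bits:
  assumes q: "q \<in> conds" "free \<delta> (length t) q" "\<And>j. j < length t \<Longrightarrow> bit_eq \<delta> j (t ! j) q"
  shows "\<exists>r. leq r q \<and> free \<delta> (length (t @ t')) r \<and> (\<forall>j<length (t @ t'). bit_eq \<delta> j ((t @ t') ! j) r)"
proof (induction t' rule: rev_induct)
  case Nil
  then show ?case using q leq_refl by auto
next
  case (snoc b t')
  define M where "M = length (t @ t')"
  from snoc obtain r where r: "leq r q" "free \<delta> M r" "\<forall>j<M. bit_eq \<delta> j ((t @ t') ! j) r"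
    unfolding M_def by blast
  have rc: "r \<in> conds" using r(1) leq_conds by blast
  have "blk \<delta> M \<notin> dom r" using r(2) unfolding free_def by blast
  then obtain r' where r': "leq r' r" "dom r' \<subseteq> {..blk \<delta> M} \<union> dom r"
      "if b then gbit (blk \<delta> M) r' else f_not leq (gbit (blk \<delta> M)) r'"
    using bit_extend[OF rc] by metis
  have "free \<delta> (Suc M) r'"
    unfolding free_def
  proof (intro allI impI)
    fix j assume j: "Suc M \<le> j"
    then have "blk \<delta> M < blk \<delta> j" using strict_monoD[OF blk_strict_mono[of \<delta>], of M j] by simp
    moreover have "blk \<delta> j \<notin> dom r" using r(2) j unfolding free_def by simp
    ultimately show "blk \<delta> j \<notin> dom r'" using r'(2) by (auto simp: not_le[symmetric])
  qed
  moreover have "bit_eq \<delta> j (((t @ t') @ [b]) ! j) r'" if "j < Suc M" for j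
  proof (cases "j = M")
    case True
    then have "((t @ t') @ [b]) ! j = b" unfolding M_def by (simp only: nth_append_length)
    then show ?thesis using r'(3) True by (simp add: bit_eq_def)
  next
    case False
    then have "j < M" using that by simp
    then have "((t @ t') @ [b]) ! j = (t @ t') ! j" unfolding M_def by (subst nth_append) simp
    moreover have "bit_eq \<delta> j ((t @ t') ! j) r'"
      using r(3) \<open>j < M\<close> regular_mono[OF regular_bit_eq _ r'(1)] by blast
    ultimately show ?thesis by simp
  qed
  moreover have "leq r' q" using le_trans[OF r'(1) r(1)] .
  moreover have "length (t @ t' @ [b]) = Suc M" "t @ t' @ [b] = (t @ t') @ [b]" by (simp_all add: M_def)
  ultimately show ?case by (intro exI[of _ r']) (simp only:, blast)
qed

end

subsection \<open>The ideal\<close>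

context forcing_order
begin

section \<open>Ideals in the extension and maximality\<close>

lemma regular_ideal: "regular (f_ideal le J)"
  unfolding f_ideal_def by (intro regular_intros)

lemma bounded_iff:
  "f_ex le (\<lambda>m. f_all (\<lambda>n. f_imp le (gmem n a) (f_ground (n < m)))) p \<longleftrightarrow>
     (\<forall>q. le q p \<longrightarrow> (\<exists>r. le r q \<and> (\<exists>m. \<forall>n t. le t r \<longrightarrow> gmem n a t \<longrightarrow> n < (m :: nat))))"
  unfolding ex_iff all_iff imp_iff[OF regular_mem regular_ground] ground_iff by blast

lemma ideal_iff:
  "f_ideal le J p \<longleftrightarrow>
     (\<forall>a b q. le q p \<longrightarrow> rmem b J q \<longrightarrow> (\<forall>n r. le r q \<longrightarrow> gmem n a r \<longrightarrow> gmem n b r) \<longrightarrow> rmem a J q) \<and>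
     (\<forall>a b q. le q p \<longrightarrow> rmem a J q \<longrightarrow> rmem b J q \<longrightarrow>
        rmem (f_compr le (\<lambda>n. f_or le (gmem n a) (gmem n b))) J q) \<and>
     (\<forall>a m q. le q p \<longrightarrow> (\<forall>n r. le r q \<longrightarrow> gmem n a r \<longrightarrow> n < m) \<longrightarrow> rmem a J q) \<and>
     (\<forall>q. le q p \<longrightarrow> \<not> rmem (f_compr le (\<lambda>n. f_ground True)) J q)"
proof -
  have 1: "f_imp le (rmem b J \<^bold>\<and> f_subset le f_geq a b) (rmem a J) p \<longleftrightarrow>
      (\<forall>q. le q p \<longrightarrow> rmem b J q \<longrightarrow> (\<forall>n r. le r q \<longrightarrow> gmem n a r \<longrightarrow> gmem n b r) \<longrightarrow> rmem a J q)" for a b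
    by (subst imp_iff, (intro regular_intros)+) (simp only: and_iff subset_iff imp_conjL)
  have 2: "f_imp le (rmem a J \<^bold>\<and> rmem b J) (rmem (f_compr le (\<lambda>n. f_or le (gmem n a) (gmem n b))) J) p \<longleftrightarrow>
      (\<forall>q. le q p \<longrightarrow> rmem a J q \<longrightarrow> rmem b J q \<longrightarrow>
        rmem (f_compr le (\<lambda>n. f_or le (gmem n a) (gmem n b))) J q)" for a b
    by (subst imp_iff, (intro regular_intros)+) (simp only: and_iff imp_conjL)
  have 3: "f_imp le (f_ex le (\<lambda>m. f_all (\<lambda>n. f_imp le (gmem n a) (f_ground (n < m))))) (rmem a J) p \<longleftrightarrow>
      (\<forall>m q. le q p \<longrightarrow> (\<forall>n r. le r q \<longrightarrow> gmem n a r \<longrightarrow> n < m) \<longrightarrow> rmem a J q)" for a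
  proof -
    have "f_imp le (f_ex le (\<lambda>m. f_all (\<lambda>n. f_imp le (gmem n a) (f_ground (n < m))))) (rmem a J) p \<longleftrightarrow>
      (\<forall>q. le q p \<longrightarrow> (\<forall>q'. le q' q \<longrightarrow> (\<exists>r. le r q' \<and> (\<exists>m. \<forall>n t. le t r \<longrightarrow> gmem n a t \<longrightarrow> n < m))) \<longrightarrow> rmem a J q)"
      by (subst imp_iff, (intro regular_intros)+) (simp only: bounded_iff)
    also have "\<dots> \<longleftrightarrow> (\<forall>m q. le q p \<longrightarrow> (\<forall>n r. le r q \<longrightarrow> gmem n a r \<longrightarrow> n < m) \<longrightarrow> rmem a J q)"
    proof (intro iffI allI impI)
      fix m q
      assume *: "\<forall>q. le q p \<longrightarrow> (\<forall>q'. le q' q \<longrightarrow> (\<exists>r. le r q' \<and> (\<exists>m. \<forall>n t. le t r \<longrightarrow> gmem n a t \<longrightarrow> n < m))) \<longrightarrow> rmem a J q"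
        and q: "le q p" "\<forall>n r. le r q \<longrightarrow> gmem n a r \<longrightarrow> n < m"
      have "\<exists>r. le r q' \<and> (\<exists>m. \<forall>n t. le t r \<longrightarrow> gmem n a t \<longrightarrow> n < m)" if "le q' q" for q'
        using q(2) le_left[OF that] le_trans[OF _ that] by blast
      then show "rmem a J q" using * q(1) by blast
    next
      fix q
      assume *: "\<forall>m q. le q p \<longrightarrow> (\<forall>n r. le r q \<longrightarrow> gmem n a r \<longrightarrow> n < m) \<longrightarrow> rmem a J q"
        and q: "le q p" "\<forall>q'. le q' q \<longrightarrow> (\<exists>r. le r q' \<and> (\<exists>m. \<forall>n t. le t r \<longrightarrow> gmem n a t \<longrightarrow> n < m))"
      show "rmem a J q"
      proof (rule regular_dense[OF regular_mem le_left[OF q(1)]])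
        fix q' assume q': "le q' q"
        then obtain r m where r: "le r q'" "\<forall>n t. le t r \<longrightarrow> gmem n a t \<longrightarrow> n < m" using q(2) by blast
        have "le r p" using r(1) q' q(1) le_trans by blast
        then show "\<exists>r. le r q' \<and> rmem a J r" using * r by blast
      qed
    qed
    finally show ?thesis .
  qed
  show ?thesis
    unfolding f_ideal_def and_iff[of _ _ p] all_iff[of _ p] 1 2 3 not_iff[of _ p] ..
qed

lemma maximal_ideal_iff:
  "f_maximal_ideal le J p \<longleftrightarrow> f_ideal le J p \<and>
     (\<forall>K q. le q p \<longrightarrow> f_ideal le K q \<longrightarrow> f_subset le real_eq J K q \<longrightarrow> f_subset le real_eq K J q)"
proof -
  have "f_imp le (f_ideal le K \<^bold>\<and> f_subset le real_eq J K) (f_subset le real_eq K J) p \<longleftrightarrow>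
      (\<forall>q. le q p \<longrightarrow> f_ideal le K q \<longrightarrow> f_subset le real_eq J K q \<longrightarrow> f_subset le real_eq K J q)" for K
    by (subst imp_iff, (intro regular_intros regular_ideal)+) (simp only: and_iff imp_conjL)
  then show ?thesis unfolding f_maximal_ideal_def and_iff[of _ _ p] all_iff[of _ p] by simp
qed

lemma ideal_cong:
  assumes "\<And>a q. le q p \<Longrightarrow> rmem a J q \<longleftrightarrow> rmem a K q"
  shows "f_ideal le J p \<longleftrightarrow> f_ideal le K p"
  unfolding ideal_iff using assms by (simp cong: imp_cong)

lemma mem_name_mono: "\<sigma> \<subseteq> \<tau> \<Longrightarrow> f_mem le eq x \<sigma> p \<Longrightarrow> f_mem le eq x \<tau> p"
  unfolding f_mem_def by blast

lemma mem_Union_name: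
  assumes "equality eq"
  shows "f_mem le eq x (\<Union>C) p \<longleftrightarrow> (\<forall>q. le q p \<longrightarrow> (\<exists>r. le r q \<and> (\<exists>T\<in>C. f_mem le eq x T r)))"
proof
  assume *: "f_mem le eq x (\<Union>C) p"
  show "\<forall>q. le q p \<longrightarrow> (\<exists>r. le r q \<and> (\<exists>T\<in>C. f_mem le eq x T r))"
  proof (intro allI impI)
    fix q assume "le q p"
    then obtain r y s T where r: "le r q" "T \<in> C" "(y, s) \<in> T" "le r s" "eq x y r"
      using * unfolding f_mem_def by blast
    then have "f_mem le eq x T r" using mem_cong[OF assms r(5) memI[OF assms r(3,4)]] by blast
    then show "\<exists>r. le r q \<and> (\<exists>T\<in>C. f_mem le eq x T r)" using r by blast
  qed
next
  assume *: "\<forall>q. le q p \<longrightarrow> (\<exists>r. le r q \<and> (\<exists>T\<in>C. f_mem le eq x T r))"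
  show "f_mem le eq x (\<Union>C) p"
    unfolding f_mem_def
  proof (intro allI impI)
    fix q assume "le q p"
    then obtain r T where r: "le r q" "T \<in> C" "f_mem le eq x T r" using * by blast
    then obtain t where "le t r" "\<exists>(y, s)\<in>T. le t s \<and> eq x y t"
      using le_left[OF r(1)] unfolding f_mem_def by blast
    then show "\<exists>r. le r q \<and> (\<exists>(y, s)\<in>\<Union>C. le r s \<and> eq x y r)" using r(1,2) le_trans by blast
  qed
qed

text \<open>The chain is a chain of names in the ground model. Two members met at different
  conditions are comparable as sets of pairs, so a single one contains both elements below a common
  condition.\<close>

lemma ideal_Union:
  assumes C: "subset.chain UNIV C" "C \<noteq> {}" and ideal: "\<And>T p. T \<in> C \<Longrightarrow> le p p \<Longrightarrow> f_ideal le T p"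
    and p: "le p p"
  shows "f_ideal le (\<Union>C) p"
proof -
  have mem: "rmem a (\<Union>C) q \<longleftrightarrow> (\<forall>q'. le q' q \<longrightarrow> (\<exists>r. le r q' \<and> (\<exists>T\<in>C. rmem a T r)))" for a q
    by (rule mem_Union_name[OF equality_real])
  have I: "f_ideal le T r" if "T \<in> C" "le r q" for T r q using ideal[OF that(1)] le_left[OF that(2)] by blast
  note I = I[unfolded ideal_iff]
  show ?thesis
    unfolding ideal_iff
  proof (intro conjI allI impI notI)
    fix a b q assume q: "le q p" "rmem b (\<Union>C) q" "\<forall>n r. le r q \<longrightarrow> gmem n a r \<longrightarrow> gmem n b r"
    show "rmem a (\<Union>C) q"
      unfolding mem
    proof (intro allI impI)
      fix q' assume q': "le q' q"
      then obtain r T where r: "le r q'" "T \<in> C" "rmem b T r" using q(2) unfolding mem by blast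
      have "\<forall>n t. le t r \<longrightarrow> gmem n a t \<longrightarrow> gmem n b t" using q(3) r(1) q' le_trans by blast
      then have "rmem a T r" using I[OF r(2,1), THEN conjunct1] le_left[OF r(1)] r(3) by blast
      then show "\<exists>r. le r q' \<and> (\<exists>T\<in>C. rmem a T r)" using r by blast
    qed
  next
    fix a b q assume q: "le q p" "rmem a (\<Union>C) q" "rmem b (\<Union>C) q"
    show "rmem (f_compr le (\<lambda>n. f_or le (gmem n a) (gmem n b))) (\<Union>C) q"
      unfolding mem
    proof (intro allI impI)
      fix q' assume q': "le q' q"
      then obtain r1 T1 where 1: "le r1 q'" "T1 \<in> C" "rmem a T1 r1" using q(2) unfolding mem by blast
      have "le r1 q" using 1(1) q' le_trans by blast
      then obtain r2 T2 where 2: "le r2 r1" "T2 \<in> C" "rmem b T2 r2" using q(3) unfolding mem by blast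
      have "T1 \<subseteq> T2 \<or> T2 \<subseteq> T1" using C(1) 1(2) 2(2) by (meson subset_chain_def)
      then obtain T where T: "T \<in> C" "T1 \<subseteq> T" "T2 \<subseteq> T" using 1(2) 2(2) by blast
      have "rmem a T r2" "rmem b T r2"
        using mem_name_mono[OF T(2) mem_mono[OF 1(3) 2(1)]] mem_name_mono[OF T(3) 2(3)] .
      then have "rmem (f_compr le (\<lambda>n. f_or le (gmem n a) (gmem n b))) T r2"
        using I[OF T(1) 2(1), THEN conjunct2, THEN conjunct1] le_left[OF 2(1)] by blast
      moreover have "le r2 q'" using 1(1) 2(1) le_trans by blast
      ultimately show "\<exists>r. le r q' \<and> (\<exists>T\<in>C. rmem (f_compr le (\<lambda>n. f_or le (gmem n a) (gmem n b))) T r)"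
        using T(1) by blast
    qed
  next
    fix a :: "'p real_name" and m q assume q: "le q p" "\<forall>n r. le r q \<longrightarrow> gmem n a r \<longrightarrow> n < m"
    obtain T where T: "T \<in> C" using C(2) by blast
    have "rmem a T q"
      using I[OF T q(1), THEN conjunct2, THEN conjunct2, THEN conjunct1] le_left[OF q(1)] q(2) by blast
    then show "rmem a (\<Union>C) q" using mem_name_mono[of T "\<Union>C"] T by blast
  next
    fix q assume q: "le q p" "rmem (f_compr le (\<lambda>n. f_ground True)) (\<Union>C) q"
    then obtain r T where r: "le r q" "T \<in> C" "rmem (f_compr le (\<lambda>n. f_ground True)) T r"
      using le_left[OF q(1)] unfolding mem by blast
    then show False
      using I[OF r(2,1), THEN conjunct2, THEN conjunct2, THEN conjunct2] le_left[OF r(1)] by blast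
  qed
qed

text \<open>
  Zorn's lemma is applied in the ground model to the names of ideals that are saturated, i.e. contain
  all pairs \<open>(a, p)\<close> such that \<open>p\<close> forces \<open>a\<close> into the ideal; for these, inclusion in the extension
  amounts to inclusion of the names.
\<close>

definition saturation :: "'p set_name \<Rightarrow> 'p set_name" where
  "saturation T = f_compr le (\<lambda>a. rmem a T)"

lemma mem_saturation: "le p p \<Longrightarrow> rmem a (saturation T) p \<longleftrightarrow> rmem a T p"
  unfolding saturation_def
  by (rule mem_compr[OF equality_real regular_mem]) (auto intro: mem_cong[OF equality_real])

lemma ideal_saturation: "f_ideal le (saturation T) p \<longleftrightarrow> f_ideal le T p"
  by (rule ideal_cong) (use mem_saturation le_left in blast)

lemma ex_maximal_ideal:
  assumes J0: "\<And>p. le p p \<Longrightarrow> f_ideal le J0 p"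
  obtains J where "\<And>p. le p p \<Longrightarrow> f_maximal_ideal le J p" "\<And>a p. le p p \<Longrightarrow> rmem a J0 p \<Longrightarrow> rmem a J p"
proof -
  let ?Z = "{T. (\<forall>p. le p p \<longrightarrow> f_ideal le T p) \<and> saturation J0 \<subseteq> T \<and> saturation T = T}"
  have sat_sat: "saturation (saturation T) = saturation T" for T
    unfolding saturation_def[of "saturation T"] unfolding saturation_def[of T] f_compr_def
    using mem_saturation[of _ _ T] unfolding saturation_def f_compr_def by auto
  have sat_mono: "saturation S \<subseteq> saturation T" if "S \<subseteq> T" for S T
    using mem_name_mono[OF that] unfolding saturation_def f_compr_def by blast
  have "\<exists>M\<in>?Z. \<forall>X\<in>?Z. M \<subseteq> X \<longrightarrow> X = M"
  proof (rule subset_Zorn)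
    fix C assume C: "subset.chain ?Z C"
    show "\<exists>U\<in>?Z. \<forall>X\<in>C. X \<subseteq> U"
    proof (cases "C = {}")
      case True
      have "saturation J0 \<in> ?Z" using J0 sat_sat ideal_saturation by auto
      then show ?thesis using True by blast
    next
      case False
      have sub: "C \<subseteq> ?Z" using C by (meson subset_chain_def)
      have "subset.chain UNIV C" using C by (simp add: subset_chain_def)
      then have ideal: "f_ideal le (\<Union>C) p" if "le p p" for p
        by (rule ideal_Union[OF _ False]) (use sub that in blast)+
      obtain T where T: "T \<in> C" using False by blast
      have X: "X \<subseteq> saturation (\<Union>C)" if X: "X \<in> C" for X
      proof -
        have "X = saturation X" using X sub by auto
        also have "\<dots> \<subseteq> saturation (\<Union>C)" using X by (intro sat_mono) blast
        finally show ?thesis .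
      qed
      have "saturation J0 \<subseteq> T" using T sub by auto
      then have "saturation J0 \<subseteq> saturation (\<Union>C)" using X[OF T] by blast
      then have "saturation (\<Union>C) \<in> ?Z" using ideal ideal_saturation sat_sat by simp
      then show ?thesis using X by blast
    qed
  qed
  then obtain M where M: "\<And>p. le p p \<Longrightarrow> f_ideal le M p" "saturation J0 \<subseteq> M" "saturation M = M"
    and max: "\<And>X. X \<in> ?Z \<Longrightarrow> M \<subseteq> X \<Longrightarrow> X = M" by auto
  have maximal: "f_subset le real_eq K M q"
    if q: "le q q" and K: "f_ideal le K q" "f_subset le real_eq M K q" for K q
  proof -
    \<comment> \<open>The competing ideal K is known only below q, while Zorn's lemma needs a name
      that is an ideal everywhere. T mixes K where q is generic with M elsewhere;
      \<open>below\<close> is the regular sentence saying that q is generic. Since T is again a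
      saturated ideal containing M, it equals M, which yields the inclusion of K below q.\<close>
    define below where "below = (\<lambda>s. \<forall>s'. le s' s \<longrightarrow> (\<exists>t. le t s' \<and> le t q))"
    have reg_below: "regular below"
      unfolding below_def by (rule regularI) (meson le_trans, meson le_trans le_left)
    have below_q: "below s" if "le s q" for s
      unfolding below_def using that le_trans le_left by blast
    define \<phi> where "\<phi> a = f_or le (below \<^bold>\<and> rmem a K) (rmem a M)" for a
    have reg: "regular (\<phi> a)" for a unfolding \<phi>_def by (intro regular_intros reg_below)
    have cong: "\<phi> a s" if ab: "real_eq a b s" and b: "\<phi> b s" for a b s
      unfolding \<phi>_def or_iff
    proof (intro allI impI)
      fix s' assume "le s' s"
      then obtain r where r: "le r s'" "(below \<^bold>\<and> rmem b K) r \<or> rmem b M r"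
        using b unfolding \<phi>_def or_iff by blast
      have "real_eq a b r" using regular_mono[OF regular_set_eq ab le_trans[OF r(1) \<open>le s' s\<close>]] .
      then show "\<exists>r. le r s' \<and> ((below \<^bold>\<and> rmem a K) r \<or> rmem a M r)"
        using r mem_cong[OF equality_real] unfolding and_iff by blast
    qed
    define T where "T = f_compr le \<phi>"
    have memT: "rmem a T s \<longleftrightarrow> \<phi> a s" if "le s s" for a s
      unfolding T_def by (rule mem_compr[OF equality_real reg _ that]) (use cong in blast)
    have T_below: "rmem a T s \<longleftrightarrow> rmem a K s" if s: "le s q" for a s
    proof -
      have "\<phi> a s \<longleftrightarrow> rmem a K s"
      proof
        assume *: "\<phi> a s"
        show "rmem a K s"
        proof (rule regular_dense[OF regular_mem le_left[OF s]])
          fix s' assume s': "le s' s"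
          then obtain r where r: "le r s'" "(below \<^bold>\<and> rmem a K) r \<or> rmem a M r"
            using * unfolding \<phi>_def or_iff by blast
          have "le r q" using r(1) s' s le_trans by blast
          then have "rmem a K r" using r(2) K(2) unfolding and_iff subset_iff by blast
          then show "\<exists>r. le r s' \<and> rmem a K r" using r(1) by blast
        qed
      next
        assume *: "rmem a K s"
        then show "\<phi> a s" unfolding \<phi>_def or_iff and_iff
          using below_q s le_left le_trans mem_mono[OF *] by meson
      qed
      then show ?thesis using memT le_left[OF s] by blast
    qed
    have T_off: "rmem a T s \<longleftrightarrow> rmem a M s" if s: "le s s" "\<forall>t. le t s \<longrightarrow> \<not> le t q" for a s
    proof -
      have "\<not> below r" if "le r s" for r
        unfolding below_def using that s(2) le_left le_trans by blast
      then have "\<phi> a s \<longleftrightarrow> (\<forall>s'. le s' s \<longrightarrow> (\<exists>r. le r s' \<and> rmem a M r))"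
        unfolding \<phi>_def or_iff and_iff using le_trans by meson
      also have "\<dots> \<longleftrightarrow> rmem a M s"
      proof
        show "rmem a M s" if "\<forall>s'. le s' s \<longrightarrow> (\<exists>r. le r s' \<and> rmem a M r)"
          by (rule regular_dense[OF regular_mem s(1)]) (use that in blast)
        show "\<forall>s'. le s' s \<longrightarrow> (\<exists>r. le r s' \<and> rmem a M r)" if "rmem a M s"
          using mem_mono[OF that] le_left by blast
      qed
      finally show ?thesis using memT[OF s(1)] by blast
    qed
    have ideal: "f_ideal le T p" if p: "le p p" for p
    proof (rule regular_dense[OF regular_ideal p])
      fix p' assume p': "le p' p"
      show "\<exists>r. le r p' \<and> f_ideal le T r"
      proof (cases "\<exists>t. le t p' \<and> le t q")
        case True
        then obtain t where t: "le t p'" "le t q" by blast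
        have "f_ideal le K t" using K(1) t(2) regular_mono[OF regular_ideal] by blast
        moreover have "f_ideal le T t \<longleftrightarrow> f_ideal le K t"
          by (rule ideal_cong) (use T_below t(2) le_trans in blast)
        ultimately show ?thesis using t(1) by blast
      next
        case False
        have "f_ideal le T p' \<longleftrightarrow> f_ideal le M p'"
        proof (rule ideal_cong)
          fix a s assume s: "le s p'"
          then have "\<forall>t. le t s \<longrightarrow> \<not> le t q" using False le_trans by blast
          then show "rmem a T s \<longleftrightarrow> rmem a M s" using T_off le_left[OF s] by blast
        qed
        then show ?thesis using M(1) le_left[OF p'] by blast
      qed
    qed
    have satT: "saturation T = T"
      unfolding saturation_def using memT unfolding T_def f_compr_def by auto
    have "M \<subseteq> T"
    proof -
      have "\<phi> a s" if "rmem a M s" for a s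
        unfolding \<phi>_def or_iff using mem_mono[OF that] le_left by blast
      then have "saturation M \<subseteq> T" unfolding saturation_def T_def f_compr_def by blast
      then show ?thesis using M(3) by simp
    qed
    then have "T \<in> ?Z" using ideal M(2) satT by auto
    then have "T = M" using max \<open>M \<subseteq> T\<close> by blast
    then show ?thesis unfolding subset_iff using T_below by blast
  qed
  have 1: "f_maximal_ideal le M p" if "le p p" for p
    unfolding maximal_ideal_iff using M(1)[OF that] maximal le_left by blast
  have 2: "rmem a M p" if "le p p" "rmem a J0 p" for a p
    using mem_name_mono[OF M(2)] mem_saturation[OF that(1)] that(2) by blast
  show ?thesis by (rule that[OF 1 2])
qed

end

section \<open>Domination by the Cohen sequences\<close>

context fs_iteration_cc
begin

text \<open>The sets coded by lists are all the possible values of a clopen sequence. As there are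
  countably many codes, one stage supports all these sentences.\<close>

definition seq_supported :: "'o \<Rightarrow> ('o \<rightharpoonup> 'q) clopen_seq_name \<Rightarrow> bool" where
  "seq_supported \<delta> d \<longleftrightarrow> (\<forall>n l. supported \<delta> (gmem (n, clop l) d))"

definition dominated :: "('o \<rightharpoonup> 'q) clopen_seq_name \<Rightarrow> 'o \<Rightarrow> nat \<Rightarrow> ('o \<rightharpoonup> 'q) sentence" where
  "dominated d \<delta> n = f_ex leq (\<lambda>l. f_ex leq (\<lambda>l'.
     f_ground (clop l \<subseteq> clop l') \<^bold>\<and> gmem (n, clop l) d \<^bold>\<and> gmem (n, clop l') (cohen \<delta>)))"

lemma regular_dominated: "regular (dominated d \<delta> n)"
  unfolding dominated_def by (intro regular_intros)

lemma supported_dominated: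
  assumes "is_lim \<delta>'" "\<delta> < \<delta>'" "seq_supported \<delta> d"
  shows "supported \<delta>' (dominated d \<delta> n)"
proof -
  have "supported \<delta>' (gmem (n, clop l) d)" for l
    using supported_mono[of \<delta> "gmem (n, clop l) d" \<delta>'] assms(2,3) unfolding seq_supported_def by simp
  then show ?thesis
    unfolding dominated_def
    by (intro supported_ex supported_and supported_ground supported_cohen assms regular_intros)
qed

lemma ex_seq_supported:
  obtains \<alpha> where "\<And>\<delta>. \<alpha> \<le> \<delta> \<Longrightarrow> seq_supported \<delta> d"
proof -
  obtain \<alpha> where "\<And>i. supported \<alpha> (gmem (fst i, clop (snd i)) d)"
    using ex_supported_countable[of "\<lambda>i. gmem (fst i, clop (snd i)) d"] by auto
  from this[of "(n, l)" for n l] have "supported \<alpha> (gmem (n, clop l) d)" for n l by simp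
  then have "seq_supported \<delta> d" if "\<alpha> \<le> \<delta>" for \<delta>
    using supported_mono[of \<alpha> "gmem (n, clop l) d" \<delta> for n l] that unfolding seq_supported_def by simp
  then show ?thesis using that by blast
qed

lemma common_small:
  assumes "finite ds" "\<And>d. d \<in> ds \<Longrightarrow> f_Omega_bar leq d q" "leq q1 q"
  shows "\<exists>r m. leq r q1 \<and> (\<forall>d\<in>ds. \<forall>n l t. m \<le> n \<longrightarrow> leq t r \<longrightarrow> gmem (n, clop l) d t \<longrightarrow>
    measure coin (clop l) \<le> (1/2) ^ k)"
  using assms(1,2)
proof (induction ds rule: finite_induct)
  case empty
  then show ?case using le_left[OF assms(3)] by blast
next
  case (insert d ds)
  then obtain r m where r: "leq r q1" "\<And>d n l t. d \<in> ds \<Longrightarrow> m \<le> n \<Longrightarrow> leq t r \<Longrightarrow> gmem (n, clop l) d t \<Longrightarrow>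
      measure coin (clop l) \<le> (1/2) ^ k" by blast
  have "leq r q" using r(1) assms(3) le_trans by blast
  then obtain r' m' where r': "leq r' r" "\<And>n l t. m' \<le> n \<Longrightarrow> leq t r' \<Longrightarrow> gmem (n, clop l) d t \<Longrightarrow>
      measure coin (clop l) \<le> (1/2) ^ k"
    using Omega_bar_small[of d q r k] insert.prems by blast
  have "measure coin (clop l) \<le> (1/2) ^ k"
    if "e \<in> insert d ds" "max m m' \<le> n" "leq t r'" "gmem (n, clop l) e t" for e n l t
    using that r(2)[of e n t l] r'(2)[of n t l] le_trans[OF that(3) r'(1)] by auto
  then show ?case using le_trans[OF r'(1) r(1)] by blast
qed

lemma common_values:
  assumes "finite ds" "\<And>d. d \<in> ds \<Longrightarrow> f_clopen_seq leq d q" "leq t q"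
  shows "\<exists>r. leq r t \<and> (\<forall>d\<in>ds. \<exists>l. gmem (n, clop l) d r)"
  using assms(1,2)
proof (induction ds rule: finite_induct)
  case empty
  then show ?case using le_left[OF assms(3)] by blast
next
  case (insert d ds)
  then obtain r where r: "leq r t" "\<forall>d\<in>ds. \<exists>l. gmem (n, clop l) d r" by blast
  have "leq r q" using r(1) assms(3) le_trans by blast
  then obtain r' l where r': "leq r' r" "gmem (n, clop l) d r'"
    using clopen_seq_total[of d q r n] insert.prems by blast
  have "\<exists>l. gmem (n, clop l) e r'" if "e \<in> insert d ds" for e
    using that r(2) r'(2) mem_mono[of f_geq "(n, clop l)" e r r' for l] r'(1) by blast
  then show ?case using le_trans[OF r'(1) r(1)] by blast
qed

text \<open>The sentences \<psi> n describe an infinite set in the stage \<delta>. After deciding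
  the bits used so far, a large n satisfying \<psi> is chosen together with values of the d at n,
  and free bits are then used to write the union of these values into the Cohen sequence at place
  n.\<close>

lemma cohen_generic:
  assumes q: "q \<in> conds" and ds: "finite ds"
    and d: "\<And>d. d \<in> ds \<Longrightarrow> seq_supported \<delta> d" "\<And>d. d \<in> ds \<Longrightarrow> f_Omega_bar leq d q"
    and \<psi>: "\<And>n. regular (\<psi> n)" "\<And>n. supported \<delta> (\<psi> n)"
      "\<And>r m. leq r q \<Longrightarrow> \<exists>t n. leq t r \<and> m \<le> n \<and> \<psi> n t"
  shows "\<exists>r n. leq r q \<and> m0 \<le> n \<and> \<psi> n r \<and> (\<forall>d\<in>ds. dominated d \<delta> n r)"
proof -
  obtain M where M: "free \<delta> M q" using ex_free[OF q] by blast
  obtain q1 t0 where q1: "leq q1 q" "free \<delta> M q1" "length t0 = M" "\<And>j. j < M \<Longrightarrow> bit_eq \<delta> j (t0 ! j) q1"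
    using decide_bits[OF q M] by blast
  \<comment> \<open>One more than the nonempty entries already decoded, as
    \<open>decode_reach\<close> requires. Each of the sets is taken of measure at most 2^-(w + card
    ds); as card ds \<le> 2^(card ds), their union has a code of weight at most 2^-w.\<close>
  define w where "w = Suc (nonempty_count (fst (decode t0)))"
  define N where "N = max m0 (Suc (length (fst (decode t0))))"
  obtain r m where r: "leq r q1" and small: "\<And>d n l t. d \<in> ds \<Longrightarrow> m \<le> n \<Longrightarrow> leq t r \<Longrightarrow> gmem (n, clop l) d t \<Longrightarrow>
      measure coin (clop l) \<le> (1/2) ^ (w + card ds)"
    using common_small[OF ds d(2) q1(1), of "w + card ds"] by blast
  have "leq r q" using r q1(1) le_trans by blast
  then obtain t n where t: "leq t r" "max m N \<le> n" "\<psi> n t" using \<psi>(3) by blast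
  have "f_clopen_seq leq d q" if "d \<in> ds" for d using d(2)[OF that] unfolding f_Omega_bar_def and_iff by blast
  then obtain q2 where q2: "leq q2 t" "\<forall>d\<in>ds. \<exists>l. gmem (n, clop l) d q2"
    using common_values[OF ds, of q t n] le_trans[OF t(1) \<open>leq r q\<close>] by blast
  then obtain L where L: "\<And>d. d \<in> ds \<Longrightarrow> gmem (n, clop (L d)) d q2" by metis
  have "\<exists>l'. clop l' = clop (L d) \<and> weight l' = measure coin (clop (L d))" for d
    by (rule clopen_eq_clop[OF open_clop closed_clop, of "L d"]) blast
  then obtain L' where L': "\<And>d. clop (L' d) = clop (L d)" "\<And>d. weight (L' d) = measure coin (clop (L d))"
    by metis
  obtain dl where dl: "set dl = ds" "distinct dl" using finite_distinct_list[OF ds] by blast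
  define l where "l = concat (map L' dl)"
  have "weight l \<le> (1/2) ^ w"
  proof -
    have weight_concat: "weight (concat ls) = (\<Sum>l\<leftarrow>ls. weight l)" for ls
      by (induction ls) (auto simp: weight_def)
    have "weight l = (\<Sum>d\<in>ds. weight (L' d))"
      unfolding l_def weight_concat by (simp add: comp_def sum_list_distinct_conv_sum_set[OF dl(2)] dl(1))
    also have "\<dots> \<le> (\<Sum>d\<in>ds. (1/2) ^ (w + card ds))"
    proof (rule sum_mono)
      fix e assume e: "e \<in> ds"
      show "weight (L' e) \<le> (1/2) ^ (w + card ds)"
        unfolding L'(2) by (rule small[OF e _ le_trans[OF q2(1) t(1)] L[OF e]]) (use t(2) in simp)
    qed
    also have "\<dots> = real (card ds) / 2 ^ card ds * (1/2) ^ w" by (simp add: power_add field_simps)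
    also have "\<dots> \<le> 1 * (1/2) ^ w"
    proof (rule mult_right_mono)
      have "card ds \<le> 2 ^ card ds" using less_exp[of "card ds"] by simp
      then have "real (card ds) \<le> 2 ^ card ds" by (metis of_nat_le_iff of_nat_numeral of_nat_power)
      then show "real (card ds) / 2 ^ card ds \<le> 1" by simp
    qed simp
    finally show ?thesis by simp
  qed
  then obtain t' where t': "n < length (fst (decode (t0 @ t')))" "fst (decode (t0 @ t')) ! n = l"
    using decode_reach[of t0 n l] t(2) unfolding N_def w_def by auto
  have q1c: "q1 \<in> conds" using q1(1) leq_conds by blast
  have q2c: "q2 \<in> conds" using q2(1) leq_conds by blast
  have "leq q2 q1" using q2(1) t(1) r le_trans by blast
  then have le: "leq q2 (q1 |` {..<\<delta>})" using leq_restrict[OF q1c] le_trans by blast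
  \<comment> \<open>Choosing n and the values may have spoiled the free bits. But what has been
    decided is supported by \<delta>, so only the part of q2 below \<delta> is kept, and the tail of
    q1 with its free bits is restored.\<close>
  define q3 where "q3 = splice \<delta> (q2 |` {..<\<delta>}) q1"
  have q3: "leq q3 q1" "leq q3 (q2 |` {..<\<delta>})" unfolding q3_def using splice_stronger[OF q1c le] .
  have q3c: "q3 \<in> conds" using q3(1) leq_conds by blast
  have transfer_down: "\<phi> q3" if "supported \<delta> \<phi>" "regular \<phi>" "\<phi> q2" for \<phi>
    using that q2c q3(2) regular_mono unfolding supported_def by blast
  have "free \<delta> M q3"
    unfolding free_def q3_def dom_splice
  proof (intro allI impI)
    fix j assume "M \<le> j"
    moreover have "\<delta> \<le> blk \<delta> j" using strict_mono_less_eq[OF blk_strict_mono[of \<delta>], of 0 j] by simp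
    ultimately show "blk \<delta> j \<notin> dom (q2 |` {..<\<delta>}) \<inter> {..<\<delta>} \<union> dom q1 \<inter> {\<delta>..}"
      using q1(2) unfolding free_def by (auto simp: not_less[symmetric])
  qed
  moreover have "bit_eq \<delta> j (t0 ! j) q3" if "j < M" for j
    using q1(4)[OF that] q3(1) regular_mono[OF regular_bit_eq] by blast
  ultimately obtain q4 where q4: "leq q4 q3" "\<forall>j<length (t0 @ t'). bit_eq \<delta> j ((t0 @ t') ! j) q4"
    using extend_bits[OF q3c, of \<delta> t0 t'] q1(3) by blast
  have q4c: "q4 \<in> conds" using q4(1) leq_conds by blast
  have coh: "gmem (n, clop l) (cohen \<delta>) q4"
    using cohen_of_bits[OF q4c, of "t0 @ t'" \<delta> n] q4(2) t' by simp
  have "dominated e \<delta> n q4" if e: "e \<in> ds" for e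
  proof -
    have "gmem (n, clop (L e)) e q3"
      by (rule transfer_down[OF _ regular_mem L[OF e]]) (use d(1)[OF e] in \<open>simp add: seq_supported_def\<close>)
    then have "gmem (n, clop (L e)) e q4" using q4(1) by (rule mem_mono)
    moreover have "clop (L e) \<subseteq> clop l"
    proof -
      have "clop (L' e) \<subseteq> clop l" using e dl(1) unfolding l_def clop_def by auto
      then show ?thesis using L'(1) by simp
    qed
    ultimately show ?thesis
      unfolding dominated_def using coh
      by (intro exI_forced[of _ "L e"] exI_forced[of _ l] regular_intros) (simp add: and_iff ground_iff)
  qed
  moreover have "\<psi> n q4"
    using transfer_down[OF \<psi>(2,1)] regular_mono[OF \<psi>(1) t(3) q2(1)] regular_mono[OF \<psi>(1) _ q4(1)] by blast
  moreover have "leq q4 q" using q4(1) q3(1) q1(1) le_trans by blast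
  moreover have "m0 \<le> n" using t(2) unfolding N_def by simp
  ultimately show ?thesis by blast
qed

text \<open>Induction on the limits occurring in S, the largest being inserted last. Domination at
  the smaller limits is supported by the largest one because it is a limit, and by the induction
  hypothesis it recurs at arbitrarily large n below every extension; so it serves as \<psi> in
  \<open>cohen_generic\<close>.\<close>

lemma dominated_fip_aux:
  assumes "finite A"
  shows "\<And>S q m0. finite S \<Longrightarrow> fst ` S \<subseteq> A \<Longrightarrow> (\<And>\<delta> d. (\<delta>, d) \<in> S \<Longrightarrow> is_lim \<delta> \<and> seq_supported \<delta> d \<and> f_Omega_bar leq d q) \<Longrightarrow>
    q \<in> conds \<Longrightarrow> \<exists>r n. leq r q \<and> (m0 :: nat) \<le> n \<and> (\<forall>(\<delta>, d)\<in>S. dominated d \<delta> n r)"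
  using assms
proof (induction A rule: finite_linorder_max_induct)
  case empty
  then show ?case using leq_refl by auto
next
  case (insert \<delta> A)
  define S' where "S' = {x \<in> S. fst x \<in> A}"
  define ds where "ds = snd ` {x \<in> S. fst x = \<delta>}"
  have fin: "finite S'" "finite ds" using insert.prems(1) by (simp_all add: S'_def ds_def)
  have S': "fst ` S' \<subseteq> A" by (auto simp: S'_def)
  define \<psi> where "\<psi> n = (\<lambda>r. \<forall>x\<in>S'. dominated (snd x) (fst x) n r)" for n
  have sup: "supported \<delta> (dominated (snd x) (fst x) n)" if "is_lim \<delta>" "x \<in> S'" for x n
    using supported_dominated[of \<delta> "fst x" "snd x" n] insert.hyps insert.prems(3)[of "fst x" "snd x"] that
    by (auto simp: S'_def)
  show ?case
  proof (cases "ds = {}")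
    case True
    then have "fst x \<noteq> \<delta>" if "x \<in> S" for x using that by (cases x) (auto simp: ds_def)
    then have "fst ` S \<subseteq> A" using insert.prems(2) by blast
    then show ?thesis using insert.IH[OF insert.prems(1) _ insert.prems(3,4)] by blast
  next
    case False
    then have lim: "is_lim \<delta>" using insert.prems(3) by (auto simp: ds_def)
    have "\<exists>r n. leq r q \<and> m0 \<le> n \<and> \<psi> n r \<and> (\<forall>d\<in>ds. dominated d \<delta> n r)"
    proof (rule cohen_generic[OF insert.prems(4) fin(2)])
      show "seq_supported \<delta> d" "f_Omega_bar leq d q" if "d \<in> ds" for d
        using that insert.prems(3) by (auto simp: ds_def)
      show "regular (\<psi> n)" for n unfolding \<psi>_def by (intro regular_ball regular_dominated)
      show "supported \<delta> (\<psi> n)" for n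
        using sup[OF lim] unfolding \<psi>_def supported_def by blast
      show "\<exists>t n. leq t r \<and> m \<le> n \<and> \<psi> n t" if r: "leq r q" for r m
      proof -
        have "is_lim \<gamma> \<and> seq_supported \<gamma> d \<and> f_Omega_bar leq d r" if "(\<gamma>, d) \<in> S'" for \<gamma> d
          using that insert.prems(3)[of \<gamma> d] regular_mono[OF regular_Omega_bar _ r] by (auto simp: S'_def)
        from insert.IH[OF fin(1) S' this leq_conds(1)[OF r], of m] show ?thesis
          unfolding \<psi>_def by (auto simp: case_prod_beta)
      qed
    qed
    then obtain r n where r: "leq r q" "m0 \<le> n" "\<psi> n r" "\<forall>d\<in>ds. dominated d \<delta> n r" by blast
    have "dominated e \<gamma> n r" if "(\<gamma>, e) \<in> S" for \<gamma> e
    proof (cases "\<gamma> = \<delta>")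
      case True
      then have "e \<in> ds" using that by (force simp: ds_def)
      then show ?thesis using r(4) True by blast
    next
      case False
      then have "(\<gamma>, e) \<in> S'" using that insert.prems(2) by (force simp: S'_def)
      then show ?thesis using r(3) unfolding \<psi>_def by fastforce
    qed
    then show ?thesis using r(1,2) by blast
  qed
qed

lemma dominated_fip:
  assumes "finite S" "\<And>\<delta> d. (\<delta>, d) \<in> S \<Longrightarrow> is_lim \<delta> \<and> seq_supported \<delta> d \<and> f_Omega_bar leq d q" "q \<in> conds"
  obtains r n where "leq r q" "(m0 :: nat) \<le> n" "\<And>\<delta> d. (\<delta>, d) \<in> S \<Longrightarrow> dominated d \<delta> n r"
  using dominated_fip_aux[of "fst ` S" S q m0] assms by fastforce

definition base :: "('o \<rightharpoonup> 'q) real_name \<Rightarrow> ('o \<rightharpoonup> 'q) \<Rightarrow> bool" where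
  "base a q \<longleftrightarrow> (\<exists>S m. finite S \<and> (\<forall>(\<delta>, d)\<in>S. is_lim \<delta> \<and> seq_supported \<delta> d \<and> f_Omega_bar leq d q) \<and>
     (\<forall>n r. m \<le> n \<longrightarrow> leq r q \<longrightarrow> gmem n a r \<longrightarrow> \<not> (\<forall>(\<delta>, d)\<in>S. dominated d \<delta> n r)))"

definition in_J0 :: "('o \<rightharpoonup> 'q) real_name \<Rightarrow> ('o \<rightharpoonup> 'q) sentence" where
  "in_J0 a p \<longleftrightarrow> (\<forall>q. leq q p \<longrightarrow> (\<exists>r. leq r q \<and> base a r))"

definition J0 :: "('o \<rightharpoonup> 'q) set_name" where
  "J0 = f_compr leq in_J0"

lemma base_mono: "base a q \<Longrightarrow> leq r q \<Longrightarrow> base a r"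
proof -
  assume q: "base a q" and r: "leq r q"
  obtain S m where S: "finite S" "\<forall>(\<delta>, d)\<in>S. is_lim \<delta> \<and> seq_supported \<delta> d \<and> f_Omega_bar leq d q"
    "\<forall>n r. m \<le> n \<longrightarrow> leq r q \<longrightarrow> gmem n a r \<longrightarrow> \<not> (\<forall>(\<delta>, d)\<in>S. dominated d \<delta> n r)"
    using q unfolding base_def by (elim exE conjE)
  have "\<forall>(\<delta>, d)\<in>S. is_lim \<delta> \<and> seq_supported \<delta> d \<and> f_Omega_bar leq d r"
    using S(2) regular_mono[OF regular_Omega_bar _ r] by blast
  moreover have "\<forall>n t. m \<le> n \<longrightarrow> leq t r \<longrightarrow> gmem n a t \<longrightarrow> \<not> (\<forall>(\<delta>, d)\<in>S. dominated d \<delta> n t)"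
    using S(3) le_trans[OF _ r] by blast
  ultimately show "base a r" using S(1) unfolding base_def by blast
qed

lemma regular_in_J0: "regular (in_J0 a)"
  unfolding in_J0_def by (rule regularI) (meson le_trans, meson le_trans le_left)

lemma base_subset:
  assumes "base b q" "\<And>n r. leq r q \<Longrightarrow> gmem n a r \<Longrightarrow> gmem n b r"
  shows "base a q"
proof -
  obtain S m where S: "finite S" "\<forall>(\<delta>, d)\<in>S. is_lim \<delta> \<and> seq_supported \<delta> d \<and> f_Omega_bar leq d q"
    "\<forall>n r. m \<le> n \<longrightarrow> leq r q \<longrightarrow> gmem n b r \<longrightarrow> \<not> (\<forall>(\<delta>, d)\<in>S. dominated d \<delta> n r)"
    using assms(1) unfolding base_def by (elim exE conjE)
  have "\<forall>n r. m \<le> n \<longrightarrow> leq r q \<longrightarrow> gmem n a r \<longrightarrow> \<not> (\<forall>(\<delta>, d)\<in>S. dominated d \<delta> n r)"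
    using S(3) assms(2) by blast
  then show ?thesis using S(1,2) unfolding base_def by blast
qed

lemma mem_J0:
  assumes "leq p p"
  shows "rmem a J0 p \<longleftrightarrow> in_J0 a p"
  unfolding J0_def
proof (rule mem_compr[OF equality_real regular_in_J0 _ assms])
  fix a b q assume eq: "real_eq a b q" and b: "in_J0 b q"
  show "in_J0 a q"
    unfolding in_J0_def
  proof (intro allI impI)
    fix q' assume q': "leq q' q"
    then obtain r where r: "leq r q'" "base b r" using b unfolding in_J0_def by blast
    have "agree r (gmem n a) (gmem n b)" for n
      using agree_mono[OF agree_gmem[OF eq]] le_trans[OF r(1) q'] by blast
    then have "base a r" using base_subset[OF r(2)] agreeD by blast
    then show "\<exists>r. leq r q' \<and> base a r" using r(1) by blast
  qed
qed

lemma base_empty: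
  assumes "\<forall>n r. leq r q \<longrightarrow> gmem n a r \<longrightarrow> n < m"
  shows "base a q"
  unfolding base_def using assms by (intro exI[of _ "{}"] exI[of _ m]) force

lemma base_union:
  assumes a: "base a q" and b: "base b q"
  shows "base (f_compr leq (\<lambda>n. f_or leq (gmem n a) (gmem n b))) q"
proof -
  obtain S m where S: "finite S" "\<forall>(\<delta>, d)\<in>S. is_lim \<delta> \<and> seq_supported \<delta> d \<and> f_Omega_bar leq d q"
    "\<And>n r. m \<le> n \<Longrightarrow> leq r q \<Longrightarrow> gmem n a r \<Longrightarrow> \<not> (\<forall>(\<delta>, d)\<in>S. dominated d \<delta> n r)"
    using a unfolding base_def by blast
  obtain S' m' where S': "finite S'" "\<forall>(\<delta>, d)\<in>S'. is_lim \<delta> \<and> seq_supported \<delta> d \<and> f_Omega_bar leq d q"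
    "\<And>n r. m' \<le> n \<Longrightarrow> leq r q \<Longrightarrow> gmem n b r \<Longrightarrow> \<not> (\<forall>(\<delta>, d)\<in>S'. dominated d \<delta> n r)"
    using b unfolding base_def by blast
  have "\<not> (\<forall>(\<delta>, d)\<in>S \<union> S'. dominated d \<delta> n r)"
    if "max m m' \<le> n" "leq r q" and mem: "gmem n (f_compr leq (\<lambda>n. f_or leq (gmem n a) (gmem n b))) r" for n r
  proof
    assume dom: "\<forall>(\<delta>, d)\<in>S \<union> S'. dominated d \<delta> n r"
    have rr: "leq r r" using that(2) le_left by blast
    have "f_or leq (gmem n a) (gmem n b) r"
      using mem mem_compr_geq[of "\<lambda>n. f_or leq (gmem n a) (gmem n b)", OF regular_or[OF regular_mem regular_mem] rr]
      by blast
    then obtain t where t: "leq t r" "gmem n a t \<or> gmem n b t" using rr unfolding or_iff by blast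
    have "\<forall>(\<delta>, d)\<in>S \<union> S'. dominated d \<delta> n t" using dom t(1) regular_mono[OF regular_dominated] by fast
    then show False using S(3)[of n t] S'(3)[of n t] t le_trans[OF t(1) that(2)] that(1) by auto
  qed
  then show ?thesis
    unfolding base_def using S(1,2) S'(1,2) by (intro exI[of _ "S \<union> S'"] exI[of _ "max m m'"]) blast
qed

text \<open>Only properness has content: if \<omega> were a member, an n provided by
  \<open>dominated_fip\<close> beyond the bound m would contradict the witness.\<close>

lemma ideal_J0:
  assumes p: "leq p p"
  shows "f_ideal leq J0 p"
proof -
  have mem: "rmem a J0 q \<longleftrightarrow> in_J0 a q" if "leq q p" for a q using mem_J0 le_left[OF that] by blast
  show ?thesis
    unfolding ideal_iff
  proof (intro conjI allI impI notI)
    fix a b q assume q: "leq q p" "rmem b J0 q" "\<forall>n r. leq r q \<longrightarrow> gmem n a r \<longrightarrow> gmem n b r"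
    have "in_J0 a q"
      unfolding in_J0_def
    proof (intro allI impI)
      fix q' assume q': "leq q' q"
      then obtain r where r: "leq r q'" "base b r" using q(2) mem[OF q(1)] unfolding in_J0_def by blast
      then have "base a r" using base_subset[OF r(2)] q(3) q' le_trans by blast
      then show "\<exists>r. leq r q' \<and> base a r" using r(1) by blast
    qed
    then show "rmem a J0 q" using mem[OF q(1)] by blast
  next
    fix a b q assume q: "leq q p" "rmem a J0 q" "rmem b J0 q"
    have "in_J0 (f_compr leq (\<lambda>n. f_or leq (gmem n a) (gmem n b))) q"
      unfolding in_J0_def
    proof (intro allI impI)
      fix q' assume q': "leq q' q"
      then obtain r where r: "leq r q'" "base a r" using q(2) mem[OF q(1)] unfolding in_J0_def by blast
      have "leq r q" using r(1) q' le_trans by blast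
      then obtain r' where r': "leq r' r" "base b r'" using q(3) mem[OF q(1)] unfolding in_J0_def by blast
      then show "\<exists>r. leq r q' \<and> base (f_compr leq (\<lambda>n. f_or leq (gmem n a) (gmem n b))) r"
        using base_union[OF base_mono[OF r(2) r'(1)] r'(2)] le_trans[OF r'(1) r(1)] by blast
    qed
    then show "rmem (f_compr leq (\<lambda>n. f_or leq (gmem n a) (gmem n b))) J0 q" using mem[OF q(1)] by blast
  next
    fix a :: "('o \<rightharpoonup> 'q) real_name" and m q assume q: "leq q p" "\<forall>n r. leq r q \<longrightarrow> gmem n a r \<longrightarrow> n < m"
    have "base a q" using base_empty[OF q(2)] .
    then have "in_J0 a q" unfolding in_J0_def using base_mono le_left by blast
    then show "rmem a J0 q" using mem[OF q(1)] by blast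
  next
    fix q assume q: "leq q p" "rmem (f_compr leq (\<lambda>n. f_ground True)) J0 q"
    then obtain r where r: "leq r q" "base (f_compr leq (\<lambda>n. f_ground True)) r"
      using mem[OF q(1)] le_left[OF q(1)] unfolding in_J0_def by blast
    then obtain S m where S: "finite S" "\<forall>(\<delta>, d)\<in>S. is_lim \<delta> \<and> seq_supported \<delta> d \<and> f_Omega_bar leq d r"
      "\<And>n t. m \<le> n \<Longrightarrow> leq t r \<Longrightarrow> gmem n (f_compr leq (\<lambda>n. f_ground True)) t \<Longrightarrow> \<not> (\<forall>(\<delta>, d)\<in>S. dominated d \<delta> n t)"
      unfolding base_def by blast
    obtain t n where t: "leq t r" "m \<le> n" "\<And>\<delta> d. (\<delta>, d) \<in> S \<Longrightarrow> dominated d \<delta> n t"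
      using dominated_fip[OF S(1) _ leq_conds(1)[OF r(1)], of m] S(2) by blast
    have "gmem n (f_compr leq (\<lambda>n. f_ground True)) t"
      using mem_compr_geq[of "\<lambda>n. f_ground True", OF regular_ground le_left[OF t(1)]] by (simp add: ground_iff)
    then show False using S(3)[OF t(2,1)] t(3) by blast
  qed
qed

lemma in_nth_dominated:
  assumes "dominated d \<delta> n p" "f_clopen_seq leq d p" "f_in_nth leq x d n p"
  shows "f_in_nth leq x (cohen \<delta>) n p"
  unfolding f_in_nth_def ex_iff and_iff
proof (intro allI impI)
  fix q assume q: "leq q p"
  then obtain r C where r: "leq r q" "gmem (n, C) d r" "f_in_clopen leq x C r"
    using assms(3) unfolding f_in_nth_def ex_iff and_iff by blast
  have rp: "leq r p" using r(1) q le_trans by blast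
  obtain t l where t: "leq t r" "f_ex leq (\<lambda>l'. f_ground (clop l \<subseteq> clop l') \<^bold>\<and> gmem (n, clop l) d \<^bold>\<and>
      gmem (n, clop l') (cohen \<delta>)) t"
    using assms(1) rp unfolding dominated_def ex_iff[of "\<lambda>l. f_ex leq (F l)" for F] by blast
  then obtain t' l' where t': "leq t' t" "clop l \<subseteq> clop l'" "gmem (n, clop l) d t'" "gmem (n, clop l') (cohen \<delta>) t'"
    using le_left[OF t(1)] unfolding ex_iff and_iff ground_iff by blast
  have t'r: "leq t' r" using t'(1) t(1) le_trans by blast
  have "C = clop l"
    using assms(2)[unfolded f_clopen_seq_def function_iff, THEN conjunct2, THEN conjunct2]
      le_trans[OF t'r rp] mem_mono[OF r(2) t'r] t'(3) by blast
  have "f_in_clopen leq x (clop l') t'"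
    unfolding f_in_clopen_def ex_iff and_iff ground_iff
    using regular_mono[OF regular_in_clopen r(3) t'r] t'(2) \<open>C = clop l\<close>
    unfolding f_in_clopen_def ex_iff and_iff ground_iff by blast
  then show "\<exists>r. leq r q \<and> (\<exists>C. gmem (n, C) (cohen \<delta>) r \<and> f_in_clopen leq x C r)"
    using t'(4) le_trans[OF t'r r(1)] by blast
qed

text \<open>The set where inclusion fails is disjoint from the generator given by the single pair of
  \<delta> and d, without any finite exception.\<close>

lemma le_cohen_J0:
  assumes p: "leq p p" and \<delta>: "is_lim \<delta>" "seq_supported \<delta> d" and d: "f_Omega_bar leq d p"
  shows "rmem (f_compr leq (\<lambda>n. f_not leq (f_all (\<lambda>x. f_imp leq (f_in_nth leq x d n) (f_in_nth leq x (cohen \<delta>) n))))) J0 p"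
    (is "rmem (f_compr leq ?\<phi>) J0 p")
proof -
  have reg: "regular (?\<phi> n)" for n by (intro regular_intros regular_in_nth)
  have "base (f_compr leq ?\<phi>) p"
    unfolding base_def
  proof (intro exI[of _ "{(\<delta>, d)}"] exI[of _ 0] conjI allI impI)
    fix n r assume r: "leq r p" "gmem n (f_compr leq ?\<phi>) r"
    have "?\<phi> n r" using r(2) mem_compr_geq[of ?\<phi>, OF reg le_left[OF r(1)]] by blast
    moreover have "f_all (\<lambda>x. f_imp leq (f_in_nth leq x d n) (f_in_nth leq x (cohen \<delta>) n)) r"
      if dom: "dominated d \<delta> n r"
      unfolding all_iff imp_iff[OF regular_in_nth regular_in_nth]
    proof (intro allI impI)
      fix x q assume q: "leq q r" "f_in_nth leq x d n q"
      have "f_Omega_bar leq d q" using regular_mono[OF regular_Omega_bar d le_trans[OF q(1) r(1)]] .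
      then show "f_in_nth leq x (cohen \<delta>) n q"
        using in_nth_dominated[OF regular_mono[OF regular_dominated dom q(1)] _ q(2)]
        unfolding f_Omega_bar_def and_iff by blast
    qed
    ultimately show "\<not> (\<forall>(\<delta>, d)\<in>{(\<delta>, d)}. dominated d \<delta> n r)"
      using le_left[OF r(1)] unfolding not_iff by blast
  qed (use \<delta> d in auto)
  then have "in_J0 (f_compr leq ?\<phi>) p" unfolding in_J0_def using base_mono le_left by blast
  then show ?thesis using mem_J0[OF p] by blast
qed

end

subsection \<open>Scales\<close>

context forcing_order
begin

lemma not_ex_iff:
  assumes "\<And>x. regular (\<phi> x)"
  shows "f_not le (f_ex le \<phi>) p \<longleftrightarrow> (\<forall>x q. le q p \<longrightarrow> \<not> \<phi> x q)"
  unfolding not_iff ex_iff using regular_mono[OF assms] le_left le_trans by meson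

lemma least_sizeI:
  assumes reg: "\<And>F. regular (\<Phi> F)" and eq: "equality eq" and p: "le p p"
    and F0: "\<Phi> F0 p" "f_embeds le eq F0 (Field \<kappa>) p"
    and min: "\<And>F q. le q p \<Longrightarrow> \<Phi> F q \<Longrightarrow> \<not> f_size_less le eq F \<kappa> q"
  shows "f_least_size le eq \<Phi> \<kappa> p"
proof -
  have "f_ex le (\<lambda>F. \<Phi> F \<^bold>\<and> f_embeds le eq F (Field \<kappa>)) p"
    by (rule exI_forced[of _ F0]) (use F0 reg regular_embeds[OF eq] in \<open>auto simp: and_iff\<close>)
  moreover have "f_imp le (\<Phi> F) (f_not le (f_size_less le eq F \<kappa>)) p" for F
    unfolding imp_iff[OF reg regular_not[OF regular_size_less[OF eq]]] not_iff
    using min le_trans regular_mono[OF reg] by blast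
  ultimately show ?thesis unfolding f_least_size_def and_iff[of _ _ p] all_iff[of _ p] by blast
qed

text \<open>An ideal contains no cofinite set, since adding the bounded remainder would put \<omega>
  into it.\<close>

lemma ideal_infinite:
  assumes J: "f_ideal le J p" and p: "le p p" and a: "rmem a J p"
    and cofinite: "\<And>n r. le r p \<Longrightarrow> m \<le> n \<Longrightarrow> gmem n a r"
  shows False
proof -
  let ?b = "f_compr le (\<lambda>n. f_ground (n < m))"
  have b: "gmem n ?b r \<longleftrightarrow> n < m" if "le r p" for n r
    using mem_compr_geq[of "\<lambda>n. f_ground (n < m)", OF regular_ground le_left[OF that]] by (simp add: ground_iff)
  note J = J[unfolded ideal_iff]
  have "rmem ?b J p" using J[THEN conjunct2, THEN conjunct2, THEN conjunct1] p b by blast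
  then have u: "rmem (f_compr le (\<lambda>n. f_or le (gmem n a) (gmem n ?b))) J p"
    using J[THEN conjunct2, THEN conjunct1] p a by blast
  have "gmem n (f_compr le (\<lambda>n. f_or le (gmem n a) (gmem n ?b))) r" if r: "le r p" for n r
  proof -
    have "f_or le (gmem n a) (gmem n ?b) r"
      unfolding or_iff
    proof (intro allI impI)
      fix q assume q: "le q r"
      have qp: "le q p" using q r le_trans by blast
      have "gmem n a q \<or> gmem n ?b q" using cofinite[OF qp, of n] b[OF qp, of n] by linarith
      then show "\<exists>t. le t q \<and> (gmem n a t \<or> gmem n ?b t)" using le_left[OF q] by blast
    qed
    then show ?thesis
      using mem_compr_geq[of "\<lambda>n. f_or le (gmem n a) (gmem n ?b)", OF regular_or[OF regular_mem regular_mem] le_left[OF r]]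
      by blast
  qed
  then have "rmem (f_compr le (\<lambda>n. f_ground True)) J p"
    using J[THEN conjunct1] p u by blast
  then show False using J[THEN conjunct2, THEN conjunct2, THEN conjunct2] p by blast
qed

lemma ideal_subset_union:
  assumes J: "f_ideal le J p" and p: "le p p" and ab: "rmem a J p" "rmem b J p"
    and sub: "\<And>n r. le r p \<Longrightarrow> gmem n c r \<Longrightarrow> \<exists>t. le t r \<and> (gmem n a t \<or> gmem n b t)"
  shows "rmem c J p"
proof -
  note J = J[unfolded ideal_iff]
  have u: "rmem (f_compr le (\<lambda>n. f_or le (gmem n a) (gmem n b))) J p"
    using J[THEN conjunct2, THEN conjunct1] p ab by blast
  have "gmem n (f_compr le (\<lambda>n. f_or le (gmem n a) (gmem n b))) r" if r: "le r p" "gmem n c r" for n r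
  proof -
    have "f_or le (gmem n a) (gmem n b) r"
      unfolding or_iff using sub le_trans[OF _ r(1)] mem_mono[OF r(2)] by blast
    then show ?thesis
      using mem_compr_geq[of "\<lambda>n. f_or le (gmem n a) (gmem n b)", OF regular_or[OF regular_mem regular_mem] le_left[OF r(1)]]
      by blast
  qed
  then show ?thesis using J[THEN conjunct1] p u by blast
qed

definition incl :: "'p clopen_seq_name \<Rightarrow> 'p clopen_seq_name \<Rightarrow> nat \<Rightarrow> 'p sentence" where
  "incl c d n = f_all (\<lambda>x. f_imp le (f_in_nth le x c n) (f_in_nth le x d n))"

definition bad :: "'p clopen_seq_name \<Rightarrow> 'p clopen_seq_name \<Rightarrow> 'p real_name" where
  "bad c d = f_compr le (\<lambda>n. f_not le (incl c d n))"

lemma le_J_eq: "f_le_J le J c d = rmem (bad c d) J"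
  unfolding f_le_J_def bad_def incl_def ..

lemma regular_incl: "regular (incl c d n)"
  unfolding incl_def by (intro regular_intros regular_in_nth)

lemma incl_iff: "incl c d n p \<longleftrightarrow> (\<forall>x q. le q p \<longrightarrow> f_in_nth le x c n q \<longrightarrow> f_in_nth le x d n q)"
  unfolding incl_def all_iff imp_iff[OF regular_in_nth regular_in_nth] by blast

lemma mem_bad: "le p p \<Longrightarrow> gmem n (bad c d) p \<longleftrightarrow> f_not le (incl c d n) p"
  unfolding bad_def by (rule mem_compr_geq) (intro regular_not regular_incl)

lemma le_J_cong:
  assumes "f_set_eq le f_geq c c' p" "f_le_J le J c' d p"
  shows "f_le_J le J c d p"
proof -
  have "agree p (gmem n (bad c d)) (gmem n (bad c' d))" for n
    unfolding bad_def incl_def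
    by (intro agree_compr agree_not agree_all agree_imp agree_in_nth_seq agree_refl assms
        regular_intros regular_in_nth)
  then have "real_eq (bad c d) (bad c' d) p" unfolding set_eq_iff[OF equality_geq] agree_def by blast
  then show ?thesis using mem_cong[OF equality_real] assms(2) unfolding le_J_eq by blast
qed

text \<open>Where the inclusion of c in e fails, the one of c in d or the one of d in e fails. Which
  of the two depends on the generic filter, so both are decided first.\<close>

lemma le_J_trans:
  assumes J: "f_ideal le J p" and p: "le p p" and cd: "f_le_J le J c d p" "f_le_J le J d e p"
  shows "f_le_J le J c e p"
  unfolding le_J_eq
proof (rule ideal_subset_union[OF J p cd[unfolded le_J_eq]])
  fix n r assume r: "le r p" "gmem n (bad c e) r"
  have nce: "f_not le (incl c e n) r" using r mem_bad le_left by blast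
  obtain t where t: "le t r" "incl c d n t \<or> f_not le (incl c d n) t" using decide le_left[OF r(1)] by metis
  obtain t' where t': "le t' t" "incl d e n t' \<or> f_not le (incl d e n) t'" using decide le_left[OF t(1)] by metis
  have "f_not le (incl c d n) t' \<or> f_not le (incl d e n) t'"
  proof (rule ccontr)
    assume no: "\<not> ?thesis"
    then have "\<not> f_not le (incl c d n) t" using regular_mono[OF regular_not[OF regular_incl] _ t'(1)] by blast
    then have "incl c d n t'" using t(2) regular_mono[OF regular_incl _ t'(1)] by blast
    moreover have "incl d e n t'" using no t'(2) by blast
    ultimately have "incl c e n t'" unfolding incl_iff by blast
    then show False using nce le_trans[OF t'(1) t(1)] unfolding not_iff by blast
  qed
  then show "\<exists>t. le t r \<and> (gmem n (bad c d) t \<or> gmem n (bad d e) t)"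
    using mem_bad[OF le_left[OF t'(1)]] le_trans[OF t'(1) t(1)] by blast
qed

lemma mem_hits: "le p p \<Longrightarrow> gmem n (f_hits le x c) p \<longleftrightarrow> f_in_nth le x c n p"
  unfolding f_hits_def by (rule mem_compr_geq) (rule regular_in_nth)

lemma hits_cong:
  assumes "real_eq x y p"
  shows "real_eq (f_hits le x c) (f_hits le y c) p"
proof -
  have "agree p (gmem n (f_hits le x c)) (gmem n (f_hits le y c))" for n
    unfolding f_hits_def by (intro agree_compr agree_in_nth_real assms regular_in_nth)
  then show ?thesis unfolding set_eq_iff[OF equality_geq] agree_def by blast
qed

lemma hits_or_bad:
  assumes "le r r" "gmem n (f_hits le x c) r"
  obtains t where "le t r" "gmem n (f_hits le x d) t \<or> gmem n (bad c d) t"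
proof -
  obtain t where t: "le t r" "incl c d n t \<or> f_not le (incl c d n) t" using decide assms(1) by metis
  have tt: "le t t" using t(1) le_left by blast
  have "f_in_nth le x c n t" using assms mem_hits regular_mono[OF regular_in_nth _ t(1)] by blast
  then have "gmem n (f_hits le x d) t \<or> gmem n (bad c d) t"
    using t(2) mem_hits[OF tt] mem_bad[OF tt] tt unfolding incl_iff by blast
  then show ?thesis using that t(1) by blast
qed

lemma not_in_N_bounded:
  assumes r: "le r r" "\<And>t. le t r \<Longrightarrow> \<not> rmem x (f_N le d) t"
  obtains t m where "le t r" "\<And>n t'. le t' t \<Longrightarrow> f_in_nth le x d n t' \<Longrightarrow> n < m"
proof -
  have "\<not> inf_often x d r" using r mem_N by blast
  then obtain m where m: "\<not> f_ex le (\<lambda>n. f_ground (m \<le> n) \<^bold>\<and> f_in_nth le x d n) r"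
    unfolding inf_often_def all_iff by blast
  have reg: "regular (f_ground (m \<le> n) \<^bold>\<and> f_in_nth le x d n)" for n
    by (intro regular_intros regular_in_nth)
  obtain t where t: "le t r" "f_not le (f_ex le (\<lambda>n. f_ground (m \<le> n) \<^bold>\<and> f_in_nth le x d n)) t"
    using not_forced[OF regular_ex[OF reg] r(1) m] by blast
  then have "n < m" if "le t' t" "f_in_nth le x d n t'" for n t'
    using that unfolding not_ex_iff[OF reg] and_iff ground_iff by (meson not_le)
  then show ?thesis using that t(1) by blast
qed

end

text \<open>The common pattern behind the six cardinals: a preordered class D in the extension with
  a cofinal, \<kappa>-directed family indexed in the ground model and without a largest element. Its
  unbounding and dominating numbers are then both \<kappa>. It is used for \<Omega>-bar with
  \<open>f_le_J\<close> and for the null ideals with inclusion.\<close>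

locale scale = fs_iteration_cc Q L
  for Q :: "'o::wellorder \<Rightarrow> ('q, 'o \<rightharpoonup> 'q) name" and L :: "'o \<Rightarrow> ('q \<times> 'q, 'o \<rightharpoonup> 'q) name" +
  fixes eq :: "'a \<Rightarrow> 'a \<Rightarrow> ('o \<rightharpoonup> 'q) sentence"
    and D :: "'a \<Rightarrow> ('o \<rightharpoonup> 'q) sentence"
    and R :: "'a \<Rightarrow> 'a \<Rightarrow> ('o \<rightharpoonup> 'q) sentence"
    and e :: "'o \<Rightarrow> 'a"
  assumes eq: "equality eq"
    and regular_D: "regular (D x)"
    and regular_R: "regular (R x y)"
    and D_cong: "leq p p \<Longrightarrow> eq x y p \<Longrightarrow> D y p \<Longrightarrow> D x p"
    and R_cong: "leq p p \<Longrightarrow> eq x y p \<Longrightarrow> R y z p \<Longrightarrow> R x z p"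
    and R_trans: "leq p p \<Longrightarrow> R x y p \<Longrightarrow> R y z p \<Longrightarrow> R x z p"
    and D_e: "leq p p \<Longrightarrow> D (e \<eta>) p"
    and R_total: "leq p p \<Longrightarrow> D x p \<Longrightarrow> \<exists>r \<eta>. leq r p \<and> R x (e \<eta>) r"
    and R_directed: "small Y \<Longrightarrow> \<exists>\<beta>\<in>Field (cofinality :: 'o rel). \<forall>\<eta>\<in>Y. \<forall>p. leq p p \<longrightarrow> R (e \<eta>) (e \<beta>) p"
    and no_top: "leq p p \<Longrightarrow> D d p \<Longrightarrow> \<exists>r x. leq r p \<and> D x r \<and> (\<forall>t. leq t r \<longrightarrow> \<not> R x d t)"
begin

lemma R_total_Field:
  assumes "leq p p" "D x p"
  obtains r \<eta> where "leq r p" "\<eta> \<in> Field (cofinality :: 'o rel)" "R x (e \<eta>) r"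
proof -
  obtain r \<eta> where r: "leq r p" "R x (e \<eta>) r" using R_total[OF assms] by blast
  obtain \<beta> where "\<beta> \<in> Field (cofinality :: 'o rel)" "\<forall>p. leq p p \<longrightarrow> R (e \<eta>) (e \<beta>) p"
    using R_directed[OF small_finite, of "{\<eta>}"] by auto
  then show ?thesis using that r R_trans le_left by blast
qed

definition scale_name :: "('a, 'o \<rightharpoonup> 'q) name" where
  "scale_name = {(e \<eta>, p) | \<eta> p. \<eta> \<in> Field (cofinality :: 'o rel) \<and> leq p p}"

lemma e_in_scale: "\<eta> \<in> Field (cofinality :: 'o rel) \<Longrightarrow> leq p p \<Longrightarrow> f_mem leq eq (e \<eta>) scale_name p"
  by (rule memI[OF eq, of _ p]) (auto simp: scale_name_def)

lemma in_scaleD: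
  assumes "f_mem leq eq x scale_name p" "leq q p"
  obtains r \<eta> where "leq r q" "\<eta> \<in> Field (cofinality :: 'o rel)" "eq x (e \<eta>) r"
  using assms unfolding f_mem_def scale_name_def by blast

lemma scale_D:
  assumes "f_mem leq eq x scale_name p" "leq p p"
  shows "D x p"
proof (rule regular_dense[OF regular_D assms(2)])
  fix q assume "leq q p"
  then obtain r \<eta> where r: "leq r q" "eq x (e \<eta>) r" using in_scaleD[OF assms(1)] by metis
  then show "\<exists>r. leq r q \<and> D x r" using D_cong[OF le_left[OF r(1)] r(2)] D_e le_left by blast
qed

text \<open>Different indices may name the same element in the extension, so x is sent to its least
  index. The \<open>guard\<close> on a pair says that no stronger condition identifies the element
  with one of smaller index.\<close>

lemma scale_embeds:
  assumes "leq p p"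
  shows "f_embeds leq eq scale_name (Field (cofinality :: 'o rel)) p"
proof -
  let ?K = "Field (cofinality :: 'o rel)"
  define guard where "guard \<eta> s \<longleftrightarrow> leq s s \<and> \<eta> \<in> ?K \<and> (\<forall>\<zeta>\<in>?K. \<zeta> < \<eta> \<longrightarrow> (\<forall>t. leq t s \<longrightarrow> \<not> eq (e \<zeta>) (e \<eta>) t))" for \<eta> s
  define f where "f = {((e \<eta>, \<eta>), s) | \<eta> s. guard \<eta> s}"
  have peq: "equality (f_pair_eq eq f_geq)" by (rule equality_pair[OF eq equality_geq])
  have f_D: "\<exists>r. leq r t \<and> eq x (e \<eta>) r \<and> guard \<eta> r"
    if mem: "f_mem leq (f_pair_eq eq f_geq) (x, \<eta>) f t" and t: "leq t t" for x \<eta> t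
  proof -
    obtain r s where r: "leq r t" "guard \<eta> s" "leq r s" "eq x (e \<eta>) r"
      using mem t unfolding f_mem_def f_def f_pair_eq_def and_iff geq_iff by auto
    have "guard \<eta> r" using r(2) le_left[OF r(1)] le_trans[OF _ r(3)] unfolding guard_def by blast
    then show ?thesis using r by blast
  qed
  have "inj_name eq scale_name ?K f r" for r
    unfolding inj_name_def
  proof (intro conjI allI impI)
    fix x t u assume t: "leq t r" "f_mem leq eq x scale_name t" and u: "leq u t"
    define A where "A = {\<eta> \<in> ?K. \<exists>r. leq r u \<and> eq x (e \<eta>) r}"
    obtain r0 \<eta>0 where "leq r0 u" "\<eta>0 \<in> ?K" "eq x (e \<eta>0) r0" using in_scaleD[OF t(2) u] by blast
    then have "\<eta>0 \<in> A" unfolding A_def by blast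
    \<comment> \<open>The least index that is possible below u; once s forces x to be the element
      with this index, nothing stronger can identify it with a smaller one.\<close>
    define \<eta> where "\<eta> = (LEAST \<eta>. \<eta> \<in> A)"
    have "\<eta> \<in> A" unfolding \<eta>_def by (rule LeastI) (rule \<open>\<eta>0 \<in> A\<close>)
    then obtain s where s: "\<eta> \<in> ?K" "leq s u" "eq x (e \<eta>) s" unfolding A_def by blast
    have "\<not> eq (e \<zeta>) (e \<eta>) t'" if "\<zeta> \<in> ?K" "\<zeta> < \<eta>" "leq t' s" for \<zeta> t'
    proof
      assume "eq (e \<zeta>) (e \<eta>) t'"
      then have "eq x (e \<zeta>) t'"
        using equality_trans[OF eq equality_mono[OF eq s(3) that(3)]] equality_sym[OF eq] by blast
      then have "\<zeta> \<in> A" using that(1) le_trans[OF that(3) s(2)] unfolding A_def by blast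
      then show False using that(2) not_less_Least unfolding \<eta>_def by blast
    qed
    then have "guard \<eta> s" using s le_left unfolding guard_def by blast
    then have "((e \<eta>, \<eta>), s) \<in> f" unfolding f_def by blast
    then have "f_mem leq (f_pair_eq eq f_geq) (e \<eta>, \<eta>) f s" using memI[OF peq] le_left[OF s(2)] by blast
    moreover have "f_pair_eq eq f_geq (x, \<eta>) (e \<eta>, \<eta>) s" using s(3) by (simp add: f_pair_eq_def and_iff geq_iff)
    ultimately have "f_mem leq (f_pair_eq eq f_geq) (x, \<eta>) f s" using mem_cong[OF peq] by blast
    then show "\<exists>t' \<zeta>. leq t' u \<and> \<zeta> \<in> ?K \<and> f_mem leq (f_pair_eq eq f_geq) (x, \<zeta>) f t'" using s by blast
  next
    fix x \<eta> \<zeta> t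
    assume t: "leq t r" "f_mem leq (f_pair_eq eq f_geq) (x, \<eta>) f t" "f_mem leq (f_pair_eq eq f_geq) (x, \<zeta>) f t"
    obtain s where s: "leq s t" "eq x (e \<eta>) s" "guard \<eta> s" using f_D[OF t(2) le_left[OF t(1)]] by blast
    obtain s' where s': "leq s' s" "eq x (e \<zeta>) s'" "guard \<zeta> s'"
      using f_D[OF mem_mono[OF t(3) s(1)] le_left[OF s(1)]] by blast
    have x: "eq x (e \<eta>) s'" using equality_mono[OF eq s(2) s'(1)] .
    have e: "eq (e \<eta>) (e \<zeta>) s'" "eq (e \<zeta>) (e \<eta>) s'"
      using equality_trans[OF eq equality_sym[OF eq x] s'(2)] equality_sym[OF eq] by blast+
    have "\<not> \<eta> < \<zeta>" using s'(3) s(3) e(1) unfolding guard_def by blast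
    moreover have "\<not> \<zeta> < \<eta>" using s(3) s'(3,1) e(2) unfolding guard_def by blast
    ultimately show "\<eta> = \<zeta>" by simp
  next
    fix x y \<eta> t
    assume t: "leq t r" "f_mem leq (f_pair_eq eq f_geq) (x, \<eta>) f t" "f_mem leq (f_pair_eq eq f_geq) (y, \<eta>) f t"
    show "eq x y t"
    proof (rule regular_dense[OF equality_regular[OF eq] le_left[OF t(1)]])
      fix q assume q: "leq q t"
      obtain s where s: "leq s q" "eq x (e \<eta>) s" using f_D[OF mem_mono[OF t(2) q] le_left[OF q]] by blast
      obtain s' where s': "leq s' s" "eq y (e \<eta>) s'"
        using f_D[OF mem_mono[OF t(3) le_trans[OF s(1) q]] le_left[OF s(1)]] by blast
      have "eq x y s'"
        using equality_trans[OF eq equality_mono[OF eq s(2) s'(1)] equality_sym[OF eq s'(2)]] .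
      then show "\<exists>r. leq r q \<and> eq x y r" using le_trans[OF s'(1) s(1)] by blast
    qed
  qed
  then show ?thesis unfolding embeds_iff[OF eq] using le_left by blast
qed

text \<open>A set of size less than \<kappa> is bounded although its members are only names. For
  every index \<zeta> of a member, an antichain of fewer than \<kappa> conditions decides a scale
  index above this member, so altogether fewer than \<kappa> scale indices are possible, and
  directedness gives one \<beta> above all of them.\<close>

lemma bounding:
  assumes size: "f_size_less leq eq F (cofinality :: 'o rel) q" and q: "leq q q"
    and F: "\<And>x r. leq r q \<Longrightarrow> f_mem leq eq x F r \<Longrightarrow> D x r"
  obtains r \<beta> where "leq r q" "\<beta> \<in> Field (cofinality :: 'o rel)"
    "\<And>x t. leq t r \<Longrightarrow> f_mem leq eq x F t \<Longrightarrow> R x (e \<beta>) t"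
proof -
  let ?p = "f_pair_eq eq f_geq"
  obtain q1 \<xi> f where q1: "leq q1 q" "\<xi> \<in> Field (cofinality :: 'o rel)"
      and f: "inj_name eq F (underS cofinality \<xi>) f q1"
    using size q unfolding size_less_iff[OF eq] by meson
  define E where "E \<zeta> t \<eta> \<longleftrightarrow> leq t q1 \<and> (\<exists>x. f_mem leq eq x F t \<and> f_mem leq ?p (x, \<zeta>) f t \<and> R x (e \<eta>) t)" for \<zeta> t \<eta>
  have "\<exists>M. antichain M \<and> (\<forall>t\<in>M. \<exists>\<eta>. E \<zeta> t \<eta>) \<and> (\<forall>t. (\<exists>\<eta>. E \<zeta> t \<eta>) \<longrightarrow> (\<exists>m\<in>M. \<exists>r. leq r t \<and> leq r m))" for \<zeta>
  proof -
    have "leq t t" if "\<exists>\<eta>. E \<zeta> t \<eta>" for t using that le_left unfolding E_def by blast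
    from maximal_antichain[of "\<lambda>t. \<exists>\<eta>. E \<zeta> t \<eta>", OF this] show ?thesis by metis
  qed
  then obtain M where M: "\<And>\<zeta>. antichain (M \<zeta>)" "\<And>\<zeta> t. t \<in> M \<zeta> \<Longrightarrow> \<exists>\<eta>. E \<zeta> t \<eta>"
      "\<And>\<zeta> t \<eta>. E \<zeta> t \<eta> \<Longrightarrow> \<exists>m\<in>M \<zeta>. \<exists>r. leq r t \<and> leq r m" by metis
  define h where "h \<zeta> t = (SOME \<eta>. E \<zeta> t \<eta>)" for \<zeta> t
  have h: "E \<zeta> t (h \<zeta> t)" if "t \<in> M \<zeta>" for \<zeta> t unfolding h_def by (rule someI_ex[OF M(2)[OF that]])
  define Y where "Y = (\<Union>\<zeta>\<in>underS cofinality \<xi>. h \<zeta> ` M \<zeta>)"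
  have "small Y"
    unfolding Y_def by (intro small_UN small_underS q1(2) small_image antichain_small M(1))
  then obtain \<beta> where \<beta>: "\<beta> \<in> Field (cofinality :: 'o rel)" "\<And>\<eta> p. \<eta> \<in> Y \<Longrightarrow> leq p p \<Longrightarrow> R (e \<eta>) (e \<beta>) p"
    using R_directed by blast
  have "R x (e \<beta>) t" if t: "leq t q1" "f_mem leq eq x F t" for x t
  proof (rule regular_dense[OF regular_R le_left[OF t(1)]])
    fix t' assume t': "leq t' t"
    obtain t1 \<zeta> where t1: "leq t1 t'" "\<zeta> \<in> underS cofinality \<xi>" "f_mem leq ?p (x, \<zeta>) f t1"
      using f[unfolded inj_name_def, THEN conjunct1] t t' by blast
    have t1t: "leq t1 t" using t1(1) t' le_trans by blast
    have F1: "f_mem leq eq x F t1" using mem_mono[OF t(2) t1t] .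
    have t1q: "leq t1 q1" using t1t t(1) le_trans by blast
    obtain t2 \<eta> where t2: "leq t2 t1" "R x (e \<eta>) t2"
      using R_total[OF le_left[OF t1(1)] F[OF le_trans[OF t1q q1(1)] F1]] by blast
    have "E \<zeta> t2 \<eta>"
      unfolding E_def
      using le_trans[OF t2(1) t1q] mem_mono[OF F1 t2(1)] mem_mono[OF t1(3) t2(1)] t2(2) by blast
    then obtain m r where m: "m \<in> M \<zeta>" "leq r t2" "leq r m" using M(3) by blast
    obtain x' where x': "leq m q1" "f_mem leq ?p (x', \<zeta>) f m" "R x' (e (h \<zeta> m)) m"
      using h[OF m(1)] unfolding E_def by blast
    have rr: "leq r r" using m(2) le_left by blast
    have rq: "leq r q1" using m(3) x'(1) le_trans by blast
    have "f_mem leq ?p (x, \<zeta>) f r" using mem_mono[OF mem_mono[OF t1(3) t2(1)] m(2)] .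
    moreover have "f_mem leq ?p (x', \<zeta>) f r" using mem_mono[OF x'(2) m(3)] .
    \<comment> \<open>The element x' considered at the antichain condition m carries the same index
      \<zeta> as x; below both conditions injectivity identifies them, which moves the bound from x'
      to x.\<close>
    ultimately have "eq x x' r"
      using f[unfolded inj_name_def, THEN conjunct2, THEN conjunct2] rq by blast
    moreover have "R x' (e (h \<zeta> m)) r" using regular_mono[OF regular_R x'(3) m(3)] .
    ultimately have "R x (e (h \<zeta> m)) r" using R_cong[OF rr] by blast
    moreover have "h \<zeta> m \<in> Y" using m(1) t1(2) unfolding Y_def by blast
    ultimately have "R x (e \<beta>) r" using R_trans[OF rr] \<beta>(2) rr by blast
    moreover have "leq r t'" using m(2) t2(1) t1(1) le_trans by blast
    ultimately show "\<exists>r. leq r t' \<and> R x (e \<beta>) r" by blast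
  qed
  then show ?thesis using that q1(1) \<beta>(1) by blast
qed

definition unbounded :: "('a, 'o \<rightharpoonup> 'q) name \<Rightarrow> ('o \<rightharpoonup> 'q) sentence" where
  "unbounded F p \<longleftrightarrow> (\<forall>x q. leq q p \<longrightarrow> f_mem leq eq x F q \<longrightarrow> D x q) \<and>
     (\<forall>d q. leq q p \<longrightarrow> D d q \<longrightarrow> \<not> (\<forall>x t. leq t q \<longrightarrow> f_mem leq eq x F t \<longrightarrow> R x d t))"

definition dominating :: "('a, 'o \<rightharpoonup> 'q) name \<Rightarrow> ('o \<rightharpoonup> 'q) sentence" where
  "dominating F p \<longleftrightarrow> (\<forall>x q. leq q p \<longrightarrow> f_mem leq eq x F q \<longrightarrow> D x q) \<and>
     (\<forall>x q. leq q p \<longrightarrow> D x q \<longrightarrow> (\<exists>r y. leq r q \<and> f_mem leq eq y F r \<and> R x y r))"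

text \<open>An upper bound of the scale would bound all of D by cofinality, against
  \<open>no_top\<close>; and smaller families are bounded by a member of the scale.\<close>

lemma least_size_unbounded:
  assumes reg: "\<And>F. regular (\<Phi> F)" and \<Phi>: "\<And>F p. leq p p \<Longrightarrow> \<Phi> F p \<longleftrightarrow> unbounded F p" and p: "leq p p"
  shows "f_least_size leq eq \<Phi> (cofinality :: 'o rel) p"
proof (rule least_sizeI[OF reg eq p])
  have "unbounded scale_name p"
    unfolding unbounded_def
  proof (intro conjI allI impI notI)
    show "D x q" if "leq q p" "f_mem leq eq x scale_name q" for x q using scale_D that le_left by blast
    fix d q assume q: "leq q p" "D d q" "\<forall>x t. leq t q \<longrightarrow> f_mem leq eq x scale_name t \<longrightarrow> R x d t"
    obtain r x where r: "leq r q" "D x r" "\<forall>t. leq t r \<longrightarrow> \<not> R x d t" using no_top[OF le_left[OF q(1)] q(2)] by blast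
    obtain r' \<eta> where r': "leq r' r" "\<eta> \<in> Field (cofinality :: 'o rel)" "R x (e \<eta>) r'"
      using R_total_Field[OF le_left[OF r(1)] r(2)] by blast
    have "R (e \<eta>) d r'" using q(3) le_trans[OF r'(1) r(1)] e_in_scale[OF r'(2) le_left[OF r'(1)]] by blast
    then show False using R_trans[OF le_left[OF r'(1)] r'(3)] r(3) r'(1) by blast
  qed
  then show "\<Phi> scale_name p" using \<Phi>[OF p] by blast
  show "f_embeds leq eq scale_name (Field (cofinality :: 'o rel)) p" by (rule scale_embeds[OF p])
next
  fix F q assume q: "leq q p" "\<Phi> F q"
  then have u: "unbounded F q" using \<Phi>[OF le_left[OF q(1)]] by blast
  show "\<not> f_size_less leq eq F (cofinality :: 'o rel) q"
  proof
    assume "f_size_less leq eq F (cofinality :: 'o rel) q"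
    then obtain r \<beta> where r: "leq r q" "\<And>x t. leq t r \<Longrightarrow> f_mem leq eq x F t \<Longrightarrow> R x (e \<beta>) t"
      using bounding[OF _ le_left[OF q(1)]] u unfolding unbounded_def by metis
    then show False using u D_e[OF le_left[OF r(1)], of \<beta>] unfolding unbounded_def by blast
  qed
qed

text \<open>The scale is itself dominating; a smaller dominating family would lie below one member
  of the scale, which would then be a largest element.\<close>

lemma least_size_dominating:
  assumes reg: "\<And>F. regular (\<Phi> F)" and \<Phi>: "\<And>F p. leq p p \<Longrightarrow> \<Phi> F p \<longleftrightarrow> dominating F p" and p: "leq p p"
  shows "f_least_size leq eq \<Phi> (cofinality :: 'o rel) p"
proof (rule least_sizeI[OF reg eq p])
  have "dominating scale_name p"
    unfolding dominating_def
  proof (intro conjI allI impI)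
    show "D x q" if "leq q p" "f_mem leq eq x scale_name q" for x q using scale_D that le_left by blast
    fix x q assume q: "leq q p" "D x q"
    then show "\<exists>r y. leq r q \<and> f_mem leq eq y scale_name r \<and> R x y r"
      using R_total_Field[OF le_left[OF q(1)] q(2)] e_in_scale le_left by metis
  qed
  then show "\<Phi> scale_name p" using \<Phi>[OF p] by blast
  show "f_embeds leq eq scale_name (Field (cofinality :: 'o rel)) p" by (rule scale_embeds[OF p])
next
  fix F q assume q: "leq q p" "\<Phi> F q"
  then have u: "dominating F q" using \<Phi>[OF le_left[OF q(1)]] by blast
  show "\<not> f_size_less leq eq F (cofinality :: 'o rel) q"
  proof
    assume "f_size_less leq eq F (cofinality :: 'o rel) q"
    then obtain r \<beta> where r: "leq r q" "\<And>x t. leq t r \<Longrightarrow> f_mem leq eq x F t \<Longrightarrow> R x (e \<beta>) t"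
      using bounding[OF _ le_left[OF q(1)]] u unfolding dominating_def by metis
    obtain r' x where r': "leq r' r" "D x r'" "\<forall>t. leq t r' \<longrightarrow> \<not> R x (e \<beta>) t"
      using no_top[OF le_left[OF r(1)] D_e[OF le_left[OF r(1)]]] by blast
    obtain s y where s: "leq s r'" "f_mem leq eq y F s" "R x y s"
      using u le_trans[OF r'(1) r(1)] r'(2) unfolding dominating_def by blast
    have "R y (e \<beta>) s" using r(2)[OF le_trans[OF s(1) r'(1)] s(2)] .
    then show False using R_trans[OF le_left[OF s(1)] s(3)] r'(3) s(1) by blast
  qed
qed

end

subsection \<open>The cardinal characteristics\<close>

context forcing_order
begin

abbreviation smem :: "'p set_name \<Rightarrow> ('p set_name, 'p) name \<Rightarrow> 'p sentence" where
  "smem \<equiv> f_mem le (f_set_eq le (f_set_eq le f_geq))"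

lemma le_J_mono: "f_le_J le J c d p \<Longrightarrow> le q p \<Longrightarrow> f_le_J le J c d q"
  unfolding le_J_eq by (rule mem_mono)

text \<open>
  The properties of \<open>{a. a \<in> J\<^sup>+}\<close> and \<open>{a. a \<in> J\<^sup>d}\<close> that are relevant for the ideals defined by them.
\<close>

definition selector :: "'p set_name \<Rightarrow> ('p real_name \<Rightarrow> 'p sentence) \<Rightarrow> bool" where
  "selector J S \<longleftrightarrow> (\<forall>a. regular (S a)) \<and> (\<forall>a b p. le p p \<longrightarrow> real_eq a b p \<longrightarrow> S b p \<longrightarrow> S a p) \<and>
     (\<forall>c d x p. le p p \<longrightarrow> f_le_J le J c d p \<longrightarrow> S (f_hits le x c) p \<longrightarrow> S (f_hits le x d) p) \<and>
     (\<forall>a p. le p p \<longrightarrow> (\<forall>n r. le r p \<longrightarrow> gmem n a r) \<longrightarrow> S a p) \<and>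
     (\<forall>a m p. le p p \<longrightarrow> S a p \<longrightarrow> \<not> (\<forall>n r. le r p \<longrightarrow> gmem n a r \<longrightarrow> n < m))"

text \<open>For monotonicity, the indices at which x is in c but not in d are all bad for the
  inclusion. So if the hits of x in d were in J, the hits in c would be as well.\<close>

lemma selector_positive:
  assumes J: "\<And>p. le p p \<Longrightarrow> f_ideal le J p"
  shows "selector J (f_positive le J)"
  unfolding selector_def f_positive_def
proof (intro conjI allI impI notI)
  show "regular (f_not le (rmem a J))" for a by (intro regular_intros)
  fix p assume p: "le p p"
  note I = J[OF p, unfolded ideal_iff]
  show "f_not le (rmem a J) p" if ab: "real_eq a b p" "f_not le (rmem b J) p" for a b
    unfolding not_iff
  proof (intro allI impI notI)
    fix q assume q: "le q p" "rmem a J q"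
    have "real_eq b a q"
      using equality_sym[OF equality_real equality_mono[OF equality_real ab(1) q(1)]] .
    then have "rmem b J q" using mem_cong[OF equality_real _ q(2)] by blast
    then show False using ab(2) q(1) unfolding not_iff by blast
  qed
  show "f_not le (rmem (f_hits le x d) J) p"
    if cd: "f_le_J le J c d p" "f_not le (rmem (f_hits le x c) J) p" for c d x
    unfolding not_iff
  proof (intro allI impI notI)
    fix q assume q: "le q p" "rmem (f_hits le x d) J q"
    have qq: "le q q" using q(1) le_left by blast
    have bad: "rmem (bad c d) J q" using le_J_mono[OF cd(1) q(1)] unfolding le_J_eq .
    have "rmem (f_hits le x c) J q"
    proof (rule ideal_subset_union[OF J[OF qq] qq q(2) bad])
      fix n r assume "le r q" "gmem n (f_hits le x c) r"
      then show "\<exists>t. le t r \<and> (gmem n (f_hits le x d) t \<or> gmem n (bad c d) t)"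
        using hits_or_bad[of r n x c d] le_left by metis
    qed
    then show False using cd(2) q(1) unfolding not_iff by blast
  qed
  show "f_not le (rmem a J) p" if a: "\<forall>n r. le r p \<longrightarrow> gmem n a r" for a
    unfolding not_iff
  proof (intro allI impI notI)
    fix q assume q: "le q p" "rmem a J q"
    have qq: "le q q" using q(1) le_left by blast
    show False by (rule ideal_infinite[OF J[OF qq] qq q(2), of 0]) (use a le_trans[OF _ q(1)] in blast)
  qed
  show False if a: "f_not le (rmem a J) p" "\<forall>n r. le r p \<longrightarrow> gmem n a r \<longrightarrow> n < m" for a m
    using I[THEN conjunct2, THEN conjunct2, THEN conjunct1] a p unfolding not_iff by blast
qed

text \<open>Monotonicity is seen on complements: an index missed by d is missed by c or bad for the
  inclusion. The last property holds because the complement of a bounded set is cofinite, hence not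
  in J.\<close>

lemma selector_dual:
  assumes J: "\<And>p. le p p \<Longrightarrow> f_ideal le J p"
  shows "selector J (f_dual le J)"
proof -
  define compl where "compl a = f_compr le (\<lambda>n. f_not le (gmem n a))" for a :: "'p real_name"
  have dual: "f_dual le J a = rmem (compl a) J" for a unfolding f_dual_def compl_def ..
  have mem: "gmem n (compl a) p \<longleftrightarrow> f_not le (gmem n a) p" if "le p p" for n a p
    unfolding compl_def by (rule mem_compr_geq[OF _ that]) (intro regular_intros)
  show ?thesis
    unfolding selector_def dual
  proof (intro conjI allI impI notI)
    show "regular (rmem (compl a) J)" for a by (intro regular_intros)
    fix p assume p: "le p p"
    note I = J[OF p, unfolded ideal_iff]
    show "rmem (compl a) J p" if ab: "real_eq a b p" "rmem (compl b) J p" for a b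
    proof -
      have "agree p (gmem n (compl a)) (gmem n (compl b))" for n
        unfolding compl_def by (intro agree_compr agree_not agree_gmem ab(1) regular_intros)
      then have "real_eq (compl a) (compl b) p" unfolding set_eq_iff[OF equality_geq] agree_def by blast
      then show ?thesis using mem_cong[OF equality_real] ab(2) by blast
    qed
    show "rmem (compl (f_hits le x d)) J p"
      if cd: "f_le_J le J c d p" "rmem (compl (f_hits le x c)) J p" for c d x
    proof (rule ideal_subset_union[OF J[OF p] p cd(2) cd(1)[unfolded le_J_eq]])
      fix n r assume r: "le r p" "gmem n (compl (f_hits le x d)) r"
      have rr: "le r r" using r(1) le_left by blast
      have nd: "f_not le (gmem n (f_hits le x d)) r" using r(2) mem[OF rr] by blast
      obtain t where t: "le t r" "gmem n (f_hits le x c) t \<or> f_not le (gmem n (f_hits le x c)) t"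
        using decide[OF rr] by metis
      have tt: "le t t" using t(1) le_left by blast
      show "\<exists>t. le t r \<and> (gmem n (compl (f_hits le x c)) t \<or> gmem n (bad c d) t)"
      proof (cases "gmem n (f_hits le x c) t")
        case True
        obtain u where u: "le u t" "gmem n (f_hits le x d) u \<or> gmem n (bad c d) u"
          using hits_or_bad[OF tt True] by blast
        have "le u r" using u(1) t(1) le_trans by blast
        then show ?thesis using u(2) nd unfolding not_iff by blast
      next
        case False
        then show ?thesis using t mem[OF tt] by blast
      qed
    qed
    show "rmem (compl a) J p" if a: "\<forall>n r. le r p \<longrightarrow> gmem n a r" for a
    proof -
      have "\<not> gmem n (compl a) r" if r: "le r p" for n r
        using mem[OF le_left[OF r]] a r le_left[OF r] unfolding not_iff by blast
      then show ?thesis using I[THEN conjunct2, THEN conjunct2, THEN conjunct1] p by blast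
    qed
    show False if a: "rmem (compl a) J p" "\<forall>n r. le r p \<longrightarrow> gmem n a r \<longrightarrow> n < m" for a m
    proof (rule ideal_infinite[OF J[OF p] p a(1)])
      fix n r assume r: "le r p" "m \<le> n"
      have "f_not le (gmem n a) r"
        unfolding not_iff using a(2) le_trans[OF _ r(1)] r(2) by (meson not_le)
      then show "gmem n (compl a) r" using mem[OF le_left[OF r(1)]] by blast
    qed
  qed
qed

definition sel_set :: "('p real_name \<Rightarrow> 'p sentence) \<Rightarrow> 'p clopen_seq_name \<Rightarrow> 'p set_name" where
  "sel_set S c = f_compr le (\<lambda>x. S (f_hits le x c))"

definition sel_ideal :: "('p real_name \<Rightarrow> 'p sentence) \<Rightarrow> ('p set_name, 'p) name" where
  "sel_ideal S = f_compr le (\<lambda>X. f_ex le (\<lambda>c. f_Omega_bar le c \<^bold>\<and> f_subset le real_eq X (sel_set S c)))"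

lemma null_ideal_eq: "f_null_ideal le J = sel_ideal (f_positive le J)"
  unfolding f_null_ideal_def sel_ideal_def sel_set_def f_N_J_def ..

lemma null_star_ideal_eq: "f_null_star_ideal le J = sel_ideal (f_dual le J)"
  unfolding f_null_star_ideal_def sel_ideal_def sel_set_def f_N_star_J_def ..

lemma mem_sel_set:
  assumes S: "selector J S" and p: "le p p"
  shows "rmem x (sel_set S c) p \<longleftrightarrow> S (f_hits le x c) p"
  unfolding sel_set_def
proof (rule mem_compr[OF equality_real _ _ p])
  show "regular (S (f_hits le x c))" for x using S unfolding selector_def by blast
  show "S (f_hits le x c) q" if "le q q" "real_eq x y q" "S (f_hits le y c) q" for x y q
    using S hits_cong[OF that(2)] that(1,3) unfolding selector_def by blast
qed

lemma sel_set_mono: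
  assumes S: "selector J S" and cd: "f_le_J le J c d p"
  shows "f_subset le real_eq (sel_set S c) (sel_set S d) p"
  unfolding subset_iff
proof (intro allI impI)
  fix x q assume q: "le q p" "rmem x (sel_set S c) q"
  have "f_le_J le J c d q" using le_J_mono[OF cd q(1)] .
  then show "rmem x (sel_set S d) q"
    using S q(2) le_left[OF q(1)] mem_sel_set[OF S le_left[OF q(1)]] unfolding selector_def by blast
qed

lemma subset_trans:
  "f_subset le eq \<sigma> \<tau> p \<Longrightarrow> f_subset le eq \<tau> \<rho> p \<Longrightarrow> f_subset le eq \<sigma> \<rho> p"
  unfolding subset_iff by blast

lemma set_eq_subset: "f_set_eq le real_eq X Y p \<Longrightarrow> f_subset le real_eq X Y p"
  unfolding subset_iff set_eq_iff[OF equality_real] by blast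

lemma mem_sel_ideal:
  assumes "le p p"
  shows "smem X (sel_ideal S) p \<longleftrightarrow>
    (\<forall>q. le q p \<longrightarrow> (\<exists>r c. le r q \<and> f_Omega_bar le c r \<and> f_subset le real_eq X (sel_set S c) r))"
proof -
  let ?\<phi> = "\<lambda>X. f_ex le (\<lambda>c. f_Omega_bar le c \<^bold>\<and> f_subset le real_eq X (sel_set S c))"
  have \<phi>: "?\<phi> X p \<longleftrightarrow>
    (\<forall>q. le q p \<longrightarrow> (\<exists>r c. le r q \<and> f_Omega_bar le c r \<and> f_subset le real_eq X (sel_set S c) r))" for X p
    unfolding ex_iff and_iff by blast
  have "smem X (f_compr le ?\<phi>) p \<longleftrightarrow> ?\<phi> X p"
  proof (rule mem_compr[OF equality_set_real _ _ assms])
    show "regular (?\<phi> X)" for X by (intro regular_intros regular_Omega_bar)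
    show "?\<phi> X q" if XY: "f_set_eq le real_eq X Y q" and Y: "?\<phi> Y q" for X Y q
      unfolding \<phi>
    proof (intro allI impI)
      fix q' assume q': "le q' q"
      then obtain r c where r: "le r q'" "f_Omega_bar le c r" "f_subset le real_eq Y (sel_set S c) r"
        using Y unfolding \<phi> by blast
      have "f_subset le real_eq X Y r"
        using regular_mono[OF regular_subset set_eq_subset[OF XY] le_trans[OF r(1) q']] .
      then show "\<exists>r c. le r q' \<and> f_Omega_bar le c r \<and> f_subset le real_eq X (sel_set S c) r"
        using r subset_trans by blast
    qed
  qed
  then show ?thesis unfolding sel_ideal_def \<phi> .
qed

lemma sel_ideal_down:
  assumes "le p p" "smem Y (sel_ideal S) p" "f_subset le real_eq X Y p"
  shows "smem X (sel_ideal S) p"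
  unfolding mem_sel_ideal[OF assms(1)]
proof (intro allI impI)
  fix q assume q: "le q p"
  then obtain r c where r: "le r q" "f_Omega_bar le c r" "f_subset le real_eq Y (sel_set S c) r"
    using assms(2) unfolding mem_sel_ideal[OF assms(1)] by blast
  have "f_subset le real_eq X Y r" using regular_mono[OF regular_subset assms(3) le_trans[OF r(1) q]] .
  then show "\<exists>r c. le r q \<and> f_Omega_bar le c r \<and> f_subset le real_eq X (sel_set S c) r"
    using r subset_trans by blast
qed

lemma mem_union:
  assumes "le p p"
  shows "rmem x (f_compr le (\<lambda>x. f_ex le (\<lambda>X. smem X F \<^bold>\<and> rmem x X))) p \<longleftrightarrow>
    (\<forall>q. le q p \<longrightarrow> (\<exists>r X. le r q \<and> smem X F r \<and> rmem x X r))"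
proof -
  let ?\<phi> = "\<lambda>x. f_ex le (\<lambda>X. smem X F \<^bold>\<and> rmem x X)"
  have \<phi>: "?\<phi> x p \<longleftrightarrow> (\<forall>q. le q p \<longrightarrow> (\<exists>r X. le r q \<and> smem X F r \<and> rmem x X r))" for x p
    unfolding ex_iff and_iff by blast
  have "rmem x (f_compr le ?\<phi>) p \<longleftrightarrow> ?\<phi> x p"
  proof (rule mem_compr[OF equality_real _ _ assms])
    show "regular (?\<phi> x)" for x by (intro regular_intros)
    show "?\<phi> x q" if xy: "real_eq x y q" and y: "?\<phi> y q" for x y q
      unfolding \<phi>
    proof (intro allI impI)
      fix q' assume q': "le q' q"
      then obtain r X where r: "le r q'" "smem X F r" "rmem y X r" using y unfolding \<phi> by blast
      have "real_eq x y r" using equality_mono[OF equality_real xy le_trans[OF r(1) q']] .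
      then have "rmem x X r" using mem_cong[OF equality_real] r(3) by blast
      then show "\<exists>r X. le r q' \<and> smem X F r \<and> rmem x X r" using r by blast
    qed
  qed
  then show ?thesis unfolding \<phi> .
qed

end

section \<open>The Cohen sequences as scales\<close>

context fs_iteration_cc
begin

text \<open>The cofinal set underlying \<kappa> need not consist of limits, so its elements index
  the Cohen sequences through a limit above them.\<close>

definition next_lim :: "'o \<Rightarrow> 'o" where
  "next_lim \<eta> = (SOME \<delta>. is_lim \<delta> \<and> \<eta> \<le> \<delta>)"

lemma next_lim: "is_lim (next_lim \<eta>)" "\<eta> \<le> next_lim \<eta>"
proof -
  have "\<exists>\<delta>. is_lim \<delta> \<and> \<eta> \<le> \<delta>" using ex_lim by blast
  from someI_ex[OF this] show "is_lim (next_lim \<eta>)" "\<eta> \<le> next_lim \<eta>" unfolding next_lim_def by blast+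
qed

text \<open>The values of the cardinals are computed from the inclusion of \<open>J0\<close> alone;
  maximality of J is a separate matter.\<close>

definition cohen_ideal :: "('o \<rightharpoonup> 'q) set_name \<Rightarrow> bool" where
  "cohen_ideal J \<longleftrightarrow> (\<forall>p. leq p p \<longrightarrow> f_ideal leq J p) \<and> (\<forall>a p. leq p p \<longrightarrow> rmem a J0 p \<longrightarrow> rmem a J p)"

lemma le_cohen:
  assumes "cohen_ideal J" "leq p p" "is_lim \<delta>" "seq_supported \<delta> d" "f_Omega_bar leq d p"
  shows "f_le_J leq J d (cohen \<delta>) p"
  using le_cohen_J0[OF assms(2-5)] assms(1,2) unfolding cohen_ideal_def le_J_eq bad_def incl_def by blast

lemma le_cohen_total:
  assumes "cohen_ideal J" "leq p p" "f_Omega_bar leq d p"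
  obtains \<eta> where "f_le_J leq J d (cohen (next_lim \<eta>)) p"
proof -
  obtain \<alpha> where "\<And>\<delta>. \<alpha> \<le> \<delta> \<Longrightarrow> seq_supported \<delta> d" using ex_seq_supported by blast
  then show ?thesis using that le_cohen[OF assms(1,2) next_lim(1) _ assms(3)] next_lim(2) by blast
qed

text \<open>A strict bound b of the limits used for Y is exceeded by the limit for some \<beta> in
  the cofinal set, and that stage supports all the earlier Cohen sequences.\<close>

lemma le_cohen_directed:
  assumes J: "cohen_ideal J" and Y: "small Y"
  shows "\<exists>\<beta>\<in>Field (cofinality :: 'o rel). \<forall>\<eta>\<in>Y. \<forall>p. leq p p \<longrightarrow>
    f_le_J leq J (cohen (next_lim \<eta>)) (cohen (next_lim \<beta>)) p"
proof -
  obtain b where b: "\<And>\<gamma>. \<gamma> \<in> next_lim ` Y \<Longrightarrow> \<gamma> < b" using small_bounded[OF small_image[OF Y]] by blast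
  obtain K where K: "(cofinality :: 'o rel) = |K|" "cofinal_in K" using cofinality_eq[where ?'o = 'o] by metis
  obtain \<beta> where \<beta>: "\<beta> \<in> K" "b \<le> \<beta>" using K(2) unfolding cofinal_in_def by blast
  have "f_le_J leq J (cohen (next_lim \<eta>)) (cohen (next_lim \<beta>)) p" if "\<eta> \<in> Y" "leq p p" for \<eta> p
  proof (rule le_cohen[OF J that(2) next_lim(1) _ cohen_Omega_bar[OF leq_conds(1)[OF that(2)]]])
    have "next_lim \<eta> < next_lim \<beta>" using b[of "next_lim \<eta>"] that(1) \<beta>(2) next_lim(2)[of \<beta>] by force
    then show "seq_supported (next_lim \<beta>) (cohen (next_lim \<eta>))"
      unfolding seq_supported_def using supported_cohen[OF next_lim(1)] by blast
  qed
  moreover have "\<beta> \<in> Field (cofinality :: 'o rel)" unfolding K(1) Field_card_of by (rule \<beta>(1))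
  ultimately show ?thesis by blast
qed

text \<open>No largest element: take x outside N(d) and the sequence c of cones shrinking to x. Then
  x lies in every c_n but, from some m on, in no d_n, so the inclusion fails on a cofinite set,
  which is not in J.\<close>

lemma scale_Omega_bar:
  assumes J: "cohen_ideal J"
  shows "scale Q L (f_set_eq leq f_geq) (f_Omega_bar leq) (f_le_J leq J) (\<lambda>\<eta>. cohen (next_lim \<eta>))"
proof
  have ideal: "f_ideal leq J p" if "leq p p" for p using J that unfolding cohen_ideal_def by blast
  show "equality (f_set_eq leq f_geq)" by (rule equality_real)
  show "regular (f_Omega_bar leq x)" for x by (rule regular_Omega_bar)
  show "regular (f_le_J leq J x y)" for x y unfolding le_J_eq by simp
  show "f_Omega_bar leq x p" if "leq p p" "f_set_eq leq f_geq x y p" "f_Omega_bar leq y p" for x y p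
    using agreeD[OF agree_Omega_bar[OF that(2)] that(1)] that(3) by blast
  show "f_le_J leq J x z p" if "leq p p" "f_set_eq leq f_geq x y p" "f_le_J leq J y z p" for x y z p
    using le_J_cong[OF that(2,3)] .
  show "f_le_J leq J x z p" if "leq p p" "f_le_J leq J x y p" "f_le_J leq J y z p" for x y z p
    using le_J_trans[OF ideal[OF that(1)] that] .
  show "f_Omega_bar leq (cohen (next_lim \<eta>)) p" if "leq p p" for \<eta> p
    using cohen_Omega_bar leq_conds(1)[OF that] .
  show "\<exists>r \<eta>. leq r p \<and> f_le_J leq J x (cohen (next_lim \<eta>)) r" if "leq p p" "f_Omega_bar leq x p" for x p
    using le_cohen_total[OF J that] that(1) by metis
  show "\<exists>\<beta>\<in>Field (cofinality :: 'o rel). \<forall>\<eta>\<in>Y. \<forall>p. leq p p \<longrightarrow>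
      f_le_J leq J (cohen (next_lim \<eta>)) (cohen (next_lim \<beta>)) p" if "small Y" for Y
    by (rule le_cohen_directed[OF J that])
  show "\<exists>r x. leq r p \<and> f_Omega_bar leq x r \<and> (\<forall>t. leq t r \<longrightarrow> \<not> f_le_J leq J x d t)"
    if p: "leq p p" "f_Omega_bar leq d p" for d p
  proof -
    obtain r x where r: "leq r p" "\<And>t. leq t r \<Longrightarrow> \<not> rmem x (f_N leq d) t" using ex_not_in_N[OF p(2,1)] by blast
    obtain c where c: "\<And>p. leq p p \<Longrightarrow> f_Omega_bar leq c p" "\<And>p n. leq p p \<Longrightarrow> f_in_nth leq x c n p"
      using ex_point_seq[of x] by blast
    have "\<not> f_le_J leq J c d t" if t: "leq t r" for t
    proof
      assume le: "f_le_J leq J c d t"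
      obtain t' m where t': "leq t' t" "\<And>n s. leq s t' \<Longrightarrow> f_in_nth leq x d n s \<Longrightarrow> n < m"
        using not_in_N_bounded[OF le_left[OF t], of x d] r(2) le_trans[OF _ t] by blast
      have tt: "leq t' t'" using t'(1) le_left by blast
      have bad: "rmem (bad c d) J t'" using le_J_mono[OF le t'(1)] unfolding le_J_eq .
      show False
      proof (rule ideal_infinite[OF ideal[OF tt] tt bad, of m])
        fix n s assume s: "leq s t'" "m \<le> n"
        have "\<not> incl c d n u" if u: "leq u s" for u
        proof
          assume "incl c d n u"
          then have "f_in_nth leq x d n u" using c(2)[OF le_left[OF u]] le_left[OF u] unfolding incl_iff by blast
          then show False using t'(2)[OF le_trans[OF u s(1)]] s(2) by force
        qed
        then show "gmem n (bad c d) s" unfolding mem_bad[OF le_left[OF s(1)]] not_iff by blast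
      qed
    qed
    then show ?thesis using r(1) c(1) le_left by blast
  qed
qed

text \<open>No largest element: if d is covered by the set defined from c, take x outside N(c). The
  singleton of x is in the ideal by its cone sequence, whereas x hits c only boundedly often and so
  is not in d.\<close>

lemma scale_sel_ideal:
  assumes J: "cohen_ideal J" and S: "selector J S"
  shows "scale Q L (f_set_eq leq (f_set_eq leq f_geq)) (\<lambda>X. smem X (sel_ideal S))
    (f_subset leq (f_set_eq leq f_geq)) (\<lambda>\<eta>. sel_set S (cohen (next_lim \<eta>)))"
proof
  show "equality (f_set_eq leq (f_set_eq leq f_geq))" by (rule equality_set_real)
  show "regular (smem x (sel_ideal S))" for x by simp
  show "regular (f_subset leq real_eq x y)" for x y by simp
  show "smem x (sel_ideal S) p" if "leq p p" "f_set_eq leq real_eq x y p" "smem y (sel_ideal S) p" for x y p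
    using mem_cong[OF equality_set_real that(2,3)] .
  show "f_subset leq real_eq x z p"
    if "leq p p" "f_set_eq leq real_eq x y p" "f_subset leq real_eq y z p" for x y z p
    using subset_trans[OF set_eq_subset[OF that(2)] that(3)] .
  show "f_subset leq real_eq x z p"
    if "leq p p" "f_subset leq real_eq x y p" "f_subset leq real_eq y z p" for x y z p
    using subset_trans[OF that(2,3)] .
  show "smem (sel_set S (cohen (next_lim \<eta>))) (sel_ideal S) p" if "leq p p" for \<eta> p
    unfolding mem_sel_ideal[OF that]
  proof (intro allI impI)
    fix q assume "leq q p"
    then have q: "leq q q" using le_left by blast
    have "f_subset leq real_eq X X q" for X unfolding subset_iff by blast
    then show "\<exists>r c. leq r q \<and> f_Omega_bar leq c r \<and>
        f_subset leq real_eq (sel_set S (cohen (next_lim \<eta>))) (sel_set S c) r"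
      using q cohen_Omega_bar[OF leq_conds(1)[OF q]] by blast
  qed
  show "\<exists>r \<eta>. leq r p \<and> f_subset leq real_eq x (sel_set S (cohen (next_lim \<eta>))) r"
    if p: "leq p p" "smem x (sel_ideal S) p" for x p
  proof -
    obtain r c where r: "leq r p" "f_Omega_bar leq c r" "f_subset leq real_eq x (sel_set S c) r"
      using p(2) p(1) unfolding mem_sel_ideal[OF p(1)] by blast
    obtain \<eta> where "f_le_J leq J c (cohen (next_lim \<eta>)) r" using le_cohen_total[OF J le_left[OF r(1)] r(2)] .
    then show ?thesis using r(1) subset_trans[OF r(3) sel_set_mono[OF S]] by blast
  qed
  show "\<exists>\<beta>\<in>Field (cofinality :: 'o rel). \<forall>\<eta>\<in>Y. \<forall>p. leq p p \<longrightarrow>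
      f_subset leq real_eq (sel_set S (cohen (next_lim \<eta>))) (sel_set S (cohen (next_lim \<beta>))) p"
    if "small Y" for Y
    using le_cohen_directed[OF J that] sel_set_mono[OF S] by blast
  show "\<exists>r x. leq r p \<and> smem x (sel_ideal S) r \<and> (\<forall>t. leq t r \<longrightarrow> \<not> f_subset leq real_eq x d t)"
    if p: "leq p p" "smem d (sel_ideal S) p" for d p
  proof -
    obtain q c where q: "leq q p" "f_Omega_bar leq c q" "f_subset leq real_eq d (sel_set S c) q"
      using p(2) p(1) unfolding mem_sel_ideal[OF p(1)] by blast
    obtain r x where r: "leq r q" "\<And>t. leq t r \<Longrightarrow> \<not> rmem x (f_N leq c) t"
      using ex_not_in_N[OF q(2) le_left[OF q(1)]] by blast
    obtain c' where c': "\<And>p. leq p p \<Longrightarrow> f_Omega_bar leq c' p" "\<And>p n. leq p p \<Longrightarrow> f_in_nth leq x c' n p"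
      using ex_point_seq[of x] by blast
    define X where "X = {(x, s) | s. leq s s}"
    have xX: "rmem x X s" if "leq s s" for s
      by (rule memI[OF equality_real, of _ s]) (use that in \<open>auto simp: X_def\<close>)
    have sub: "f_subset leq real_eq X (sel_set S c') s" if "leq s s" for s
      unfolding subset_iff
    proof (intro allI impI)
      fix y u assume u: "leq u s" "rmem y X u"
      show "rmem y (sel_set S c') u"
      proof (rule regular_dense[OF regular_mem le_left[OF u(1)]])
        fix u' assume u': "leq u' u"
        then obtain v where v: "leq v u'" "real_eq y x v" using u(2) unfolding f_mem_def X_def by blast
        have vv: "leq v v" using v(1) le_left by blast
        have "\<forall>n r. leq r v \<longrightarrow> gmem n (f_hits leq x c') r" using mem_hits c'(2) le_left by blast
        then have "S (f_hits leq x c') v" using S vv unfolding selector_def by blast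
        then have "rmem x (sel_set S c') v" using mem_sel_set[OF S vv] by blast
        then have "rmem y (sel_set S c') v" using mem_cong[OF equality_real v(2)] by blast
        then show "\<exists>r. leq r u' \<and> rmem y (sel_set S c') r" using v(1) by blast
      qed
    qed
    have "smem X (sel_ideal S) r"
      unfolding mem_sel_ideal[OF le_left[OF r(1)]] using sub c'(1) le_left by blast
    moreover have "\<not> f_subset leq real_eq X d t" if t: "leq t r" for t
    proof
      assume "f_subset leq real_eq X d t"
      then have "rmem x d t" using xX[OF le_left[OF t]] le_left[OF t] unfolding subset_iff by blast
      then have "rmem x (sel_set S c) t" using q(3) le_trans[OF t r(1)] unfolding subset_iff by blast
      then have St: "S (f_hits leq x c) t" using mem_sel_set[OF S le_left[OF t]] by blast
      obtain t' m where t': "leq t' t" "\<And>n s. leq s t' \<Longrightarrow> f_in_nth leq x c n s \<Longrightarrow> n < m"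
        using not_in_N_bounded[OF le_left[OF t], of x c] r(2) le_trans[OF _ t] by blast
      have tt: "leq t' t'" using t'(1) le_left by blast
      have "S (f_hits leq x c) t'" using S regular_mono[of "S (f_hits leq x c)" t t'] St t'(1) unfolding selector_def by blast
      moreover have "\<forall>n s. leq s t' \<longrightarrow> gmem n (f_hits leq x c) s \<longrightarrow> n < m"
        using t'(2) mem_hits le_left by blast
      ultimately show False using S tt unfolding selector_def by blast
    qed
    ultimately show ?thesis using le_trans[OF r(1) q(1)] by blast
  qed
qed

section \<open>The six values\<close>

lemma b_eq:
  assumes J: "cohen_ideal J" and p: "leq p p"
  shows "f_b_eq leq J (cofinality :: 'o rel) p"
proof -
  interpret scale Q L "f_set_eq leq f_geq" "f_Omega_bar leq" "f_le_J leq J" "\<lambda>\<eta>. cohen (next_lim \<eta>)"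
    by (rule scale_Omega_bar[OF J])
  let ?bd = "\<lambda>F d. f_Omega_bar leq d \<^bold>\<and> f_all (\<lambda>c. f_imp leq (f_mem leq (f_set_eq leq f_geq) c F) (f_le_J leq J c d))"
  have reg: "regular (?bd F d)" for F d by (intro regular_intros regular_D regular_R)
  show ?thesis
    unfolding f_b_eq_def
  proof (rule least_size_unbounded[OF _ _ p])
    fix F and p
    let ?\<Phi> = "f_all (\<lambda>c. f_imp leq (f_mem leq (f_set_eq leq f_geq) c F) (f_Omega_bar leq c)) \<^bold>\<and>
      f_not leq (f_ex leq (?bd F))"
    show "regular ?\<Phi>" by (intro regular_intros regular_D regular_R)
    show "?\<Phi> p \<longleftrightarrow> unbounded F p"
      unfolding and_iff[of _ _ p] all_iff[of _ p] not_ex_iff[of "?bd F" p, OF reg] unbounded_def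
        imp_iff[OF regular_mem regular_D] imp_iff[OF regular_mem regular_R] and_iff all_iff
      by blast
  qed
qed

lemma d_eq:
  assumes J: "cohen_ideal J" and p: "leq p p"
  shows "f_d_eq leq J (cofinality :: 'o rel) p"
proof -
  interpret scale Q L "f_set_eq leq f_geq" "f_Omega_bar leq" "f_le_J leq J" "\<lambda>\<eta>. cohen (next_lim \<eta>)"
    by (rule scale_Omega_bar[OF J])
  let ?ub = "\<lambda>F c. f_ex leq (\<lambda>d. f_mem leq (f_set_eq leq f_geq) d F \<^bold>\<and> f_le_J leq J c d)"
  have reg: "regular (?ub F d)" for F d by (intro regular_intros regular_R)
  show ?thesis
    unfolding f_d_eq_def
  proof (rule least_size_dominating[OF _ _ p])
    fix F and p
    let ?\<Phi> = "f_all (\<lambda>c. f_imp leq (f_mem leq (f_set_eq leq f_geq) c F) (f_Omega_bar leq c)) \<^bold>\<and>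
      f_all (\<lambda>c. f_imp leq (f_Omega_bar leq c) (?ub F c))"
    show "regular ?\<Phi>" by (intro regular_intros regular_D regular_R)
    have "(\<forall>q. leq q p \<longrightarrow> f_Omega_bar leq c q \<longrightarrow> ?ub F c q) \<longleftrightarrow> (\<forall>q. leq q p \<longrightarrow> f_Omega_bar leq c q \<longrightarrow>
        (\<exists>r y. leq r q \<and> f_mem leq (f_set_eq leq f_geq) y F r \<and> f_le_J leq J c y r))" for c
      unfolding ex_iff and_iff using regular_mono[OF regular_D] le_left le_trans by meson
    then show "?\<Phi> p \<longleftrightarrow> dominating F p"
      unfolding and_iff[of _ _ p] all_iff[of _ p] dominating_def
        imp_iff[OF regular_mem regular_D] imp_iff[OF regular_D reg]
      by blast
  qed
qed

lemma add_eq: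
  assumes J: "cohen_ideal J" and S: "selector J S" and p: "leq p p"
  shows "f_add_eq leq (sel_ideal S) (cofinality :: 'o rel) p"
proof -
  interpret scale Q L "f_set_eq leq (f_set_eq leq f_geq)" "\<lambda>X. smem X (sel_ideal S)"
    "f_subset leq (f_set_eq leq f_geq)" "\<lambda>\<eta>. sel_set S (cohen (next_lim \<eta>))"
    by (rule scale_sel_ideal[OF J S])
  let ?U = "\<lambda>F. f_compr leq (\<lambda>x. f_ex leq (\<lambda>X. smem X F \<^bold>\<and> rmem x X))"
  show ?thesis
    unfolding f_add_eq_def
  proof (rule least_size_unbounded[OF _ _ p])
    fix F and p
    let ?\<Phi> = "f_subset leq (f_set_eq leq (f_set_eq leq f_geq)) F (sel_ideal S) \<^bold>\<and>
      f_not leq (smem (?U F) (sel_ideal S))"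
    show "regular ?\<Phi>" by (intro regular_intros)
    \<comment> \<open>The ideal is closed downwards, so the union of F belongs to it exactly if F
      has an upper bound in it with respect to inclusion; additivity is thus an unbounding
      number.\<close>
    have "(\<forall>q. leq q p \<longrightarrow> \<not> smem (?U F) (sel_ideal S) q) \<longleftrightarrow>
      (\<forall>d q. leq q p \<longrightarrow> smem d (sel_ideal S) q \<longrightarrow> \<not> (\<forall>X t. leq t q \<longrightarrow> smem X F t \<longrightarrow> f_subset leq real_eq X d t))"
    proof (intro iffI allI impI notI)
      fix d q assume no: "\<forall>q. leq q p \<longrightarrow> \<not> smem (?U F) (sel_ideal S) q"
        and q: "leq q p" "smem d (sel_ideal S) q" "\<forall>X t. leq t q \<longrightarrow> smem X F t \<longrightarrow> f_subset leq real_eq X d t"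
      have "f_subset leq real_eq (?U F) d q"
        unfolding subset_iff
      proof (intro allI impI)
        fix x t assume t: "leq t q" "rmem x (?U F) t"
        show "rmem x d t"
        proof (rule regular_dense[OF regular_mem le_left[OF t(1)]])
          fix u assume u: "leq u t"
          then obtain r X where r: "leq r u" "smem X F r" "rmem x X r"
            using t(2) unfolding mem_union[OF le_left[OF t(1)]] by blast
          have "f_subset leq real_eq X d r" using q(3) r(2) le_trans[OF r(1) le_trans[OF u t(1)]] by blast
          then have "rmem x d r" using r(3) le_left[OF r(1)] unfolding subset_iff by blast
          then show "\<exists>r. leq r u \<and> rmem x d r" using r(1) by blast
        qed
      qed
      then have "smem (?U F) (sel_ideal S) q" using sel_ideal_down[OF le_left[OF q(1)] q(2)] by blast
      then show False using no q(1) by blast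
    next
      fix q assume no: "\<forall>d q. leq q p \<longrightarrow> smem d (sel_ideal S) q \<longrightarrow>
          \<not> (\<forall>X t. leq t q \<longrightarrow> smem X F t \<longrightarrow> f_subset leq real_eq X d t)"
        and q: "leq q p" "smem (?U F) (sel_ideal S) q"
      have "f_subset leq real_eq X (?U F) t" if t: "leq t q" "smem X F t" for X t
        unfolding subset_iff
      proof (intro allI impI)
        fix x u assume u: "leq u t" "rmem x X u"
        show "rmem x (?U F) u"
          unfolding mem_union[OF le_left[OF u(1)]]
        proof (intro allI impI)
          fix v assume v: "leq v u"
          have "smem X F v" using mem_mono[OF t(2) le_trans[OF v u(1)]] .
          moreover have "rmem x X v" using mem_mono[OF u(2) v] .
          ultimately show "\<exists>r X. leq r v \<and> smem X F r \<and> rmem x X r" using le_left[OF v] by blast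
        qed
      qed
      then show False using no q by blast
    qed
    then show "?\<Phi> p \<longleftrightarrow> unbounded F p"
      unfolding and_iff[of _ _ p] subset_iff[of _ F "sel_ideal S" p] not_iff[of "smem (?U F) (sel_ideal S)" p] unbounded_def by blast
  qed
qed

lemma cof_eq:
  assumes J: "cohen_ideal J" and S: "selector J S" and p: "leq p p"
  shows "f_cof_eq leq (sel_ideal S) (cofinality :: 'o rel) p"
proof -
  interpret scale Q L "f_set_eq leq (f_set_eq leq f_geq)" "\<lambda>X. smem X (sel_ideal S)"
    "f_subset leq (f_set_eq leq f_geq)" "\<lambda>\<eta>. sel_set S (cohen (next_lim \<eta>))"
    by (rule scale_sel_ideal[OF J S])
  let ?ub = "\<lambda>F X. f_ex leq (\<lambda>Y. smem Y F \<^bold>\<and> f_subset leq real_eq X Y)"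
  have reg: "regular (?ub F X)" for F X by (intro regular_intros)
  show ?thesis
    unfolding f_cof_eq_def
  proof (rule least_size_dominating[OF _ _ p])
    fix F and p
    let ?\<Phi> = "f_subset leq (f_set_eq leq (f_set_eq leq f_geq)) F (sel_ideal S) \<^bold>\<and>
      f_all (\<lambda>X. f_imp leq (smem X (sel_ideal S)) (?ub F X))"
    show "regular ?\<Phi>" by (intro regular_intros)
    have "(\<forall>q. leq q p \<longrightarrow> smem X (sel_ideal S) q \<longrightarrow> ?ub F X q) \<longleftrightarrow> (\<forall>q. leq q p \<longrightarrow> smem X (sel_ideal S) q \<longrightarrow>
        (\<exists>r y. leq r q \<and> smem y F r \<and> f_subset leq real_eq X y r))" for X
      unfolding ex_iff and_iff using regular_mono[OF regular_D] le_left le_trans by meson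
    then show "?\<Phi> p \<longleftrightarrow> dominating F p"
      unfolding and_iff[of _ _ p] all_iff[of _ p] subset_iff[of _ F "sel_ideal S" p] dominating_def
        imp_iff[OF regular_mem reg]
      by blast
  qed
qed

lemma ex_maximal_cohen_ideal:
  obtains J where "\<And>p. leq p p \<Longrightarrow> f_maximal_ideal leq J p" "cohen_ideal J"
proof -
  obtain J where J: "\<And>p. leq p p \<Longrightarrow> f_maximal_ideal leq J p"
    "\<And>a p. leq p p \<Longrightarrow> rmem a J0 p \<Longrightarrow> rmem a J p"
    using ex_maximal_ideal[OF ideal_J0] by blast
  then have "cohen_ideal J" unfolding cohen_ideal_def maximal_ideal_iff by blast
  then show ?thesis using that J(1) by blast
qed

lemma all_values_eq:
  assumes J: "cohen_ideal J" and p: "leq p p"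
  shows "f_all_values_eq leq J (cofinality :: 'o rel) p"
proof -
  have ideal: "\<And>p. leq p p \<Longrightarrow> f_ideal leq J p" using J unfolding cohen_ideal_def by blast
  show ?thesis
    unfolding f_all_values_eq_def and_iff null_ideal_eq null_star_ideal_eq
    by (intro conjI b_eq[OF J p] d_eq[OF J p] add_eq[OF J _ p] cof_eq[OF J _ p]
        selector_positive selector_dual ideal)
qed

end

theorem theorem6p2:
  fixes Q :: "'o::wellorder \<Rightarrow> ('q, 'o \<rightharpoonup> 'q) name"
    and L :: "'o \<Rightarrow> ('q \<times> 'q, 'o \<rightharpoonup> 'q) name"
  assumes limit: "\<forall>\<alpha>::'o. \<exists>\<beta>. \<alpha> < \<beta>"
    and uncountable_cof: "|UNIV :: nat set| <o (cofinality :: 'o rel)"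
    and poset: "\<forall>\<alpha>. forced (fs_stage Q L \<alpha>) (f_preorder (fs_stage Q L \<alpha>) (Q \<alpha>) (L \<alpha>))"
    and nontrivial: "\<forall>\<alpha>. forced (fs_stage Q L \<alpha>) (f_nontrivial (fs_stage Q L \<alpha>) (Q \<alpha>) (L \<alpha>))"
    and cc: "\<forall>\<alpha>. forced (fs_stage Q L \<alpha>)
                 (f_cc (fs_stage Q L \<alpha>) (cofinality :: 'o rel) (Q \<alpha>) (L \<alpha>))"
  shows "forced (fs_limit Q L) (f_ex (fs_limit Q L) (\<lambda>J.
            f_ideal (fs_limit Q L) J \<^bold>\<and>
            f_all_values_eq (fs_limit Q L) J (cofinality :: 'o rel)))
       \<and> forced (fs_limit Q L) (f_ex (fs_limit Q L) (\<lambda>J.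
            f_maximal_ideal (fs_limit Q L) J \<^bold>\<and>
            f_all_values_eq (fs_limit Q L) J (cofinality :: 'o rel)))"
proof -
  interpret fs_iteration_cc Q L
    by unfold_locales (use uncountable_cof poset nontrivial cc in blast)+
  obtain J where J: "\<And>p. leq p p \<Longrightarrow> f_maximal_ideal leq J p" "cohen_ideal J"
    using ex_maximal_cohen_ideal by blast
  have "f_ideal leq J p" if "leq p p" for p using J(1)[OF that] unfolding maximal_ideal_iff by blast
  then show ?thesis
    unfolding forced_def ex_iff and_iff using J all_values_eq[OF J(2)] le_left by blast
qed

end
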